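(* Let $\mathbb C$ be a $\tau$-pretopos. The functor $\Sigma \colon \mathsf{PreOrd}(\mathbb C) \to \mathsf{Stab}(\mathbb C)$ is universal among all finite coproduct preserving torsion theory functors $G \colon \mathsf{PreOrd}(\mathbb C)\to \mathbb X$, where $\mathbb X$ is a pointed category with a torsion theory $(\mathcal T,\mathcal F)$ and with binary coproducts that are disjoint and pre-universal. Consider any such $\mathbb X$ and any finite coproduct preserving torsion theory functor $G \colon \mathsf{PreOrd}(\mathbb C) \to \mathbb X$ that sends $\mathcal Z$-kernels to kernels and $\mathcal Z$-cokernels to cokernels (then in particular short $\mathcal Z$-exact sequences to short exact sequences). Then $G$ factors uniquely through $\Sigma$, i.e. there is a unique functor $\overline G \colon \mathsf{Stab}(\mathbb C)\to\mathbb X$ with $\overline G\circ\Sigma=G$, and the induced functor $\overline G$ preserves finite coproducts, and is a torsion theory functor that preserves kernels and cokernels (then in particular short exact sequences).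
   Context: **Pretopos, $\tau$-pretopos.** A pretopos is a (Barr-)exact category $\mathbb C$ with finite coproducts which is extensive (equivalently, finite coproducts are disjoint and universal). It has a strict initial object $0$. A $\tau$-pretopos is a pretopos in which the transitive closure of any relation on an object exists. **Preorders.** $\mathsf{PreOrd}(\mathbb C)$ has as objects the internal preorders $(A,\rho)$: $\langle r_1,r_2\rangle\colon\rho\to A\times A$ is a subobject that is reflexive (contains the diagonal $\Delta_A$) and transitive. A morphism $(A,\rho)\to(B,\sigma)$ is a morphism $f\colon A\to B$ in $\mathbb C$ for which there is a (necessarily unique) $\hat f\colon \rho\to\sigma$ with $f r_i=s_i\hat f$, $i=1,2$. One often writes $A$ for $(A,\rho)$. $\mathsf{Eq}(\mathbb C)$ and $\mathsf{ParOrd}(\mathbb C)$ are the full subcategories of equivalence relations ($\rho^\circ=\rho$) and of partial orders ($\rho\cap\rho^\circ=\Delta_A$). $\mathcal Z=\mathsf{Eq}(\mathbb C)\cap\mathsf{ParOrd}(\mathbb C)$ consists of the discrete preorders $(A,\Delta_A)$ (trivial objects); a morphism is trivial if it factors through an object of $\mathcal Z$. **Complemented subobjects.** A subobject $\alpha\colon(A',\rho')\to(A,\rho)$ in $\mathsf{PreOrd}(\mathbb C)$ is complemented if there is a subobject $\alpha^c\colon(A'^c,\rho'^c)\to(A,\rho)$ (its complement) with intersection $0$ and union $(A,\rho)$; equivalently, $\alpha,\alpha^c$ exhibit $A=A'\coprod A'^c$ in $\mathbb C$, $\rho'$ and $\rho'^c$ are the inverse images of $\rho$ along $\alpha$ and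 $\alpha^c$, and for $i=1,2$ the squares formed by the $i$-th projections of $\rho',\rho,\rho'^c$ and $\alpha,\alpha^c$ are pullbacks (so $\rho=\rho'\coprod\rho'^c$). These are exactly the coproduct decompositions of $(A,\rho)$ in $\mathsf{PreOrd}(\mathbb C)$. **Stable category.** $\mathsf{PaPreOrd}(\mathbb C)$ has the same objects as $\mathsf{PreOrd}(\mathbb C)$; a morphism $A\to B$ is a pair $(\alpha,f)$ with $\alpha\colon A'\to A$ a complemented subobject (taken up to isomorphism) and $f\colon A'\to B$ a morphism in $\mathsf{PreOrd}(\mathbb C)$. Composition: $(\beta,g)\circ(\alpha,f)=(\alpha\alpha',gf')$, where $\alpha',f'$ are the projections of the pullback of $f$ and $\beta$, with $\alpha'$ the pullback of $\beta$ along $f$ and $f'$ the pullback of $f$ along $\beta$. Two parallel morphisms $(\alpha_1,f_1),(\alpha_2,f_2)\colon A\to B$, with $\alpha_i\colon A_i\to A$, are equivalent, $(\alpha_1,f_1)\sim(\alpha_2,f_2)$, if there are an object $A_0$ and complemented subobjects $\alpha_0\colon A_0\to A$ and $\alpha_0^i\colon A_0\to A_i$ ($i=1,2$) with $\alpha_i\alpha_0^i=\alpha_0$, $f_1\alpha_0^1=f_2\alpha_0^2$, and such that each $f_i$ restricted to the complement of $A_0$ in $A_i$ is a trivial morphism. This is a congruence on $\mathsf{PaPreOrd}(\mathbb C)$, and the stable category $\mathsf{Stab}(\mathbb C)$ is the quotient category. $\langle\alpha,f\rangle$ denotes the class of $(\alpha,f)$. $\Sigma\colon\mathsf{PreOrd}(\mathbb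 C)\to\mathsf{Stab}(\mathbb C)$ is the identity on objects and sends $f\colon A\to B$ to $\langle 1_A,f\rangle$. $\mathsf{Stab}(\mathbb C)$ is pointed with zero object $\Sigma(0)$. **(Pre)torsion theories.** Let $(\mathcal T,\mathcal F)$ be a pair of full replete subcategories of a category, $\mathcal Z=\mathcal T\cap\mathcal F$; $\mathcal Z$-trivial morphisms are those factoring through an object of $\mathcal Z$. $\mathcal Z$-kernels, $\mathcal Z$-cokernels and short $\mathcal Z$-exact sequences ($f$ is a $\mathcal Z$-kernel of $g$ and $g$ is a $\mathcal Z$-cokernel of $f$) are defined as usual kernels, cokernels and short exact sequences with zero morphisms replaced by $\mathcal Z$-trivial ones. $(\mathcal T,\mathcal F)$ is a pretorsion theory if every morphism from an object of $\mathcal T$ to an object of $\mathcal F$ is $\mathcal Z$-trivial and every object $X$ has a short $\mathcal Z$-exact sequence $T(X)\to X\to F(X)$ with $T(X)\in\mathcal T$, $F(X)\in\mathcal F$ (the canonical sequence). A torsion theory in a pointed category is a pretorsion theory for which $\mathcal Z$ is the class of zero objects. $(\mathsf{Eq}(\mathbb C),\mathsf{ParOrd}(\mathbb C))$ is a pretorsion theory in $\mathsf{PreOrd}(\mathbb C)$, with canonical sequences $(A,\sim_\rho)\to(A,\rho)\to(A/{\sim_\rho},\pi(\rho))$, where ${\sim_\rho}=\rho\cap\rho^\circ$, the first morphism is the identity on $A$, $\pi\colon A\to A/{\sim_\rho}$ is the quotient and $\pi(\rho)$ the induced partial order. $\mathsf{PreOrd}(\mathbb C)$ is equipped with this pretorsion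 theory, and $\mathsf{Stab}(\mathbb C)$ with the torsion theory given by its full subcategories on the equivalence relations and on the partial orders. **Torsion theory functor.** Given a category $\mathbb A$ with a pretorsion theory $(\mathcal T,\mathcal F)$ and a pointed category $\mathbb B$ with a torsion theory $(\mathcal T',\mathcal F')$, a functor $G\colon\mathbb A\to\mathbb B$ is a torsion theory functor if (1) $G(\mathcal T)\subseteq\mathcal T'$ and $G(\mathcal F)\subseteq\mathcal F'$ on objects; (2) for each object $A$ with canonical short $\mathcal Z$-exact sequence $T(A)\to A\to F(A)$, the sequence $0\to G(T(A))\to G(A)\to G(F(A))\to0$ is short exact in $\mathbb B$. **Coproducts in $\mathbb X$.** A binary coproduct $A\coprod B$ is disjoint if its coprojections are monomorphisms and their pullback is the initial object of the category of subobjects of $A\coprod B$. Binary coproducts are pre-universal if for every morphism $f\colon C\to A\coprod B$ there are a coproduct decomposition $C=A'\coprod B'$ with coprojections $s_{A'},s_{B'}$ and morphisms $f_A\colon A'\to A$, $f_B\colon B'\to B$ with $f s_{A'}=s_A f_A$ and $f s_{B'}=s_B f_B$, where $s_A,s_B$ are the coprojections of $A\coprod B$. "$G$ sends $\mathcal Z$-kernels to kernels" means: if $k$ is a $\mathcal Z$-kernel of $f$, then $G(k)$ is a kernel of $G(f)$; similarly for cokernels. *)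

theory Defs
  imports Main
begin

section \<open>Categories and functors\<close>

text \<open>
  A category is given by a set of objects and a set of arrows inside two ambient types.
  \<open>g \<cdot>\<^bsub>C\<^esub> f\<close> is "g after f" and is meaningful only when \<open>Cod C f = Dom C g\<close>.
  Values of the operations outside the carriers are irrelevant, so equality of functors
  (\<open>functor_eq\<close> below) is equality on the carriers.
\<close>

record ('o, 'm) cat =
  Ob :: "'o set"
  Ar :: "'m set"
  Dom :: "'m \<Rightarrow> 'o"
  Cod :: "'m \<Rightarrow> 'o"
  Ide :: "'o \<Rightarrow> 'm"
  Comp :: "'m \<Rightarrow> 'm \<Rightarrow> 'm"  (infixr \<open>\<cdot>\<index>\<close> 70)

definition hom :: "('o, 'm) cat \<Rightarrow> 'o \<Rightarrow> 'o \<Rightarrow> 'm set" where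
  "hom C A B = {f \<in> Ar C. Dom C f = A \<and> Cod C f = B}"

definition category :: "('o, 'm) cat \<Rightarrow> bool" where
  "category C \<longleftrightarrow>
     (\<forall>f\<in>Ar C. Dom C f \<in> Ob C \<and> Cod C f \<in> Ob C) \<and>
     (\<forall>A\<in>Ob C. Ide C A \<in> hom C A A) \<and>
     (\<forall>f\<in>Ar C. \<forall>g\<in>Ar C. Cod C f = Dom C g \<longrightarrow> g \<cdot>\<^bsub>C\<^esub> f \<in> hom C (Dom C f) (Cod C g)) \<and>
     (\<forall>f\<in>Ar C. f \<cdot>\<^bsub>C\<^esub> Ide C (Dom C f) = f \<and> Ide C (Cod C f) \<cdot>\<^bsub>C\<^esub> f = f) \<and>
     (\<forall>f\<in>Ar C. \<forall>g\<in>Ar C. \<forall>h\<in>Ar C. Cod C f = Dom C g \<and> Cod C g = Dom C h \<longrightarrow>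
        h \<cdot>\<^bsub>C\<^esub> (g \<cdot>\<^bsub>C\<^esub> f) = (h \<cdot>\<^bsub>C\<^esub> g) \<cdot>\<^bsub>C\<^esub> f)"

record ('o, 'm, 'p, 'q) ftor =
  on_ob :: "'o \<Rightarrow> 'p"
  on_ar :: "'m \<Rightarrow> 'q"

definition is_functor :: "('o, 'm) cat \<Rightarrow> ('p, 'q) cat \<Rightarrow> ('o, 'm, 'p, 'q) ftor \<Rightarrow> bool" where
  "is_functor A B G \<longleftrightarrow>
     (\<forall>X\<in>Ob A. on_ob G X \<in> Ob B) \<and>
     (\<forall>f\<in>Ar A. on_ar G f \<in> hom B (on_ob G (Dom A f)) (on_ob G (Cod A f))) \<and>
     (\<forall>X\<in>Ob A. on_ar G (Ide A X) = Ide B (on_ob G X)) \<and>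
     (\<forall>f\<in>Ar A. \<forall>g\<in>Ar A. Cod A f = Dom A g \<longrightarrow>
        on_ar G (g \<cdot>\<^bsub>A\<^esub> f) = on_ar G g \<cdot>\<^bsub>B\<^esub> on_ar G f)"

definition functor_comp ::
  "('p, 'q, 'r, 's) ftor \<Rightarrow> ('o, 'm, 'p, 'q) ftor \<Rightarrow> ('o, 'm, 'r, 's) ftor" where
  "functor_comp H G = \<lparr>on_ob = on_ob H \<circ> on_ob G, on_ar = on_ar H \<circ> on_ar G\<rparr>"

definition functor_eq ::
  "('o, 'm) cat \<Rightarrow> ('o, 'm, 'p, 'q) ftor \<Rightarrow> ('o, 'm, 'p, 'q) ftor \<Rightarrow> bool" where
  "functor_eq A G H \<longleftrightarrow>
     (\<forall>X\<in>Ob A. on_ob G X = on_ob H X) \<and> (\<forall>f\<in>Ar A. on_ar G f = on_ar H f)"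


section \<open>Limits, colimits and subobjects\<close>

definition is_iso :: "('o, 'm) cat \<Rightarrow> 'm \<Rightarrow> bool" where
  "is_iso C f \<longleftrightarrow> f \<in> Ar C \<and> (\<exists>g \<in> hom C (Cod C f) (Dom C f).
     g \<cdot>\<^bsub>C\<^esub> f = Ide C (Dom C f) \<and> f \<cdot>\<^bsub>C\<^esub> g = Ide C (Cod C f))"

definition is_mono :: "('o, 'm) cat \<Rightarrow> 'm \<Rightarrow> bool" where
  "is_mono C m \<longleftrightarrow> m \<in> Ar C \<and>
     (\<forall>u\<in>Ar C. \<forall>v\<in>Ar C. Dom C u = Dom C v \<and> Cod C u = Dom C m \<and> Cod C v = Dom C m \<and>
        m \<cdot>\<^bsub>C\<^esub> u = m \<cdot>\<^bsub>C\<^esub> v \<longrightarrow> u = v)"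

definition is_initial :: "('o, 'm) cat \<Rightarrow> 'o \<Rightarrow> bool" where
  "is_initial C I \<longleftrightarrow> I \<in> Ob C \<and> (\<forall>A\<in>Ob C. \<exists>!f. f \<in> hom C I A)"

definition is_terminal :: "('o, 'm) cat \<Rightarrow> 'o \<Rightarrow> bool" where
  "is_terminal C T \<longleftrightarrow> T \<in> Ob C \<and> (\<forall>A\<in>Ob C. \<exists>!f. f \<in> hom C A T)"

definition zero_objects :: "('o, 'm) cat \<Rightarrow> 'o set" where
  "zero_objects C = {A. is_initial C A \<and> is_terminal C A}"

definition pointed :: "('o, 'm) cat \<Rightarrow> bool" where
  "pointed C \<longleftrightarrow> zero_objects C \<noteq> {}"

text \<open>\<open>i\<close> and \<open>j\<close> are the coprojections of a coproduct with object \<open>Cod C i = Cod C j\<close>.\<close>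

definition is_coproduct :: "('o, 'm) cat \<Rightarrow> 'm \<Rightarrow> 'm \<Rightarrow> bool" where
  "is_coproduct C i j \<longleftrightarrow> i \<in> Ar C \<and> j \<in> Ar C \<and> Cod C i = Cod C j \<and>
     (\<forall>f\<in>Ar C. \<forall>g\<in>Ar C. Dom C f = Dom C i \<and> Dom C g = Dom C j \<and> Cod C f = Cod C g \<longrightarrow>
        (\<exists>!h. h \<in> hom C (Cod C i) (Cod C f) \<and> h \<cdot>\<^bsub>C\<^esub> i = f \<and> h \<cdot>\<^bsub>C\<^esub> j = g))"

text \<open>
  \<open>is_pullback C f g p q\<close>: the square \<open>f \<cdot> p = g \<cdot> q\<close> is a pullback, \<open>p\<close> being the pullback of
  \<open>g\<close> along \<open>f\<close> and \<open>q\<close> the pullback of \<open>f\<close> along \<open>g\<close>.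
\<close>

definition is_pullback :: "('o, 'm) cat \<Rightarrow> 'm \<Rightarrow> 'm \<Rightarrow> 'm \<Rightarrow> 'm \<Rightarrow> bool" where
  "is_pullback C f g p q \<longleftrightarrow>
     f \<in> Ar C \<and> g \<in> Ar C \<and> p \<in> Ar C \<and> q \<in> Ar C \<and> Cod C f = Cod C g \<and>
     Dom C p = Dom C q \<and> Cod C p = Dom C f \<and> Cod C q = Dom C g \<and>
     f \<cdot>\<^bsub>C\<^esub> p = g \<cdot>\<^bsub>C\<^esub> q \<and>
     (\<forall>u\<in>Ar C. \<forall>v\<in>Ar C. Dom C u = Dom C v \<and> Cod C u = Dom C f \<and> Cod C v = Dom C g \<and>
        f \<cdot>\<^bsub>C\<^esub> u = g \<cdot>\<^bsub>C\<^esub> v \<longrightarrow>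
        (\<exists>!h. h \<in> hom C (Dom C u) (Dom C p) \<and> p \<cdot>\<^bsub>C\<^esub> h = u \<and> q \<cdot>\<^bsub>C\<^esub> h = v))"

definition is_coequalizer :: "('o, 'm) cat \<Rightarrow> 'm \<Rightarrow> 'm \<Rightarrow> 'm \<Rightarrow> bool" where
  "is_coequalizer C f g q \<longleftrightarrow>
     f \<in> Ar C \<and> g \<in> Ar C \<and> q \<in> Ar C \<and> Dom C f = Dom C g \<and> Cod C f = Cod C g \<and>
     Dom C q = Cod C f \<and> q \<cdot>\<^bsub>C\<^esub> f = q \<cdot>\<^bsub>C\<^esub> g \<and>
     (\<forall>u\<in>Ar C. Dom C u = Cod C f \<and> u \<cdot>\<^bsub>C\<^esub> f = u \<cdot>\<^bsub>C\<^esub> g \<longrightarrow>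
        (\<exists>!h. h \<in> hom C (Cod C q) (Cod C u) \<and> h \<cdot>\<^bsub>C\<^esub> q = u))"

definition is_regular_epi :: "('o, 'm) cat \<Rightarrow> 'm \<Rightarrow> bool" where
  "is_regular_epi C q \<longleftrightarrow> (\<exists>f g. is_coequalizer C f g q)"

definition has_finite_limits :: "('o, 'm) cat \<Rightarrow> bool" where
  "has_finite_limits C \<longleftrightarrow> (\<exists>T. is_terminal C T) \<and>
     (\<forall>f\<in>Ar C. \<forall>g\<in>Ar C. Cod C f = Cod C g \<longrightarrow> (\<exists>p q. is_pullback C f g p q))"

definition has_binary_coproducts :: "('o, 'm) cat \<Rightarrow> bool" where
  "has_binary_coproducts C \<longleftrightarrow>
     (\<forall>A\<in>Ob C. \<forall>B\<in>Ob C. \<exists>i j. is_coproduct C i j \<and> Dom C i = A \<and> Dom C j = B)"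

definition has_finite_coproducts :: "('o, 'm) cat \<Rightarrow> bool" where
  "has_finite_coproducts C \<longleftrightarrow> (\<exists>I. is_initial C I) \<and> has_binary_coproducts C"

definition subobj_le :: "('o, 'm) cat \<Rightarrow> 'm \<Rightarrow> 'm \<Rightarrow> bool" where
  "subobj_le C m n \<longleftrightarrow> Cod C m = Cod C n \<and> (\<exists>h \<in> hom C (Dom C m) (Dom C n). n \<cdot>\<^bsub>C\<^esub> h = m)"

text \<open>
  \<open>a\<close> and \<open>b\<close> are subobjects of the same object with intersection (pullback) the initial object
  and with union (least upper bound in the preorder of subobjects) the whole object.
\<close>

definition is_complement :: "('o, 'm) cat \<Rightarrow> 'm \<Rightarrow> 'm \<Rightarrow> bool" where
  "is_complement C a b \<longleftrightarrow> is_mono C a \<and> is_mono C b \<and> Cod C a = Cod C b \<and>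
     (\<exists>p q. is_pullback C a b p q \<and> is_initial C (Dom C p)) \<and>
     (\<forall>u. is_mono C u \<and> subobj_le C a u \<and> subobj_le C b u \<longrightarrow>
        subobj_le C (Ide C (Cod C a)) u)"

definition complemented :: "('o, 'm) cat \<Rightarrow> 'm \<Rightarrow> bool" where
  "complemented C a \<longleftrightarrow> (\<exists>b. is_complement C a b)"


section \<open>Internal relations\<close>

text \<open>
  A relation on \<open>A\<close>, i.e. a subobject of \<open>A \<times> A\<close>, is represented by its two projections, a
  jointly monic pair of arrows into \<open>A\<close>. Equality of relations as subobjects is \<open>rel_eq\<close>.
\<close>

fun is_relation :: "('o, 'm) cat \<Rightarrow> 'o \<Rightarrow> 'm \<times> 'm \<Rightarrow> bool" where
  "is_relation C A (r1, r2) \<longleftrightarrow>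
     r1 \<in> Ar C \<and> r2 \<in> Ar C \<and> Dom C r1 = Dom C r2 \<and> Cod C r1 = A \<and> Cod C r2 = A \<and>
     (\<forall>u\<in>Ar C. \<forall>v\<in>Ar C. Dom C u = Dom C v \<and> Cod C u = Dom C r1 \<and> Cod C v = Dom C r1 \<and>
        r1 \<cdot>\<^bsub>C\<^esub> u = r1 \<cdot>\<^bsub>C\<^esub> v \<and> r2 \<cdot>\<^bsub>C\<^esub> u = r2 \<cdot>\<^bsub>C\<^esub> v \<longrightarrow> u = v)"

fun rel_le :: "('o, 'm) cat \<Rightarrow> 'm \<times> 'm \<Rightarrow> 'm \<times> 'm \<Rightarrow> bool" where
  "rel_le C (r1, r2) (s1, s2) \<longleftrightarrow>
     (\<exists>h \<in> hom C (Dom C r1) (Dom C s1). s1 \<cdot>\<^bsub>C\<^esub> h = r1 \<and> s2 \<cdot>\<^bsub>C\<^esub> h = r2)"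

definition rel_eq :: "('o, 'm) cat \<Rightarrow> 'm \<times> 'm \<Rightarrow> 'm \<times> 'm \<Rightarrow> bool" where
  "rel_eq C R S \<longleftrightarrow> rel_le C R S \<and> rel_le C S R"

fun rel_op :: "'m \<times> 'm \<Rightarrow> 'm \<times> 'm" where
  "rel_op (r1, r2) = (r2, r1)"

definition diagonal :: "('o, 'm) cat \<Rightarrow> 'o \<Rightarrow> 'm \<times> 'm" where
  "diagonal C A = (Ide C A, Ide C A)"

definition is_rel_meet :: "('o, 'm) cat \<Rightarrow> 'o \<Rightarrow> 'm \<times> 'm \<Rightarrow> 'm \<times> 'm \<Rightarrow> 'm \<times> 'm \<Rightarrow> bool" where
  "is_rel_meet C A T R S \<longleftrightarrow> is_relation C A T \<and> rel_le C T R \<and> rel_le C T S \<and>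
     (\<forall>U. is_relation C A U \<and> rel_le C U R \<and> rel_le C U S \<longrightarrow> rel_le C U T)"

definition reflexive_rel :: "('o, 'm) cat \<Rightarrow> 'o \<Rightarrow> 'm \<times> 'm \<Rightarrow> bool" where
  "reflexive_rel C A R \<longleftrightarrow> rel_le C (diagonal C A) R"

definition symmetric_rel :: "('o, 'm) cat \<Rightarrow> 'm \<times> 'm \<Rightarrow> bool" where
  "symmetric_rel C R \<longleftrightarrow> rel_eq C (rel_op R) R"

text \<open>\<open>R \<times>\<^sub>A R \<rightarrow> A \<times> A\<close> factors through \<open>R\<close>.\<close>

fun transitive_rel :: "('o, 'm) cat \<Rightarrow> 'm \<times> 'm \<Rightarrow> bool" where
  "transitive_rel C (r1, r2) \<longleftrightarrow>
     (\<forall>p q. is_pullback C r2 r1 p q \<longrightarrow> rel_le C (r1 \<cdot>\<^bsub>C\<^esub> p, r2 \<cdot>\<^bsub>C\<^esub> q) (r1, r2))"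

definition is_equivalence_rel :: "('o, 'm) cat \<Rightarrow> 'o \<Rightarrow> 'm \<times> 'm \<Rightarrow> bool" where
  "is_equivalence_rel C A R \<longleftrightarrow> is_relation C A R \<and>
     reflexive_rel C A R \<and> symmetric_rel C R \<and> transitive_rel C R"

definition is_transitive_closure :: "('o, 'm) cat \<Rightarrow> 'o \<Rightarrow> 'm \<times> 'm \<Rightarrow> 'm \<times> 'm \<Rightarrow> bool" where
  "is_transitive_closure C A R T \<longleftrightarrow> is_relation C A T \<and> transitive_rel C T \<and> rel_le C R T \<and>
     (\<forall>S. is_relation C A S \<and> transitive_rel C S \<and> rel_le C R S \<longrightarrow> rel_le C T S)"


section \<open>\<open>\<tau>\<close>-pretoposes\<close>

definition regular_category :: "('o, 'm) cat \<Rightarrow> bool" where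
  "regular_category C \<longleftrightarrow> category C \<and> has_finite_limits C \<and>
     (\<forall>f p q. is_pullback C f f p q \<longrightarrow> (\<exists>e. is_coequalizer C p q e)) \<and>
     (\<forall>f g p q. is_pullback C f g p q \<and> is_regular_epi C g \<longrightarrow> is_regular_epi C p)"

definition exact_category :: "('o, 'm) cat \<Rightarrow> bool" where
  "exact_category C \<longleftrightarrow> regular_category C \<and>
     (\<forall>A\<in>Ob C. \<forall>r1 r2. is_equivalence_rel C A (r1, r2) \<longrightarrow> (\<exists>f. is_pullback C f f r1 r2))"

text \<open>
  Finite coproducts are disjoint and universal; universality of the empty coproduct is
  strictness of the initial object.
\<close>

definition extensive :: "('o, 'm) cat \<Rightarrow> bool" where
  "extensive C \<longleftrightarrow> has_finite_coproducts C \<and>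
     (\<forall>i j. is_coproduct C i j \<longrightarrow> is_mono C i \<and> is_mono C j \<and>
        (\<forall>p q. is_pullback C i j p q \<longrightarrow> is_initial C (Dom C p))) \<and>
     (\<forall>i j f p p' q q'. is_coproduct C i j \<and> is_pullback C f i p p' \<and> is_pullback C f j q q' \<longrightarrow>
        is_coproduct C p q) \<and>
     (\<forall>f\<in>Ar C. is_initial C (Cod C f) \<longrightarrow> is_initial C (Dom C f))"

definition pretopos :: "('o, 'm) cat \<Rightarrow> bool" where
  "pretopos C \<longleftrightarrow> exact_category C \<and> extensive C"

definition tau_pretopos :: "('o, 'm) cat \<Rightarrow> bool" where
  "tau_pretopos C \<longleftrightarrow> pretopos C \<and>
     (\<forall>A\<in>Ob C. \<forall>R. is_relation C A R \<longrightarrow> (\<exists>T. is_transitive_closure C A R T))"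


section \<open>Internal preorders\<close>

text \<open>
  A preorder is \<open>(A, \<rho>)\<close> with \<open>\<rho> = (r1, r2)\<close>; an arrow of preorders is the triple consisting of
  its domain, the underlying arrow and its codomain.
\<close>

type_synonym ('o, 'm) preord = "'o \<times> 'm \<times> 'm"
type_synonym ('o, 'm) preord_arrow = "('o, 'm) preord \<times> 'm \<times> ('o, 'm) preord"

fun is_preord :: "('o, 'm) cat \<Rightarrow> ('o, 'm) preord \<Rightarrow> bool" where
  "is_preord C (A, \<rho>) \<longleftrightarrow>
     A \<in> Ob C \<and> is_relation C A \<rho> \<and> reflexive_rel C A \<rho> \<and> transitive_rel C \<rho>"

fun is_preord_arrow :: "('o, 'm) cat \<Rightarrow> ('o, 'm) preord_arrow \<Rightarrow> bool" where
  "is_preord_arrow C ((A, r1, r2), f, (B, s1, s2)) \<longleftrightarrow>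
     is_preord C (A, r1, r2) \<and> is_preord C (B, s1, s2) \<and> f \<in> hom C A B \<and>
     (\<exists>fh \<in> hom C (Dom C r1) (Dom C s1). f \<cdot>\<^bsub>C\<^esub> r1 = s1 \<cdot>\<^bsub>C\<^esub> fh \<and> f \<cdot>\<^bsub>C\<^esub> r2 = s2 \<cdot>\<^bsub>C\<^esub> fh)"

definition PreOrd :: "('o, 'm) cat \<Rightarrow> (('o, 'm) preord, ('o, 'm) preord_arrow) cat" where
  "PreOrd C = \<lparr>Ob = {X. is_preord C X}, Ar = {F. is_preord_arrow C F},
     Dom = (\<lambda>(X, f, Y). X), Cod = (\<lambda>(X, f, Y). Y),
     Ide = (\<lambda>X. (X, Ide C (fst X), X)),
     Comp = (\<lambda>(Y', g, Z) (X, f, Y). (X, g \<cdot>\<^bsub>C\<^esub> f, Z))\<rparr>"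

text \<open>
  The full subcategories \<open>Eq(C)\<close> and \<open>ParOrd(C)\<close> are given by their sets of objects, and so are
  the full subcategories of a (pre)torsion theory below.
\<close>

definition EqOb :: "('o, 'm) cat \<Rightarrow> ('o, 'm) preord set" where
  "EqOb C = {(A, \<rho>). is_preord C (A, \<rho>) \<and> rel_eq C (rel_op \<rho>) \<rho>}"

definition ParOrdOb :: "('o, 'm) cat \<Rightarrow> ('o, 'm) preord set" where
  "ParOrdOb C = {(A, \<rho>). is_preord C (A, \<rho>) \<and> is_rel_meet C A (diagonal C A) \<rho> (rel_op \<rho>)}"


section \<open>Pretorsion theories\<close>

definition trivial_arrow :: "('o, 'm) cat \<Rightarrow> 'o set \<Rightarrow> 'm \<Rightarrow> bool" where
  "trivial_arrow C \<Z> f \<longleftrightarrow> f \<in> Ar C \<and>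
     (\<exists>Z\<in>\<Z>. \<exists>g \<in> hom C (Dom C f) Z. \<exists>h \<in> hom C Z (Cod C f). f = h \<cdot>\<^bsub>C\<^esub> g)"

text \<open>\<open>k\<close> is a \<open>\<Z>\<close>-kernel of \<open>f\<close>, respectively \<open>q\<close> is a \<open>\<Z>\<close>-cokernel of \<open>f\<close>.\<close>

definition is_zkernel :: "('o, 'm) cat \<Rightarrow> 'o set \<Rightarrow> 'm \<Rightarrow> 'm \<Rightarrow> bool" where
  "is_zkernel C \<Z> k f \<longleftrightarrow> k \<in> Ar C \<and> f \<in> Ar C \<and> Cod C k = Dom C f \<and>
     trivial_arrow C \<Z> (f \<cdot>\<^bsub>C\<^esub> k) \<and>
     (\<forall>g\<in>Ar C. Cod C g = Dom C f \<and> trivial_arrow C \<Z> (f \<cdot>\<^bsub>C\<^esub> g) \<longrightarrow>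
        (\<exists>!h. h \<in> hom C (Dom C g) (Dom C k) \<and> k \<cdot>\<^bsub>C\<^esub> h = g))"

definition is_zcokernel :: "('o, 'm) cat \<Rightarrow> 'o set \<Rightarrow> 'm \<Rightarrow> 'm \<Rightarrow> bool" where
  "is_zcokernel C \<Z> q f \<longleftrightarrow> q \<in> Ar C \<and> f \<in> Ar C \<and> Dom C q = Cod C f \<and>
     trivial_arrow C \<Z> (q \<cdot>\<^bsub>C\<^esub> f) \<and>
     (\<forall>g\<in>Ar C. Dom C g = Cod C f \<and> trivial_arrow C \<Z> (g \<cdot>\<^bsub>C\<^esub> f) \<longrightarrow>
        (\<exists>!h. h \<in> hom C (Cod C q) (Cod C g) \<and> h \<cdot>\<^bsub>C\<^esub> q = g))"

definition short_zexact :: "('o, 'm) cat \<Rightarrow> 'o set \<Rightarrow> 'm \<Rightarrow> 'm \<Rightarrow> bool" where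
  "short_zexact C \<Z> f g \<longleftrightarrow> is_zkernel C \<Z> f g \<and> is_zcokernel C \<Z> g f"

text \<open>
  In a pointed category the zero morphisms are those factoring through a zero object, so kernels,
  cokernels and short exact sequences are the case \<open>\<Z> = zero_objects C\<close>.
\<close>

abbreviation is_kernel :: "('o, 'm) cat \<Rightarrow> 'm \<Rightarrow> 'm \<Rightarrow> bool" where
  "is_kernel C \<equiv> is_zkernel C (zero_objects C)"

abbreviation is_cokernel :: "('o, 'm) cat \<Rightarrow> 'm \<Rightarrow> 'm \<Rightarrow> bool" where
  "is_cokernel C \<equiv> is_zcokernel C (zero_objects C)"

abbreviation short_exact :: "('o, 'm) cat \<Rightarrow> 'm \<Rightarrow> 'm \<Rightarrow> bool" where
  "short_exact C \<equiv> short_zexact C (zero_objects C)"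

definition replete :: "('o, 'm) cat \<Rightarrow> 'o set \<Rightarrow> bool" where
  "replete C S \<longleftrightarrow> S \<subseteq> Ob C \<and> (\<forall>f. is_iso C f \<and> Dom C f \<in> S \<longrightarrow> Cod C f \<in> S)"

definition canonical_sequence ::
  "('o, 'm) cat \<Rightarrow> 'o set \<Rightarrow> 'o set \<Rightarrow> 'o \<Rightarrow> 'm \<Rightarrow> 'm \<Rightarrow> bool" where
  "canonical_sequence C \<T> \<F> X t f \<longleftrightarrow>
     short_zexact C (\<T> \<inter> \<F>) t f \<and> Dom C t \<in> \<T> \<and> Cod C t = X \<and> Cod C f \<in> \<F>"

definition pretorsion_theory :: "('o, 'm) cat \<Rightarrow> 'o set \<Rightarrow> 'o set \<Rightarrow> bool" where
  "pretorsion_theory C \<T> \<F> \<longleftrightarrow> replete C \<T> \<and> replete C \<F> \<and>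
     (\<forall>f\<in>Ar C. Dom C f \<in> \<T> \<and> Cod C f \<in> \<F> \<longrightarrow> trivial_arrow C (\<T> \<inter> \<F>) f) \<and>
     (\<forall>X\<in>Ob C. \<exists>t f. canonical_sequence C \<T> \<F> X t f)"

definition torsion_theory :: "('o, 'm) cat \<Rightarrow> 'o set \<Rightarrow> 'o set \<Rightarrow> bool" where
  "torsion_theory C \<T> \<F> \<longleftrightarrow> pretorsion_theory C \<T> \<F> \<and> \<T> \<inter> \<F> = zero_objects C"

text \<open>
  Canonical sequences are unique only up to isomorphism, so the second condition ranges over all
  of them.
\<close>

definition torsion_theory_functor ::
  "('o, 'm) cat \<Rightarrow> 'o set \<Rightarrow> 'o set \<Rightarrow> ('p, 'q) cat \<Rightarrow> 'p set \<Rightarrow> 'p set \<Rightarrow>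
   ('o, 'm, 'p, 'q) ftor \<Rightarrow> bool" where
  "torsion_theory_functor A \<T> \<F> B \<T>' \<F>' G \<longleftrightarrow> is_functor A B G \<and>
     (\<forall>X\<in>\<T>. on_ob G X \<in> \<T>') \<and> (\<forall>X\<in>\<F>. on_ob G X \<in> \<F>') \<and>
     (\<forall>X\<in>Ob A. \<forall>t f. canonical_sequence A \<T> \<F> X t f \<longrightarrow>
        short_exact B (on_ar G t) (on_ar G f))"


section \<open>The stable category\<close>

text \<open>
  Partial arrows in a category \<open>P\<close>: a pair \<open>(\<alpha>, f) : Cod P \<alpha> \<rightarrow> Cod P f\<close> with \<open>\<alpha>\<close> a complemented
  subobject. Two of them are identified when they differ by an isomorphism of the domain of the
  subobjects; the arrows of \<open>partial_cat P\<close> are the classes. All members of a class have the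
  same source and target, and all composites of members of two classes, for all choices of the
  pullback, form one class.
\<close>

definition partial_arrows :: "('o, 'm) cat \<Rightarrow> ('m \<times> 'm) set" where
  "partial_arrows P = {(\<alpha>, f). complemented P \<alpha> \<and> f \<in> Ar P \<and> Dom P f = Dom P \<alpha>}"

definition partial_iso :: "('o, 'm) cat \<Rightarrow> (('m \<times> 'm) \<times> ('m \<times> 'm)) set" where
  "partial_iso P = {((\<alpha>, f), (\<beta>, g)).
     (\<alpha>, f) \<in> partial_arrows P \<and> (\<beta>, g) \<in> partial_arrows P \<and>
     (\<exists>i. is_iso P i \<and> Dom P i = Dom P \<alpha> \<and> Cod P i = Dom P \<beta> \<and> \<beta> \<cdot>\<^bsub>P\<^esub> i = \<alpha> \<and> g \<cdot>\<^bsub>P\<^esub> i = f)}"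

definition partial_class :: "('o, 'm) cat \<Rightarrow> 'm \<Rightarrow> 'm \<Rightarrow> ('m \<times> 'm) set" where
  "partial_class P \<alpha> f = partial_iso P `` {(\<alpha>, f)}"

definition partial_cat :: "('o, 'm) cat \<Rightarrow> ('o, ('m \<times> 'm) set) cat" where
  "partial_cat P = \<lparr>Ob = Ob P, Ar = partial_arrows P // partial_iso P,
     Dom = (\<lambda>F. Cod P (fst (SOME x. x \<in> F))), Cod = (\<lambda>F. Cod P (snd (SOME x. x \<in> F))),
     Ide = (\<lambda>A. partial_class P (Ide P A) (Ide P A)),
     Comp = (\<lambda>G F. {(\<alpha> \<cdot>\<^bsub>P\<^esub> \<alpha>', g \<cdot>\<^bsub>P\<^esub> f') | \<alpha> f \<beta> g \<alpha>' f'.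
                      (\<alpha>, f) \<in> F \<and> (\<beta>, g) \<in> G \<and> is_pullback P f \<beta> \<alpha>' f'})\<rparr>"

text \<open>
  The congruence on partial arrows relative to a class \<open>\<Z>\<close> of trivial objects; \<open>c1\<close> and \<open>c2\<close> are
  the complements of \<open>A0 = Dom P a0\<close> in \<open>A1 = Dom P \<alpha>1\<close> and \<open>A2 = Dom P \<alpha>2\<close>.
\<close>

definition stable_rel :: "('o, 'm) cat \<Rightarrow> 'o set \<Rightarrow> (('m \<times> 'm) set \<times> ('m \<times> 'm) set) set" where
  "stable_rel P \<Z> = {(F1, F2).
     F1 \<in> Ar (partial_cat P) \<and> F2 \<in> Ar (partial_cat P) \<and>
     Dom (partial_cat P) F1 = Dom (partial_cat P) F2 \<and>
     Cod (partial_cat P) F1 = Cod (partial_cat P) F2 \<and>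
     (\<exists>\<alpha>1 f1 \<alpha>2 f2 a0 a1 a2 c1 c2. (\<alpha>1, f1) \<in> F1 \<and> (\<alpha>2, f2) \<in> F2 \<and>
        complemented P a0 \<and> is_complement P a1 c1 \<and> is_complement P a2 c2 \<and>
        Dom P a1 = Dom P a0 \<and> Dom P a2 = Dom P a0 \<and>
        Cod P a1 = Dom P \<alpha>1 \<and> Cod P a2 = Dom P \<alpha>2 \<and>
        \<alpha>1 \<cdot>\<^bsub>P\<^esub> a1 = a0 \<and> \<alpha>2 \<cdot>\<^bsub>P\<^esub> a2 = a0 \<and> f1 \<cdot>\<^bsub>P\<^esub> a1 = f2 \<cdot>\<^bsub>P\<^esub> a2 \<and>
        trivial_arrow P \<Z> (f1 \<cdot>\<^bsub>P\<^esub> c1) \<and> trivial_arrow P \<Z> (f2 \<cdot>\<^bsub>P\<^esub> c2))}"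

text \<open>The quotient of a category by a congruence on its arrows.\<close>

definition quotient_cat :: "('o, 'm) cat \<Rightarrow> ('m \<times> 'm) set \<Rightarrow> ('o, 'm set) cat" where
  "quotient_cat K R = \<lparr>Ob = Ob K, Ar = Ar K // R,
     Dom = (\<lambda>Q. Dom K (SOME F. F \<in> Q)), Cod = (\<lambda>Q. Cod K (SOME F. F \<in> Q)),
     Ide = (\<lambda>A. R `` {Ide K A}),
     Comp = (\<lambda>Q' Q. \<Union>G\<in>Q'. \<Union>F\<in>Q. R `` {G \<cdot>\<^bsub>K\<^esub> F})\<rparr>"

type_synonym ('o, 'm) papreord_arrow =
  "(('o, 'm) preord_arrow \<times> ('o, 'm) preord_arrow) set"

definition PaPreOrd :: "('o, 'm) cat \<Rightarrow> (('o, 'm) preord, ('o, 'm) papreord_arrow) cat" where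
  "PaPreOrd C = partial_cat (PreOrd C)"

definition Stab :: "('o, 'm) cat \<Rightarrow> (('o, 'm) preord, ('o, 'm) papreord_arrow set) cat" where
  "Stab C = quotient_cat (PaPreOrd C) (stable_rel (PreOrd C) (EqOb C \<inter> ParOrdOb C))"

definition stab_class ::
  "('o, 'm) cat \<Rightarrow> ('o, 'm) preord_arrow \<Rightarrow> ('o, 'm) preord_arrow \<Rightarrow> ('o, 'm) papreord_arrow set"
  where
  "stab_class C \<alpha> f =
     stable_rel (PreOrd C) (EqOb C \<inter> ParOrdOb C) `` {partial_class (PreOrd C) \<alpha> f}"

definition Sigma_functor :: "('o, 'm) cat \<Rightarrow>
    (('o, 'm) preord, ('o, 'm) preord_arrow, ('o, 'm) preord, ('o, 'm) papreord_arrow set) ftor"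
  where
  "Sigma_functor C = \<lparr>on_ob = (\<lambda>A. A),
     on_ar = (\<lambda>f. stab_class C (Ide (PreOrd C) (Dom (PreOrd C) f)) f)\<rparr>"


section \<open>Preservation properties and the class of functors\<close>

definition preserves_finite_coproducts ::
  "('o, 'm) cat \<Rightarrow> ('p, 'q) cat \<Rightarrow> ('o, 'm, 'p, 'q) ftor \<Rightarrow> bool" where
  "preserves_finite_coproducts A B G \<longleftrightarrow>
     (\<forall>I. is_initial A I \<longrightarrow> is_initial B (on_ob G I)) \<and>
     (\<forall>i j. is_coproduct A i j \<longrightarrow> is_coproduct B (on_ar G i) (on_ar G j))"

definition zkernels_to_kernels ::
  "('o, 'm) cat \<Rightarrow> 'o set \<Rightarrow> ('p, 'q) cat \<Rightarrow> ('o, 'm, 'p, 'q) ftor \<Rightarrow> bool" where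
  "zkernels_to_kernels A \<Z> B G \<longleftrightarrow>
     (\<forall>k f. is_zkernel A \<Z> k f \<longrightarrow> is_kernel B (on_ar G k) (on_ar G f))"

definition zcokernels_to_cokernels ::
  "('o, 'm) cat \<Rightarrow> 'o set \<Rightarrow> ('p, 'q) cat \<Rightarrow> ('o, 'm, 'p, 'q) ftor \<Rightarrow> bool" where
  "zcokernels_to_cokernels A \<Z> B G \<longleftrightarrow>
     (\<forall>q f. is_zcokernel A \<Z> q f \<longrightarrow> is_cokernel B (on_ar G q) (on_ar G f))"

definition zexact_to_exact ::
  "('o, 'm) cat \<Rightarrow> 'o set \<Rightarrow> ('p, 'q) cat \<Rightarrow> ('o, 'm, 'p, 'q) ftor \<Rightarrow> bool" where
  "zexact_to_exact A \<Z> B G \<longleftrightarrow>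
     (\<forall>f g. short_zexact A \<Z> f g \<longrightarrow> short_exact B (on_ar G f) (on_ar G g))"

definition disjoint_coproducts :: "('o, 'm) cat \<Rightarrow> bool" where
  "disjoint_coproducts X \<longleftrightarrow>
     (\<forall>i j. is_coproduct X i j \<longrightarrow> is_mono X i \<and> is_mono X j \<and>
        (\<exists>p q. is_pullback X i j p q \<and> is_mono X (i \<cdot>\<^bsub>X\<^esub> p) \<and>
           (\<forall>m. is_mono X m \<and> Cod X m = Cod X i \<longrightarrow> subobj_le X (i \<cdot>\<^bsub>X\<^esub> p) m)))"

definition preuniversal_coproducts :: "('o, 'm) cat \<Rightarrow> bool" where
  "preuniversal_coproducts X \<longleftrightarrow>
     (\<forall>sA sB f. is_coproduct X sA sB \<and> f \<in> Ar X \<and> Cod X f = Cod X sA \<longrightarrow>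
        (\<exists>sA' sB'. is_coproduct X sA' sB' \<and> Cod X sA' = Dom X f \<and>
           (\<exists>fA \<in> hom X (Dom X sA') (Dom X sA). f \<cdot>\<^bsub>X\<^esub> sA' = sA \<cdot>\<^bsub>X\<^esub> fA) \<and>
           (\<exists>fB \<in> hom X (Dom X sB') (Dom X sB). f \<cdot>\<^bsub>X\<^esub> sB' = sB \<cdot>\<^bsub>X\<^esub> fB)))"

definition admissible_target :: "('o, 'm) cat \<Rightarrow> 'o set \<Rightarrow> 'o set \<Rightarrow> bool" where
  "admissible_target X \<T> \<F> \<longleftrightarrow> category X \<and> pointed X \<and> torsion_theory X \<T> \<F> \<and>
     has_binary_coproducts X \<and> disjoint_coproducts X \<and> preuniversal_coproducts X"

definition coproduct_torsion_functor ::
  "('o, 'm) cat \<Rightarrow> 'o set \<Rightarrow> 'o set \<Rightarrow> ('p, 'q) cat \<Rightarrow> 'p set \<Rightarrow> 'p set \<Rightarrow>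
   ('o, 'm, 'p, 'q) ftor \<Rightarrow> bool" where
  "coproduct_torsion_functor A \<T> \<F> B \<T>' \<F>' G \<longleftrightarrow>
     preserves_finite_coproducts A B G \<and> torsion_theory_functor A \<T> \<F> B \<T>' \<F>' G"

end

theory Submission
  imports Defs
begin

text \<open>
  A partial arrow from \<open>A\<close> to \<open>B\<close> defined on a complemented subobject is the same as a total arrow
  from \<open>A\<close> to \<open>B + 1\<close>, and the congruence defining the stable category becomes: two total arrows
  agree on one summand of a coproduct decomposition of \<open>A\<close> and are trivial on the other one. Hence
  the coprojection \<open>B \<rightarrow> B + 1\<close> becomes invertible in the stable category, and each of its arrows
  \<open>\<phi>\<close> into \<open>B\<close> is determined by \<open>\<Sigma>(incl) \<circ> \<phi> = \<Sigma>(t)\<close> for some arrow \<open>t\<close> of preorders into \<open>B + 1\<close>.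
  This forces the value of the induced functor at \<open>\<phi>\<close>, and reduces kernels and
  cokernels in the stable category to the \<open>\<Z>\<close>-kernels and \<open>\<Z>\<close>-cokernels of \<open>t\<close>. All this only
  uses that the category of preorders is extensive with finite limits and has \<open>\<Z>\<close>-kernels and
  \<open>\<Z>\<close>-cokernels; transitive closures are needed for the latter.
\<close>

section \<open>Arrows, coproducts and pullbacks\<close>

text \<open>Arrows of \<open>Stab C\<close> are classes of classes of partial arrows, composed
  through all representatives and all pullbacks. Reading partial arrows as total arrows to
  \<open>B + 1\<close> replaces this by Kleisli composition for the monad \<open>- + 1\<close>,
  modulo the relation \<open>sim\<close>. Since the terminal preorder is trivial, a functor that
  sends trivial objects to zero objects and preserves coproducts inverts the coprojection of
  \<open>B\<close> into \<open>B + 1\<close>, so such a functor cannot see the difference between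
  the two readings. The delicate point is uniqueness for cokernels: a congruence after composing
  with a \<Z>-cokernel \<open>q\<close> is witnessed by a decomposition of the source of
  \<open>q\<close>, and this has to be moved to its target. That works because \<open>1 + 1\<close>
  is again trivial. On the concrete side, relations are jointly monic pairs and surjections have no
  sections. Preorders are therefore treated through generalized elements, which are localized in two
  ways: along the summands of a coproduct decomposition and along covers.\<close>

declare hom_def [simp]

locale cat =
  fixes C :: "('o, 'm) cat" (structure)
  assumes category: "category C"
begin

lemma Dom_Ob [simp]: "f \<in> Ar C \<Longrightarrow> Dom C f \<in> Ob C"
  and Cod_Ob [simp]: "f \<in> Ar C \<Longrightarrow> Cod C f \<in> Ob C"
  and Ide_Ar [simp]: "A \<in> Ob C \<Longrightarrow> Ide C A \<in> Ar C"
  and Dom_Ide [simp]: "A \<in> Ob C \<Longrightarrow> Dom C (Ide C A) = A"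
  and Cod_Ide [simp]: "A \<in> Ob C \<Longrightarrow> Cod C (Ide C A) = A"
  using category by (auto simp: category_def)

lemma comp_Ar [simp]: "f \<in> Ar C \<Longrightarrow> g \<in> Ar C \<Longrightarrow> Cod C f = Dom C g \<Longrightarrow> g \<cdot> f \<in> Ar C"
  and Dom_comp [simp]: "f \<in> Ar C \<Longrightarrow> g \<in> Ar C \<Longrightarrow> Cod C f = Dom C g \<Longrightarrow> Dom C (g \<cdot> f) = Dom C f"
  and Cod_comp [simp]: "f \<in> Ar C \<Longrightarrow> g \<in> Ar C \<Longrightarrow> Cod C f = Dom C g \<Longrightarrow> Cod C (g \<cdot> f) = Cod C g"
  using category by (auto simp: category_def)

lemma comp_Ide [simp]: "f \<in> Ar C \<Longrightarrow> Dom C f = A \<Longrightarrow> f \<cdot> Ide C A = f"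
  and Ide_comp [simp]: "f \<in> Ar C \<Longrightarrow> Cod C f = A \<Longrightarrow> Ide C A \<cdot> f = f"
  using category by (auto simp: category_def)

lemma assoc [simp]: "f \<in> Ar C \<Longrightarrow> g \<in> Ar C \<Longrightarrow> h \<in> Ar C \<Longrightarrow> Cod C f = Dom C g \<Longrightarrow> Cod C g = Dom C h
    \<Longrightarrow> (h \<cdot> g) \<cdot> f = h \<cdot> (g \<cdot> f)"
  using category by (auto simp: category_def)

text \<open>The simplifier nests composites to the right by \<open>assoc\<close>, and there an
  equation \<open>a \<cdot> b = r\<close> no longer matches inside a longer composite. This is the
  form in which it can still be used for rewriting.\<close>

lemma reassoc: "a \<cdot> b = r \<Longrightarrow> a \<in> Ar C \<Longrightarrow> b \<in> Ar C \<Longrightarrow> x \<in> Ar C \<Longrightarrow> Cod C x = Dom C b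
    \<Longrightarrow> Cod C b = Dom C a \<Longrightarrow> a \<cdot> (b \<cdot> x) = r \<cdot> x"
  using assoc by metis

lemma is_isoE:
  assumes "is_iso C f"
  obtains g where "f \<in> Ar C" "g \<in> Ar C" "Dom C g = Cod C f" "Cod C g = Dom C f"
    "g \<cdot> f = Ide C (Dom C f)" "f \<cdot> g = Ide C (Cod C f)"
  using assms by (auto simp: is_iso_def)

lemma is_isoI: "f \<in> Ar C \<Longrightarrow> g \<in> Ar C \<Longrightarrow> Dom C g = Cod C f \<Longrightarrow> Cod C g = Dom C f
    \<Longrightarrow> g \<cdot> f = Ide C (Dom C f) \<Longrightarrow> f \<cdot> g = Ide C (Cod C f) \<Longrightarrow> is_iso C f"
  by (auto simp: is_iso_def)

lemma is_iso_Ide: "A \<in> Ob C \<Longrightarrow> is_iso C (Ide C A)"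
  by (rule is_isoI[of _ "Ide C A"]) auto

lemma is_mono_Ar: "is_mono C m \<Longrightarrow> m \<in> Ar C"
  by (simp add: is_mono_def)

lemma mono_cancel: "is_mono C m \<Longrightarrow> m \<cdot> u = m \<cdot> v \<Longrightarrow> u \<in> Ar C \<Longrightarrow> v \<in> Ar C \<Longrightarrow> Cod C u = Dom C m
    \<Longrightarrow> Cod C v = Dom C m \<Longrightarrow> u = v"
  by (metis Dom_comp is_mono_def)

lemma is_monoI: "m \<in> Ar C \<Longrightarrow> (\<And>u v. u \<in> Ar C \<Longrightarrow> v \<in> Ar C \<Longrightarrow> Dom C v = Dom C u \<Longrightarrow> Cod C u = Dom C m
    \<Longrightarrow> Cod C v = Dom C m \<Longrightarrow> m \<cdot> u = m \<cdot> v \<Longrightarrow> u = v) \<Longrightarrow> is_mono C m"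
  by (auto simp: is_mono_def)

lemma iso_mono: assumes "is_iso C f" shows "is_mono C f"
proof -
  obtain g where g [simp]: "f \<in> Ar C" "g \<in> Ar C" "Dom C g = Cod C f" "Cod C g = Dom C f"
    "g \<cdot> f = Ide C (Dom C f)"
    using assms by (rule is_isoE)
  show ?thesis
  proof (rule is_monoI)
    fix u v assume [simp]: "u \<in> Ar C" "v \<in> Ar C" "Dom C v = Dom C u" "Cod C u = Dom C f"
      "Cod C v = Dom C f" and "f \<cdot> u = f \<cdot> v"
    then have "g \<cdot> (f \<cdot> u) = g \<cdot> (f \<cdot> v)" by simp
    then show "u = v" by (simp add: reassoc[OF g(5)])
  qed simp
qed

lemma mono_comp:
  assumes "is_mono C f" "is_mono C g" "Cod C f = Dom C g"
  shows "is_mono C (g \<cdot> f)"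
proof (rule is_monoI)
  have [simp]: "f \<in> Ar C" "g \<in> Ar C" using assms by (auto simp: is_mono_def)
  show "g \<cdot> f \<in> Ar C" by (simp add: assms(3))
  fix u v assume [simp]: "u \<in> Ar C" "v \<in> Ar C" "Dom C v = Dom C u" "Cod C u = Dom C (g \<cdot> f)"
    "Cod C v = Dom C (g \<cdot> f)" and e: "(g \<cdot> f) \<cdot> u = (g \<cdot> f) \<cdot> v"
  have "g \<cdot> (f \<cdot> u) = g \<cdot> (f \<cdot> v)" using e assms(3) by simp
  then have "f \<cdot> u = f \<cdot> v" by (rule mono_cancel[OF assms(2)]) (auto simp: assms(3))
  then show "u = v" by (rule mono_cancel[OF assms(1)]) (auto simp: assms(3))
qed

lemma mono_left_factor:
  assumes "is_mono C (g \<cdot> f)" "f \<in> Ar C" "g \<in> Ar C" "Cod C f = Dom C g"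
  shows "is_mono C f"
proof (rule is_monoI)
  fix u v assume [simp]: "u \<in> Ar C" "v \<in> Ar C" "Dom C v = Dom C u" "Cod C u = Dom C f"
    "Cod C v = Dom C f" and e: "f \<cdot> u = f \<cdot> v"
  show "u = v" by (rule mono_cancel[OF assms(1)]) (use assms e in auto)
qed (use assms in simp)

lemma initial_arrow:
  assumes "is_initial C I" "A \<in> Ob C"
  obtains f where "f \<in> Ar C" "Dom C f = I" "Cod C f = A"
  using assms by (auto simp: is_initial_def)

lemma initial_eq: "is_initial C (Dom C u) \<Longrightarrow> u \<in> Ar C \<Longrightarrow> v \<in> Ar C \<Longrightarrow> Dom C v = Dom C u
    \<Longrightarrow> Cod C v = Cod C u \<Longrightarrow> u = v"
  using Cod_Ob[of u] unfolding is_initial_def hom_def by (metis (mono_tags, lifting) mem_Collect_eq)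

lemma terminal_arrow:
  assumes "is_terminal C T" "A \<in> Ob C"
  obtains f where "f \<in> Ar C" "Dom C f = A" "Cod C f = T"
  using assms by (auto simp: is_terminal_def)

lemma terminal_eq: "is_terminal C (Cod C u) \<Longrightarrow> u \<in> Ar C \<Longrightarrow> v \<in> Ar C \<Longrightarrow> Dom C v = Dom C u
    \<Longrightarrow> Cod C v = Cod C u \<Longrightarrow> u = v"
  using Dom_Ob[of u] unfolding is_terminal_def hom_def by (metis (mono_tags, lifting) mem_Collect_eq)

lemma iso_initial:
  assumes "is_iso C f" "is_initial C (Dom C f)"
  shows "is_initial C (Cod C f)"
proof -
  obtain g where g [simp]: "f \<in> Ar C" "g \<in> Ar C" "Dom C g = Cod C f" "Cod C g = Dom C f"
    "g \<cdot> f = Ide C (Dom C f)" "f \<cdot> g = Ide C (Cod C f)"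
    using assms(1) by (rule is_isoE)
  show ?thesis unfolding is_initial_def
  proof (intro conjI ballI)
    fix A assume A: "A \<in> Ob C"
    obtain u where [simp]: "u \<in> Ar C" "Dom C u = Dom C f" "Cod C u = A"
      using initial_arrow[OF assms(2) A] .
    show "\<exists>!u. u \<in> hom C (Cod C f) A"
    proof (rule ex1I[of _ "u \<cdot> g"])
      fix v assume "v \<in> hom C (Cod C f) A"
      then have [simp]: "v \<in> Ar C" "Dom C v = Cod C f" "Cod C v = A" by auto
      have "v \<cdot> f = u" by (rule initial_eq) (auto simp: assms)
      from reassoc[OF this, of g] show "v = u \<cdot> g" by simp
    qed simp
  qed simp
qed

lemma initial_unique_iso:
  assumes "is_initial C I" "is_initial C J"
  obtains k where "is_iso C k" "Dom C k = I" "Cod C k = J"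
proof -
  have IJ: "I \<in> Ob C" "J \<in> Ob C" using assms by (auto simp: is_initial_def)
  obtain k where [simp]: "k \<in> Ar C" "Dom C k = I" "Cod C k = J" using initial_arrow[OF assms(1) IJ(2)] .
  obtain l where [simp]: "l \<in> Ar C" "Dom C l = J" "Cod C l = I" using initial_arrow[OF assms(2) IJ(1)] .
  have "is_iso C k"
    by (rule is_isoI[of _ l]) (auto intro!: initial_eq simp: assms IJ)
  then show thesis using that by simp
qed

section \<open>Coproducts\<close>

lemma coproductD:
  assumes "is_coproduct C i j"
  shows "i \<in> Ar C" "j \<in> Ar C" "Cod C j = Cod C i"
  using assms by (auto simp: is_coproduct_def)

lemma copair_ex1:
  assumes "is_coproduct C i j" "f \<in> Ar C" "g \<in> Ar C" "Dom C f = Dom C i" "Dom C g = Dom C j"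
    "Cod C g = Cod C f"
  shows "\<exists>!h. h \<in> hom C (Cod C i) (Cod C f) \<and> h \<cdot> i = f \<and> h \<cdot> j = g"
proof -
  have "\<forall>f\<in>Ar C. \<forall>g\<in>Ar C. Dom C f = Dom C i \<and> Dom C g = Dom C j \<and> Cod C f = Cod C g \<longrightarrow>
        (\<exists>!h. h \<in> hom C (Cod C i) (Cod C f) \<and> h \<cdot> i = f \<and> h \<cdot> j = g)"
    using assms(1) unfolding is_coproduct_def by blast
  from this[rule_format, OF assms(2,3)] show ?thesis using assms(4-6) by (simp only: simp_thms)
qed

lemma copair:
  assumes "is_coproduct C i j" "f \<in> Ar C" "g \<in> Ar C" "Dom C f = Dom C i" "Dom C g = Dom C j"
    "Cod C g = Cod C f"
  obtains h where "h \<in> Ar C" "Dom C h = Cod C i" "Cod C h = Cod C f" "h \<cdot> i = f" "h \<cdot> j = g"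
  using copair_ex1[OF assms] that by auto

lemma coproduct_eq:
  assumes "is_coproduct C i j" "h \<cdot> i = k \<cdot> i" "h \<cdot> j = k \<cdot> j" "h \<in> Ar C" "k \<in> Ar C"
    "Dom C h = Cod C i" "Dom C k = Cod C i" "Cod C k = Cod C h"
  shows "h = k"
proof -
  note D = coproductD[OF assms(1)]
  have "\<exists>!l. l \<in> hom C (Cod C i) (Cod C (h \<cdot> i)) \<and> l \<cdot> i = h \<cdot> i \<and> l \<cdot> j = h \<cdot> j"
    by (rule copair_ex1[OF assms(1)]) (simp_all add: D assms(4-))
  then obtain l where l: "\<And>l'. l' \<in> hom C (Cod C i) (Cod C (h \<cdot> i)) \<and> l' \<cdot> i = h \<cdot> i \<and> l' \<cdot> j = h \<cdot> j \<Longrightarrow> l' = l"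
    by (elim ex1E) blast
  have "h = l" by (rule l) (simp add: D assms(4-))
  moreover have "k = l" by (rule l) (simp add: D assms)
  ultimately show ?thesis by simp
qed

lemma coproductI:
  assumes "i \<in> Ar C" "j \<in> Ar C" "Cod C j = Cod C i"
    "\<And>f g. f \<in> Ar C \<Longrightarrow> g \<in> Ar C \<Longrightarrow> Dom C f = Dom C i \<Longrightarrow> Dom C g = Dom C j \<Longrightarrow> Cod C g = Cod C f
      \<Longrightarrow> \<exists>h. h \<in> Ar C \<and> Dom C h = Cod C i \<and> Cod C h = Cod C f \<and> h \<cdot> i = f \<and> h \<cdot> j = g"
    "\<And>h k. h \<in> Ar C \<Longrightarrow> k \<in> Ar C \<Longrightarrow> Dom C h = Cod C i \<Longrightarrow> Dom C k = Cod C i \<Longrightarrow> Cod C k = Cod C h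
      \<Longrightarrow> h \<cdot> i = k \<cdot> i \<Longrightarrow> h \<cdot> j = k \<cdot> j \<Longrightarrow> h = k"
  shows "is_coproduct C i j"
  unfolding is_coproduct_def
proof (intro conjI ballI impI)
  fix f g assume "f \<in> Ar C" "g \<in> Ar C" "Dom C f = Dom C i \<and> Dom C g = Dom C j \<and> Cod C f = Cod C g"
  then obtain h where "h \<in> Ar C \<and> Dom C h = Cod C i \<and> Cod C h = Cod C f \<and> h \<cdot> i = f \<and> h \<cdot> j = g"
    using assms(4)[of f g] by auto
  then show "\<exists>!h. h \<in> hom C (Cod C i) (Cod C f) \<and> h \<cdot> i = f \<and> h \<cdot> j = g"
    by (intro ex1I[of _ h]) (simp, rule assms(5), auto)
qed (use assms(1-3) in auto)

lemma coproduct_sym: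
  assumes "is_coproduct C i j" shows "is_coproduct C j i"
proof (rule coproductI)
  note D = coproductD[OF assms]
  fix f g assume "f \<in> Ar C" "g \<in> Ar C" "Dom C f = Dom C j" "Dom C g = Dom C i" "Cod C g = Cod C f"
  then show "\<exists>h. h \<in> Ar C \<and> Dom C h = Cod C j \<and> Cod C h = Cod C f \<and> h \<cdot> j = f \<and> h \<cdot> i = g"
    by - (rule copair[OF assms, of g f], simp_all add: D, blast)
next
  note D = coproductD[OF assms]
  fix h k assume "h \<in> Ar C" "k \<in> Ar C" "Dom C h = Cod C j" "Dom C k = Cod C j" "Cod C k = Cod C h"
    "h \<cdot> j = k \<cdot> j" "h \<cdot> i = k \<cdot> i"
  then show "h = k" by - (rule coproduct_eq[OF assms], simp_all add: D)
qed (use coproductD[OF assms] in auto)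

lemma coproduct_iso_dom:
  assumes "is_coproduct C i j" "is_iso C a" "is_iso C b" "Cod C a = Dom C i" "Cod C b = Dom C j"
  shows "is_coproduct C (i \<cdot> a) (j \<cdot> b)"
proof -
  note [simp] = coproductD[OF assms(1)] assms(4,5)
  obtain a' where a [simp]: "a \<in> Ar C" "a' \<in> Ar C" "Dom C a' = Cod C a" "Cod C a' = Dom C a"
    "a' \<cdot> a = Ide C (Dom C a)" "a \<cdot> a' = Ide C (Cod C a)" using assms(2) by (rule is_isoE)
  obtain b' where b [simp]: "b \<in> Ar C" "b' \<in> Ar C" "Dom C b' = Cod C b" "Cod C b' = Dom C b"
    "b' \<cdot> b = Ide C (Dom C b)" "b \<cdot> b' = Ide C (Cod C b)" using assms(3) by (rule is_isoE)
  show ?thesis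
  proof (rule coproductI)
    fix f g assume [simp]: "f \<in> Ar C" "g \<in> Ar C" "Dom C f = Dom C (i \<cdot> a)" "Dom C g = Dom C (j \<cdot> b)"
      "Cod C g = Cod C f"
    obtain h where [simp]: "h \<in> Ar C" "Dom C h = Cod C i" "Cod C h = Cod C (f \<cdot> a')" 
      and h: "h \<cdot> i = f \<cdot> a'" "h \<cdot> j = g \<cdot> b'"
      by (rule copair[OF assms(1), of "f \<cdot> a'" "g \<cdot> b'"]) auto
    show "\<exists>h. h \<in> Ar C \<and> Dom C h = Cod C (i \<cdot> a) \<and> Cod C h = Cod C f \<and> h \<cdot> (i \<cdot> a) = f \<and> h \<cdot> (j \<cdot> b) = g"
      by (intro exI[of _ h]) (auto simp: reassoc[OF h(1)] reassoc[OF h(2)])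
  next
    fix h k assume [simp]: "h \<in> Ar C" "k \<in> Ar C" "Dom C h = Cod C (i \<cdot> a)" "Dom C k = Cod C (i \<cdot> a)"
      "Cod C k = Cod C h" and e: "h \<cdot> (i \<cdot> a) = k \<cdot> (i \<cdot> a)" "h \<cdot> (j \<cdot> b) = k \<cdot> (j \<cdot> b)"
    have "(h \<cdot> (i \<cdot> a)) \<cdot> a' = (k \<cdot> (i \<cdot> a)) \<cdot> a'" "(h \<cdot> (j \<cdot> b)) \<cdot> b' = (k \<cdot> (j \<cdot> b)) \<cdot> b'"
      using e by auto
    then have "h \<cdot> i = k \<cdot> i" "h \<cdot> j = k \<cdot> j" by auto
    then show "h = k" by (rule coproduct_eq[OF assms(1)]) auto
  qed auto
qed

lemma coproduct_iso_cod:
  assumes "is_coproduct C i j" "is_iso C k" "Dom C k = Cod C i"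
  shows "is_coproduct C (k \<cdot> i) (k \<cdot> j)"
proof -
  note [simp] = coproductD[OF assms(1)]
  obtain l where l [simp]: "k \<in> Ar C" "l \<in> Ar C" "Dom C l = Cod C k" "Cod C l = Dom C k"
    "l \<cdot> k = Ide C (Dom C k)" "k \<cdot> l = Ide C (Cod C k)" using assms(2) by (rule is_isoE)
  note [simp] = assms(3)
  show ?thesis
  proof (rule coproductI)
    fix f g assume [simp]: "f \<in> Ar C" "g \<in> Ar C" "Dom C f = Dom C (k \<cdot> i)" "Dom C g = Dom C (k \<cdot> j)"
      "Cod C g = Cod C f"
    obtain h where [simp]: "h \<in> Ar C" "Dom C h = Cod C i" "Cod C h = Cod C f" 
      and h: "h \<cdot> i = f" "h \<cdot> j = g"
      by (rule copair[OF assms(1), of "f" "g"]) auto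
    show "\<exists>h. h \<in> Ar C \<and> Dom C h = Cod C (k \<cdot> i) \<and> Cod C h = Cod C f \<and> h \<cdot> (k \<cdot> i) = f \<and> h \<cdot> (k \<cdot> j) = g"
      by (intro exI[of _ "h \<cdot> l"]) (auto simp: reassoc[OF l(5)] h)
  next
    fix h h' assume [simp]: "h \<in> Ar C" "h' \<in> Ar C" "Dom C h = Cod C (k \<cdot> i)" "Dom C h' = Cod C (k \<cdot> i)"
      "Cod C h' = Cod C h" and e: "h \<cdot> (k \<cdot> i) = h' \<cdot> (k \<cdot> i)" "h \<cdot> (k \<cdot> j) = h' \<cdot> (k \<cdot> j)"
    have "h \<cdot> k = h' \<cdot> k" by (rule coproduct_eq[OF assms(1)]) (auto simp: e)
    then have "(h \<cdot> k) \<cdot> l = (h' \<cdot> k) \<cdot> l" by simp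
    then show "h = h'" by simp
  qed auto
qed

lemma coproduct_unique:
  assumes "is_coproduct C i j" "is_coproduct C i' j'" "Dom C i' = Dom C i" "Dom C j' = Dom C j"
  obtains k where "is_iso C k" "k \<in> Ar C" "Dom C k = Cod C i" "Cod C k = Cod C i'" "k \<cdot> i = i'" "k \<cdot> j = j'"
proof -
  note [simp] = coproductD[OF assms(1)] coproductD[OF assms(2)] assms(3,4)
  obtain k where k [simp]: "k \<in> Ar C" "Dom C k = Cod C i" "Cod C k = Cod C i'" "k \<cdot> i = i'" "k \<cdot> j = j'"
    by (rule copair[OF assms(1), of i' j']) auto
  obtain l where l [simp]: "l \<in> Ar C" "Dom C l = Cod C i'" "Cod C l = Cod C i" "l \<cdot> i' = i" "l \<cdot> j' = j"
    by (rule copair[OF assms(2), of i j]) auto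
  have "is_iso C k"
    by (rule is_isoI[of _ l])
      (simp_all, (rule coproduct_eq[OF assms(1)], simp_all), (rule coproduct_eq[OF assms(2)], simp_all))
  then show thesis using that by simp
qed

lemma coproduct_initial:
  assumes "i \<in> Ar C" "is_iso C i" "j \<in> Ar C" "Cod C j = Cod C i" "is_initial C (Dom C j)"
  shows "is_coproduct C i j"
proof -
  obtain l where l [simp]: "i \<in> Ar C" "l \<in> Ar C" "Dom C l = Cod C i" "Cod C l = Dom C i"
    "l \<cdot> i = Ide C (Dom C i)" "i \<cdot> l = Ide C (Cod C i)" using assms(2) by (rule is_isoE)
  note [simp] = assms(1,3,4)
  show ?thesis
  proof (rule coproductI)
    fix f g assume [simp]: "f \<in> Ar C" "g \<in> Ar C" "Dom C f = Dom C i" "Dom C g = Dom C j" "Cod C g = Cod C f"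
    have "(f \<cdot> l) \<cdot> j = g" by (rule initial_eq) (auto simp: assms)
    then show "\<exists>h. h \<in> Ar C \<and> Dom C h = Cod C i \<and> Cod C h = Cod C f \<and> h \<cdot> i = f \<and> h \<cdot> j = g"
      by (intro exI[of _ "f \<cdot> l"]) auto
  next
    fix h k assume [simp]: "h \<in> Ar C" "k \<in> Ar C" "Dom C h = Cod C i" "Dom C k = Cod C i"
      "Cod C k = Cod C h" and "h \<cdot> i = k \<cdot> i"
    then have "(h \<cdot> i) \<cdot> l = (k \<cdot> i) \<cdot> l" by simp
    then show "h = k" by simp
  qed auto
qed

text \<open>Copairing the identity with the arrow out of the initial summand gives the inverse. This
  is what makes an adjoined point invisible once it has been sent to a zero object.\<close>

lemma coproduct_initial_iso:
  assumes "is_coproduct C i j" "is_initial C (Dom C j)"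
  shows "is_iso C i"
proof -
  note [simp] = coproductD[OF assms(1)]
  obtain z where [simp]: "z \<in> Ar C" "Dom C z = Dom C j" "Cod C z = Dom C i"
    using initial_arrow[OF assms(2), of "Dom C i"] by auto
  obtain l where [simp]: "l \<in> Ar C" "Dom C l = Cod C i" "Cod C l = Dom C i" "l \<cdot> i = Ide C (Dom C i)"
    "l \<cdot> j = z" by (rule copair[OF assms(1), of "Ide C (Dom C i)" z]) auto
  have [simp]: "i \<cdot> z = j" by (rule initial_eq) (auto simp: assms)
  have "i \<cdot> l = Ide C (Cod C i)" by (rule coproduct_eq[OF assms(1)]) auto
  then show ?thesis by (intro is_isoI[of _ l]) auto
qed

section \<open>Pullbacks\<close>

lemma pullbackD:
  assumes "is_pullback C f g p q"
  shows "f \<in> Ar C" "g \<in> Ar C" "p \<in> Ar C" "q \<in> Ar C" "Cod C g = Cod C f" "Dom C q = Dom C p"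
    "Cod C p = Dom C f" "Cod C q = Dom C g" "f \<cdot> p = g \<cdot> q"
  using assms by (auto simp: is_pullback_def)

lemma pullback_ex1:
  assumes "is_pullback C f g p q" "f \<cdot> u = g \<cdot> v" "u \<in> Ar C" "v \<in> Ar C" "Dom C v = Dom C u"
    "Cod C u = Dom C f" "Cod C v = Dom C g"
  shows "\<exists>!h. h \<in> hom C (Dom C u) (Dom C p) \<and> p \<cdot> h = u \<and> q \<cdot> h = v"
proof -
  have "\<forall>u\<in>Ar C. \<forall>v\<in>Ar C. Dom C u = Dom C v \<and> Cod C u = Dom C f \<and> Cod C v = Dom C g \<and>
        f \<cdot> u = g \<cdot> v \<longrightarrow> (\<exists>!h. h \<in> hom C (Dom C u) (Dom C p) \<and> p \<cdot> h = u \<and> q \<cdot> h = v)"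
    using assms(1) unfolding is_pullback_def by blast
  from this[rule_format, OF assms(3,4)] show ?thesis using assms(2,5-7) by (simp only: simp_thms)
qed

lemma pullback_lift:
  assumes "is_pullback C f g p q" "f \<cdot> u = g \<cdot> v" "u \<in> Ar C" "v \<in> Ar C" "Dom C v = Dom C u"
    "Cod C u = Dom C f" "Cod C v = Dom C g"
  obtains h where "h \<in> Ar C" "Dom C h = Dom C u" "Cod C h = Dom C p" "p \<cdot> h = u" "q \<cdot> h = v"
  using pullback_ex1[OF assms] that by auto

text \<open>That \<open>h\<close> and \<open>k\<close> are parallel is not a premise: it is
  recovered by taking domains in \<open>p \<cdot> h = p \<cdot> k\<close>.\<close>

lemma pullback_eq:
  assumes "is_pullback C f g p q" "p \<cdot> h = p \<cdot> k" "q \<cdot> h = q \<cdot> k" "h \<in> Ar C" "k \<in> Ar C"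
    "Cod C h = Dom C p" "Cod C k = Dom C p"
  shows "h = k"
proof -
  note D = pullbackD[OF assms(1)]
  have "Dom C (p \<cdot> k) = Dom C (p \<cdot> h)" using assms(2) by simp
  then have dk: "Dom C k = Dom C h" by (simp add: D assms(4-))
  have "\<exists>!l. l \<in> hom C (Dom C (p \<cdot> h)) (Dom C p) \<and> p \<cdot> l = p \<cdot> h \<and> q \<cdot> l = q \<cdot> h"
    by (rule pullback_ex1[OF assms(1)]) (simp_all add: D assms(4-) reassoc[OF D(9)])
  then obtain l where l: "\<And>l'. l' \<in> hom C (Dom C (p \<cdot> h)) (Dom C p) \<and> p \<cdot> l' = p \<cdot> h \<and> q \<cdot> l' = q \<cdot> h \<Longrightarrow> l' = l"
    by (elim ex1E) blast
  have "h = l" by (rule l) (simp add: D assms(4-))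
  moreover have "k = l" by (rule l) (simp add: D dk assms)
  ultimately show ?thesis by simp
qed

lemma pullbackI:
  assumes "f \<in> Ar C" "g \<in> Ar C" "p \<in> Ar C" "q \<in> Ar C" "Cod C g = Cod C f" "Dom C q = Dom C p"
    "Cod C p = Dom C f" "Cod C q = Dom C g" "f \<cdot> p = g \<cdot> q"
    "\<And>u v. u \<in> Ar C \<Longrightarrow> v \<in> Ar C \<Longrightarrow> Dom C v = Dom C u \<Longrightarrow> Cod C u = Dom C f \<Longrightarrow> Cod C v = Dom C g
      \<Longrightarrow> f \<cdot> u = g \<cdot> v \<Longrightarrow> \<exists>h. h \<in> Ar C \<and> Dom C h = Dom C u \<and> Cod C h = Dom C p \<and> p \<cdot> h = u \<and> q \<cdot> h = v"
    "\<And>h k. h \<in> Ar C \<Longrightarrow> k \<in> Ar C \<Longrightarrow> Dom C k = Dom C h \<Longrightarrow> Cod C h = Dom C p \<Longrightarrow> Cod C k = Dom C p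
      \<Longrightarrow> p \<cdot> h = p \<cdot> k \<Longrightarrow> q \<cdot> h = q \<cdot> k \<Longrightarrow> h = k"
  shows "is_pullback C f g p q"
  unfolding is_pullback_def
proof (intro conjI ballI impI)
  fix u v assume "u \<in> Ar C" "v \<in> Ar C"
    "Dom C u = Dom C v \<and> Cod C u = Dom C f \<and> Cod C v = Dom C g \<and> f \<cdot> u = g \<cdot> v"
  then obtain h where "h \<in> Ar C \<and> Dom C h = Dom C u \<and> Cod C h = Dom C p \<and> p \<cdot> h = u \<and> q \<cdot> h = v"
    using assms(10)[of u v] by auto
  then show "\<exists>!h. h \<in> hom C (Dom C u) (Dom C p) \<and> p \<cdot> h = u \<and> q \<cdot> h = v"
    by (intro ex1I[of _ h]) (simp, rule assms(11), auto)
qed (use assms(1-9) in auto)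

lemma pullback_sym:
  assumes "is_pullback C f g p q" shows "is_pullback C g f q p"
proof (rule pullbackI)
  note [simp] = pullbackD[OF assms]
  fix u v assume [simp]: "u \<in> Ar C" "v \<in> Ar C" "Dom C v = Dom C u" "Cod C u = Dom C g" "Cod C v = Dom C f"
    and e: "g \<cdot> u = f \<cdot> v"
  obtain h where "h \<in> Ar C" "Dom C h = Dom C v" "Cod C h = Dom C p" "p \<cdot> h = v" "q \<cdot> h = u"
    by (rule pullback_lift[OF assms e[symmetric]]) auto
  then show "\<exists>h. h \<in> Ar C \<and> Dom C h = Dom C u \<and> Cod C h = Dom C q \<and> q \<cdot> h = u \<and> p \<cdot> h = v"
    by (intro exI[of _ h]) auto
next
  note [simp] = pullbackD[OF assms]
  fix h k assume "h \<in> Ar C" "k \<in> Ar C" "Dom C k = Dom C h" "Cod C h = Dom C q" "Cod C k = Dom C q"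
    "q \<cdot> h = q \<cdot> k" "p \<cdot> h = p \<cdot> k"
  then show "h = k" by - (rule pullback_eq[OF assms], simp_all)
qed (simp_all add: pullbackD[OF assms])

lemma pullback_unique:
  assumes "is_pullback C f g p q" "is_pullback C f g p' q'"
  obtains k where "is_iso C k" "k \<in> Ar C" "Dom C k = Dom C p'" "Cod C k = Dom C p" "p \<cdot> k = p'" "q \<cdot> k = q'"
proof -
  note [simp] = pullbackD[OF assms(1)] pullbackD[OF assms(2)]
  obtain k where k [simp]: "k \<in> Ar C" "Dom C k = Dom C p'" "Cod C k = Dom C p" "p \<cdot> k = p'" "q \<cdot> k = q'"
    by (rule pullback_lift[OF assms(1), of p' q']) auto
  obtain l where l [simp]: "l \<in> Ar C" "Dom C l = Dom C p" "Cod C l = Dom C p'" "p' \<cdot> l = p" "q' \<cdot> l = q"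
    by (rule pullback_lift[OF assms(2), of p q]) auto
  have "k \<cdot> l = Ide C (Dom C p)"
    by (rule pullback_eq[OF assms(1)]) (auto simp: reassoc[OF k(4)] reassoc[OF k(5)])
  moreover have "l \<cdot> k = Ide C (Dom C p')"
    by (rule pullback_eq[OF assms(2)]) (auto simp: reassoc[OF l(4)] reassoc[OF l(5)])
  ultimately have "is_iso C k" by (intro is_isoI[of _ l]) auto
  then show thesis using that by simp
qed

lemma pullback_iso_dom:
  assumes "is_pullback C f g p q" "is_iso C k" "Cod C k = Dom C p"
  shows "is_pullback C f g (p \<cdot> k) (q \<cdot> k)"
proof -
  note [simp] = pullbackD[OF assms(1)] assms(3)
  obtain l where l [simp]: "k \<in> Ar C" "l \<in> Ar C" "Dom C l = Cod C k" "Cod C l = Dom C k"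
    "l \<cdot> k = Ide C (Dom C k)" "k \<cdot> l = Ide C (Cod C k)" using assms(2) by (rule is_isoE)
  note k_mono = iso_mono[OF assms(2)]
  show ?thesis
  proof (rule pullbackI)
    fix u v assume [simp]: "u \<in> Ar C" "v \<in> Ar C" "Dom C v = Dom C u" "Cod C u = Dom C f"
      "Cod C v = Dom C g" and e: "f \<cdot> u = g \<cdot> v"
    obtain h where [simp]: "h \<in> Ar C" "Dom C h = Dom C u" "Cod C h = Dom C p" "p \<cdot> h = u" "q \<cdot> h = v"
      by (rule pullback_lift[OF assms(1) e]) auto
    show "\<exists>h. h \<in> Ar C \<and> Dom C h = Dom C u \<and> Cod C h = Dom C (p \<cdot> k) \<and> (p \<cdot> k) \<cdot> h = u \<and> (q \<cdot> k) \<cdot> h = v"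
      by (intro exI[of _ "l \<cdot> h"]) (auto simp: reassoc[OF l(6)])
  next
    fix h h' assume [simp]: "h \<in> Ar C" "h' \<in> Ar C" "Dom C h' = Dom C h" "Cod C h = Dom C (p \<cdot> k)"
      "Cod C h' = Dom C (p \<cdot> k)" and e: "(p \<cdot> k) \<cdot> h = (p \<cdot> k) \<cdot> h'" "(q \<cdot> k) \<cdot> h = (q \<cdot> k) \<cdot> h'"
    have "k \<cdot> h = k \<cdot> h'" by (rule pullback_eq[OF assms(1)]) (use e in auto)
    then show "h = h'" by (rule mono_cancel[OF k_mono]) auto
  qed (auto simp: reassoc[OF pullbackD(9)[OF assms(1)]])
qed

lemma pullback_mono_cod:
  assumes "is_pullback C f g p q" "is_mono C k" "Dom C k = Cod C f"
  shows "is_pullback C (k \<cdot> f) (k \<cdot> g) p q"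
proof -
  note [simp] = pullbackD[OF assms(1)] assms(3) is_mono_Ar[OF assms(2)]
  show ?thesis
  proof (rule pullbackI)
    fix u v assume [simp]: "u \<in> Ar C" "v \<in> Ar C" "Dom C v = Dom C u" "Cod C u = Dom C (k \<cdot> f)"
      "Cod C v = Dom C (k \<cdot> g)" and e: "(k \<cdot> f) \<cdot> u = (k \<cdot> g) \<cdot> v"
    have "f \<cdot> u = g \<cdot> v" by (rule mono_cancel[OF assms(2)]) (use e in auto)
    then obtain h where "h \<in> Ar C" "Dom C h = Dom C u" "Cod C h = Dom C p" "p \<cdot> h = u" "q \<cdot> h = v"
      by (rule pullback_lift[OF assms(1)]) auto
    then show "\<exists>h. h \<in> Ar C \<and> Dom C h = Dom C u \<and> Cod C h = Dom C p \<and> p \<cdot> h = u \<and> q \<cdot> h = v"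
      by blast
  next
    fix h k assume "h \<in> Ar C" "k \<in> Ar C" "Dom C k = Dom C h" "Cod C h = Dom C p" "Cod C k = Dom C p"
      "p \<cdot> h = p \<cdot> k" "q \<cdot> h = q \<cdot> k"
    then show "h = k" by - (rule pullback_eq[OF assms(1)])
  qed auto
qed

lemma pullback_mono:
  assumes "is_pullback C f g p q" "is_mono C g"
  shows "is_mono C p"
proof (rule is_monoI)
  note [simp] = pullbackD[OF assms(1)] is_mono_Ar[OF assms(2)]
  show "p \<in> Ar C" by simp
  fix u v assume [simp]: "u \<in> Ar C" "v \<in> Ar C" "Dom C v = Dom C u" "Cod C u = Dom C p"
      "Cod C v = Dom C p" and e: "p \<cdot> u = p \<cdot> v"
  have "g \<cdot> (q \<cdot> u) = g \<cdot> (q \<cdot> v)"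
    using reassoc[OF pullbackD(9)[OF assms(1)], of u] reassoc[OF pullbackD(9)[OF assms(1)], of v] e
    by simp
  then have "q \<cdot> u = q \<cdot> v" by (rule mono_cancel[OF assms(2)]) auto
  with e show "u = v" by (rule pullback_eq[OF assms(1)]) auto
qed

text \<open>Pulling back a composite \<open>i \<cdot> b\<close> in two stages is what composition of
  partial arrows amounts to.\<close>

lemma pullback_paste:
  assumes 1: "is_pullback C t i a f" and 2: "is_pullback C f b a' f'"
  shows "is_pullback C t (i \<cdot> b) (a \<cdot> a') f'"
proof (rule pullbackI)
  note [simp] = pullbackD[OF 1] pullbackD[OF 2]
  note sq = reassoc[OF pullbackD(9)[OF 1]] reassoc[OF pullbackD(9)[OF 2]]
  show "t \<cdot> a \<cdot> a' = (i \<cdot> b) \<cdot> f'" by (simp add: sq)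
  fix u v assume [simp]: "u \<in> Ar C" "v \<in> Ar C" "Dom C v = Dom C u" "Cod C u = Dom C t"
    "Cod C v = Dom C (i \<cdot> b)" and e: "t \<cdot> u = (i \<cdot> b) \<cdot> v"
  have "t \<cdot> u = i \<cdot> (b \<cdot> v)" using e by simp
  then obtain h where [simp]: "h \<in> Ar C" "Dom C h = Dom C u" "Cod C h = Dom C a" "a \<cdot> h = u"
    and fh: "f \<cdot> h = b \<cdot> v" by (rule pullback_lift[OF 1]) auto
  obtain k where [simp]: "k \<in> Ar C" "Dom C k = Dom C u" "Cod C k = Dom C a'" "a' \<cdot> k = h" "f' \<cdot> k = v"
    by (rule pullback_lift[OF 2 fh]) auto
  show "\<exists>h. h \<in> Ar C \<and> Dom C h = Dom C u \<and> Cod C h = Dom C (a \<cdot> a') \<and> (a \<cdot> a') \<cdot> h = u \<and> f' \<cdot> h = v"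
    by (intro exI[of _ k]) auto
next
  note [simp] = pullbackD[OF 1] pullbackD[OF 2]
  note sq = reassoc[OF pullbackD(9)[OF 1]] reassoc[OF pullbackD(9)[OF 2]]
  fix h k assume [simp]: "h \<in> Ar C" "k \<in> Ar C" "Dom C k = Dom C h" "Cod C h = Dom C (a \<cdot> a')"
    "Cod C k = Dom C (a \<cdot> a')" and e: "(a \<cdot> a') \<cdot> h = (a \<cdot> a') \<cdot> k" "f' \<cdot> h = f' \<cdot> k"
  have "a' \<cdot> h = a' \<cdot> k" by (rule pullback_eq[OF 1]) (use e in \<open>auto simp: sq\<close>)
  then show "h = k" using e(2) by (rule pullback_eq[OF 2]) auto
qed (auto simp: pullbackD[OF 1] pullbackD[OF 2])

end

subsection \<open>Trivial arrows, kernels and cokernels\<close>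

lemma ex1_eq: "\<exists>!x. Q x \<Longrightarrow> Q a \<Longrightarrow> Q b \<Longrightarrow> a = b"
  by blast

context cat
begin

lemma triv_Ar: "trivial_arrow C Z f \<Longrightarrow> f \<in> Ar C"
  by (simp add: trivial_arrow_def)

lemma trivE:
  assumes "trivial_arrow C Z f"
  obtains g h where "f = h \<cdot> g" "g \<in> Ar C" "h \<in> Ar C" "Dom C g = Dom C f" "Cod C g = Dom C h"
    "Cod C h = Cod C f" "Cod C g \<in> Z"
  using assms by (auto simp: trivial_arrow_def)

lemma trivI: "g \<in> Ar C \<Longrightarrow> h \<in> Ar C \<Longrightarrow> Cod C g = Dom C h \<Longrightarrow> Cod C g \<in> Z \<Longrightarrow> trivial_arrow C Z (h \<cdot> g)"
  unfolding trivial_arrow_def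
  by (intro conjI bexI[of _ "Cod C g"] bexI[of _ g] bexI[of _ h]) simp_all

lemma triv_through: "A \<in> Z \<Longrightarrow> f \<in> Ar C \<Longrightarrow> Cod C f = A \<Longrightarrow> trivial_arrow C Z f"
  using trivI[of f "Ide C A"] Cod_Ob[of f] by auto

lemma triv_from: "A \<in> Z \<Longrightarrow> f \<in> Ar C \<Longrightarrow> Dom C f = A \<Longrightarrow> trivial_arrow C Z f"
  using trivI[of "Ide C A" f] Dom_Ob[of f] by auto

lemma triv_comp_left:
  assumes "trivial_arrow C Z f" "h \<in> Ar C" "Dom C h = Cod C f"
  shows "trivial_arrow C Z (h \<cdot> f)"
proof -
  obtain g k where "f = k \<cdot> g" and [simp]: "g \<in> Ar C" "k \<in> Ar C" "Cod C g = Dom C k"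
    and "Cod C k = Cod C f" "Cod C g \<in> Z" using assms(1) by (rule trivE)
  then show ?thesis using assms(2,3) trivI[of g "h \<cdot> k" Z] by simp
qed

lemma triv_comp_right:
  assumes "trivial_arrow C Z f" "h \<in> Ar C" "Cod C h = Dom C f"
  shows "trivial_arrow C Z (f \<cdot> h)"
proof -
  obtain g k where "f = k \<cdot> g" and [simp]: "g \<in> Ar C" "k \<in> Ar C" "Cod C g = Dom C k"
    and "Dom C g = Dom C f" "Cod C g \<in> Z" using assms(1) by (rule trivE)
  then show ?thesis using assms(2,3) trivI[of "g \<cdot> h" k Z] by simp
qed

lemma triv_iso_left:
  assumes "is_iso C m" "f \<in> Ar C" "Cod C f = Dom C m"
  shows "trivial_arrow C Z (m \<cdot> f) \<longleftrightarrow> trivial_arrow C Z f"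
proof
  obtain n where n [simp]: "m \<in> Ar C" "n \<in> Ar C" "Dom C n = Cod C m" "Cod C n = Dom C m" "n \<cdot> m = Ide C (Dom C m)"
    using assms(1) by (rule is_isoE)
  show "trivial_arrow C Z f" if "trivial_arrow C Z (m \<cdot> f)"
    using triv_comp_left[OF that, of n] assms(2,3) by (simp add: reassoc[OF n(5)])
  show "trivial_arrow C Z (m \<cdot> f)" if "trivial_arrow C Z f"
    using triv_comp_left[OF that, of m] assms(2,3) by simp
qed

lemma triv_iso_right:
  assumes "is_iso C m" "f \<in> Ar C" "Dom C f = Cod C m"
  shows "trivial_arrow C Z (f \<cdot> m) \<longleftrightarrow> trivial_arrow C Z f"
proof
  obtain n where n [simp]: "m \<in> Ar C" "n \<in> Ar C" "Dom C n = Cod C m" "Cod C n = Dom C m" "m \<cdot> n = Ide C (Cod C m)"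
    using assms(1) by (rule is_isoE)
  show "trivial_arrow C Z f" if "trivial_arrow C Z (f \<cdot> m)"
    using triv_comp_right[OF that, of n] assms(2,3) by simp
  show "trivial_arrow C Z (f \<cdot> m)" if "trivial_arrow C Z f"
    using triv_comp_right[OF that, of m] assms(2,3) by simp
qed

lemma zero_arrow_eq:
  assumes "trivial_arrow C (zero_objects C) f" "trivial_arrow C (zero_objects C) g"
    "Dom C g = Dom C f" "Cod C g = Cod C f"
  shows "f = g"
proof -
  obtain a b where f: "f = b \<cdot> a" and [simp]: "a \<in> Ar C" "b \<in> Ar C" "Dom C a = Dom C f" "Cod C a = Dom C b"
    "Cod C b = Cod C f" and z: "Dom C b \<in> zero_objects C" using assms(1) by (elim trivE) simp
  obtain c d where g: "g = d \<cdot> c" and [simp]: "c \<in> Ar C" "d \<in> Ar C" "Dom C c = Dom C g" "Cod C c = Dom C d"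
    "Cod C d = Cod C g" and z': "Dom C d \<in> zero_objects C" using assms(2) by (elim trivE) simp
  note [simp] = assms(3,4)
  have I: "is_initial C (Dom C b)" and T: "is_terminal C (Dom C d)"
    using z z' by (simp_all add: zero_objects_def)
  \<comment> \<open>The two arrows may factor through different zero objects; \<open>x\<close> is
    the comparison between these.\<close>
  obtain x where [simp]: "x \<in> Ar C" "Dom C x = Dom C b" "Cod C x = Dom C d"
    by (rule initial_arrow[OF I, of "Dom C d"]) simp
  have c: "x \<cdot> a = c" by (rule terminal_eq) (simp_all add: T)
  have b: "d \<cdot> x = b" by (rule initial_eq) (simp_all add: I)
  from reassoc[OF b, of a] show ?thesis by (simp add: f g c)
qed

lemma zkernelD:
  assumes "is_zkernel C Z k f"
  shows "k \<in> Ar C" "f \<in> Ar C" "Cod C k = Dom C f" "trivial_arrow C Z (f \<cdot> k)"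
  using assms by (auto simp: is_zkernel_def)

lemma zkernel_ex1:
  assumes "is_zkernel C Z k f" "g \<in> Ar C" "Cod C g = Dom C f" "trivial_arrow C Z (f \<cdot> g)"
  shows "\<exists>!h. h \<in> hom C (Dom C g) (Dom C k) \<and> k \<cdot> h = g"
  using assms unfolding is_zkernel_def by blast

lemma zkernel_lift:
  assumes "is_zkernel C Z k f" "g \<in> Ar C" "Cod C g = Dom C f" "trivial_arrow C Z (f \<cdot> g)"
  obtains h where "h \<in> Ar C" "Dom C h = Dom C g" "Cod C h = Dom C k" "k \<cdot> h = g"
  using zkernel_ex1[OF assms] that by auto

text \<open>Every \<open>f \<cdot> k \<cdot> u\<close> is trivial, so the uniqueness clause applies
  to the factorization of \<open>k \<cdot> u\<close> through \<open>k\<close>.\<close>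

lemma zkernel_mono:
  assumes "is_zkernel C Z k f" shows "is_mono C k"
proof (rule is_monoI)
  note [simp] = zkernelD(1-3)[OF assms]
  show "k \<in> Ar C" by simp
  fix u v assume [simp]: "u \<in> Ar C" "v \<in> Ar C" "Dom C v = Dom C u" "Cod C u = Dom C k"
    "Cod C v = Dom C k" and e: "k \<cdot> u = k \<cdot> v"
  have "trivial_arrow C Z ((f \<cdot> k) \<cdot> u)" by (rule triv_comp_right[OF zkernelD(4)[OF assms]]) simp_all
  then have "\<exists>!h. h \<in> hom C (Dom C (k \<cdot> u)) (Dom C k) \<and> k \<cdot> h = k \<cdot> u"
    by (intro zkernel_ex1[OF assms]) simp_all
  then show "u = v" by (rule ex1_eq) (simp_all add: e)
qed

lemma zkernelI:
  assumes "k \<in> Ar C" "f \<in> Ar C" "Cod C k = Dom C f" "trivial_arrow C Z (f \<cdot> k)" "is_mono C k"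
    "\<And>g. g \<in> Ar C \<Longrightarrow> Cod C g = Dom C f \<Longrightarrow> trivial_arrow C Z (f \<cdot> g)
      \<Longrightarrow> \<exists>h. h \<in> Ar C \<and> Dom C h = Dom C g \<and> Cod C h = Dom C k \<and> k \<cdot> h = g"
  shows "is_zkernel C Z k f"
  unfolding is_zkernel_def
proof (intro conjI ballI impI)
  fix g assume "g \<in> Ar C" "Cod C g = Dom C f \<and> trivial_arrow C Z (f \<cdot> g)"
  then obtain h where h: "h \<in> Ar C" "Dom C h = Dom C g" "Cod C h = Dom C k" "k \<cdot> h = g"
    using assms(6)[of g] by blast
  show "\<exists>!h. h \<in> hom C (Dom C g) (Dom C k) \<and> k \<cdot> h = g"
  proof (rule ex1I[of _ h])
    fix h' assume "h' \<in> hom C (Dom C g) (Dom C k) \<and> k \<cdot> h' = g"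
    then show "h' = h" using h by (intro mono_cancel[OF assms(5), of h' h]) simp_all
  qed (use h in simp)
qed (use assms(1-4) in auto)

lemma zkernel_unique:
  assumes "is_zkernel C Z k f" "is_zkernel C Z k' f"
  obtains m where "is_iso C m" "m \<in> Ar C" "Dom C m = Dom C k'" "Cod C m = Dom C k" "k \<cdot> m = k'"
proof -
  note [simp] = zkernelD[OF assms(1)] zkernelD[OF assms(2)]
  obtain m where m [simp]: "m \<in> Ar C" "Dom C m = Dom C k'" "Cod C m = Dom C k" "k \<cdot> m = k'"
    by (rule zkernel_lift[OF assms(1), of k']) simp_all
  obtain n where n [simp]: "n \<in> Ar C" "Dom C n = Dom C k" "Cod C n = Dom C k'" "k' \<cdot> n = k"
    by (rule zkernel_lift[OF assms(2), of k]) simp_all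
  have "m \<cdot> n = Ide C (Dom C k)"
    by (rule mono_cancel[OF zkernel_mono[OF assms(1)]]) (simp_all add: reassoc[OF m(4)])
  moreover have "n \<cdot> m = Ide C (Dom C k')"
    by (rule mono_cancel[OF zkernel_mono[OF assms(2)]]) (simp_all add: reassoc[OF n(4)])
  ultimately have "is_iso C m" by (intro is_isoI[of _ n]) simp_all
  then show thesis using that by simp
qed

lemma zkernel_iso:
  assumes "is_zkernel C Z k f" "is_iso C m" "Cod C m = Dom C k"
  shows "is_zkernel C Z (k \<cdot> m) f"
proof (rule zkernelI)
  note [simp] = zkernelD[OF assms(1)] assms(3)
  obtain n where n [simp]: "m \<in> Ar C" "n \<in> Ar C" "Dom C n = Cod C m" "Cod C n = Dom C m" 
    "m \<cdot> n = Ide C (Cod C m)" using assms(2) by (rule is_isoE)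
  show "k \<cdot> m \<in> Ar C" "f \<in> Ar C" "Cod C (k \<cdot> m) = Dom C f" by simp_all
  show "trivial_arrow C Z (f \<cdot> k \<cdot> m)" using triv_comp_right[OF zkernelD(4)[OF assms(1)], of m] by simp
  show "is_mono C (k \<cdot> m)" by (rule mono_comp[OF iso_mono[OF assms(2)] zkernel_mono[OF assms(1)]]) simp
  fix g assume g: "g \<in> Ar C" "Cod C g = Dom C f" "trivial_arrow C Z (f \<cdot> g)"
  obtain h where "h \<in> Ar C" "Dom C h = Dom C g" "Cod C h = Dom C k" "k \<cdot> h = g"
    by (rule zkernel_lift[OF assms(1) g])
  then show "\<exists>h. h \<in> Ar C \<and> Dom C h = Dom C g \<and> Cod C h = Dom C (k \<cdot> m) \<and> (k \<cdot> m) \<cdot> h = g"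
    by (intro exI[of _ "n \<cdot> h"]) (simp add: reassoc[OF n(5)])
qed

text \<open>Composing with an isomorphism does not change which composites are trivial. In this way
  an arrow of the stable category and its composite with the image of \<open>incl\<close> will share
  their kernels.\<close>

lemma zkernel_iso_left:
  assumes "is_iso C m" "f \<in> Ar C" "Dom C m = Cod C f"
  shows "is_zkernel C Z k (m \<cdot> f) \<longleftrightarrow> is_zkernel C Z k f"
proof -
  note [simp] = assms(2,3)
  have [simp]: "m \<in> Ar C" using assms(1) by (simp add: is_iso_def)
  have t: "trivial_arrow C Z ((m \<cdot> f) \<cdot> g) \<longleftrightarrow> trivial_arrow C Z (f \<cdot> g)" if "g \<in> Ar C" "Cod C g = Dom C f" for g
    using triv_iso_left[OF assms(1), of "f \<cdot> g" Z] that by simp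
  show ?thesis
  proof
    assume k: "is_zkernel C Z k (m \<cdot> f)"
    have [simp]: "k \<in> Ar C" "Cod C k = Dom C f" using zkernelD[OF k] by simp_all
    show "is_zkernel C Z k f"
    proof (rule zkernelI)
      fix g assume g: "g \<in> Ar C" "Cod C g = Dom C f" "trivial_arrow C Z (f \<cdot> g)"
      have g': "Cod C g = Dom C (m \<cdot> f)" "trivial_arrow C Z ((m \<cdot> f) \<cdot> g)"
        using g t[OF g(1,2)] by simp_all
      obtain h where "h \<in> Ar C" "Dom C h = Dom C g" "Cod C h = Dom C k" "k \<cdot> h = g"
        by (rule zkernel_lift[OF k g(1) g'])
      then show "\<exists>h. h \<in> Ar C \<and> Dom C h = Dom C g \<and> Cod C h = Dom C k \<and> k \<cdot> h = g" by blast
    qed (use zkernelD(4)[OF k] t[of k] zkernel_mono[OF k] in simp_all)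
  next
    assume k: "is_zkernel C Z k f"
    have [simp]: "k \<in> Ar C" "Cod C k = Dom C f" using zkernelD[OF k] by simp_all
    show "is_zkernel C Z k (m \<cdot> f)"
    proof (rule zkernelI)
      fix g assume g: "g \<in> Ar C" "Cod C g = Dom C (m \<cdot> f)" "trivial_arrow C Z ((m \<cdot> f) \<cdot> g)"
      have g': "Cod C g = Dom C f" using g(2) by simp
      have "trivial_arrow C Z (f \<cdot> g)" using g(3) t[OF g(1) g'] by blast
      then obtain h where "h \<in> Ar C" "Dom C h = Dom C g" "Cod C h = Dom C k" "k \<cdot> h = g"
        by (rule zkernel_lift[OF k g(1) g'])
      then show "\<exists>h. h \<in> Ar C \<and> Dom C h = Dom C g \<and> Cod C h = Dom C k \<and> k \<cdot> h = g" by blast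
    qed (use zkernelD(4)[OF k] t[of k] zkernel_mono[OF k] in simp_all)
  qed
qed

lemma zcokernelD:
  assumes "is_zcokernel C Z q f"
  shows "q \<in> Ar C" "f \<in> Ar C" "Dom C q = Cod C f" "trivial_arrow C Z (q \<cdot> f)"
  using assms by (auto simp: is_zcokernel_def)

lemma zcokernel_ex1:
  assumes "is_zcokernel C Z q f" "g \<in> Ar C" "Dom C g = Cod C f" "trivial_arrow C Z (g \<cdot> f)"
  shows "\<exists>!h. h \<in> hom C (Cod C q) (Cod C g) \<and> h \<cdot> q = g"
  using assms unfolding is_zcokernel_def by blast

lemma zcokernel_lift:
  assumes "is_zcokernel C Z q f" "g \<in> Ar C" "Dom C g = Cod C f" "trivial_arrow C Z (g \<cdot> f)"
  obtains h where "h \<in> Ar C" "Dom C h = Cod C q" "Cod C h = Cod C g" "h \<cdot> q = g"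
  using zcokernel_ex1[OF assms] that by auto

lemma zcokernel_eq:
  assumes "is_zcokernel C Z q f" "h \<cdot> q = k \<cdot> q" "h \<in> Ar C" "k \<in> Ar C" "Dom C h = Cod C q"
    "Dom C k = Cod C q" "Cod C k = Cod C h"
  shows "h = k"
proof -
  note [simp] = zcokernelD(1-3)[OF assms(1)] assms(3-)
  have "trivial_arrow C Z (h \<cdot> (q \<cdot> f))" by (rule triv_comp_left[OF zcokernelD(4)[OF assms(1)]]) simp_all
  then have "\<exists>!l. l \<in> hom C (Cod C q) (Cod C (h \<cdot> q)) \<and> l \<cdot> q = h \<cdot> q"
    by (intro zcokernel_ex1[OF assms(1)]) simp_all
  then show "h = k" by (rule ex1_eq) (simp_all add: assms(2))
qed

lemma zcokernelI:
  assumes "q \<in> Ar C" "f \<in> Ar C" "Dom C q = Cod C f" "trivial_arrow C Z (q \<cdot> f)"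
    "\<And>h k. h \<in> Ar C \<Longrightarrow> k \<in> Ar C \<Longrightarrow> Dom C h = Cod C q \<Longrightarrow> Dom C k = Cod C q \<Longrightarrow> Cod C k = Cod C h
      \<Longrightarrow> h \<cdot> q = k \<cdot> q \<Longrightarrow> h = k"
    "\<And>g. g \<in> Ar C \<Longrightarrow> Dom C g = Cod C f \<Longrightarrow> trivial_arrow C Z (g \<cdot> f)
      \<Longrightarrow> \<exists>h. h \<in> Ar C \<and> Dom C h = Cod C q \<and> Cod C h = Cod C g \<and> h \<cdot> q = g"
  shows "is_zcokernel C Z q f"
  unfolding is_zcokernel_def
proof (intro conjI ballI impI)
  fix g assume "g \<in> Ar C" "Dom C g = Cod C f \<and> trivial_arrow C Z (g \<cdot> f)"
  then obtain h where h: "h \<in> Ar C" "Dom C h = Cod C q" "Cod C h = Cod C g" "h \<cdot> q = g"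
    using assms(6)[of g] by blast
  show "\<exists>!h. h \<in> hom C (Cod C q) (Cod C g) \<and> h \<cdot> q = g"
  proof (rule ex1I[of _ h])
    fix h' assume "h' \<in> hom C (Cod C q) (Cod C g) \<and> h' \<cdot> q = g"
    then show "h' = h" using h by (intro assms(5)[of h' h]) simp_all
  qed (use h in simp)
qed (use assms(1-4) in auto)

lemma zcokernel_unique:
  assumes "is_zcokernel C Z q f" "is_zcokernel C Z q' f"
  obtains m where "is_iso C m" "m \<in> Ar C" "Dom C m = Cod C q" "Cod C m = Cod C q'" "m \<cdot> q = q'"
proof -
  note [simp] = zcokernelD[OF assms(1)] zcokernelD[OF assms(2)]
  obtain m where m [simp]: "m \<in> Ar C" "Dom C m = Cod C q" "Cod C m = Cod C q'" "m \<cdot> q = q'"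
    by (rule zcokernel_lift[OF assms(1), of q']) simp_all
  obtain n where n [simp]: "n \<in> Ar C" "Dom C n = Cod C q'" "Cod C n = Cod C q" "n \<cdot> q' = q"
    by (rule zcokernel_lift[OF assms(2), of q]) simp_all
  have "m \<cdot> n = Ide C (Cod C q')" by (rule zcokernel_eq[OF assms(2)]) simp_all
  moreover have "n \<cdot> m = Ide C (Cod C q)" by (rule zcokernel_eq[OF assms(1)]) simp_all
  ultimately have "is_iso C m" by (intro is_isoI[of _ n]) simp_all
  then show thesis using that by simp
qed

lemma zcokernel_iso:
  assumes "is_zcokernel C Z q f" "is_iso C m" "Dom C m = Cod C q"
  shows "is_zcokernel C Z (m \<cdot> q) f"
proof (rule zcokernelI)
  note [simp] = zcokernelD[OF assms(1)] assms(3)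
  obtain n where n [simp]: "m \<in> Ar C" "n \<in> Ar C" "Dom C n = Cod C m" "Cod C n = Dom C m" 
    "n \<cdot> m = Ide C (Dom C m)" "m \<cdot> n = Ide C (Cod C m)" using assms(2) by (rule is_isoE)
  show "m \<cdot> q \<in> Ar C" "f \<in> Ar C" "Dom C (m \<cdot> q) = Cod C f" by simp_all
  show "trivial_arrow C Z ((m \<cdot> q) \<cdot> f)" using triv_comp_left[OF zcokernelD(4)[OF assms(1)], of m] by simp
  show "h = k" if "h \<in> Ar C" "k \<in> Ar C" "Dom C h = Cod C (m \<cdot> q)" "Dom C k = Cod C (m \<cdot> q)"
    "Cod C k = Cod C h" and e: "h \<cdot> m \<cdot> q = k \<cdot> m \<cdot> q" for h k
  proof -
    note [simp] = that(1-5)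
    have "h \<cdot> m = k \<cdot> m" by (rule zcokernel_eq[OF assms(1)]) (simp_all add: e)
    then have "(h \<cdot> m) \<cdot> n = (k \<cdot> m) \<cdot> n" by simp
    then show ?thesis by simp
  qed
  fix g assume g: "g \<in> Ar C" "Dom C g = Cod C f" "trivial_arrow C Z (g \<cdot> f)"
  obtain h where "h \<in> Ar C" "Dom C h = Cod C q" "Cod C h = Cod C g" "h \<cdot> q = g"
    by (rule zcokernel_lift[OF assms(1) g])
  then show "\<exists>h. h \<in> Ar C \<and> Dom C h = Cod C (m \<cdot> q) \<and> Cod C h = Cod C g \<and> h \<cdot> m \<cdot> q = g"
    by (intro exI[of _ "h \<cdot> n"]) (simp add: reassoc[OF n(5)])
qed

text \<open>The target moves along \<open>m\<close>, hence so does the cokernel. With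
  \<open>m\<close> the image of \<open>incl B\<close>, a cokernel of a classifying arrow becomes one
  of the arrow that it classifies.\<close>

lemma zcokernel_iso_left:
  assumes "is_iso C m" "f \<in> Ar C" "Dom C m = Cod C f" "is_zcokernel C Z q (m \<cdot> f)"
  shows "is_zcokernel C Z (q \<cdot> m) f"
proof (rule zcokernelI)
  note [simp] = assms(2,3)
  obtain n where n [simp]: "m \<in> Ar C" "n \<in> Ar C" "Dom C n = Cod C m" "Cod C n = Dom C m" 
    "n \<cdot> m = Ide C (Dom C m)" "m \<cdot> n = Ide C (Cod C m)" using assms(1) by (rule is_isoE)
  have [simp]: "q \<in> Ar C" "Dom C q = Cod C m" using zcokernelD[OF assms(4)] by simp_all
  show "q \<cdot> m \<in> Ar C" "f \<in> Ar C" "Dom C (q \<cdot> m) = Cod C f" by simp_all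
  show "trivial_arrow C Z ((q \<cdot> m) \<cdot> f)" using zcokernelD(4)[OF assms(4)] by simp
  show "h = k" if "h \<in> Ar C" "k \<in> Ar C" "Dom C h = Cod C (q \<cdot> m)" "Dom C k = Cod C (q \<cdot> m)"
    "Cod C k = Cod C h" and e: "h \<cdot> q \<cdot> m = k \<cdot> q \<cdot> m" for h k
  proof -
    note [simp] = that(1-5)
    have "(h \<cdot> q \<cdot> m) \<cdot> n = (k \<cdot> q \<cdot> m) \<cdot> n" by (simp only: e)
    then have "h \<cdot> q = k \<cdot> q" by simp
    then show ?thesis by (rule zcokernel_eq[OF assms(4)]) simp_all
  qed
  fix g assume [simp]: "g \<in> Ar C" "Dom C g = Cod C f" and t: "trivial_arrow C Z (g \<cdot> f)"
  obtain h where [simp]: "h \<in> Ar C" "Dom C h = Cod C q" "Cod C h = Cod C (g \<cdot> n)" and h: "h \<cdot> q = g \<cdot> n"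
    by (rule zcokernel_lift[OF assms(4), of "g \<cdot> n"]) (simp_all add: reassoc[OF n(5)] t)
  show "\<exists>h. h \<in> Ar C \<and> Dom C h = Cod C (q \<cdot> m) \<and> Cod C h = Cod C g \<and> h \<cdot> q \<cdot> m = g"
    by (intro exI[of _ h]) (simp add: reassoc[OF h])
qed

subsection \<open>Rearranging coproducts\<close>

text \<open>Regrouping of \<open>(A + B) + J\<close> as \<open>A + (B + J)\<close>: the complement
  of a composite of coprojections is the sum of the two complements.\<close>

lemma coproduct_assoc:
  assumes 1: "is_coproduct C i j" and 2: "is_coproduct C a b" "Cod C a = Dom C i"
    and 3: "is_coproduct C p q" "Dom C p = Dom C b" "Dom C q = Dom C j"
    and m: "m \<in> Ar C" "Dom C m = Cod C p" "Cod C m = Cod C i" "m \<cdot> p = i \<cdot> b" "m \<cdot> q = j"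
  shows "is_coproduct C (i \<cdot> a) m"
proof -
  note [simp] = coproductD[OF 1] coproductD[OF 2(1)] coproductD[OF 3(1)] 2(2) 3(2,3) m
  show ?thesis
  proof (rule coproductI)
    fix f g assume [simp]: "f \<in> Ar C" "g \<in> Ar C" "Dom C f = Dom C (i \<cdot> a)" "Dom C g = Dom C m"
      "Cod C g = Cod C f"
    obtain h where h [simp]: "h \<in> Ar C" "Dom C h = Cod C a" "Cod C h = Cod C f" "h \<cdot> a = f"
      "h \<cdot> b = g \<cdot> p" by (rule copair[OF 2(1), of f "g \<cdot> p"]) auto
    obtain k where k [simp]: "k \<in> Ar C" "Dom C k = Cod C i" "Cod C k = Cod C f" "k \<cdot> i = h"
      "k \<cdot> j = g \<cdot> q" by (rule copair[OF 1, of h "g \<cdot> q"]) auto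
    have "k \<cdot> m = g"
      by (rule coproduct_eq[OF 3(1)]) (simp_all add: reassoc[OF k(4)])
    then show "\<exists>h. h \<in> Ar C \<and> Dom C h = Cod C (i \<cdot> a) \<and> Cod C h = Cod C f \<and> h \<cdot> i \<cdot> a = f \<and> h \<cdot> m = g"
      by (intro exI[of _ k]) (simp add: reassoc[OF k(4)])
  next
    fix h k assume [simp]: "h \<in> Ar C" "k \<in> Ar C" "Dom C h = Cod C (i \<cdot> a)" "Dom C k = Cod C (i \<cdot> a)"
      "Cod C k = Cod C h" and e: "h \<cdot> i \<cdot> a = k \<cdot> i \<cdot> a" "h \<cdot> m = k \<cdot> m"
    have "(h \<cdot> m) \<cdot> p = (k \<cdot> m) \<cdot> p" "(h \<cdot> m) \<cdot> q = (k \<cdot> m) \<cdot> q" using e(2) by simp_all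
    then have b: "h \<cdot> i \<cdot> b = k \<cdot> i \<cdot> b" and j: "h \<cdot> j = k \<cdot> j" by simp_all
    have "h \<cdot> i = k \<cdot> i"
      by (rule coproduct_eq[OF 2(1)]) (simp_all add: e(1) b)
    then show "h = k" by (rule coproduct_eq[OF 1]) (simp_all add: j)
  qed auto
qed

text \<open>Regrouping of \<open>(A + B) + (C + D)\<close> as \<open>(A + C) + (B + D)\<close>, by
  which decompositions of two summands merge into one decomposition of their sum.\<close>

lemma coproduct_interchange:
  assumes 1: "is_coproduct C i j" and 2: "is_coproduct C a b" "Cod C a = Dom C i"
    and 3: "is_coproduct C c d" "Cod C c = Dom C j"
    and 4: "is_coproduct C p q" "Dom C p = Dom C a" "Dom C q = Dom C c"
    and 5: "is_coproduct C p' q'" "Dom C p' = Dom C b" "Dom C q' = Dom C d"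
    and m: "m \<in> Ar C" "Dom C m = Cod C p" "Cod C m = Cod C i" "m \<cdot> p = i \<cdot> a" "m \<cdot> q = j \<cdot> c"
    and n: "n \<in> Ar C" "Dom C n = Cod C p'" "Cod C n = Cod C i" "n \<cdot> p' = i \<cdot> b" "n \<cdot> q' = j \<cdot> d"
  shows "is_coproduct C m n"
proof -
  note [simp] = coproductD[OF 1] coproductD[OF 2(1)] coproductD[OF 3(1)] coproductD[OF 4(1)]
    coproductD[OF 5(1)] 2(2) 3(2) 4(2,3) 5(2,3) m n
  show ?thesis
  proof (rule coproductI)
    fix f g assume [simp]: "f \<in> Ar C" "g \<in> Ar C" "Dom C f = Dom C m" "Dom C g = Dom C n"
      "Cod C g = Cod C f"
    obtain h where h [simp]: "h \<in> Ar C" "Dom C h = Cod C a" "Cod C h = Cod C f" "h \<cdot> a = f \<cdot> p"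
      "h \<cdot> b = g \<cdot> p'" by (rule copair[OF 2(1), of "f \<cdot> p" "g \<cdot> p'"]) auto
    obtain l where l [simp]: "l \<in> Ar C" "Dom C l = Cod C c" "Cod C l = Cod C f" "l \<cdot> c = f \<cdot> q"
      "l \<cdot> d = g \<cdot> q'" by (rule copair[OF 3(1), of "f \<cdot> q" "g \<cdot> q'"]) auto
    obtain k where k [simp]: "k \<in> Ar C" "Dom C k = Cod C i" "Cod C k = Cod C f" "k \<cdot> i = h"
      "k \<cdot> j = l" by (rule copair[OF 1, of h l]) auto
    have "k \<cdot> m = f"
      by (rule coproduct_eq[OF 4(1)]) (simp_all add: reassoc[OF k(4)] reassoc[OF k(5)])
    moreover have "k \<cdot> n = g"
      by (rule coproduct_eq[OF 5(1)]) (simp_all add: reassoc[OF k(4)] reassoc[OF k(5)])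
    ultimately show "\<exists>h. h \<in> Ar C \<and> Dom C h = Cod C m \<and> Cod C h = Cod C f \<and> h \<cdot> m = f \<and> h \<cdot> n = g"
      by (intro exI[of _ k]) simp
  next
    fix h k assume [simp]: "h \<in> Ar C" "k \<in> Ar C" "Dom C h = Cod C m" "Dom C k = Cod C m"
      "Cod C k = Cod C h" and e: "h \<cdot> m = k \<cdot> m" "h \<cdot> n = k \<cdot> n"
    have e1: "(h \<cdot> m) \<cdot> p = (k \<cdot> m) \<cdot> p" "(h \<cdot> m) \<cdot> q = (k \<cdot> m) \<cdot> q" using e by simp_all
    have e2: "(h \<cdot> n) \<cdot> p' = (k \<cdot> n) \<cdot> p'" "(h \<cdot> n) \<cdot> q' = (k \<cdot> n) \<cdot> q'" using e by simp_all
    have i: "h \<cdot> i = k \<cdot> i"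
      by (rule coproduct_eq[OF 2(1)]) (use e1 e2 in simp_all)
    have j: "h \<cdot> j = k \<cdot> j"
      by (rule coproduct_eq[OF 3(1)]) (use e1 e2 in simp_all)
    show "h = k" by (rule coproduct_eq[OF 1 i j]) simp_all
  qed auto
qed

end


section \<open>Categories with finite limits and extensive coproducts\<close>

locale lextensive = cat +
  assumes finite_limits: "has_finite_limits C" and extensive: "extensive C"
begin

lemma pullback_exists:
  assumes "f \<in> Ar C" "g \<in> Ar C" "Cod C g = Cod C f"
  obtains p q where "is_pullback C f g p q"
proof -
  have "\<exists>p q. is_pullback C f g p q"
    using finite_limits assms(1,2) assms(3)[symmetric] unfolding has_finite_limits_def by blast
  then show thesis using that by blast
qed

lemma terminal_exists: obtains T where "is_terminal C T"
  using finite_limits unfolding has_finite_limits_def by blast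

lemma initial_exists: obtains I where "is_initial C I"
  using extensive unfolding extensive_def has_finite_coproducts_def by blast

lemma coproduct_exists:
  assumes "A \<in> Ob C" "B \<in> Ob C"
  obtains i j where "is_coproduct C i j" "Dom C i = A" "Dom C j = B" "i \<in> Ar C" "j \<in> Ar C"
    "Cod C j = Cod C i"
proof -
  obtain i j where "is_coproduct C i j" "Dom C i = A" "Dom C j = B"
    using extensive assms unfolding extensive_def has_finite_coproducts_def has_binary_coproducts_def
    by blast
  then show thesis using that coproductD[of i j] by blast
qed

lemma strict_initial: "f \<in> Ar C \<Longrightarrow> is_initial C (Cod C f) \<Longrightarrow> is_initial C (Dom C f)"
  using extensive unfolding extensive_def by blast

lemma coproj_mono:
  assumes "is_coproduct C i j"
  shows "is_mono C i" "is_mono C j"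
  using extensive assms unfolding extensive_def by blast+

text \<open>A common element of the two summands factors through the pullback of the coprojections,
  which is initial, and the source of an arrow into an initial object is initial.\<close>

lemma disjoint:
  assumes "is_coproduct C i j" "i \<cdot> x = j \<cdot> y" "x \<in> Ar C" "y \<in> Ar C" "Cod C x = Dom C i"
    "Cod C y = Dom C j"
  shows "is_initial C (Dom C x)"
proof -
  note [simp] = coproductD[OF assms(1)] assms(3-6)
  obtain p q where pq: "is_pullback C i j p q" by (rule pullback_exists[of i j]) simp_all
  then have ini: "is_initial C (Dom C p)"
    using extensive assms(1) unfolding extensive_def by blast
  have "Dom C (i \<cdot> x) = Dom C (j \<cdot> y)" by (simp only: assms(2))
  then have [simp]: "Dom C y = Dom C x" by simp
  obtain h where "h \<in> Ar C" "Dom C h = Dom C x" "Cod C h = Dom C p"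
    by (rule pullback_lift[OF pq assms(2)]) simp_all
  with ini strict_initial[of h] show ?thesis by simp
qed

lemma decompose:
  assumes "is_coproduct C i j" "f \<in> Ar C" "Cod C f = Cod C i"
  obtains d1 d2 f1 f2 where "is_coproduct C d1 d2" "is_pullback C f i d1 f1" "is_pullback C f j d2 f2"
    "d1 \<in> Ar C" "d2 \<in> Ar C" "f1 \<in> Ar C" "f2 \<in> Ar C" "Cod C d1 = Dom C f" "Cod C d2 = Dom C f"
    "Dom C f1 = Dom C d1" "Dom C f2 = Dom C d2" "Cod C f1 = Dom C i" "Cod C f2 = Dom C j"
    "f \<cdot> d1 = i \<cdot> f1" "f \<cdot> d2 = j \<cdot> f2"
proof -
  note [simp] = coproductD[OF assms(1)] assms(2,3)
  obtain d1 f1 where 1: "is_pullback C f i d1 f1" by (rule pullback_exists[of f i]) simp_all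
  obtain d2 f2 where 2: "is_pullback C f j d2 f2" by (rule pullback_exists[of f j]) simp_all
  have "is_coproduct C d1 d2"
    using extensive assms(1) 1 2 unfolding extensive_def by blast
  then show thesis using that[OF _ 1 2] pullbackD[OF 1] pullbackD[OF 2] by simp
qed

text \<open>A converse to \<open>decompose\<close>. The part of \<open>u\<close> that lies in the
  summand \<open>b\<close> is sent by \<open>t\<close> into both \<open>i\<close> and
  \<open>j\<close>, so this part is initial and \<open>u\<close> factors through
  \<open>a\<close>.\<close>

lemma coproduct_pullback:
  assumes 1: "is_coproduct C a b" and 2: "is_coproduct C i j"
    and t [simp]: "t \<in> Ar C" "Dom C t = Cod C a" "Cod C t = Cod C i"
    and f [simp]: "f \<in> Ar C" "Dom C f = Dom C a" "Cod C f = Dom C i" "t \<cdot> a = i \<cdot> f"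
    and x [simp]: "x \<in> Ar C" "Dom C x = Dom C b" "Cod C x = Dom C j" "t \<cdot> b = j \<cdot> x"
  shows "is_pullback C t i a f"
proof (rule pullbackI)
  note [simp] = coproductD[OF 1] coproductD[OF 2]
  fix u v assume [simp]: "u \<in> Ar C" "v \<in> Ar C" "Dom C v = Dom C u" "Cod C u = Dom C t" "Cod C v = Dom C i"
    and e: "t \<cdot> u = i \<cdot> v"
  obtain d1 d2 u1 u2 where d: "is_coproduct C d1 d2"
    and [simp]: "d1 \<in> Ar C" "d2 \<in> Ar C" "u1 \<in> Ar C" "u2 \<in> Ar C" "Cod C d1 = Dom C u" "Cod C d2 = Dom C u"
    "Dom C u1 = Dom C d1" "Dom C u2 = Dom C d2" "Cod C u1 = Dom C a" "Cod C u2 = Dom C b"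
    and ud: "u \<cdot> d1 = a \<cdot> u1" "u \<cdot> d2 = b \<cdot> u2"
    by (rule decompose[OF 1, of u]) simp_all
  have "i \<cdot> v \<cdot> d2 = t \<cdot> u \<cdot> d2" by (simp add: reassoc[OF e])
  also have "\<dots> = j \<cdot> x \<cdot> u2" by (simp add: ud reassoc[OF x(4)])
  finally have "is_initial C (Dom C (v \<cdot> d2))" by (rule disjoint[OF 2]) simp_all
  then have ini: "is_initial C (Dom C d2)" by simp
  obtain z where [simp]: "z \<in> Ar C" "Dom C z = Dom C d2" "Cod C z = Dom C a"
    using initial_arrow[OF ini, of "Dom C a"] by auto
  obtain h where h [simp]: "h \<in> Ar C" "Dom C h = Cod C d1" "Cod C h = Cod C u1" "h \<cdot> d1 = u1" "h \<cdot> d2 = z"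
    by (rule copair[OF d, of u1 z]) simp_all
  note [simp] = coproductD[OF d]
  have ah: "a \<cdot> h = u"
  proof (rule coproduct_eq[OF d])
    show "(a \<cdot> h) \<cdot> d2 = u \<cdot> d2" by (rule initial_eq) (simp_all add: ini)
  qed (simp_all add: ud)
  have "i \<cdot> f \<cdot> h = t \<cdot> a \<cdot> h" by (simp add: reassoc[OF f(4)])
  also have "\<dots> = i \<cdot> v" by (simp add: ah e)
  finally have "i \<cdot> f \<cdot> h = i \<cdot> v" .
  then have "f \<cdot> h = v" by (rule mono_cancel[OF coproj_mono(1)[OF 2]]) simp_all
  then show "\<exists>h. h \<in> Ar C \<and> Dom C h = Dom C u \<and> Cod C h = Dom C a \<and> a \<cdot> h = u \<and> f \<cdot> h = v"
    using ah by (intro exI[of _ h]) simp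
next
  note [simp] = coproductD[OF 1] coproductD[OF 2]
  fix h k assume "h \<in> Ar C" "k \<in> Ar C" "Dom C k = Dom C h" "Cod C h = Dom C a" "Cod C k = Dom C a"
    "a \<cdot> h = a \<cdot> k"
  then show "h = k" using mono_cancel[OF coproj_mono(1)[OF 1]] by blast
qed (simp_all add: coproductD[OF 1] coproductD[OF 2])

text \<open>Elements are split along \<open>i\<close> and \<open>j\<close>; where two splittings
  disagree, \<open>disj\<close> makes the domain initial. A pair of arrows is treated, not a single
  one, so that subobjects of a sum (\<open>m1 = m2\<close>) and relations on a sum are both
  covered.\<close>

lemma copair_jointly_monic:
  assumes c: "is_coproduct C i j"
    and a [simp]: "a1 \<in> Ar C" "a2 \<in> Ar C" "Dom C a1 = Dom C i" "Dom C a2 = Dom C i"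
      "Cod C a1 = S" "Cod C a2 = T"
    and b [simp]: "b1 \<in> Ar C" "b2 \<in> Ar C" "Dom C b1 = Dom C j" "Dom C b2 = Dom C j"
      "Cod C b1 = S" "Cod C b2 = T"
    and a_monic: "\<And>u v. u \<in> Ar C \<Longrightarrow> v \<in> Ar C \<Longrightarrow> Cod C u = Dom C i \<Longrightarrow> Cod C v = Dom C i
      \<Longrightarrow> Dom C v = Dom C u \<Longrightarrow> a1 \<cdot> u = a1 \<cdot> v \<Longrightarrow> a2 \<cdot> u = a2 \<cdot> v \<Longrightarrow> u = v"
    and b_monic: "\<And>u v. u \<in> Ar C \<Longrightarrow> v \<in> Ar C \<Longrightarrow> Cod C u = Dom C j \<Longrightarrow> Cod C v = Dom C j
      \<Longrightarrow> Dom C v = Dom C u \<Longrightarrow> b1 \<cdot> u = b1 \<cdot> v \<Longrightarrow> b2 \<cdot> u = b2 \<cdot> v \<Longrightarrow> u = v"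
    and disj: "\<And>u v. u \<in> Ar C \<Longrightarrow> v \<in> Ar C \<Longrightarrow> Cod C u = Dom C i \<Longrightarrow> Cod C v = Dom C j
      \<Longrightarrow> Dom C v = Dom C u \<Longrightarrow> a1 \<cdot> u = b1 \<cdot> v \<Longrightarrow> is_initial C (Dom C u)"
    and m [simp]: "m1 \<in> Ar C" "m2 \<in> Ar C" "Dom C m1 = Cod C i" "Dom C m2 = Cod C i"
      "Cod C m1 = S" "Cod C m2 = T" "m1 \<cdot> i = a1" "m1 \<cdot> j = b1" "m2 \<cdot> i = a2" "m2 \<cdot> j = b2"
    and u [simp]: "u \<in> Ar C" "v \<in> Ar C" "Dom C v = Dom C u" "Cod C u = Cod C i" "Cod C v = Cod C i"
    and e: "m1 \<cdot> u = m1 \<cdot> v" "m2 \<cdot> u = m2 \<cdot> v"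
  shows "u = v"
proof -
  note [simp] = coproductD[OF c]
  note mr = reassoc[OF m(7)] reassoc[OF m(8)] reassoc[OF m(9)] reassoc[OF m(10)]
  \<comment> \<open>An element of the sum with the same images as an element \<open>w\<close> of one
    summand is that element. With this only \<open>u\<close> has to be decomposed in the end, and
    \<open>v\<close> is compared with its pieces.\<close>
  have I: "i \<cdot> w = x" if [simp]: "w \<in> Ar C" "x \<in> Ar C" "Cod C w = Dom C i" "Cod C x = Cod C i" "Dom C x = Dom C w"
    and ex: "m1 \<cdot> x = a1 \<cdot> w" "m2 \<cdot> x = a2 \<cdot> w" for w x
  proof -
    obtain d1 d2 x1 x2 where d: "is_coproduct C d1 d2"
      and [simp]: "d1 \<in> Ar C" "d2 \<in> Ar C" "x1 \<in> Ar C" "x2 \<in> Ar C" "Cod C d1 = Dom C x" "Cod C d2 = Dom C x"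
      "Dom C x1 = Dom C d1" "Dom C x2 = Dom C d2" "Cod C x1 = Dom C i" "Cod C x2 = Dom C j"
      and xd: "x \<cdot> d1 = i \<cdot> x1" "x \<cdot> d2 = j \<cdot> x2"
      by (rule decompose[OF c, of x]) simp_all
    have "a1 \<cdot> x1 = m1 \<cdot> x \<cdot> d1" "a2 \<cdot> x1 = m2 \<cdot> x \<cdot> d1" "b1 \<cdot> x2 = m1 \<cdot> x \<cdot> d2"
      by (simp_all add: xd mr)
    then have *: "a1 \<cdot> x1 = a1 \<cdot> w \<cdot> d1" "a2 \<cdot> x1 = a2 \<cdot> w \<cdot> d1" "b1 \<cdot> x2 = a1 \<cdot> w \<cdot> d2"
      by (simp_all add: reassoc[OF ex(1)] reassoc[OF ex(2)])
    have 1: "w \<cdot> d1 = x1" by (rule a_monic) (simp_all add: *)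
    have "is_initial C (Dom C (w \<cdot> d2))" by (rule disj[of _ x2]) (simp_all add: *)
    then have ini: "is_initial C (Dom C d2)" by simp
    show ?thesis
    proof (rule coproduct_eq[OF d])
      show "(i \<cdot> w) \<cdot> d2 = x \<cdot> d2" by (rule initial_eq) (simp_all add: ini)
    qed (simp_all add: xd 1)
  qed
  have J: "j \<cdot> w = x" if [simp]: "w \<in> Ar C" "x \<in> Ar C" "Cod C w = Dom C j" "Cod C x = Cod C i" "Dom C x = Dom C w"
    and ex: "m1 \<cdot> x = b1 \<cdot> w" "m2 \<cdot> x = b2 \<cdot> w" for w x
  proof -
    obtain d1 d2 x1 x2 where d: "is_coproduct C d1 d2"
      and [simp]: "d1 \<in> Ar C" "d2 \<in> Ar C" "x1 \<in> Ar C" "x2 \<in> Ar C" "Cod C d1 = Dom C x" "Cod C d2 = Dom C x"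
      "Dom C x1 = Dom C d1" "Dom C x2 = Dom C d2" "Cod C x1 = Dom C i" "Cod C x2 = Dom C j"
      and xd: "x \<cdot> d1 = i \<cdot> x1" "x \<cdot> d2 = j \<cdot> x2"
      by (rule decompose[OF c, of x]) simp_all
    have "b1 \<cdot> x2 = m1 \<cdot> x \<cdot> d2" "b2 \<cdot> x2 = m2 \<cdot> x \<cdot> d2" "a1 \<cdot> x1 = m1 \<cdot> x \<cdot> d1"
      by (simp_all add: xd mr)
    then have *: "b1 \<cdot> x2 = b1 \<cdot> w \<cdot> d2" "b2 \<cdot> x2 = b2 \<cdot> w \<cdot> d2" "a1 \<cdot> x1 = b1 \<cdot> w \<cdot> d1"
      by (simp_all add: reassoc[OF ex(1)] reassoc[OF ex(2)])
    have 1: "w \<cdot> d2 = x2" by (rule b_monic) (simp_all add: *)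
    have "is_initial C (Dom C x1)" by (rule disj[of _ "w \<cdot> d1"]) (simp_all add: *)
    then have ini: "is_initial C (Dom C d1)" by simp
    show ?thesis
    proof (rule coproduct_eq[OF d])
      show "(j \<cdot> w) \<cdot> d1 = x \<cdot> d1" by (rule initial_eq) (simp_all add: ini)
    qed (simp_all add: xd 1 coproductD[OF d])
  qed
  obtain d1 d2 u1 u2 where d: "is_coproduct C d1 d2"
    and [simp]: "d1 \<in> Ar C" "d2 \<in> Ar C" "u1 \<in> Ar C" "u2 \<in> Ar C" "Cod C d1 = Dom C u" "Cod C d2 = Dom C u"
    "Dom C u1 = Dom C d1" "Dom C u2 = Dom C d2" "Cod C u1 = Dom C i" "Cod C u2 = Dom C j"
    and ud: "u \<cdot> d1 = i \<cdot> u1" "u \<cdot> d2 = j \<cdot> u2"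
    by (rule decompose[OF c, of u]) simp_all
  have "a1 \<cdot> u1 = m1 \<cdot> u \<cdot> d1" "a2 \<cdot> u1 = m2 \<cdot> u \<cdot> d1" "b1 \<cdot> u2 = m1 \<cdot> u \<cdot> d2" "b2 \<cdot> u2 = m2 \<cdot> u \<cdot> d2"
    by (simp_all add: ud mr)
  then have *: "m1 \<cdot> v \<cdot> d1 = a1 \<cdot> u1" "m2 \<cdot> v \<cdot> d1 = a2 \<cdot> u1" "m1 \<cdot> v \<cdot> d2 = b1 \<cdot> u2" "m2 \<cdot> v \<cdot> d2 = b2 \<cdot> u2"
    by (simp_all add: reassoc[OF e(1)] reassoc[OF e(2)])
  have "i \<cdot> u1 = v \<cdot> d1" by (rule I) (simp_all add: *)
  moreover have "j \<cdot> u2 = v \<cdot> d2" by (rule J) (simp_all add: *)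
  ultimately have "u \<cdot> d1 = v \<cdot> d1" "u \<cdot> d2 = v \<cdot> d2" by (simp_all add: ud)
  then show ?thesis by (rule coproduct_eq[OF d]) (simp_all add: coproductD[OF d])
qed

lemma copair_mono:
  assumes c: "is_coproduct C i j" and a: "is_mono C a" "Dom C a = Dom C i" and b: "is_mono C b" "Dom C b = Dom C j"
    "Cod C b = Cod C a"
    and disj: "\<And>u v. u \<in> Ar C \<Longrightarrow> v \<in> Ar C \<Longrightarrow> Cod C u = Dom C i \<Longrightarrow> Cod C v = Dom C j
      \<Longrightarrow> Dom C v = Dom C u \<Longrightarrow> a \<cdot> u = b \<cdot> v \<Longrightarrow> is_initial C (Dom C u)"
    and m: "m \<in> Ar C" "Dom C m = Cod C i" "Cod C m = Cod C a" "m \<cdot> i = a" "m \<cdot> j = b"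
  shows "is_mono C m"
proof (rule is_monoI)
  note [simp] = is_mono_Ar[OF a(1)] is_mono_Ar[OF b(1)] a(2) b(2-) m(1-3)
  fix u v assume uv: "u \<in> Ar C" "v \<in> Ar C" "Dom C v = Dom C u" "Cod C u = Dom C m" "Cod C v = Dom C m" "m \<cdot> u = m \<cdot> v"
  show "u = v"
  proof (rule copair_jointly_monic[OF c, of a a "Cod C a" "Cod C a" b b m m])
    fix x y assume "x \<in> Ar C" "y \<in> Ar C" "Cod C x = Dom C i" "Cod C y = Dom C i" "a \<cdot> x = a \<cdot> y"
    then show "x = y" by - (rule mono_cancel[OF a(1)], simp_all)
  next
    fix x y assume "x \<in> Ar C" "y \<in> Ar C" "Cod C x = Dom C j" "Cod C y = Dom C j" "b \<cdot> x = b \<cdot> y"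
    then show "x = y" by - (rule mono_cancel[OF b(1)], simp_all)
  next
    fix x y assume "x \<in> Ar C" "y \<in> Ar C" "Cod C x = Dom C i" "Cod C y = Dom C j" "Dom C y = Dom C x"
      "a \<cdot> x = b \<cdot> y"
    then show "is_initial C (Dom C x)" by (rule disj)
  qed (use uv m(4,5) in simp_all)
qed (rule m)

text \<open>For subobjects with initial intersection the copairing from the sum is monic, and it
  contains both. The union condition then gives it a section, and a monic arrow with a section is
  invertible. Conversely, a subobject above both coprojections receives the copairing of the two
  factorizations, which is a section of it.\<close>

lemma complement_iff_coproduct: "is_complement C a b \<longleftrightarrow> is_coproduct C a b"
proof
  assume a: "is_complement C a b"
  then obtain p q where mono: "is_mono C a" "is_mono C b" and [simp]: "Cod C b = Cod C a"
    and pq: "is_pullback C a b p q" "is_initial C (Dom C p)"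
    and union: "\<And>u. is_mono C u \<Longrightarrow> subobj_le C a u \<Longrightarrow> subobj_le C b u \<Longrightarrow> subobj_le C (Ide C (Cod C a)) u"
    by (auto simp: is_complement_def)
  note [simp] = mono[THEN is_mono_Ar]
  obtain i j where c: "is_coproduct C i j" and [simp]: "Dom C i = Dom C a" "Dom C j = Dom C b"
    "i \<in> Ar C" "j \<in> Ar C" "Cod C j = Cod C i"
    by (rule coproduct_exists[of "Dom C a" "Dom C b"]) simp_all
  obtain m where m [simp]: "m \<in> Ar C" "Dom C m = Cod C i" "Cod C m = Cod C a" "m \<cdot> i = a" "m \<cdot> j = b"
    by (rule copair[OF c, of a b]) simp_all
  have mm: "is_mono C m"
  proof (rule copair_mono[OF c mono(1) _ mono(2)])
    fix u v assume [simp]: "u \<in> Ar C" "v \<in> Ar C" "Cod C u = Dom C i" "Cod C v = Dom C j" "Dom C v = Dom C u"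
      and e: "a \<cdot> u = b \<cdot> v"
    obtain h where "h \<in> Ar C" "Dom C h = Dom C u" "Cod C h = Dom C p"
      by (rule pullback_lift[OF pq(1) e]) simp_all
    with pq(2) strict_initial[of h] show "is_initial C (Dom C u)" by simp
  qed simp_all
  have "subobj_le C a m" unfolding subobj_le_def by (intro conjI bexI[of _ i]) simp_all
  moreover have "subobj_le C b m" unfolding subobj_le_def by (intro conjI bexI[of _ j]) simp_all
  ultimately have "subobj_le C (Ide C (Cod C a)) m" by (rule union[OF mm])
  then obtain h where h [simp]: "h \<in> Ar C" "Dom C h = Cod C a" "Cod C h = Cod C i" "m \<cdot> h = Ide C (Cod C a)"
    by (auto simp: subobj_le_def)
  have "m \<cdot> h \<cdot> m = m \<cdot> Ide C (Dom C m)" by (simp add: reassoc[OF h(4)])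
  then have "h \<cdot> m = Ide C (Dom C m)" by (rule mono_cancel[OF mm]) simp_all
  then have "is_iso C m" by (intro is_isoI[of _ h]) simp_all
  from coproduct_iso_cod[OF c this] show "is_coproduct C a b" by simp
next
  assume c: "is_coproduct C a b"
  note [simp] = coproductD[OF c]
  obtain p q where pq: "is_pullback C a b p q" by (rule pullback_exists[of a b]) simp_all
  note [simp] = pullbackD[OF pq]
  have ini: "is_initial C (Dom C p)"
    by (rule disjoint[OF c pullbackD(9)[OF pq]]) simp_all
  show "is_complement C a b" unfolding is_complement_def
  proof (intro conjI allI impI)
    fix u assume "is_mono C u \<and> subobj_le C a u \<and> subobj_le C b u"
    then obtain a' b' where [simp]: "u \<in> Ar C" "Cod C u = Cod C a" "a' \<in> Ar C" "b' \<in> Ar C"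
      "Dom C a' = Dom C a" "Dom C b' = Dom C b" "Cod C a' = Dom C u" "Cod C b' = Dom C u"
      and u: "u \<cdot> a' = a" "u \<cdot> b' = b"
      by (auto simp: subobj_le_def is_mono_def)
    obtain h where [simp]: "h \<in> Ar C" "Dom C h = Cod C a" "Cod C h = Dom C u" "h \<cdot> a = a'" "h \<cdot> b = b'"
      by (rule copair[OF c, of a' b']) simp_all
    have "u \<cdot> h = Ide C (Cod C a)" by (rule coproduct_eq[OF c]) (simp_all add: u)
    then show "subobj_le C (Ide C (Cod C a)) u" unfolding subobj_le_def
      by (intro conjI bexI[of _ h]) simp_all
  qed (use pq ini coproj_mono[OF c] in auto)
qed

lemma complemented_iff: "complemented C a \<longleftrightarrow> (\<exists>b. is_coproduct C a b)"
  by (simp add: complemented_def complement_iff_coproduct)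

lemma coproduct_Ide:
  assumes "A \<in> Ob C"
  obtains z where "is_coproduct C (Ide C A) z" "is_initial C (Dom C z)" "z \<in> Ar C" "Cod C z = A"
proof -
  obtain I where I: "is_initial C I" by (rule initial_exists)
  obtain z where [simp]: "z \<in> Ar C" "Dom C z = I" "Cod C z = A" using initial_arrow[OF I assms] .
  have "is_coproduct C (Ide C A) z"
    by (rule coproduct_initial) (use assms I in \<open>simp_all add: is_iso_Ide\<close>)
  then show thesis using that I by simp
qed

lemma complemented_comp:
  assumes "complemented C a" "complemented C b" "Cod C a = Dom C b"
  shows "complemented C (b \<cdot> a)"
proof -
  obtain a' b' where c: "is_coproduct C b b'" "is_coproduct C a a'"
    using assms by (auto simp: complemented_iff)
  note [simp] = coproductD[OF c(1)] coproductD[OF c(2)] assms(3)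
  obtain p q where pq: "is_coproduct C p q" and [simp]: "Dom C p = Dom C a'" "Dom C q = Dom C b'"
    "p \<in> Ar C" "q \<in> Ar C" "Cod C q = Cod C p"
    by (rule coproduct_exists[of "Dom C a'" "Dom C b'"]) simp_all
  obtain m where [simp]: "m \<in> Ar C" "Dom C m = Cod C p" "Cod C m = Cod C b" "m \<cdot> p = b \<cdot> a'" "m \<cdot> q = b'"
    by (rule copair[OF pq, of "b \<cdot> a'" b']) simp_all
  have "is_coproduct C (b \<cdot> a) m" by (rule coproduct_assoc[OF c(1,2) _ pq]) simp_all
  then show ?thesis by (auto simp: complemented_iff)
qed

end

section \<open>The congruence modulo trivial arrows\<close>

text \<open>The conditions make trivial arrows behave like zero arrows for partial maps:
  \<open>Z_coproduct\<close> lets triviality be tested on summands, \<open>Z_terminal\<close> makes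
  the point of \<open>B + 1\<close> trivial, \<open>trivial_mono_cancel\<close> passes from a
  composite with \<open>incl\<close> back to the arrow, and \<open>trivial_Ide\<close> makes the
  zero objects of the quotient exactly \<open>Z\<close>.\<close>

locale stable = lextensive P for P :: "('o, 'm) cat" (structure) +
  fixes Z :: "'o set"
  assumes Z_Ob: "Z \<subseteq> Ob P"
    and Z_coproduct: "is_coproduct P i j \<Longrightarrow> Dom P i \<in> Z \<Longrightarrow> Dom P j \<in> Z \<Longrightarrow> Cod P i \<in> Z"
    and Z_terminal: "\<exists>T\<in>Z. is_terminal P T"
    and trivial_mono_cancel: "is_mono P m \<Longrightarrow> f \<in> Ar P \<Longrightarrow> Cod P f = Dom P m
      \<Longrightarrow> trivial_arrow P Z (m \<cdot> f) \<Longrightarrow> trivial_arrow P Z f"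
    and trivial_Ide: "A \<in> Ob P \<Longrightarrow> trivial_arrow P Z (Ide P A) \<Longrightarrow> A \<in> Z"
begin

abbreviation triv :: "'m \<Rightarrow> bool" where
  "triv \<equiv> trivial_arrow P Z"

text \<open>The factorizations on the two summands combine to one through the sum of the two trivial
  objects, which is trivial by \<open>Z_coproduct\<close>.\<close>

lemma triv_coproduct:
  assumes c: "is_coproduct P i j" and f: "f \<in> Ar P" "Dom P f = Cod P i"
    and t: "triv (f \<cdot> i)" "triv (f \<cdot> j)"
  shows "triv f"
proof -
  note [simp] = coproductD[OF c] f
  obtain g h where g: "f \<cdot> i = h \<cdot> g" and [simp]: "g \<in> Ar P" "h \<in> Ar P" "Dom P g = Dom P (f \<cdot> i)" "Cod P g = Dom P h"
    "Cod P h = Cod P (f \<cdot> i)" and gZ: "Cod P g \<in> Z" using t(1) by (rule trivE)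
  obtain k l where k: "f \<cdot> j = l \<cdot> k" and [simp]: "k \<in> Ar P" "l \<in> Ar P" "Dom P k = Dom P (f \<cdot> j)" "Cod P k = Dom P l"
    "Cod P l = Cod P (f \<cdot> j)" and kZ: "Cod P k \<in> Z" using t(2) by (rule trivE)
  obtain p q where pq: "is_coproduct P p q" and [simp]: "Dom P p = Dom P h" "Dom P q = Dom P l"
    "p \<in> Ar P" "q \<in> Ar P" "Cod P q = Cod P p" by (rule coproduct_exists[of "Dom P h" "Dom P l"]) simp_all
  obtain a where a [simp]: "a \<in> Ar P" "Dom P a = Cod P i" "Cod P a = Cod P p" "a \<cdot> i = p \<cdot> g" "a \<cdot> j = q \<cdot> k"
    by (rule copair[OF c, of "p \<cdot> g" "q \<cdot> k"]) simp_all
  obtain b where b [simp]: "b \<in> Ar P" "Dom P b = Cod P p" "Cod P b = Cod P f" "b \<cdot> p = h" "b \<cdot> q = l"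
    by (rule copair[OF pq, of h l]) simp_all
  have "f = b \<cdot> a"
    by (rule coproduct_eq[OF c]) (simp_all add: g k reassoc[OF b(4)] reassoc[OF b(5)])
  moreover have "Cod P p \<in> Z" using Z_coproduct[OF pq] gZ kZ by simp
  ultimately show ?thesis using trivI[of a b] by simp
qed

text \<open>The adjoined point has to be terminal, so that the undefined part of an arrow is
  classified in a unique way, and trivial, so that it vanishes in the quotient.\<close>

definition one :: 'o where "one = (SOME T. T \<in> Z \<and> is_terminal P T)"

lemma one: "one \<in> Z" "is_terminal P one"
  using someI_ex[of "\<lambda>T. T \<in> Z \<and> is_terminal P T"] Z_terminal unfolding one_def by blast+

lemma one_Ob [simp]: "one \<in> Ob P"
  using one Z_Ob by blast

lemma to_one:
  assumes "A \<in> Ob P" obtains b where "b \<in> Ar P" "Dom P b = A" "Cod P b = one"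
  using terminal_arrow[OF one(2) assms] .

text \<open>By strictness the arrow from an initial object to \<open>one\<close> is monic. It is
  trivial since its target is, so cancelling it makes the identity of the initial object
  trivial.\<close>

lemma triv_initial:
  assumes "f \<in> Ar P" "is_initial P (Dom P f)"
  shows "triv f"
proof -
  obtain b where b: "b \<in> Ar P" "Dom P b = Dom P f" "Cod P b = one" by (rule to_one[of "Dom P f"]) (simp add: assms)
  have "is_mono P b"
  proof (rule is_monoI)
    fix u v assume *: "u \<in> Ar P" "v \<in> Ar P" "Dom P v = Dom P u" "Cod P u = Dom P b" "Cod P v = Dom P b"
    have "is_initial P (Dom P u)" by (rule strict_initial) (simp_all add: * b assms)
    then show "u = v" by (rule initial_eq) (simp_all add: *)
  qed (rule b)
  moreover have "triv (b \<cdot> Ide P (Dom P f))" by (rule triv_through[OF one(1)]) (simp_all add: assms b)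
  ultimately have "triv (Ide P (Dom P f))" using trivial_mono_cancel[of b "Ide P (Dom P f)"] by (simp add: assms b)
  from triv_comp_left[OF this, of f] show ?thesis by (simp add: assms)
qed

text \<open>The congruence of the stable category, read on total arrows.\<close>

definition sim :: "'m \<Rightarrow> 'm \<Rightarrow> bool" where
  "sim f g \<longleftrightarrow> f \<in> Ar P \<and> g \<in> Ar P \<and> Dom P g = Dom P f \<and> Cod P g = Cod P f \<and>
     (\<exists>i j. is_coproduct P i j \<and> Cod P i = Dom P f \<and> f \<cdot> i = g \<cdot> i \<and> triv (f \<cdot> j) \<and> triv (g \<cdot> j))"

lemma simD: "sim f g \<Longrightarrow> f \<in> Ar P" "sim f g \<Longrightarrow> g \<in> Ar P" "sim f g \<Longrightarrow> Dom P g = Dom P f"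
  "sim f g \<Longrightarrow> Cod P g = Cod P f"
  by (simp_all add: sim_def)

lemma simE:
  assumes "sim f g"
  obtains i j where "is_coproduct P i j" "Cod P i = Dom P f" "f \<cdot> i = g \<cdot> i" "triv (f \<cdot> j)" "triv (g \<cdot> j)"
  using assms unfolding sim_def by blast

lemma simI: "is_coproduct P i j \<Longrightarrow> f \<in> Ar P \<Longrightarrow> g \<in> Ar P \<Longrightarrow> Dom P f = Cod P i \<Longrightarrow> Dom P g = Cod P i
    \<Longrightarrow> Cod P g = Cod P f \<Longrightarrow> f \<cdot> i = g \<cdot> i \<Longrightarrow> triv (f \<cdot> j) \<Longrightarrow> triv (g \<cdot> j) \<Longrightarrow> sim f g"
  unfolding sim_def by (intro conjI exI[of _ i] exI[of _ j]) simp_all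

lemma sim_refl:
  assumes "f \<in> Ar P" shows "sim f f"
proof -
  obtain z where z: "is_coproduct P (Ide P (Dom P f)) z" "is_initial P (Dom P z)" "z \<in> Ar P" "Cod P z = Dom P f"
    by (rule coproduct_Ide[of "Dom P f"]) (simp add: assms)
  have "triv (f \<cdot> z)" by (rule triv_initial) (simp_all add: assms z)
  then show ?thesis by (intro simI[OF z(1)]) (simp_all add: assms)
qed

lemma sim_sym: assumes "sim f g" shows "sim g f"
proof -
  obtain i j where "is_coproduct P i j" "Cod P i = Dom P f" "f \<cdot> i = g \<cdot> i" "triv (f \<cdot> j)" "triv (g \<cdot> j)"
    using assms by (rule simE)
  then show ?thesis by (intro simI[of i j]) (simp_all add: simD[OF assms])
qed

lemma sim_triv:
  assumes "triv f" "triv g" "Dom P g = Dom P f" "Cod P g = Cod P f"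
  shows "sim f g"
proof -
  note [simp] = triv_Ar[OF assms(1)] triv_Ar[OF assms(2)] assms(3,4)
  obtain z where z: "is_coproduct P (Ide P (Dom P f)) z" "is_initial P (Dom P z)" "z \<in> Ar P" "Cod P z = Dom P f"
    by (rule coproduct_Ide[of "Dom P f"]) simp
  have "f \<cdot> z = g \<cdot> z" by (rule initial_eq) (simp_all add: z)
  then show ?thesis by (intro simI[OF coproduct_sym[OF z(1)]]) (simp_all add: z assms)
qed

text \<open>On one summand \<open>g\<close> is a restriction of \<open>f\<close>, on the other it is
  trivial by assumption.\<close>

lemma sim_trivD:
  assumes "sim f g" "triv f" shows "triv g"
proof -
  obtain i j where c: "is_coproduct P i j" "Cod P i = Dom P f" "f \<cdot> i = g \<cdot> i" "triv (f \<cdot> j)" "triv (g \<cdot> j)"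
    using assms(1) by (rule simE)
  note [simp] = simD[OF assms(1)] coproductD[OF c(1)]
  show ?thesis
    by (rule triv_coproduct[OF c(1)]) (simp_all add: c(2,5) c(3)[symmetric] triv_comp_right assms(2))
qed

lemma sim_comp_left:
  assumes "sim f g" "h \<in> Ar P" "Dom P h = Cod P f"
  shows "sim (h \<cdot> f) (h \<cdot> g)"
proof -
  obtain i j where c: "is_coproduct P i j" "Cod P i = Dom P f" "f \<cdot> i = g \<cdot> i" "triv (f \<cdot> j)" "triv (g \<cdot> j)"
    using assms(1) by (rule simE)
  note [simp] = simD[OF assms(1)] assms(2,3) coproductD[OF c(1)] c(2)
  show ?thesis
    using triv_comp_left[OF c(4), of h] triv_comp_left[OF c(5), of h]
    by (intro simI[OF c(1)]) (simp_all add: c(3))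
qed

text \<open>The decomposition of the target of \<open>h\<close> pulls back along \<open>h\<close>,
  by universality of coproducts.\<close>

lemma sim_comp_right:
  assumes "sim f g" "h \<in> Ar P" "Cod P h = Dom P f"
  shows "sim (f \<cdot> h) (g \<cdot> h)"
proof -
  obtain i j where c: "is_coproduct P i j" "Cod P i = Dom P f" "f \<cdot> i = g \<cdot> i" "triv (f \<cdot> j)" "triv (g \<cdot> j)"
    using assms(1) by (rule simE)
  note [simp] = simD[OF assms(1)] assms(2,3) coproductD[OF c(1)] c(2)
  obtain d1 d2 h1 h2 where d: "is_coproduct P d1 d2"
    and [simp]: "d1 \<in> Ar P" "d2 \<in> Ar P" "h1 \<in> Ar P" "h2 \<in> Ar P" "Cod P d1 = Dom P h" "Cod P d2 = Dom P h"
    "Dom P h1 = Dom P d1" "Dom P h2 = Dom P d2" "Cod P h1 = Dom P i" "Cod P h2 = Dom P j"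
    and hd: "h \<cdot> d1 = i \<cdot> h1" "h \<cdot> d2 = j \<cdot> h2"
    by (rule decompose[OF c(1), of h]) simp_all
  show ?thesis
    using triv_comp_right[OF c(4), of h2] triv_comp_right[OF c(5), of h2]
    by (intro simI[OF d]) (simp_all add: hd reassoc[OF c(3)])
qed

text \<open>The second congruence is restricted to the summand \<open>i\<close> on which
  \<open>f\<close> and \<open>g\<close> agree, where it gives a decomposition into \<open>k\<close>
  and \<open>l\<close>. Then \<open>f\<close> and \<open>h\<close> agree on
  \<open>i \<cdot> k\<close>, and the rest, the sum of \<open>l\<close> and \<open>j\<close>, is
  where both are trivial.\<close>

lemma sim_trans:
  assumes "sim f g" "sim g h" shows "sim f h"
proof -
  obtain i j where c: "is_coproduct P i j" "Cod P i = Dom P f" "f \<cdot> i = g \<cdot> i" "triv (f \<cdot> j)" "triv (g \<cdot> j)"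
    using assms(1) by (rule simE)
  note [simp] = simD[OF assms(1)] simD[OF assms(2)] coproductD[OF c(1)] c(2)
  have "sim (g \<cdot> i) (h \<cdot> i)" by (rule sim_comp_right[OF assms(2)]) simp_all
  then obtain k l where d: "is_coproduct P k l" "Cod P k = Dom P (g \<cdot> i)" "(g \<cdot> i) \<cdot> k = (h \<cdot> i) \<cdot> k"
    "triv ((g \<cdot> i) \<cdot> l)" "triv ((h \<cdot> i) \<cdot> l)" by (rule simE)
  \<comment> \<open>On \<open>j\<close> triviality of \<open>h\<close> comes from its congruence
    with \<open>g\<close>, which is trivial there.\<close>
  have "sim (g \<cdot> j) (h \<cdot> j)" by (rule sim_comp_right[OF assms(2)]) simp_all
  then have hj: "triv (h \<cdot> j)" using c(5) by (rule sim_trivD)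
  note [simp] = coproductD[OF d(1)] 
  have [simp]: "Cod P k = Dom P i" using d(2) by simp
  obtain p q where pq: "is_coproduct P p q" and [simp]: "Dom P p = Dom P l" "Dom P q = Dom P j"
    "p \<in> Ar P" "q \<in> Ar P" "Cod P q = Cod P p"
    by (rule coproduct_exists[of "Dom P l" "Dom P j"]) simp_all
  obtain m where m [simp]: "m \<in> Ar P" "Dom P m = Cod P p" "Cod P m = Cod P i" "m \<cdot> p = i \<cdot> l" "m \<cdot> q = j"
    by (rule copair[OF pq, of "i \<cdot> l" j]) simp_all
  have 1: "is_coproduct P (i \<cdot> k) m" by (rule coproduct_assoc[OF c(1) d(1) _ pq]) simp_all
  have "triv (f \<cdot> m)"
    by (rule triv_coproduct[OF pq]) (use d(4) in \<open>simp_all add: c(4) reassoc[OF c(3)]\<close>)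
  moreover have "triv (h \<cdot> m)"
    by (rule triv_coproduct[OF pq]) (use d(5) in \<open>simp_all add: hj\<close>)
  moreover have "f \<cdot> i \<cdot> k = h \<cdot> i \<cdot> k" using d(3) by (simp add: reassoc[OF c(3)])
  ultimately show ?thesis by (intro simI[OF 1]) simp_all
qed

lemma sim_mono_cancel:
  assumes "is_mono P m" "sim (m \<cdot> f) (m \<cdot> g)" "f \<in> Ar P" "g \<in> Ar P" "Cod P f = Dom P m" "Cod P g = Dom P m"
  shows "sim f g"
proof -
  note [simp] = is_mono_Ar[OF assms(1)] assms(3-)
  obtain i j where c: "is_coproduct P i j" "Cod P i = Dom P (m \<cdot> f)" "(m \<cdot> f) \<cdot> i = (m \<cdot> g) \<cdot> i"
    "triv ((m \<cdot> f) \<cdot> j)" "triv ((m \<cdot> g) \<cdot> j)"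
    using assms(2) by (rule simE)
  have [simp]: "Dom P g = Dom P f" using simD(3)[OF assms(2)] by simp
  note [simp] = coproductD[OF c(1)]
  have [simp]: "Cod P i = Dom P f" using c(2) by simp
  have "f \<cdot> i = g \<cdot> i" by (rule mono_cancel[OF assms(1)]) (use c(3) in simp_all)
  moreover have "triv (f \<cdot> j)" "triv (g \<cdot> j)"
    by (rule trivial_mono_cancel[OF assms(1)]; use c(4,5) in simp)+
  ultimately show ?thesis by (intro simI[OF c(1)]) simp_all
qed

text \<open>The witnessing decompositions of the two summands merge by
  \<open>coproduct_interchange\<close>, the parts of agreement into one summand and the trivial
  parts into the other.\<close>

lemma sim_copair:
  assumes c: "is_coproduct P i j" and f: "f \<in> Ar P" "Dom P f = Cod P i" and g: "g \<in> Ar P" "Dom P g = Cod P i"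
    and s: "sim (f \<cdot> i) (g \<cdot> i)" "sim (f \<cdot> j) (g \<cdot> j)"
  shows "sim f g"
proof -
  note [simp] = coproductD[OF c] f g
  have [simp]: "Cod P g = Cod P f" using simD(4)[OF s(1)] by simp
  obtain a b where ab: "is_coproduct P a b" "Cod P a = Dom P (f \<cdot> i)" "(f \<cdot> i) \<cdot> a = (g \<cdot> i) \<cdot> a"
    "triv ((f \<cdot> i) \<cdot> b)" "triv ((g \<cdot> i) \<cdot> b)" using s(1) by (rule simE)
  obtain k l where kl: "is_coproduct P k l" "Cod P k = Dom P (f \<cdot> j)" "(f \<cdot> j) \<cdot> k = (g \<cdot> j) \<cdot> k"
    "triv ((f \<cdot> j) \<cdot> l)" "triv ((g \<cdot> j) \<cdot> l)" using s(2) by (rule simE)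
  note [simp] = coproductD[OF ab(1)] coproductD[OF kl(1)]
  have [simp]: "Cod P a = Dom P i" "Cod P k = Dom P j" using ab(2) kl(2) by simp_all
  obtain p q where pq: "is_coproduct P p q" and [simp]: "Dom P p = Dom P a" "Dom P q = Dom P k"
    "p \<in> Ar P" "q \<in> Ar P" "Cod P q = Cod P p" by (rule coproduct_exists[of "Dom P a" "Dom P k"]) simp_all
  obtain p' q' where pq': "is_coproduct P p' q'" and [simp]: "Dom P p' = Dom P b" "Dom P q' = Dom P l"
    "p' \<in> Ar P" "q' \<in> Ar P" "Cod P q' = Cod P p'" by (rule coproduct_exists[of "Dom P b" "Dom P l"]) simp_all
  obtain m where m [simp]: "m \<in> Ar P" "Dom P m = Cod P p" "Cod P m = Cod P i" "m \<cdot> p = i \<cdot> a" "m \<cdot> q = j \<cdot> k"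
    by (rule copair[OF pq, of "i \<cdot> a" "j \<cdot> k"]) simp_all
  obtain n where n [simp]: "n \<in> Ar P" "Dom P n = Cod P p'" "Cod P n = Cod P i" "n \<cdot> p' = i \<cdot> b" "n \<cdot> q' = j \<cdot> l"
    by (rule copair[OF pq', of "i \<cdot> b" "j \<cdot> l"]) simp_all
  have mn: "is_coproduct P m n"
    by (rule coproduct_interchange[OF c ab(1) _ kl(1) _ pq _ _ pq']) simp_all
  have "f \<cdot> m = g \<cdot> m" by (rule coproduct_eq[OF pq]) (use ab(3) kl(3) in simp_all)
  moreover have "triv (f \<cdot> n)" by (rule triv_coproduct[OF pq']) (use ab(4) kl(4) in simp_all)
  moreover have "triv (g \<cdot> n)" by (rule triv_coproduct[OF pq']) (use ab(5) kl(5) in simp_all)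
  ultimately show ?thesis by (intro simI[OF mn]) simp_all
qed


subsection \<open>Classification of partial arrows by a point\<close>

text \<open>
  \<open>maybe B\<close> is \<open>B + 1\<close> with coprojections \<open>incl B\<close> and \<open>pt B\<close>. The partial arrows classified by
  \<open>t : A \<rightarrow> B + 1\<close> are the pullbacks of \<open>incl B\<close> along \<open>t\<close>; they form \<open>part B t\<close>, which is one arrow
  of \<open>partial_cat P\<close>, and composition of partial arrows is Kleisli composition via \<open>ext\<close>.
\<close>

definition classifier :: "'o \<Rightarrow> 'm \<times> 'm" where
  "classifier B = (SOME c. is_coproduct P (fst c) (snd c) \<and> Dom P (fst c) = B \<and> Dom P (snd c) = one)"

definition incl :: "'o \<Rightarrow> 'm" where "incl B = fst (classifier B)"
definition pt :: "'o \<Rightarrow> 'm" where "pt B = snd (classifier B)"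
definition maybe :: "'o \<Rightarrow> 'o" where "maybe B = Cod P (incl B)"

lemma incl_coproduct:
  assumes "B \<in> Ob P" shows "is_coproduct P (incl B) (pt B)" "Dom P (incl B) = B" "Dom P (pt B) = one"
proof -
  obtain i j where "is_coproduct P i j" "Dom P i = B" "Dom P j = one"
    using coproduct_exists[OF assms one_Ob] by metis
  then have "\<exists>c. is_coproduct P (fst c) (snd c) \<and> Dom P (fst c) = B \<and> Dom P (snd c) = one"
    by (intro exI[of _ "(i, j)"]) simp
  from someI_ex[OF this, folded classifier_def]
  show "is_coproduct P (incl B) (pt B)" "Dom P (incl B) = B" "Dom P (pt B) = one"
    by (simp_all add: incl_def pt_def)
qed

lemma incl [simp]:
  assumes "B \<in> Ob P"
  shows "incl B \<in> Ar P" "pt B \<in> Ar P" "Dom P (incl B) = B" "Dom P (pt B) = one" "Cod P (incl B) = maybe B"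
    "Cod P (pt B) = maybe B"
  using incl_coproduct[OF assms] coproductD[OF incl_coproduct(1)[OF assms]] by (simp_all add: maybe_def)

lemma maybe_Ob [simp]: "B \<in> Ob P \<Longrightarrow> maybe B \<in> Ob P"
  using Cod_Ob[of "incl B"] by simp

lemma incl_mono: "B \<in> Ob P \<Longrightarrow> is_mono P (incl B)"
  using coproj_mono[OF incl_coproduct(1)] by simp

lemma triv_pt: "B \<in> Ob P \<Longrightarrow> x \<in> Ar P \<Longrightarrow> Cod P x = one \<Longrightarrow> triv (pt B \<cdot> x)"
  by (rule trivI) (simp_all add: one)

lemma triv_pt': "B \<in> Ob P \<Longrightarrow> h \<in> Ar P \<Longrightarrow> Dom P h = maybe B \<Longrightarrow> triv (h \<cdot> pt B)"
  by (rule triv_from[OF one(1)]) simp_all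

lemma to_one_eq: "x \<in> Ar P \<Longrightarrow> y \<in> Ar P \<Longrightarrow> Dom P y = Dom P x \<Longrightarrow> Cod P x = one \<Longrightarrow> Cod P y = one \<Longrightarrow> x = y"
  using terminal_eq[of x y] one(2) by simp

definition ext :: "'o \<Rightarrow> 'm \<Rightarrow> 'm" where
  "ext D f = (SOME h. h \<in> Ar P \<and> Dom P h = maybe (Dom P f) \<and> Cod P h = maybe D \<and>
     h \<cdot> incl (Dom P f) = f \<and> h \<cdot> pt (Dom P f) = pt D)"

lemma ext [simp]:
  assumes "D \<in> Ob P" "f \<in> Ar P" "Cod P f = maybe D"
  shows "ext D f \<in> Ar P" "Dom P (ext D f) = maybe (Dom P f)" "Cod P (ext D f) = maybe D"
    "ext D f \<cdot> incl (Dom P f) = f" "ext D f \<cdot> pt (Dom P f) = pt D"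
proof -
  note [simp] = assms
  obtain h where "h \<in> Ar P" "Dom P h = Cod P (incl (Dom P f))" "Cod P h = Cod P f" "h \<cdot> incl (Dom P f) = f"
    "h \<cdot> pt (Dom P f) = pt D"
    by (rule copair[OF incl_coproduct(1)[of "Dom P f"], of f "pt D"]) simp_all
  then have "\<exists>h. h \<in> Ar P \<and> Dom P h = maybe (Dom P f) \<and> Cod P h = maybe D \<and>
     h \<cdot> incl (Dom P f) = f \<and> h \<cdot> pt (Dom P f) = pt D" by auto
  from someI_ex[OF this, folded ext_def]
  show "ext D f \<in> Ar P" "Dom P (ext D f) = maybe (Dom P f)" "Cod P (ext D f) = maybe D"
    "ext D f \<cdot> incl (Dom P f) = f" "ext D f \<cdot> pt (Dom P f) = pt D" by simp_all
qed

lemma ext_incl: "D \<in> Ob P \<Longrightarrow> f \<in> Ar P \<Longrightarrow> Cod P f = maybe D \<Longrightarrow> Dom P f = B \<Longrightarrow> ext D f \<cdot> incl B = f"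
  and ext_pt: "D \<in> Ob P \<Longrightarrow> f \<in> Ar P \<Longrightarrow> Cod P f = maybe D \<Longrightarrow> Dom P f = B \<Longrightarrow> ext D f \<cdot> pt B = pt D"
  using ext by blast+

lemma maybe_eq:
  assumes "B \<in> Ob P" "h \<in> Ar P" "k \<in> Ar P" "Dom P h = maybe B" "Dom P k = maybe B" "Cod P k = Cod P h"
    "h \<cdot> incl B = k \<cdot> incl B" "h \<cdot> pt B = k \<cdot> pt B"
  shows "h = k"
  by (rule coproduct_eq[OF incl_coproduct(1)[OF assms(1)]]) (simp_all add: assms)

lemma sim_ext:
  assumes "D \<in> Ob P" "sim f g" "Cod P f = maybe D"
  shows "sim (ext D f) (ext D g)"
proof -
  note [simp] = simD[OF assms(2)] assms(1,3)
  show ?thesis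
    by (rule sim_copair[OF incl_coproduct(1)[of "Dom P f"]])
      (simp_all add: assms(2) ext_incl ext_pt sim_refl)
qed

text \<open>Associativity of Kleisli composition; it becomes associativity of composition in the
  quotient.\<close>

lemma ext_ext:
  assumes "E \<in> Ob P" "f \<in> Ar P" "Cod P f = maybe D" "D \<in> Ob P" "g \<in> Ar P" "Dom P g = D" "Cod P g = maybe E"
  shows "ext E (ext E g \<cdot> f) = ext E g \<cdot> ext D f"
  by (rule maybe_eq[of "Dom P f"]) (simp_all add: assms ext_incl ext_pt)

lemma ext_incl_Ide: "D \<in> Ob P \<Longrightarrow> ext D (incl D) = Ide P (maybe D)"
  by (rule maybe_eq[of D]) (simp_all add: ext_incl ext_pt)

definition part :: "'o \<Rightarrow> 'm \<Rightarrow> ('m \<times> 'm) set" where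
  "part B t = {(a, f). is_pullback P t (incl B) a f}"

lemma partE:
  assumes "B \<in> Ob P" "t \<in> Ar P" "Cod P t = maybe B"
  obtains a b f x where "is_coproduct P a b" "is_pullback P t (incl B) a f" "(a, f) \<in> part B t"
    "a \<in> Ar P" "b \<in> Ar P" "f \<in> Ar P" "x \<in> Ar P" "Cod P a = Dom P t" "Cod P b = Dom P t"
    "Dom P f = Dom P a" "Dom P x = Dom P b" "Cod P f = B" "Cod P x = one" "t \<cdot> a = incl B \<cdot> f" "t \<cdot> b = pt B \<cdot> x"
proof -
  show thesis
    by (rule decompose[OF incl_coproduct(1)[OF assms(1)], of t]) (use assms in \<open>simp_all add: that part_def\<close>)
qed

lemma part_iso:
  assumes "(a, f) \<in> part B t" "(a', f') \<in> part B t"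
  obtains k where "is_iso P k" "k \<in> Ar P" "Dom P k = Dom P a'" "Cod P k = Dom P a" "a \<cdot> k = a'" "f \<cdot> k = f'"
  using assms unfolding part_def by (auto elim: pullback_unique)

lemma partD:
  assumes "(a, f) \<in> part B t" "B \<in> Ob P"
  shows "a \<in> Ar P" "f \<in> Ar P" "Cod P a = Dom P t" "Cod P f = B" "Dom P f = Dom P a" "t \<cdot> a = incl B \<cdot> f"
  using assms pullbackD[of t "incl B" a f] by (auto simp: part_def)

text \<open>The part of \<open>b\<close> that \<open>t\<close> sends into \<open>B\<close> also lies
  in \<open>a\<close>, which is a pullback of \<open>incl B\<close>; being disjoint from
  \<open>a\<close>, it is initial. So \<open>t\<close> is the point on every complement of
  \<open>a\<close>, and not only on the one that \<open>partE\<close> supplies.\<close>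

lemma part_complement:
  assumes "(a, f) \<in> part B t" "B \<in> Ob P" "is_coproduct P a b"
  obtains x where "x \<in> Ar P" "Dom P x = Dom P b" "Cod P x = one" "t \<cdot> b = pt B \<cdot> x"
proof -
  have pb: "is_pullback P t (incl B) a f" using assms(1) by (simp add: part_def)
  note [simp] = partD[OF assms(1,2)] pullbackD(1)[OF pb] assms(2) coproductD[OF assms(3)]
  have [simp]: "Cod P t = maybe B" using pullbackD(5)[OF pb] incl(5)[OF assms(2)] by simp
  obtain d1 d2 g1 g2 where d: "is_coproduct P d1 d2"
    and [simp]: "d1 \<in> Ar P" "d2 \<in> Ar P" "g1 \<in> Ar P" "g2 \<in> Ar P" "Cod P d1 = Dom P b" "Cod P d2 = Dom P b"
    "Dom P g1 = Dom P d1" "Dom P g2 = Dom P d2" "Cod P g1 = B" "Cod P g2 = one"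
    and gd: "(t \<cdot> b) \<cdot> d1 = incl B \<cdot> g1" "(t \<cdot> b) \<cdot> d2 = pt B \<cdot> g2"
    by (rule decompose[OF incl_coproduct(1)[OF assms(2)], of "t \<cdot> b"]) simp_all
  obtain h where h: "h \<in> Ar P" "Dom P h = Dom P (b \<cdot> d1)" "Cod P h = Dom P a" "a \<cdot> h = b \<cdot> d1"
    by (rule pullback_lift[OF pb, of "b \<cdot> d1" g1]) (use gd in simp_all)
  have "is_initial P (Dom P h)" by (rule disjoint[OF assms(3) h(4)]) (simp_all add: h)
  then have ini: "is_initial P (Dom P d1)" by (simp add: h)
  obtain x where [simp]: "x \<in> Ar P" "Dom P x = Dom P b" "Cod P x = one" by (rule to_one[of "Dom P b"]) simp
  have g2: "x \<cdot> d2 = g2" by (rule to_one_eq) simp_all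
  note [simp] = coproductD[OF d]
  have "t \<cdot> b = pt B \<cdot> x"
  proof (rule coproduct_eq[OF d])
    show "(t \<cdot> b) \<cdot> d1 = (pt B \<cdot> x) \<cdot> d1" by (rule initial_eq) (simp_all add: ini)
    show "(t \<cdot> b) \<cdot> d2 = (pt B \<cdot> x) \<cdot> d2" using gd(2) by (simp add: g2)
  qed simp_all
  then show thesis by (rule that[rotated 3]) simp_all
qed

text \<open>One pullback of \<open>incl B\<close> is a coprojection by extensivity, and any other
  differs from it by an isomorphism.\<close>

lemma part_partial:
  assumes "B \<in> Ob P" "(a, f) \<in> part B t"
  shows "(a, f) \<in> partial_arrows P"
proof -
  have pb: "is_pullback P t (incl B) a f" using assms(2) by (simp add: part_def)
  obtain a' b f' x where c: "is_coproduct P a' b" "(a', f') \<in> part B t"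
    by (rule partE[of B t]) (use pullbackD[OF pb] assms in simp_all)
  obtain k where k: "is_iso P k" "k \<in> Ar P" "Dom P k = Dom P a" "Cod P k = Dom P a'" "a' \<cdot> k = a"
    by (rule part_iso[OF c(2) assms(2)])
  have "is_coproduct P (a' \<cdot> k) (b \<cdot> Ide P (Dom P b))"
    by (rule coproduct_iso_dom[OF c(1) k(1)]) (simp_all add: k is_iso_Ide coproductD[OF c(1)])
  then have "is_coproduct P a b" by (simp add: k coproductD[OF c(1)])
  then show ?thesis using partD[OF assms(2,1)] by (auto simp: partial_arrows_def complemented_iff)
qed

text \<open>The classifying arrow is \<open>f\<close> on the domain of definition and the point on
  its complement; \<open>coproduct_pullback\<close> recognizes the domain of definition as the
  pullback of \<open>incl\<close>.\<close>

lemma partial_part: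
  assumes "(a, f) \<in> partial_arrows P"
  obtains t where "t \<in> Ar P" "Dom P t = Cod P a" "Cod P t = maybe (Cod P f)" "(a, f) \<in> part (Cod P f) t"
proof -
  obtain b where c: "is_coproduct P a b" and [simp]: "f \<in> Ar P" "Dom P f = Dom P a"
    using assms by (auto simp: partial_arrows_def complemented_iff)
  note [simp] = coproductD[OF c]
  obtain x where [simp]: "x \<in> Ar P" "Dom P x = Dom P b" "Cod P x = one" by (rule to_one[of "Dom P b"]) simp
  obtain t where [simp]: "t \<in> Ar P" "Dom P t = Cod P a" "Cod P t = maybe (Cod P f)"
    "t \<cdot> a = incl (Cod P f) \<cdot> f" "t \<cdot> b = pt (Cod P f) \<cdot> x"
    by (rule copair[OF c, of "incl (Cod P f) \<cdot> f" "pt (Cod P f) \<cdot> x"]) simp_all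
  have "is_pullback P t (incl (Cod P f)) a f"
    by (rule coproduct_pullback[OF c incl_coproduct(1)[of "Cod P f"], of t f x]) simp_all
  then show thesis by (intro that[of t]) (simp_all add: part_def)
qed

text \<open>Pullbacks are determined up to exactly those isomorphisms that
  \<open>partial_iso\<close> divides out, so all pullbacks of \<open>incl B\<close> along
  \<open>t\<close> together form one class.\<close>

lemma part_eq_class:
  assumes "B \<in> Ob P" "(a, f) \<in> part B t"
  shows "part B t = partial_class P a f"
proof (rule set_eqI, clarify)
  fix a' f'
  have pb: "is_pullback P t (incl B) a f" using assms(2) by (simp add: part_def)
  show "(a', f') \<in> part B t \<longleftrightarrow> (a', f') \<in> partial_class P a f"
  proof
    assume *: "(a', f') \<in> part B t"
    obtain k where "is_iso P k" "k \<in> Ar P" "Dom P k = Dom P a" "Cod P k = Dom P a'" "a' \<cdot> k = a" "f' \<cdot> k = f"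
      by (rule part_iso[OF * assms(2)])
    then show "(a', f') \<in> partial_class P a f"
      using part_partial[OF assms(1) *] part_partial[OF assms]
      by (auto simp: partial_class_def partial_iso_def)
  next
    assume "(a', f') \<in> partial_class P a f"
    then obtain i where pa: "(a', f') \<in> partial_arrows P" and i: "is_iso P i" "Dom P i = Dom P a" "Cod P i = Dom P a'"
      "a' \<cdot> i = a" "f' \<cdot> i = f"
      by (auto simp: partial_class_def partial_iso_def)
    obtain j where [simp]: "i \<in> Ar P" "j \<in> Ar P" "Dom P j = Cod P i" "Cod P j = Dom P i"
      "j \<cdot> i = Ide P (Dom P i)" and ij: "i \<cdot> j = Ide P (Cod P i)" using i(1) by (rule is_isoE)
    have a' [simp]: "a' \<in> Ar P" "f' \<in> Ar P" "Dom P f' = Dom P a'"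
      using pa coproductD by (auto simp: partial_arrows_def complemented_iff)
    have "is_iso P j" using ij by (intro is_isoI[of _ i]) simp_all
    then have "is_pullback P t (incl B) (a \<cdot> j) (f \<cdot> j)"
      by (rule pullback_iso_dom[OF pb]) (simp add: i)
    moreover have "(a' \<cdot> i) \<cdot> j = a'" "(f' \<cdot> i) \<cdot> j = f'" by (simp_all add: i(3) ij)
    then have "a \<cdot> j = a'" "f \<cdot> j = f'" by (simp_all add: i(4,5))
    ultimately show "(a', f') \<in> part B t" unfolding part_def by simp
  qed
qed

lemma partial_cat_Ar: "Ar (partial_cat P) = {part B t | B t. B \<in> Ob P \<and> t \<in> Ar P \<and> Cod P t = maybe B}"
proof (intro set_eqI iffI)
  fix F assume "F \<in> Ar (partial_cat P)"
  then obtain a f where F: "(a, f) \<in> partial_arrows P" "F = partial_class P a f"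
    by (auto simp: partial_cat_def quotient_def partial_class_def)
  then obtain t where t: "t \<in> Ar P" "Dom P t = Cod P a" "Cod P t = maybe (Cod P f)" "(a, f) \<in> part (Cod P f) t"
    by (elim partial_part)
  have f: "Cod P f \<in> Ob P" using F(1) by (simp add: partial_arrows_def)
  have "F = part (Cod P f) t" using F(2) part_eq_class[OF f t(4)] by simp
  then show "F \<in> {part B t | B t. B \<in> Ob P \<and> t \<in> Ar P \<and> Cod P t = maybe B}"
    using t f by blast
next
  fix F assume "F \<in> {part B t | B t. B \<in> Ob P \<and> t \<in> Ar P \<and> Cod P t = maybe B}"
  then obtain B t where F: "F = part B t" "B \<in> Ob P" "t \<in> Ar P" "Cod P t = maybe B" by auto
  obtain a b f x where "(a, f) \<in> part B t" by (rule partE[OF F(2-4)])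
  then show "F \<in> Ar (partial_cat P)"
    using F part_eq_class[OF F(2), of a f t] part_partial[OF F(2), of a f t]
    by (auto simp: partial_cat_def quotient_def partial_class_def)
qed

lemma partial_cat_Dom: "B \<in> Ob P \<Longrightarrow> t \<in> Ar P \<Longrightarrow> Cod P t = maybe B \<Longrightarrow> Dom (partial_cat P) (part B t) = Dom P t"
  and partial_cat_Cod: "B \<in> Ob P \<Longrightarrow> t \<in> Ar P \<Longrightarrow> Cod P t = maybe B \<Longrightarrow> Cod (partial_cat P) (part B t) = B"
proof -
  assume t: "B \<in> Ob P" "t \<in> Ar P" "Cod P t = maybe B"
  obtain a b f x where "(a, f) \<in> part B t" by (rule partE[OF t])
  then have "(SOME x. x \<in> part B t) \<in> part B t" by (rule someI)
  then show "Dom (partial_cat P) (part B t) = Dom P t" "Cod (partial_cat P) (part B t) = B"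
    using partD[OF _ t(1), of "fst (SOME x. x \<in> part B t)" "snd (SOME x. x \<in> part B t)" t]
    by (simp_all add: partial_cat_def)
qed

lemma part_Sigma:
  assumes "f \<in> Ar P"
  shows "partial_class P (Ide P (Dom P f)) f = part (Cod P f) (incl (Cod P f) \<cdot> f)"
proof -
  have "is_pullback P (incl (Cod P f) \<cdot> f) (incl (Cod P f)) (Ide P (Dom P f)) f"
  proof (rule pullbackI)
    fix u v assume uv: "u \<in> Ar P" "v \<in> Ar P" "Dom P v = Dom P u" "Cod P u = Dom P (incl (Cod P f) \<cdot> f)"
      "Cod P v = Dom P (incl (Cod P f))" "(incl (Cod P f) \<cdot> f) \<cdot> u = incl (Cod P f) \<cdot> v"
    have "f \<cdot> u = v" by (rule mono_cancel[OF incl_mono[of "Cod P f"]]) (use uv assms in simp_all)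
    then show "\<exists>h. h \<in> Ar P \<and> Dom P h = Dom P u \<and> Cod P h = Dom P (Ide P (Dom P f)) \<and> Ide P (Dom P f) \<cdot> h = u \<and> f \<cdot> h = v"
      using uv assms by (intro exI[of _ u]) simp
  qed (use assms in simp_all)
  then show ?thesis using part_eq_class[of "Cod P f" "Ide P (Dom P f)" f] assms by (simp add: part_def)
qed

text \<open>The subobject \<open>incl D\<close> is pulled back along
  \<open>ext D s \<cdot> t\<close> in two stages. Along \<open>ext D s\<close> it becomes
  \<open>incl B \<cdot> b\<close>, because everything else in \<open>B + 1\<close> goes to the
  point. Pulling this back along \<open>t\<close> is the pullback that defines the composite, pasted
  to the one that defines \<open>a\<close>.\<close>

lemma partial_cat_comp:
  assumes t: "B \<in> Ob P" "t \<in> Ar P" "Cod P t = maybe B" and s: "D \<in> Ob P" "s \<in> Ar P" "Cod P s = maybe D" "Dom P s = B"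
  shows "part D s \<cdot>\<^bsub>partial_cat P\<^esub> part B t = part D (ext D s \<cdot> t)"
proof -
  note [simp] = t s
  have key: "(a \<cdot> a', g \<cdot> f') \<in> part D (ext D s \<cdot> t)"
    if a: "(a, f) \<in> part B t" and b: "(b, g) \<in> part D s" and pb: "is_pullback P f b a' f'" for a f b g a' f'
  proof -
    note [simp] = partD[OF a t(1)] partD[OF b s(1)] pullbackD[OF pb]
    have g: "is_pullback P s (incl D) b g" using b by (simp add: part_def)
    have b_mono: "is_mono P b" by (rule pullback_mono[OF g incl_mono]) simp
    obtain b' where c: "is_coproduct P b b'" using part_partial[OF s(1) b] by (auto simp: partial_arrows_def complemented_iff)
    note [simp] = coproductD[OF c]
    obtain x where x [simp]: "x \<in> Ar P" "Dom P x = Dom P b'" "Cod P x = one" "s \<cdot> b' = pt D \<cdot> x"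
      by (rule part_complement[OF b s(1) c])
    obtain p q where pq: "is_coproduct P p q" and [simp]: "Dom P p = Dom P b'" "Dom P q = one"
      "p \<in> Ar P" "q \<in> Ar P" "Cod P q = Cod P p" by (rule coproduct_exists[of "Dom P b'" one]) simp_all
    \<comment> \<open>\<open>m\<close> is the complement of \<open>incl B \<cdot> b\<close> in
      \<open>B + 1\<close>: the part of \<open>B\<close> where the second partial arrow is
      undefined, together with the point.\<close>
    obtain m where m [simp]: "m \<in> Ar P" "Dom P m = Cod P p" "Cod P m = maybe B" "m \<cdot> p = incl B \<cdot> b'" "m \<cdot> q = pt B"
      by (rule copair[OF pq, of "incl B \<cdot> b'" "pt B"]) simp_all
    have 1: "is_coproduct P (incl B \<cdot> b) m"
      by (rule coproduct_assoc[OF incl_coproduct(1)[OF t(1)] c _ pq]) simp_all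
    obtain y where y [simp]: "y \<in> Ar P" "Dom P y = Dom P m" "Cod P y = one" by (rule to_one[of "Dom P m"]) simp
    have yx: "y \<cdot> p = x" "y \<cdot> q = Ide P one" by (rule to_one_eq; simp)+
    have e: "ext D s \<cdot> incl B = s" "ext D s \<cdot> pt B = pt D" by (simp_all add: ext_incl ext_pt)
    have my: "ext D s \<cdot> m = pt D \<cdot> y"
      by (rule coproduct_eq[OF pq]) (simp_all add: yx reassoc[OF e(1)] e(2))
    have "is_pullback P (ext D s) (incl D) (incl B \<cdot> b) g"
      by (rule coproduct_pullback[OF 1 incl_coproduct(1)[OF s(1)], where x = y]) (simp_all add: my reassoc[OF e(1)])
    moreover have "is_pullback P t (incl B \<cdot> b) (a \<cdot> a') f'"
      by (rule pullback_paste[OF _ pb]) (use a in \<open>simp add: part_def\<close>)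
    then have "is_pullback P (incl B \<cdot> b) t f' (a \<cdot> a')" by (rule pullback_sym)
    ultimately have "is_pullback P (incl D) (ext D s \<cdot> t) (g \<cdot> f') (a \<cdot> a')"
      by (intro pullback_paste) (rule pullback_sym)
    then show ?thesis unfolding part_def by (simp add: pullback_sym)
  qed
  obtain a b f x where a: "(a, f) \<in> part B t" by (rule partE[OF t])
  obtain b d g y where b: "(b, g) \<in> part D s" by (rule partE[OF s(1-3)])
  note [simp] = partD[OF a t(1)] partD[OF b s(1)]
  obtain a' f' where pb: "is_pullback P f b a' f'" by (rule pullback_exists[of f b]) simp_all
  note [simp] = pullbackD[OF pb]
  show ?thesis
  proof (intro set_eqI iffI)
    fix x assume "x \<in> part D s \<cdot>\<^bsub>partial_cat P\<^esub> part B t"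
    then show "x \<in> part D (ext D s \<cdot> t)" unfolding partial_cat_def using key by auto
  next
    fix x assume "x \<in> part D (ext D s \<cdot> t)"
    then obtain c h where x: "x = (c, h)" "(c, h) \<in> part D (ext D s \<cdot> t)" by (cases x) simp
    \<comment> \<open>Composition uses every choice of pullback, so an arbitrary member of the class
      is reached by moving the chosen pullback along \<open>k\<close>.\<close>
    obtain k where k: "is_iso P k" "k \<in> Ar P" "Dom P k = Dom P c" "Cod P k = Dom P (a \<cdot> a')" "(a \<cdot> a') \<cdot> k = c"
      "(g \<cdot> f') \<cdot> k = h" by (rule part_iso[OF key[OF a b pb] x(2)])
    have "is_pullback P f b (a' \<cdot> k) (f' \<cdot> k)" by (rule pullback_iso_dom[OF pb k(1)]) (simp add: k)
    moreover have "c = a \<cdot> a' \<cdot> k" "h = g \<cdot> f' \<cdot> k" using k by simp_all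
    ultimately show "x \<in> part D s \<cdot>\<^bsub>partial_cat P\<^esub> part B t"
      using a b unfolding x(1) partial_cat_def by simp blast
  qed
qed

end

section \<open>The stable category\<close>

context stable
begin

text \<open>Inside the domain \<alpha> the complement \<open>b\<close> of
  \<open>\<alpha> \<cdot> a\<close> is disjoint from \<open>a\<close>, hence lies in
  \<open>c\<close>, where \<open>f\<close> is trivial. Outside \<alpha> the classifying arrow is the
  point.\<close>

lemma stable_rel_triv_complement:
  assumes "B \<in> Ob P" and a: "(\<alpha>, f) \<in> part B t" and c: "is_coproduct P a c" "Cod P a = Dom P \<alpha>"
    and fc: "triv (f \<cdot> c)" and b: "is_coproduct P (\<alpha> \<cdot> a) b"
  shows "triv (t \<cdot> b)"
proof -
  note [simp] = assms(1) partD[OF a] coproductD[OF c(1)] c(2)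
  have [simp]: "t \<in> Ar P" "Cod P t = maybe B"
    using a pullbackD(1,5)[of t "incl B" \<alpha> f] incl[of B] by (auto simp: part_def)
  obtain \<alpha>' where \<alpha>': "is_coproduct P \<alpha> \<alpha>'"
    using part_partial[OF assms(1) a] by (auto simp: partial_arrows_def complemented_iff)
  obtain x where x [simp]: "x \<in> Ar P" "Dom P x = Dom P \<alpha>'" "Cod P x = one" "t \<cdot> \<alpha>' = pt B \<cdot> x"
    by (rule part_complement[OF a assms(1) \<alpha>'])
  have [simp]: "b \<in> Ar P" "Cod P b = Dom P t" "\<alpha>' \<in> Ar P" "Cod P \<alpha>' = Dom P t"
    using coproductD[OF b] coproductD[OF \<alpha>'] by simp_all
  obtain d1 d2 g1 g2 where d: "is_coproduct P d1 d2"
    and [simp]: "d1 \<in> Ar P" "d2 \<in> Ar P" "g1 \<in> Ar P" "g2 \<in> Ar P" "Cod P d1 = Dom P b" "Cod P d2 = Dom P b"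
    "Dom P g1 = Dom P d1" "Dom P g2 = Dom P d2" "Cod P g1 = Dom P \<alpha>" "Cod P g2 = Dom P \<alpha>'"
    and bd: "b \<cdot> d1 = \<alpha> \<cdot> g1" "b \<cdot> d2 = \<alpha>' \<cdot> g2"
    by (rule decompose[OF \<alpha>', of b]) simp_all
  obtain e1 e2 k1 k2 where e: "is_coproduct P e1 e2"
    and [simp]: "e1 \<in> Ar P" "e2 \<in> Ar P" "k1 \<in> Ar P" "k2 \<in> Ar P" "Cod P e1 = Dom P g1" "Cod P e2 = Dom P g1"
    "Dom P k1 = Dom P e1" "Dom P k2 = Dom P e2" "Cod P k1 = Dom P a" "Cod P k2 = Dom P c"
    and ge: "g1 \<cdot> e1 = a \<cdot> k1" "g1 \<cdot> e2 = c \<cdot> k2"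
    by (rule decompose[OF c(1), of g1]) (simp_all add: c)
  have "(\<alpha> \<cdot> a) \<cdot> k1 = b \<cdot> d1 \<cdot> e1" by (simp add: ge[symmetric] reassoc[OF bd(1)])
  then have "is_initial P (Dom P k1)" by (rule disjoint[OF b]) simp_all
  then have ini: "is_initial P (Dom P e1)" by simp
  have fg: "triv (f \<cdot> g1)"
  proof (rule triv_coproduct[OF e])
    show "triv ((f \<cdot> g1) \<cdot> e1)" by (rule triv_initial) (simp_all add: ini)
    show "triv ((f \<cdot> g1) \<cdot> e2)" using triv_comp_right[OF fc, of k2] by (simp add: ge)
  qed (simp_all add: coproductD[OF e])
  have 1: "triv (incl B \<cdot> f \<cdot> g1)" by (rule triv_comp_left[OF fg]) simp_all
  have 2: "triv (pt B \<cdot> x \<cdot> g2)" by (rule triv_pt) simp_all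
  show ?thesis
    by (rule triv_coproduct[OF d])
      (simp_all add: coproductD[OF d] bd reassoc[OF partD(6)[OF a assms(1)]] reassoc[OF x(4)] 1 2)
qed

text \<open>The subobject \<open>a\<close> is the intersection of the domain \<alpha> with the
  summand \<open>i\<close>, so by universality its complement \<open>c\<close> is the intersection
  with \<open>j\<close>. There \<open>incl B \<cdot> f \<cdot> c\<close> is a restriction of the
  trivial arrow \<open>t \<cdot> j\<close>, and \<open>incl B\<close> can be cancelled.\<close>

lemma stable_rel_restrict:
  assumes "B \<in> Ob P" and c: "is_coproduct P i j" "Cod P i = Dom P t" and tj: "triv (t \<cdot> j)"
    and m: "is_pullback P (t \<cdot> i) (incl B) m k" and a: "(\<alpha>, f) \<in> part B t"
  obtains a c where "is_complement P a c" "Cod P a = Dom P \<alpha>" "Dom P a = Dom P m" "\<alpha> \<cdot> a = i \<cdot> m"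
    "f \<cdot> a = k" "triv (f \<cdot> c)"
proof -
  note [simp] = assms(1) partD[OF a] coproductD[OF c(1)] c(2)
  have pb: "is_pullback P t (incl B) \<alpha> f" using a by (simp add: part_def)
  have [simp]: "t \<in> Ar P" "Cod P t = maybe B"
    using pullbackD(1,5)[OF pb] incl[of B] by simp_all
  have [simp]: "m \<in> Ar P" "k \<in> Ar P" "Dom P k = Dom P m" "Cod P m = Dom P i" "Cod P k = B"
    using pullbackD[OF m] by simp_all
  have tm: "t \<cdot> i \<cdot> m = incl B \<cdot> k" using pullbackD(9)[OF m] by simp
  obtain a where [simp]: "a \<in> Ar P" "Dom P a = Dom P m" "Cod P a = Dom P \<alpha>" and aa: "\<alpha> \<cdot> a = i \<cdot> m" "f \<cdot> a = k"
    by (rule pullback_lift[OF pb, of "i \<cdot> m" k]) (simp_all add: tm)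
  have 1: "is_pullback P \<alpha> i a m"
  proof (rule pullbackI)
    fix u v assume [simp]: "u \<in> Ar P" "v \<in> Ar P" "Dom P v = Dom P u" "Cod P u = Dom P \<alpha>" "Cod P v = Dom P i"
      and e: "\<alpha> \<cdot> u = i \<cdot> v"
    have "(t \<cdot> i) \<cdot> v = t \<cdot> \<alpha> \<cdot> u" by (simp add: e)
    also have "\<dots> = incl B \<cdot> f \<cdot> u" by (simp add: reassoc[OF partD(6)[OF a assms(1)]])
    finally have "(t \<cdot> i) \<cdot> v = incl B \<cdot> f \<cdot> u" .
    then obtain h where [simp]: "h \<in> Ar P" "Dom P h = Dom P v" "Cod P h = Dom P m" and h: "m \<cdot> h = v"
      by (rule pullback_lift[OF m]) simp_all
    have "\<alpha> \<cdot> a \<cdot> h = \<alpha> \<cdot> u" by (simp add: reassoc[OF aa(1)] h e)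
    then have "a \<cdot> h = u" by (rule mono_cancel[OF pullback_mono[OF pb incl_mono[OF assms(1)]]]) simp_all
    then show "\<exists>h. h \<in> Ar P \<and> Dom P h = Dom P u \<and> Cod P h = Dom P a \<and> a \<cdot> h = u \<and> m \<cdot> h = v"
      by (intro exI[of _ h]) (simp add: h)
  next
    fix h l assume hl: "h \<in> Ar P" "l \<in> Ar P" "Dom P l = Dom P h" "Cod P h = Dom P a" "Cod P l = Dom P a"
      "m \<cdot> h = m \<cdot> l"
    have "is_mono P m" by (rule pullback_mono[OF m incl_mono[OF assms(1)]])
    then show "h = l" using hl(6) by (rule mono_cancel) (simp_all add: hl)
  qed (simp_all add: aa)
  obtain c y where 2: "is_pullback P \<alpha> j c y" by (rule pullback_exists[of \<alpha> j]) simp_all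
  note [simp] = pullbackD[OF 2]
  have ac: "is_coproduct P a c"
    using extensive c(1) 1 2 unfolding extensive_def by blast
  have "t \<cdot> j \<cdot> y = incl B \<cdot> f \<cdot> c" using reassoc[OF partD(6)[OF a assms(1)], of c] by simp
  then have "triv (incl B \<cdot> f \<cdot> c)" using triv_comp_right[OF tj, of y] by simp
  then have "triv (f \<cdot> c)" using trivial_mono_cancel[OF incl_mono[OF assms(1)], of "f \<cdot> c"] by simp
  then show thesis using ac aa by (intro that[of a c]) (simp_all add: complement_iff_coproduct)
qed

text \<open>From a decomposition for \<open>sim\<close>, the common domain is obtained as the part
  of the summand \<open>i\<close> where the arrows are defined. On the rest of \<open>i\<close> both
  classifying arrows are the point, so \<open>sim\<close> can ask for agreement on a summand of the
  whole source. Conversely the common domain and its complement serve as the decomposition.\<close>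

lemma stable_rel_iff:
  assumes t: "B \<in> Ob P" "t \<in> Ar P" "Cod P t = maybe B" and s: "D \<in> Ob P" "s \<in> Ar P" "Cod P s = maybe D"
  shows "(part B t, part D s) \<in> stable_rel P Z \<longleftrightarrow> D = B \<and> sim t s"
proof
  note [simp] = t s
  assume "(part B t, part D s) \<in> stable_rel P Z"
  then obtain \<alpha>1 f1 \<alpha>2 f2 a0 a1 a2 c1 c2 where
    dc: "Dom (partial_cat P) (part B t) = Dom (partial_cat P) (part D s)"
     "Cod (partial_cat P) (part B t) = Cod (partial_cat P) (part D s)"
    and p: "(\<alpha>1, f1) \<in> part B t" "(\<alpha>2, f2) \<in> part D s" and a0: "complemented P a0"
    and c: "is_complement P a1 c1" "is_complement P a2 c2"
    and [simp]: "Dom P a1 = Dom P a0" "Dom P a2 = Dom P a0" "Cod P a1 = Dom P \<alpha>1" "Cod P a2 = Dom P \<alpha>2"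
    and \<alpha>: "\<alpha>1 \<cdot> a1 = a0" "\<alpha>2 \<cdot> a2 = a0" and fa: "f1 \<cdot> a1 = f2 \<cdot> a2"
    and tr: "triv (f1 \<cdot> c1)" "triv (f2 \<cdot> c2)"
    unfolding stable_rel_def by blast
  have DB [simp]: "D = B" "Dom P s = Dom P t" using dc by (simp_all add: partial_cat_Dom partial_cat_Cod)
  obtain b0 where b0: "is_coproduct P a0 b0" using a0 by (auto simp: complemented_iff)
  note c' = c[unfolded complement_iff_coproduct]
  note [simp] = partD[OF p(1) t(1)] partD[OF p(2) s(1)] coproductD[OF c'(1)] coproductD[OF c'(2)] coproductD[OF b0]
  have [simp]: "Cod P a0 = Dom P t" unfolding \<alpha>(1)[symmetric] by simp
  have 1: "t \<cdot> a0 = incl B \<cdot> f1 \<cdot> a1" unfolding \<alpha>(1)[symmetric]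
    by (simp add: reassoc[OF partD(6)[OF p(1) t(1)]])
  have 2: "s \<cdot> a0 = incl B \<cdot> f2 \<cdot> a2" unfolding \<alpha>(2)[symmetric]
    using reassoc[OF partD(6)[OF p(2) s(1)], of a2] by simp
  have "triv (t \<cdot> b0)" by (rule stable_rel_triv_complement[OF t(1) p(1) c'(1)]) (simp_all add: tr \<alpha> b0)
  moreover have "triv (s \<cdot> b0)" by (rule stable_rel_triv_complement[OF s(1) p(2) c'(2)]) (simp_all add: tr \<alpha> b0)
  ultimately have "sim t s" using 1 2 fa by (intro simI[OF b0]) simp_all
  then show "D = B \<and> sim t s" by simp
next
  note [simp] = t s
  assume "D = B \<and> sim t s"
  then have [simp]: "D = B" and sim: "sim t s" by auto
  note [simp] = simD[OF sim]
  obtain i j where c: "is_coproduct P i j" "Cod P i = Dom P t" "t \<cdot> i = s \<cdot> i" "triv (t \<cdot> j)" "triv (s \<cdot> j)"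
    using sim by (rule simE)
  note [simp] = coproductD[OF c(1)] c(2)
  obtain \<alpha>1 b1 f1 x1 where p1: "(\<alpha>1, f1) \<in> part B t" by (rule partE[OF t])
  obtain \<alpha>2 b2 f2 x2 where p2: "(\<alpha>2, f2) \<in> part D s" by (rule partE[OF s])
  obtain m b k x where m: "is_pullback P (t \<cdot> i) (incl B) m k" "(m, k) \<in> part B (t \<cdot> i)"
    by (rule partE[of B "t \<cdot> i"]) simp_all
  obtain a1 c1 where 1: "is_complement P a1 c1" "Cod P a1 = Dom P \<alpha>1" "Dom P a1 = Dom P m" "\<alpha>1 \<cdot> a1 = i \<cdot> m"
    "f1 \<cdot> a1 = k" "triv (f1 \<cdot> c1)"
    by (rule stable_rel_restrict[OF t(1) c(1) c(2) c(4) m(1) p1])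
  \<comment> \<open>Since \<open>t\<close> and \<open>s\<close> agree on \<open>i\<close>, the
    pullback given by \<open>m\<close> and \<open>k\<close> serves for \<open>s\<close> as
    well.\<close>
  obtain a2 c2 where 2: "is_complement P a2 c2" "Cod P a2 = Dom P \<alpha>2" "Dom P a2 = Dom P m" "\<alpha>2 \<cdot> a2 = i \<cdot> m"
    "f2 \<cdot> a2 = k" "triv (f2 \<cdot> c2)"
    by (rule stable_rel_restrict[OF s(1) c(1) _ c(5) _ p2, of m k]) (use m(1) c(3) in simp_all)
  have [simp]: "m \<in> Ar P" "Cod P m = Dom P i" using pullbackD[OF m(1)] by simp_all
  have "complemented P m" using part_partial[OF t(1) m(2)] by (simp add: partial_arrows_def)
  moreover have "complemented P i" using c(1) by (auto simp: complemented_iff)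
  ultimately have "complemented P (i \<cdot> m)" by (rule complemented_comp) simp
  then have body: "(\<alpha>1, f1) \<in> part B t \<and> (\<alpha>2, f2) \<in> part D s \<and>
    complemented P (i \<cdot> m) \<and> is_complement P a1 c1 \<and> is_complement P a2 c2 \<and>
    Dom P a1 = Dom P (i \<cdot> m) \<and> Dom P a2 = Dom P (i \<cdot> m) \<and> Cod P a1 = Dom P \<alpha>1 \<and> Cod P a2 = Dom P \<alpha>2 \<and>
    \<alpha>1 \<cdot> a1 = i \<cdot> m \<and> \<alpha>2 \<cdot> a2 = i \<cdot> m \<and> f1 \<cdot> a1 = f2 \<cdot> a2 \<and> triv (f1 \<cdot> c1) \<and> triv (f2 \<cdot> c2)"
    using p1 p2 1 2 by simp
  show "(part B t, part D s) \<in> stable_rel P Z"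
    unfolding stable_rel_def
  proof (intro CollectI case_prodI conjI)
    show "part B t \<in> Ar (partial_cat P)" "part D s \<in> Ar (partial_cat P)"
      unfolding partial_cat_Ar using t s by blast+
    show "Dom (partial_cat P) (part B t) = Dom (partial_cat P) (part D s)"
      "Cod (partial_cat P) (part B t) = Cod (partial_cat P) (part D s)"
      by (simp_all add: partial_cat_Dom partial_cat_Cod)
  qed (intro exI, rule body)
qed

section \<open>The quotient category in terms of classifying arrows\<close>

definition St :: "('o, ('m \<times> 'm) set set) cat" where
  "St = quotient_cat (partial_cat P) (stable_rel P Z)"

definition cl :: "'o \<Rightarrow> 'm \<Rightarrow> ('m \<times> 'm) set set" where
  "cl B t = stable_rel P Z `` {part B t}"

lemma cl_alt:
  assumes "B \<in> Ob P" "t \<in> Ar P" "Cod P t = maybe B"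
  shows "cl B t = {part B s | s. sim t s}"
proof (intro set_eqI iffI)
  fix F assume "F \<in> cl B t"
  then have F: "(part B t, F) \<in> stable_rel P Z" by (simp add: cl_def)
  then have "F \<in> Ar (partial_cat P)" by (auto simp: stable_rel_def)
  then obtain D s where "F = part D s" "D \<in> Ob P" "s \<in> Ar P" "Cod P s = maybe D" by (auto simp: partial_cat_Ar)
  then show "F \<in> {part B s | s. sim t s}" using stable_rel_iff[OF assms, of D s] F by auto
next
  fix F assume "F \<in> {part B s | s. sim t s}"
  then obtain s where s: "F = part B s" "sim t s" by auto
  then show "F \<in> cl B t" using stable_rel_iff[OF assms, of B s] assms simD[OF s(2)] by (simp add: cl_def)
qed

lemma cl_eq_iff:
  assumes t: "B \<in> Ob P" "t \<in> Ar P" "Cod P t = maybe B" and s: "D \<in> Ob P" "s \<in> Ar P" "Cod P s = maybe D"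
  shows "cl B t = cl D s \<longleftrightarrow> D = B \<and> sim t s"
proof
  assume "cl B t = cl D s"
  then have "part D s \<in> cl B t" using sim_refl[OF s(2)] by (auto simp: cl_alt[OF s])
  then show "D = B \<and> sim t s" using stable_rel_iff[OF t s] by (simp add: cl_def)
next
  assume *: "D = B \<and> sim t s"
  then have "sim t u \<longleftrightarrow> sim s u" for u using sim_trans sim_sym by blast
  then have "cl B t = {part D u | u. sim s u}" using * unfolding cl_alt[OF t] by simp
  then show "cl B t = cl D s" unfolding cl_alt[OF s] .
qed

lemma St_Ob [simp]: "Ob St = Ob P"
  by (simp add: St_def quotient_cat_def partial_cat_def)

lemma St_Ar: "Ar St = {cl B t | B t. B \<in> Ob P \<and> t \<in> Ar P \<and> Cod P t = maybe B}"
  unfolding St_def quotient_cat_def quotient_def by (auto simp: partial_cat_Ar cl_def)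

lemma cl_Ar [simp]: "B \<in> Ob P \<Longrightarrow> t \<in> Ar P \<Longrightarrow> Cod P t = maybe B \<Longrightarrow> cl B t \<in> Ar St"
  unfolding St_Ar by blast

lemma cl_some:
  assumes "B \<in> Ob P" "t \<in> Ar P" "Cod P t = maybe B"
  obtains s where "(SOME F. F \<in> cl B t) = part B s" "sim t s"
proof -
  have "part B t \<in> cl B t" using sim_refl[OF assms(2)] by (auto simp: cl_alt[OF assms])
  then have "(SOME F. F \<in> cl B t) \<in> cl B t" by (rule someI)
  then show thesis using that by (auto simp: cl_alt[OF assms])
qed

lemma Dom_cl [simp]: "B \<in> Ob P \<Longrightarrow> t \<in> Ar P \<Longrightarrow> Cod P t = maybe B \<Longrightarrow> Dom St (cl B t) = Dom P t"
  and Cod_cl [simp]: "B \<in> Ob P \<Longrightarrow> t \<in> Ar P \<Longrightarrow> Cod P t = maybe B \<Longrightarrow> Cod St (cl B t) = B"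
proof -
  assume t: "B \<in> Ob P" "t \<in> Ar P" "Cod P t = maybe B"
  obtain s where s: "(SOME F. F \<in> cl B t) = part B s" "sim t s" by (rule cl_some[OF t])
  then show "Dom St (cl B t) = Dom P t" "Cod St (cl B t) = B"
    by (simp_all add: St_def quotient_cat_def partial_cat_Dom partial_cat_Cod t simD[OF s(2)])
qed

text \<open>The quotient takes the union over all pairs of representatives. Kleisli composition
  respects \<open>sim\<close> in both arguments, so all these composites give the same
  class.\<close>

lemma comp_cl:
  assumes t: "B \<in> Ob P" "t \<in> Ar P" "Cod P t = maybe B" and s: "D \<in> Ob P" "s \<in> Ar P" "Cod P s = maybe D" "Dom P s = B"
  shows "cl D s \<cdot>\<^bsub>St\<^esub> cl B t = cl D (ext D s \<cdot> t)"
proof -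
  have *: "cl D (ext D s' \<cdot> t') = cl D (ext D s \<cdot> t)" "part D s' \<cdot>\<^bsub>partial_cat P\<^esub> part B t' = part D (ext D s' \<cdot> t')"
    if "sim t t'" "sim s s'" for t' s'
  proof -
    note [simp] = simD[OF that(1)] simD[OF that(2)] t s
    have "sim (ext D s \<cdot> t) (ext D s' \<cdot> t)"
      by (rule sim_comp_right[OF sim_ext]) (simp_all add: that)
    moreover have "sim (ext D s' \<cdot> t) (ext D s' \<cdot> t')" by (rule sim_comp_left) (simp_all add: that)
    ultimately have "sim (ext D s' \<cdot> t') (ext D s \<cdot> t)" by (rule sim_sym[OF sim_trans])
    then show "cl D (ext D s' \<cdot> t') = cl D (ext D s \<cdot> t)" by (simp add: cl_eq_iff)
    show "part D s' \<cdot>\<^bsub>partial_cat P\<^esub> part B t' = part D (ext D s' \<cdot> t')"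
      by (rule partial_cat_comp) simp_all
  qed
  have "cl D s \<cdot>\<^bsub>St\<^esub> cl B t = (\<Union>G\<in>cl D s. \<Union>F\<in>cl B t. stable_rel P Z `` {G \<cdot>\<^bsub>partial_cat P\<^esub> F})"
    by (simp add: St_def quotient_cat_def)
  also have "\<dots> = (\<Union>s'\<in>{s'. sim s s'}. \<Union>t'\<in>{t'. sim t t'}. stable_rel P Z `` {part D s' \<cdot>\<^bsub>partial_cat P\<^esub> part B t'})"
  proof -
    have "cl B t = part B ` {t'. sim t t'}" "cl D s = part D ` {s'. sim s s'}"
      unfolding cl_alt[OF t] cl_alt[OF s(1-3)] by auto
    then show ?thesis by simp
  qed
  also have "\<dots> = (\<Union>s'\<in>{s'. sim s s'}. \<Union>t'\<in>{t'. sim t t'}. cl D (ext D s \<cdot> t))"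
    by (intro SUP_cong refl) (simp add: *(2) cl_def[symmetric], simp add: *(1))
  also have "\<dots> = cl D (ext D s \<cdot> t)" using sim_refl[OF t(2)] sim_refl[OF s(2)] by auto
  finally show ?thesis .
qed

lemma Ide_St: "A \<in> Ob P \<Longrightarrow> Ide St A = cl A (incl A)"
  using part_Sigma[of "Ide P A"] by (simp add: St_def quotient_cat_def partial_cat_def cl_def)

lemma category_St: "category St"
  unfolding category_def
proof (intro conjI ballI impI)
  fix \<phi> assume "\<phi> \<in> Ar St"
  then obtain B t where [simp]: "\<phi> = cl B t" "B \<in> Ob P" "t \<in> Ar P" "Cod P t = maybe B" by (auto simp: St_Ar)
  show "Dom St \<phi> \<in> Ob St" "Cod St \<phi> \<in> Ob St" by simp_all
  show "\<phi> \<cdot>\<^bsub>St\<^esub> Ide St (Dom St \<phi>) = \<phi>"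
    by (simp add: Ide_St comp_cl)
  show "Ide St (Cod St \<phi>) \<cdot>\<^bsub>St\<^esub> \<phi> = \<phi>" by (simp add: Ide_St comp_cl ext_incl_Ide)
  fix \<psi> assume "\<psi> \<in> Ar St"
  then obtain D s where [simp]: "\<psi> = cl D s" "D \<in> Ob P" "s \<in> Ar P" "Cod P s = maybe D" by (auto simp: St_Ar)
  show "\<psi> \<cdot>\<^bsub>St\<^esub> \<phi> \<in> hom St (Dom St \<phi>) (Cod St \<psi>)" if "Cod St \<phi> = Dom St \<psi>"
    using that by (simp add: comp_cl)
  fix \<chi> assume "\<chi> \<in> Ar St"
  then obtain E r where [simp]: "\<chi> = cl E r" "E \<in> Ob P" "r \<in> Ar P" "Cod P r = maybe E" by (auto simp: St_Ar)
  show "\<chi> \<cdot>\<^bsub>St\<^esub> \<psi> \<cdot>\<^bsub>St\<^esub> \<phi> = (\<chi> \<cdot>\<^bsub>St\<^esub> \<psi>) \<cdot>\<^bsub>St\<^esub> \<phi>" if "Cod St \<phi> = Dom St \<psi> \<and> Cod St \<psi> = Dom St \<chi>"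
    using that by (simp add: comp_cl ext_ext)
next
  fix A assume "A \<in> Ob St" then show "Ide St A \<in> hom St A A" by (simp add: Ide_St)
qed

sublocale K: cat St
  by unfold_locales (rule category_St)


subsection \<open>The quotient functor\<close>

definition Sg :: "'m \<Rightarrow> ('m \<times> 'm) set set" where
  "Sg f = stable_rel P Z `` {partial_class P (Ide P (Dom P f)) f}"

lemma Sg_cl: "f \<in> Ar P \<Longrightarrow> Sg f = cl (Cod P f) (incl (Cod P f) \<cdot> f)"
  by (simp add: Sg_def cl_def part_Sigma)

lemma Sg_Ar [simp]: "f \<in> Ar P \<Longrightarrow> Sg f \<in> Ar St"
  and Dom_Sg [simp]: "f \<in> Ar P \<Longrightarrow> Dom St (Sg f) = Dom P f"
  and Cod_Sg [simp]: "f \<in> Ar P \<Longrightarrow> Cod St (Sg f) = Cod P f"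
  by (simp_all add: Sg_cl)

lemma Sg_Ide: "A \<in> Ob P \<Longrightarrow> Sg (Ide P A) = Ide St A"
  by (simp add: Sg_cl Ide_St)

lemma Sg_comp: "f \<in> Ar P \<Longrightarrow> g \<in> Ar P \<Longrightarrow> Cod P f = Dom P g \<Longrightarrow> Sg (g \<cdot> f) = Sg g \<cdot>\<^bsub>St\<^esub> Sg f"
  using reassoc[OF ext(4), of "Cod P g" "incl (Cod P g) \<cdot> g" f]
  by (simp add: Sg_cl comp_cl)

lemma Sg_eq_iff: "f \<in> Ar P \<Longrightarrow> g \<in> Ar P \<Longrightarrow> Cod P g = Cod P f \<Longrightarrow> Sg f = Sg g \<longleftrightarrow> sim f g"
  using sim_mono_cancel[OF incl_mono, of "Cod P f" f g] sim_comp_left[of f g "incl (Cod P f)"]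
  by (auto simp: Sg_cl cl_eq_iff)

text \<open>It suffices to compare two arrows from \<open>B + 1\<close> to
  \<open>(B + 1) + 1\<close>. They agree on \<open>B\<close>; one sends the point to the outer point
  and the other to the inner one. Both are trivial there, so the two arrows are congruent.\<close>

lemma Sg_incl_cl:
  assumes "B \<in> Ob P" "t \<in> Ar P" "Cod P t = maybe B"
  shows "Sg (incl B) \<cdot>\<^bsub>St\<^esub> cl B t = Sg t"
proof -
  note [simp] = assms
  let ?B = "maybe B"
  have e: "ext ?B (incl ?B \<cdot> incl B) \<cdot> incl B = incl ?B \<cdot> incl B" "ext ?B (incl ?B \<cdot> incl B) \<cdot> pt B = pt ?B"
    by (simp_all add: ext_incl ext_pt)
  have "sim (ext ?B (incl ?B \<cdot> incl B)) (incl ?B)"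
  proof (rule sim_copair[OF incl_coproduct(1)[OF assms(1)]])
    show "sim (ext ?B (incl ?B \<cdot> incl B) \<cdot> pt B) (incl ?B \<cdot> pt B)"
      by (rule sim_triv) (simp_all add: e(2) triv_pt' triv_from[OF one(1)])
  qed (simp_all add: e(1) sim_refl)
  then have "sim (ext ?B (incl ?B \<cdot> incl B) \<cdot> t) (incl ?B \<cdot> t)" by (rule sim_comp_right) simp_all
  then show ?thesis by (simp add: Sg_cl comp_cl cl_eq_iff)
qed

text \<open>The inverse is the partial identity from \<open>B + 1\<close> to \<open>B\<close>,
  undefined at the point; it is classified by the identity of \<open>B + 1\<close>.\<close>

lemma Sg_incl_iso: "B \<in> Ob P \<Longrightarrow> is_iso St (Sg (incl B))"
proof (rule K.is_isoI[of _ "cl B (Ide P (maybe B))"])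
  assume [simp]: "B \<in> Ob P"
  show "cl B (Ide P (maybe B)) \<cdot>\<^bsub>St\<^esub> Sg (incl B) = Ide St (Dom St (Sg (incl B)))"
    using reassoc[OF ext(4), of B "Ide P (maybe B)" "incl B"]
    by (simp add: Ide_St Sg_cl comp_cl)
  show "Sg (incl B) \<cdot>\<^bsub>St\<^esub> cl B (Ide P (maybe B)) = Ide St (Cod St (Sg (incl B)))"
    by (simp add: Sg_incl_cl Sg_Ide)
qed simp_all

lemma Sg_incl_cancel:
  assumes "B \<in> Ob P" "Sg (incl B) \<cdot>\<^bsub>St\<^esub> \<phi> = Sg (incl B) \<cdot>\<^bsub>St\<^esub> \<psi>" "\<phi> \<in> Ar St" "\<psi> \<in> Ar St"
    "Cod St \<phi> = B" "Cod St \<psi> = B"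
  shows "\<phi> = \<psi>"
  by (rule K.mono_cancel[OF K.iso_mono[OF Sg_incl_iso[OF assms(1)]] assms(2)]) (simp_all add: assms)

text \<open>Together with \<open>St_arrow\<close> this is the interface to the quotient: arrows are
  handled through the total arrow of \<open>P\<close> that they become after the invertible
  \<open>Sg (incl B)\<close>.\<close>

lemma St_factor:
  assumes "\<phi> \<in> Ar St"
  obtains t where "t \<in> Ar P" "Dom P t = Dom St \<phi>" "Cod P t = maybe (Cod St \<phi>)" "Cod St \<phi> \<in> Ob P"
    "Sg (incl (Cod St \<phi>)) \<cdot>\<^bsub>St\<^esub> \<phi> = Sg t"
proof -
  obtain B t where [simp]: "\<phi> = cl B t" "B \<in> Ob P" "t \<in> Ar P" "Cod P t = maybe B"
    using assms by (auto simp: St_Ar)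
  show thesis by (rule that[of t]) (simp_all add: Sg_incl_cl)
qed

lemma St_arrow:
  assumes "t \<in> Ar P" "Cod P t = maybe B" "B \<in> Ob P"
  obtains \<phi> where "\<phi> \<in> Ar St" "Dom St \<phi> = Dom P t" "Cod St \<phi> = B" "Sg (incl B) \<cdot>\<^bsub>St\<^esub> \<phi> = Sg t"
  by (rule that[of "cl B t"]) (simp_all add: assms Sg_incl_cl)

end

subsection \<open>Pretorsion theories and pointed categories\<close>

context cat
begin

lemma zcokernel_iso_right:
  assumes "is_zcokernel C Z q f" "is_iso C m" "Cod C m = Dom C f"
  shows "is_zcokernel C Z q (f \<cdot> m)"
proof (rule zcokernelI)
  note [simp] = zcokernelD(1-3)[OF assms(1)] assms(3)
  have [simp]: "m \<in> Ar C" using assms(2) by (simp add: is_iso_def)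
  show "q \<in> Ar C" "f \<cdot> m \<in> Ar C" "Dom C q = Cod C (f \<cdot> m)" by simp_all
  have t: "trivial_arrow C Z (g \<cdot> f \<cdot> m) \<longleftrightarrow> trivial_arrow C Z (g \<cdot> f)" if "g \<in> Ar C" "Dom C g = Cod C f" for g
    using triv_iso_right[OF assms(2), of "g \<cdot> f"] that by simp
  show "trivial_arrow C Z (q \<cdot> f \<cdot> m)" using zcokernelD(4)[OF assms(1)] t[of q] by simp
  show "h = k" if "h \<in> Ar C" "k \<in> Ar C" "Dom C h = Cod C q" "Dom C k = Cod C q"
    "Cod C k = Cod C h" "h \<cdot> q = k \<cdot> q" for h k
    using that by - (rule zcokernel_eq[OF assms(1)])
  fix g assume g: "g \<in> Ar C" "Dom C g = Cod C (f \<cdot> m)" "trivial_arrow C Z (g \<cdot> f \<cdot> m)"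
  have g': "Dom C g = Cod C f" using g(2) by simp
  have "trivial_arrow C Z (g \<cdot> f)" using g(3) t[OF g(1) g'] by blast
  then obtain h where "h \<in> Ar C" "Dom C h = Cod C q" "Cod C h = Cod C g" "h \<cdot> q = g"
    by (rule zcokernel_lift[OF assms(1) g(1) g'])
  then show "\<exists>h. h \<in> Ar C \<and> Dom C h = Cod C q \<and> Cod C h = Cod C g \<and> h \<cdot> q = g" by blast
qed

lemma short_zexact_iso:
  assumes "short_zexact C Z k c" "is_iso C m" "Cod C m = Dom C k" "is_iso C n" "Dom C n = Cod C c"
  shows "short_zexact C Z (k \<cdot> m) (n \<cdot> c)"
proof -
  have k: "is_zkernel C Z k c" and c: "is_zcokernel C Z c k" using assms(1) by (simp_all add: short_zexact_def)
  have c_Ar: "c \<in> Ar C" using zcokernelD[OF c] by simp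
  have "is_zkernel C Z (k \<cdot> m) (n \<cdot> c)"
    using zkernel_iso[OF k assms(2,3)] zkernel_iso_left[OF assms(4) c_Ar assms(5)] by blast
  moreover have "is_zcokernel C Z (n \<cdot> c) (k \<cdot> m)"
    by (rule zcokernel_iso[OF zcokernel_iso_right[OF c assms(2,3)] assms(4,5)])
  ultimately show ?thesis by (simp add: short_zexact_def)
qed

text \<open>If \<open>w \<cdot> q\<close> is \<open>z \<cdot> y\<close> with \<open>y\<close> into a
  trivial object, then \<open>y \<cdot> f\<close> is trivial as well, so \<open>y\<close> factors
  through \<open>q\<close> and the factorization descends to \<open>w\<close>.\<close>

lemma zcokernel_triv_cancel:
  assumes q: "is_zcokernel C Z q f" and w: "trivial_arrow C Z (w \<cdot> q)" "w \<in> Ar C" "Dom C w = Cod C q"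
  shows "trivial_arrow C Z w"
proof -
  note [simp] = zcokernelD(1-3)[OF q] w(2,3)
  obtain y z where e: "w \<cdot> q = z \<cdot> y" and [simp]: "y \<in> Ar C" "z \<in> Ar C" "Cod C y = Dom C z"
    and d: "Dom C y = Dom C (w \<cdot> q)" "Cod C z = Cod C (w \<cdot> q)" and Z: "Cod C y \<in> Z" using w(1) by (rule trivE)
  have [simp]: "Dom C y = Dom C q" "Cod C z = Cod C w" using d by simp_all
  have "trivial_arrow C Z (y \<cdot> f)" by (rule triv_through[OF Z]) simp_all
  then obtain h where [simp]: "h \<in> Ar C" "Dom C h = Cod C q" "Cod C h = Cod C y" and h: "h \<cdot> q = y"
    by (rule zcokernel_lift[OF q, rotated 2]) simp_all
  have "w = z \<cdot> h" by (rule zcokernel_eq[OF q]) (simp_all add: e h)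
  then show ?thesis using trivI[of h z Z] Z by simp
qed

text \<open>The identity of \<open>X\<close> then factors through the kernel \<open>t\<close>, which
  is therefore invertible, and repleteness applies.\<close>

lemma pretorsion_torsionI:
  assumes "pretorsion_theory C T F" "canonical_sequence C T F X t f" "trivial_arrow C (T \<inter> F) f"
  shows "X \<in> T"
proof -
  have k: "is_zkernel C (T \<inter> F) t f" and [simp]: "Cod C t = X" and dt: "Dom C t \<in> T"
    using assms(2) by (simp_all add: canonical_sequence_def short_zexact_def)
  have [simp]: "t \<in> Ar C" "f \<in> Ar C" "Dom C f = X" using zkernelD[OF k] by simp_all
  have [simp]: "X \<in> Ob C" using Cod_Ob[of t] by simp
  obtain h where h [simp]: "h \<in> Ar C" "Dom C h = X" "Cod C h = Dom C t" "t \<cdot> h = Ide C X"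
    by (rule zkernel_lift[OF k, of "Ide C X"]) (simp_all add: assms(3))
  have "h \<cdot> t = Ide C (Dom C t)"
    by (rule mono_cancel[OF zkernel_mono[OF k]]) (simp_all add: reassoc[OF h(4)])
  then have "is_iso C t" by (intro is_isoI[of _ h]) simp_all
  then show ?thesis using assms(1) dt by (auto simp: pretorsion_theory_def replete_def)
qed

lemma pretorsion_freeI:
  assumes "pretorsion_theory C T F" "canonical_sequence C T F X t f" "trivial_arrow C (T \<inter> F) t"
  shows "X \<in> F"
proof -
  have k: "is_zcokernel C (T \<inter> F) f t" and [simp]: "Cod C t = X" and dt: "Cod C f \<in> F"
    using assms(2) by (simp_all add: canonical_sequence_def short_zexact_def)
  have [simp]: "t \<in> Ar C" "f \<in> Ar C" "Dom C f = X" using zcokernelD[OF k] by simp_all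
  have [simp]: "X \<in> Ob C" using Cod_Ob[of t] by simp
  obtain h where h [simp]: "h \<in> Ar C" "Dom C h = Cod C f" "Cod C h = X" "h \<cdot> f = Ide C X"
    by (rule zcokernel_lift[OF k, of "Ide C X"]) (simp_all add: assms(3))
  have "f \<cdot> h = Ide C (Cod C f)"
    by (rule zcokernel_eq[OF k]) simp_all
  then have "is_iso C h" by (intro is_isoI[of _ f]) simp_all
  then show ?thesis using assms(1) dt h(2,3) unfolding pretorsion_theory_def replete_def by metis
qed

text \<open>Composites from one torsion part to the other torsion-free part are trivial. Hence
  \<open>t\<close> factors through \<open>t'\<close> and \<open>f\<close> through \<open>f'\<close>,
  which makes \<open>t'\<close> a kernel of \<open>f\<close> and \<open>f'\<close> a cokernel of
  \<open>t\<close>; these are unique up to isomorphism.\<close>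

lemma pretorsion_canonical_unique:
  assumes "pretorsion_theory C T F" "canonical_sequence C T F X t f" "canonical_sequence C T F X t' f'"
  obtains m n where "is_iso C m" "is_iso C n" "Cod C m = Dom C t" "Dom C n = Cod C f" "t' = t \<cdot> m" "f' = n \<cdot> f"
proof -
  let ?Z = "T \<inter> F"
  have k: "is_zkernel C ?Z t f" and c: "is_zcokernel C ?Z f t" and [simp]: "Cod C t = X"
    and T: "Dom C t \<in> T" "Cod C f \<in> F"
    using assms(2) by (simp_all add: canonical_sequence_def short_zexact_def)
  have k': "is_zkernel C ?Z t' f'" and c': "is_zcokernel C ?Z f' t'" and [simp]: "Cod C t' = X"
    and T': "Dom C t' \<in> T" "Cod C f' \<in> F"
    using assms(3) by (simp_all add: canonical_sequence_def short_zexact_def)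
  have [simp]: "t \<in> Ar C" "f \<in> Ar C" "Dom C f = X" using zcokernelD[OF c] by simp_all
  have [simp]: "t' \<in> Ar C" "f' \<in> Ar C" "Dom C f' = X" using zcokernelD[OF c'] by simp_all
  have TF: "trivial_arrow C ?Z g" if "g \<in> Ar C" "Dom C g \<in> T" "Cod C g \<in> F" for g
    using assms(1) that by (simp add: pretorsion_theory_def)
  obtain w where w [simp]: "w \<in> Ar C" "Dom C w = Dom C t" "Cod C w = Dom C t'" "t' \<cdot> w = t"
    by (rule zkernel_lift[OF k', of t]) (simp_all add: TF T T')
  obtain v where v [simp]: "v \<in> Ar C" "Dom C v = Cod C f'" "Cod C v = Cod C f" "v \<cdot> f' = f"
    by (rule zcokernel_lift[OF c', of f]) (simp_all add: TF T T')
  have "is_zkernel C ?Z t' f"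
  proof (rule zkernelI)
    fix g assume g: "g \<in> Ar C" "Cod C g = Dom C f" "trivial_arrow C ?Z (f \<cdot> g)"
    obtain h where "h \<in> Ar C" "Dom C h = Dom C g" "Cod C h = Dom C t" "t \<cdot> h = g" by (rule zkernel_lift[OF k g])
    then show "\<exists>h. h \<in> Ar C \<and> Dom C h = Dom C g \<and> Cod C h = Dom C t' \<and> t' \<cdot> h = g"
      by (intro exI[of _ "w \<cdot> h"]) (simp add: reassoc[OF w(4)])
  qed (simp_all add: TF T T' zkernel_mono[OF k'])
  from zkernel_unique[OF k this] obtain m where m: "is_iso C m" "Cod C m = Dom C t" "t' = t \<cdot> m" by metis
  have "is_zcokernel C ?Z f' t"
  proof (rule zcokernelI)
    fix g assume g: "g \<in> Ar C" "Dom C g = Cod C t" "trivial_arrow C ?Z (g \<cdot> t)"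
    obtain h where "h \<in> Ar C" "Dom C h = Cod C f" "Cod C h = Cod C g" "h \<cdot> f = g" by (rule zcokernel_lift[OF c g])
    then show "\<exists>h. h \<in> Ar C \<and> Dom C h = Cod C f' \<and> Cod C h = Cod C g \<and> h \<cdot> f' = g"
      by (intro exI[of _ "h \<cdot> v"]) simp
  next
    fix h k assume "h \<in> Ar C" "k \<in> Ar C" "Dom C h = Cod C f'" "Dom C k = Cod C f'" "Cod C k = Cod C h" "h \<cdot> f' = k \<cdot> f'"
    then show "h = k" by - (rule zcokernel_eq[OF c'])
  qed (simp_all add: TF T T')
  from zcokernel_unique[OF c this] obtain n where n: "is_iso C n" "Dom C n = Cod C f" "f' = n \<cdot> f" by metis
  show thesis by (rule that[OF m(1) n(1) m(2) n(2) m(3) n(3)])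
qed

lemma zero_arrow_exists:
  assumes "pointed C" "A \<in> Ob C" "B \<in> Ob C"
  obtains z where "z \<in> Ar C" "Dom C z = A" "Cod C z = B" "trivial_arrow C (zero_objects C) z"
proof -
  obtain O' where z: "O' \<in> zero_objects C" using assms(1) by (auto simp: pointed_def)
  then have I: "is_initial C O'" and T: "is_terminal C O'" by (simp_all add: zero_objects_def)
  obtain a where [simp]: "a \<in> Ar C" "Dom C a = A" "Cod C a = O'" by (rule terminal_arrow[OF T assms(2)])
  obtain b where [simp]: "b \<in> Ar C" "Dom C b = O'" "Cod C b = B" by (rule initial_arrow[OF I assms(3)])
  show thesis by (rule that[of "b \<cdot> a"]) (simp_all add: trivI z)
qed

text \<open>In a pointed category each coprojection is split by the arrow vanishing on the other summand.\<close>

lemma pointed_disjoint_coproducts: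
  assumes "pointed C" shows "disjoint_coproducts C"
proof -
  let ?zero = "trivial_arrow C (zero_objects C)"
  have split: "\<exists>r. r \<in> Ar C \<and> Dom C r = Cod C i \<and> Cod C r = Dom C i \<and> r \<cdot> i = Ide C (Dom C i) \<and> ?zero (r \<cdot> j)"
    if c: "is_coproduct C i j" for i j
  proof -
    note [simp] = coproductD[OF c]
    obtain z where [simp]: "z \<in> Ar C" "Dom C z = Dom C j" "Cod C z = Dom C i" "?zero z"
      by (rule zero_arrow_exists[OF assms, of "Dom C j" "Dom C i"]) simp_all
    obtain r where [simp]: "r \<in> Ar C" "Dom C r = Cod C i" "Cod C r = Dom C i" "r \<cdot> i = Ide C (Dom C i)" "r \<cdot> j = z"
      by (rule copair[OF c, of "Ide C (Dom C i)" z]) simp_all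
    show ?thesis by (intro exI[of _ r]) simp
  qed
  have mono: "is_mono C i" if c: "is_coproduct C i j" for i j
  proof -
    obtain r where [simp]: "r \<in> Ar C" "Dom C r = Cod C i" and r: "r \<cdot> i = Ide C (Dom C i)" using split[OF c] by blast
    have "i \<in> Ar C" using coproductD[OF c] by simp
    then show ?thesis
      using iso_mono[OF is_iso_Ide, of "Dom C i"] mono_left_factor[of r i] by (simp add: r)
  qed
  obtain O' where z: "O' \<in> zero_objects C" using assms by (auto simp: pointed_def)
  then have I: "is_initial C O'" and T: "is_terminal C O'" by (simp_all add: zero_objects_def)
  have "\<exists>p q. is_pullback C i j p q \<and> is_mono C (i \<cdot> p) \<and> (\<forall>m. is_mono C m \<and> Cod C m = Cod C i \<longrightarrow> subobj_le C (i \<cdot> p) m)"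
    if c: "is_coproduct C i j" for i j
  proof -
    note [simp] = coproductD[OF c]
    obtain p where [simp]: "p \<in> Ar C" "Dom C p = O'" "Cod C p = Dom C i" by (rule initial_arrow[OF I, of "Dom C i"]) simp
    obtain q where [simp]: "q \<in> Ar C" "Dom C q = O'" "Cod C q = Dom C j" by (rule initial_arrow[OF I, of "Dom C j"]) simp
    obtain r where r [simp]: "r \<in> Ar C" "Dom C r = Cod C i" "Cod C r = Dom C i" "r \<cdot> i = Ide C (Dom C i)" "?zero (r \<cdot> j)"
      using split[OF c] by blast
    obtain s where s [simp]: "s \<in> Ar C" "Dom C s = Cod C j" "Cod C s = Dom C j" "s \<cdot> j = Ide C (Dom C j)" "?zero (s \<cdot> i)"
      using split[OF coproduct_sym[OF c]] by blast
    have "is_pullback C i j p q"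
    proof (rule pullbackI)
      show "i \<cdot> p = j \<cdot> q" by (rule initial_eq) (simp_all add: I)
      fix u v assume uv [simp]: "u \<in> Ar C" "v \<in> Ar C" "Dom C v = Dom C u" "Cod C u = Dom C i" "Cod C v = Dom C j"
        and e: "i \<cdot> u = j \<cdot> v"
      obtain h where [simp]: "h \<in> Ar C" "Dom C h = Dom C u" "Cod C h = O'" by (rule terminal_arrow[OF T, of "Dom C u"]) simp
      have zh: "?zero (p \<cdot> h)" "?zero (q \<cdot> h)" by (simp_all add: trivI z)
      \<comment> \<open>The retraction \<open>r\<close> recovers \<open>u\<close> from
        \<open>i \<cdot> u\<close> but kills \<open>j\<close>, so an element lying in both summands
        is zero.\<close>
      have "u = (r \<cdot> j) \<cdot> v" using reassoc[OF r(4), of u] by (simp add: e)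
      then have "?zero u" using triv_comp_right[OF r(5), of v] by simp
      then have "p \<cdot> h = u" by - (rule zero_arrow_eq, simp_all add: zh)
      moreover have "v = (s \<cdot> i) \<cdot> u" using reassoc[OF s(4), of v] by (simp add: e)
      then have "?zero v" using triv_comp_right[OF s(5), of u] by simp
      then have "q \<cdot> h = v" by - (rule zero_arrow_eq, simp_all add: zh)
      ultimately show "\<exists>h. h \<in> Ar C \<and> Dom C h = Dom C u \<and> Cod C h = Dom C p \<and> p \<cdot> h = u \<and> q \<cdot> h = v"
        by (intro exI[of _ h]) simp
    qed (simp_all add: terminal_eq T)
    moreover have "is_mono C (i \<cdot> p)"
      by (rule is_monoI) (simp_all add: terminal_eq T)
    moreover have "subobj_le C (i \<cdot> p) m" if "is_mono C m" "Cod C m = Cod C i" for m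
    proof -
      have [simp]: "m \<in> Ar C" using that(1) by (simp add: is_mono_def)
      obtain h where [simp]: "h \<in> Ar C" "Dom C h = O'" "Cod C h = Dom C m" by (rule initial_arrow[OF I, of "Dom C m"]) simp
      have "m \<cdot> h = i \<cdot> p" by (rule initial_eq) (simp_all add: I that)
      then show ?thesis using that unfolding subobj_le_def by (intro conjI bexI[of _ h]) simp_all
    qed
    ultimately show ?thesis by blast
  qed
  then show ?thesis using mono coproduct_sym unfolding disjoint_coproducts_def by blast
qed

end


subsection \<open>Zero arrows, coproducts, kernels and cokernels of the stable category\<close>

context stable
begin

abbreviation zero where "zero \<equiv> trivial_arrow St (zero_objects St)"

lemma maybe_Z: "A \<in> Z \<Longrightarrow> maybe A \<in> Z"
  using Z_coproduct[OF incl_coproduct(1), of A] incl[of A] one(1) Z_Ob by auto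

text \<open>Arrows out of \<open>A\<close> have classifying arrows out of \<open>A\<close>, and
  arrows into \<open>A\<close> have classifying arrows into \<open>A + 1\<close>. Both objects are
  trivial, and parallel trivial arrows are congruent.\<close>

lemma Z_zero: assumes A: "A \<in> Z" shows "A \<in> zero_objects St"
proof -
  have [simp]: "A \<in> Ob P" using A Z_Ob by auto
  have arr: "\<exists>\<phi>. \<phi> \<in> Ar St \<and> Dom St \<phi> = X \<and> Cod St \<phi> = Y" if [simp]: "X \<in> Ob P" "Y \<in> Ob P" for X Y
  proof -
    obtain b where [simp]: "b \<in> Ar P" "Dom P b = X" "Cod P b = one" by (rule to_one[of X]) simp
    show ?thesis by (rule St_arrow[of "pt Y \<cdot> b" Y]) auto
  qed
  have eq: "\<phi> = \<psi>" if [simp]: "\<phi> \<in> Ar St" "\<psi> \<in> Ar St" "Dom St \<psi> = Dom St \<phi>" "Cod St \<psi> = Cod St \<phi>"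
    and A': "Dom St \<phi> = A \<or> Cod St \<phi> = A" for \<phi> \<psi>
  proof -
    obtain t where t [simp]: "t \<in> Ar P" "Dom P t = Dom St \<phi>" "Cod P t = maybe (Cod St \<phi>)" and B: "Cod St \<phi> \<in> Ob P"
      and e: "Sg (incl (Cod St \<phi>)) \<cdot>\<^bsub>St\<^esub> \<phi> = Sg t" by (rule St_factor[of \<phi>]) simp_all
    obtain s where s [simp]: "s \<in> Ar P" "Dom P s = Dom St \<phi>" "Cod P s = maybe (Cod St \<phi>)"
      and e': "Sg (incl (Cod St \<phi>)) \<cdot>\<^bsub>St\<^esub> \<psi> = Sg s" by (rule St_factor[of \<psi>]) simp_all
    have "triv t \<and> triv s"
      using A' triv_from[OF A, of t] triv_from[OF A, of s] triv_through[OF maybe_Z[OF A], of t]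
        triv_through[OF maybe_Z[OF A], of s] by auto
    then have "sim t s" by (intro sim_triv) simp_all
    then have "Sg t = Sg s" by (simp add: Sg_eq_iff)
    then show ?thesis by - (rule Sg_incl_cancel[OF B], simp_all add: e e')
  qed
  have "\<exists>!f. f \<in> hom St X Y" if XY: "X \<in> Ob P" "Y \<in> Ob P" "X = A \<or> Y = A" for X Y
  proof -
    obtain \<phi> where \<phi>: "\<phi> \<in> Ar St \<and> Dom St \<phi> = X \<and> Cod St \<phi> = Y" using arr[OF XY(1,2)] by blast
    show ?thesis
    proof (rule ex1I[of _ \<phi>])
      show "\<phi> \<in> hom St X Y" using \<phi> by simp
      fix \<psi> assume "\<psi> \<in> hom St X Y"
      then show "\<psi> = \<phi>" using \<phi> XY(3) by - (rule eq, auto)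
    qed
  qed
  then show ?thesis by (simp add: zero_objects_def is_initial_def is_terminal_def)
qed

lemma triv_Sg: "triv f \<Longrightarrow> zero (Sg f)"
  by (erule trivE) (use Z_zero in \<open>auto simp: Sg_comp intro!: K.trivI\<close>)

text \<open>Zero arrows of the quotient are equal, so after \<open>incl\<close> the arrow is
  congruent to the trivial arrow to the point, and congruence preserves triviality. Composing with
  \<open>incl\<close> first guarantees that there is a trivial arrow to compare with.\<close>

lemma zero_Sg_iff: assumes [simp]: "f \<in> Ar P" shows "zero (Sg f) \<longleftrightarrow> triv f"
proof
  assume f: "zero (Sg f)"
  let ?B = "Cod P f"
  obtain b where [simp]: "b \<in> Ar P" "Dom P b = Dom P f" "Cod P b = one" by (rule to_one[of "Dom P f"]) simp
  have "zero (Sg (incl ?B) \<cdot>\<^bsub>St\<^esub> Sg f)" by (rule K.triv_comp_left[OF f]) simp_all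
  then have "zero (Sg (incl ?B \<cdot> f))" by (simp add: Sg_comp)
  moreover have tb: "triv (pt ?B \<cdot> b)" by (rule triv_pt) simp_all
  ultimately have "Sg (pt ?B \<cdot> b) = Sg (incl ?B \<cdot> f)"
    by - (rule K.zero_arrow_eq, simp_all add: triv_Sg)
  then have "sim (pt ?B \<cdot> b) (incl ?B \<cdot> f)" by (subst (asm) Sg_eq_iff) simp_all
  then have "triv (incl ?B \<cdot> f)" by (rule sim_trivD[OF _ tb])
  then show "triv f" by (rule trivial_mono_cancel[OF incl_mono, rotated 3]) simp_all
qed (rule triv_Sg)

lemma zero_objects_St: "zero_objects St = Z"
proof (intro set_eqI iffI)
  fix A assume A: "A \<in> zero_objects St"
  then have Ob: "A \<in> Ob P" by (simp add: zero_objects_def is_initial_def)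
  have "zero (Sg (Ide P A))" by (rule K.triv_through[OF A]) (simp_all add: Ob)
  then show "A \<in> Z" using Ob by (intro trivial_Ide) (simp_all add: zero_Sg_iff)
qed (rule Z_zero)

lemma pointed_St: "pointed St"
  using one(1) by (auto simp: pointed_def zero_objects_St)

lemma zero_factor_iff:
  assumes "\<phi> \<in> Ar St" "t \<in> Ar P" "Sg (incl (Cod St \<phi>)) \<cdot>\<^bsub>St\<^esub> \<phi> = Sg t"
  shows "zero \<phi> \<longleftrightarrow> triv t"
proof -
  have [simp]: "Cod St \<phi> \<in> Ob P" using K.Cod_Ob[OF assms(1)] by simp
  have "zero (Sg (incl (Cod St \<phi>)) \<cdot>\<^bsub>St\<^esub> \<phi>) \<longleftrightarrow> zero \<phi>"
    by (rule K.triv_iso_left[OF Sg_incl_iso]) (simp_all add: assms)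
  then show ?thesis using zero_Sg_iff[OF assms(2)] by (simp add: assms(3))
qed

lemma Sg_initial: "is_initial P I \<Longrightarrow> is_initial St I"
  using Z_zero[of I] trivial_Ide[of I] triv_initial[of "Ide P I"]
  by (auto simp: zero_objects_def is_initial_def)

text \<open>Copairing is done on the classifying arrows in \<open>P\<close>; uniqueness is
  \<open>sim_copair\<close>.\<close>

lemma Sg_coproduct:
  assumes c: "is_coproduct P i j" shows "is_coproduct St (Sg i) (Sg j)"
proof (rule K.coproductI)
  note [simp] = coproductD[OF c]
  fix \<phi> \<psi> assume [simp]: "\<phi> \<in> Ar St" "\<psi> \<in> Ar St" "Dom St \<phi> = Dom St (Sg i)" "Dom St \<psi> = Dom St (Sg j)" "Cod St \<psi> = Cod St \<phi>"
  let ?B = "Cod St \<phi>"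
  obtain t where t [simp]: "t \<in> Ar P" "Dom P t = Dom St \<phi>" "Cod P t = maybe ?B" and [simp]: "?B \<in> Ob P"
    and e: "Sg (incl ?B) \<cdot>\<^bsub>St\<^esub> \<phi> = Sg t" by (rule St_factor[of \<phi>]) simp_all
  obtain s where s [simp]: "s \<in> Ar P" "Dom P s = Dom St \<psi>" "Cod P s = maybe ?B"
    and e': "Sg (incl ?B) \<cdot>\<^bsub>St\<^esub> \<psi> = Sg s" by (rule St_factor[of \<psi>]) simp_all
  obtain h where h [simp]: "h \<in> Ar P" "Dom P h = Cod P i" "Cod P h = maybe ?B" "h \<cdot> i = t" "h \<cdot> j = s"
    by (rule copair[OF c, of t s]) simp_all
  obtain \<chi> where \<chi> [simp]: "\<chi> \<in> Ar St" "Dom St \<chi> = Dom P h" "Cod St \<chi> = ?B" "Sg (incl ?B) \<cdot>\<^bsub>St\<^esub> \<chi> = Sg h"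
    by (rule St_arrow[of h ?B]) simp_all
  have "\<chi> \<cdot>\<^bsub>St\<^esub> Sg i = \<phi>"
    by (rule Sg_incl_cancel[of ?B]) (simp_all add: K.reassoc[OF \<chi>(4)] e Sg_comp[symmetric])
  moreover have "\<chi> \<cdot>\<^bsub>St\<^esub> Sg j = \<psi>"
    by (rule Sg_incl_cancel[of ?B]) (simp_all add: K.reassoc[OF \<chi>(4)] e' Sg_comp[symmetric])
  ultimately show "\<exists>h. h \<in> Ar St \<and> Dom St h = Cod St (Sg i) \<and> Cod St h = ?B \<and> h \<cdot>\<^bsub>St\<^esub> Sg i = \<phi> \<and> h \<cdot>\<^bsub>St\<^esub> Sg j = \<psi>"
    by (intro exI[of _ \<chi>]) simp
next
  note [simp] = coproductD[OF c]
  fix \<phi> \<psi> assume [simp]: "\<phi> \<in> Ar St" "\<psi> \<in> Ar St" "Dom St \<phi> = Cod St (Sg i)" "Dom St \<psi> = Cod St (Sg i)" "Cod St \<psi> = Cod St \<phi>"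
    and eq: "\<phi> \<cdot>\<^bsub>St\<^esub> Sg i = \<psi> \<cdot>\<^bsub>St\<^esub> Sg i" "\<phi> \<cdot>\<^bsub>St\<^esub> Sg j = \<psi> \<cdot>\<^bsub>St\<^esub> Sg j"
  let ?B = "Cod St \<phi>"
  obtain t where t [simp]: "t \<in> Ar P" "Dom P t = Dom St \<phi>" "Cod P t = maybe ?B" and [simp]: "?B \<in> Ob P"
    and e: "Sg (incl ?B) \<cdot>\<^bsub>St\<^esub> \<phi> = Sg t" by (rule St_factor[of \<phi>]) simp_all
  obtain s where s [simp]: "s \<in> Ar P" "Dom P s = Dom St \<psi>" "Cod P s = maybe ?B"
    and e': "Sg (incl ?B) \<cdot>\<^bsub>St\<^esub> \<psi> = Sg s" by (rule St_factor[of \<psi>]) simp_all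
  have *: "Sg (t \<cdot> x) = Sg (s \<cdot> x)" if [simp]: "x \<in> Ar P" "Cod P x = Cod P i"
    and x: "\<phi> \<cdot>\<^bsub>St\<^esub> Sg x = \<psi> \<cdot>\<^bsub>St\<^esub> Sg x" for x
    using K.reassoc[OF e, of "Sg x"] K.reassoc[OF e', of "Sg x"] x by (simp add: Sg_comp)
  have "sim (t \<cdot> i) (s \<cdot> i)" "sim (t \<cdot> j) (s \<cdot> j)"
    using *[of i] *[of j] eq by (simp_all add: Sg_eq_iff)
  then have "sim t s" by - (rule sim_copair[OF c], simp_all)
  then have "Sg t = Sg s" by (simp add: Sg_eq_iff)
  then show "\<phi> = \<psi>" by - (rule Sg_incl_cancel[of ?B], simp_all add: e e')
qed (simp_all add: coproductD[OF c])

lemma has_binary_coproducts_St: "has_binary_coproducts St"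
  unfolding has_binary_coproducts_def
proof (intro ballI)
  fix A B assume "A \<in> Ob St" "B \<in> Ob St"
  then have "A \<in> Ob P" "B \<in> Ob P" by simp_all
  then obtain i j where "is_coproduct P i j" "Dom P i = A" "Dom P j = B" "i \<in> Ar P" "j \<in> Ar P"
    by (rule coproduct_exists)
  then show "\<exists>i j. is_coproduct St i j \<and> Dom St i = A \<and> Dom St j = B"
    using Sg_coproduct[of i j] by (intro exI[of _ "Sg i"] exI[of _ "Sg j"]) simp
qed

section \<open>Kernels and cokernels in the quotient\<close>

definition maybe_map :: "'m \<Rightarrow> 'm" where
  "maybe_map f = ext (Cod P f) (incl (Cod P f) \<cdot> f)"

lemma maybe_map [simp]:
  assumes "f \<in> Ar P"
  shows "maybe_map f \<in> Ar P" "Dom P (maybe_map f) = maybe (Dom P f)" "Cod P (maybe_map f) = maybe (Cod P f)"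
  using assms by (simp_all add: maybe_map_def)

lemma maybe_map_incl:
  assumes "f \<in> Ar P" "Dom P f = A" "Cod P f = B"
  shows "maybe_map f \<cdot> incl A = incl B \<cdot> f" "maybe_map f \<cdot> pt A = pt B"
  using assms by (auto simp: maybe_map_def ext_incl ext_pt)

text \<open>By naturality of \<open>incl\<close>, following an arrow by a total arrow
  \<open>f\<close> acts on classifying arrows as composition with
  \<open>maybe_map f\<close>.\<close>

lemma Sg_maybe_map:
  assumes "f \<in> Ar P" "\<phi> \<in> Ar St" "Cod St \<phi> = Dom P f" "t \<in> Ar P" "Cod P t = maybe (Dom P f)"
    "Sg (incl (Dom P f)) \<cdot>\<^bsub>St\<^esub> \<phi> = Sg t"
  shows "Sg (incl (Cod P f)) \<cdot>\<^bsub>St\<^esub> Sg f \<cdot>\<^bsub>St\<^esub> \<phi> = Sg (maybe_map f \<cdot> t)"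
proof -
  note [simp] = assms(1-5)
  have "Sg (incl (Cod P f)) \<cdot>\<^bsub>St\<^esub> Sg f \<cdot>\<^bsub>St\<^esub> \<phi> = Sg (incl (Cod P f) \<cdot> f) \<cdot>\<^bsub>St\<^esub> \<phi>"
    by (simp add: Sg_comp)
  also have "\<dots> = Sg (maybe_map f) \<cdot>\<^bsub>St\<^esub> Sg (incl (Dom P f)) \<cdot>\<^bsub>St\<^esub> \<phi>"
    unfolding maybe_map_incl(1)[OF assms(1) refl refl, symmetric] by (simp add: Sg_comp)
  finally show ?thesis by (simp add: assms(6) Sg_comp)
qed

lemma maybe_map_mono:
  assumes "is_mono P m" shows "is_mono P (maybe_map m)"
proof -
  have [simp]: "m \<in> Ar P" using assms by (simp add: is_mono_def)
  show ?thesis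
  proof (rule copair_mono[OF incl_coproduct(1)])
    show "is_mono P (incl (Cod P m) \<cdot> m)" by (rule mono_comp[OF assms incl_mono]) simp_all
    show "is_mono P (pt (Cod P m))" using coproj_mono(2)[OF incl_coproduct(1)] by simp
    show "is_initial P (Dom P u)" if [simp]: "u \<in> Ar P" "v \<in> Ar P" "Cod P u = Dom P (incl (Dom P m))"
      "Cod P v = Dom P (pt (Dom P m))" "Dom P v = Dom P u" and e: "(incl (Cod P m) \<cdot> m) \<cdot> u = pt (Cod P m) \<cdot> v" for u v
    proof -
      have e': "incl (Cod P m) \<cdot> m \<cdot> u = pt (Cod P m) \<cdot> v" using e by simp
      have "is_initial P (Dom P (m \<cdot> u))" by (rule disjoint[OF incl_coproduct(1) e']) simp_all
      then show ?thesis by simp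
    qed
  qed (simp_all add: maybe_map_incl)
qed

lemma Sg_mono:
  assumes "is_mono P m" shows "is_mono St (Sg m)"
proof (rule K.is_monoI)
  have [simp]: "m \<in> Ar P" using assms by (simp add: is_mono_def)
  show "Sg m \<in> Ar St" by simp
  fix \<phi> \<psi> assume [simp]: "\<phi> \<in> Ar St" "\<psi> \<in> Ar St" "Dom St \<psi> = Dom St \<phi>" "Cod St \<phi> = Dom St (Sg m)"
    "Cod St \<psi> = Dom St (Sg m)" and eq: "Sg m \<cdot>\<^bsub>St\<^esub> \<phi> = Sg m \<cdot>\<^bsub>St\<^esub> \<psi>"
  obtain t where t [simp]: "t \<in> Ar P" "Dom P t = Dom St \<phi>" "Cod P t = maybe (Cod St \<phi>)"
    and e: "Sg (incl (Cod St \<phi>)) \<cdot>\<^bsub>St\<^esub> \<phi> = Sg t" by (rule St_factor[of \<phi>]) simp_all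
  obtain s where s [simp]: "s \<in> Ar P" "Dom P s = Dom St \<phi>" "Cod P s = maybe (Cod St \<phi>)"
    and e': "Sg (incl (Cod St \<phi>)) \<cdot>\<^bsub>St\<^esub> \<psi> = Sg s" by (rule St_factor[of \<psi>]) simp_all
  have "Sg (maybe_map m \<cdot> t) = Sg (maybe_map m \<cdot> s)"
    using Sg_maybe_map[of m \<phi> t] Sg_maybe_map[of m \<psi> s] e e' eq by simp
  then have "sim (maybe_map m \<cdot> t) (maybe_map m \<cdot> s)" by (simp add: Sg_eq_iff)
  then have "sim t s" by (rule sim_mono_cancel[OF maybe_map_mono[OF assms]]) simp_all
  then have "Sg t = Sg s" by (simp add: Sg_eq_iff)
  then show "\<phi> = \<psi>" using e e' by - (rule Sg_incl_cancel[of "Dom P m"], simp_all)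
qed

text \<open>Where the classifying arrow \<open>t\<close> of \<phi> is defined, its composite with
  \<open>f\<close> is trivial and it lifts along \<open>k\<close>; where it is the point, the lift
  is the point too. The copairing of these two pieces classifies the factorization.\<close>

lemma Sg_zkernel:
  assumes k: "is_zkernel P Z k f" shows "is_kernel St (Sg k) (Sg f)"
proof (rule K.zkernelI)
  note [simp] = zkernelD(1-3)[OF k]
  show "Sg k \<in> Ar St" "Sg f \<in> Ar St" "Cod St (Sg k) = Dom St (Sg f)" by simp_all
  show "zero (Sg f \<cdot>\<^bsub>St\<^esub> Sg k)" using triv_Sg[OF zkernelD(4)[OF k]] by (simp add: Sg_comp)
  show "is_mono St (Sg k)" by (rule Sg_mono[OF zkernel_mono[OF k]])
  fix \<phi> assume [simp]: "\<phi> \<in> Ar St" "Cod St \<phi> = Dom St (Sg f)" and z: "zero (Sg f \<cdot>\<^bsub>St\<^esub> \<phi>)"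
  let ?A = "Dom P f" and ?B = "Cod P f"
  obtain t where t [simp]: "t \<in> Ar P" "Dom P t = Dom St \<phi>" "Cod P t = maybe ?A"
    and e: "Sg (incl ?A) \<cdot>\<^bsub>St\<^esub> \<phi> = Sg t" by (rule St_factor[of \<phi>]) simp_all
  have tz: "triv (maybe_map f \<cdot> t)"
    using z zero_factor_iff[of "Sg f \<cdot>\<^bsub>St\<^esub> \<phi>" "maybe_map f \<cdot> t"] Sg_maybe_map[of f \<phi> t] e by simp
  obtain d1 d2 g1 g2 where d: "is_coproduct P d1 d2"
    and [simp]: "d1 \<in> Ar P" "d2 \<in> Ar P" "g1 \<in> Ar P" "g2 \<in> Ar P" "Cod P d1 = Dom P t" "Cod P d2 = Dom P t"
    "Dom P g1 = Dom P d1" "Dom P g2 = Dom P d2" "Cod P g1 = ?A" "Cod P g2 = one"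
    and td: "t \<cdot> d1 = incl ?A \<cdot> g1" "t \<cdot> d2 = pt ?A \<cdot> g2"
    by (rule decompose[OF incl_coproduct(1)[of ?A], of t]) simp_all
  have "triv ((maybe_map f \<cdot> t) \<cdot> d1)" by (rule triv_comp_right[OF tz]) simp_all
  then have "triv (incl ?B \<cdot> f \<cdot> g1)"
    using reassoc[OF maybe_map_incl(1)[of f ?A ?B], of g1] by (simp add: td)
  then have "triv (f \<cdot> g1)" using trivial_mono_cancel[OF incl_mono[of ?B], of "f \<cdot> g1"] by simp
  then obtain h1 where h1 [simp]: "h1 \<in> Ar P" "Dom P h1 = Dom P g1" "Cod P h1 = Dom P k" "k \<cdot> h1 = g1"
    by (rule zkernel_lift[OF k, rotated 2]) simp_all
  note [simp] = coproductD[OF d]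
  obtain h where h [simp]: "h \<in> Ar P" "Dom P h = Cod P d1" "Cod P h = maybe (Dom P k)" "h \<cdot> d1 = incl (Dom P k) \<cdot> h1"
    "h \<cdot> d2 = pt (Dom P k) \<cdot> g2"
    by (rule copair[OF d, of "incl (Dom P k) \<cdot> h1" "pt (Dom P k) \<cdot> g2"]) simp_all
  have th: "maybe_map k \<cdot> h = t"
    by (rule coproduct_eq[OF d])
      (simp_all add: td reassoc[OF maybe_map_incl(1)[of k "Dom P k" ?A]] reassoc[OF maybe_map_incl(2)[of k "Dom P k" ?A]])
  obtain \<theta> where \<theta> [simp]: "\<theta> \<in> Ar St" "Dom St \<theta> = Dom P h" "Cod St \<theta> = Dom P k" 
    and e\<theta>: "Sg (incl (Dom P k)) \<cdot>\<^bsub>St\<^esub> \<theta> = Sg h" by (rule St_arrow[of h "Dom P k"]) simp_all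
  have "Sg k \<cdot>\<^bsub>St\<^esub> \<theta> = \<phi>"
    using Sg_maybe_map[of k \<theta> h] e\<theta> by - (rule Sg_incl_cancel[of ?A], simp_all add: e th)
  then show "\<exists>h. h \<in> Ar St \<and> Dom St h = Dom St \<phi> \<and> Cod St h = Dom St (Sg k) \<and> Sg k \<cdot>\<^bsub>St\<^esub> h = \<phi>"
    by (intro exI[of _ \<theta>]) simp
qed

text \<open>Complemented subobjects descend along a \<open>\<Z>\<close>-cokernel \<open>q\<close>: their characteristic arrows
  have a trivial codomain, hence factor through \<open>q\<close>.\<close>

lemma zcokernel_decompose:
  assumes q: "is_zcokernel P Z q f" and c: "is_coproduct P i j" "Cod P i = Dom P q"
  obtains e0 e1 q0 q1 where "is_coproduct P e0 e1" "Cod P e0 = Cod P q" "q0 \<in> Ar P" "q1 \<in> Ar P"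
    "Dom P q0 = Dom P i" "Dom P q1 = Dom P j" "Cod P q0 = Dom P e0" "Cod P q1 = Dom P e1"
    "e0 \<cdot> q0 = q \<cdot> i" "e1 \<cdot> q1 = q \<cdot> j"
proof -
  note [simp] = zcokernelD(1-3)[OF q] coproductD[OF c(1)] c(2)
  obtain u v where uv: "is_coproduct P u v" and [simp]: "Dom P u = one" "Dom P v = one" "u \<in> Ar P" "v \<in> Ar P"
    "Cod P v = Cod P u" by (rule coproduct_exists[of one one]) simp_all
  have U: "Cod P u \<in> Z" using Z_coproduct[OF uv] one(1) by simp
  obtain a where [simp]: "a \<in> Ar P" "Dom P a = Dom P i" "Cod P a = one" by (rule to_one[of "Dom P i"]) simp
  obtain b where [simp]: "b \<in> Ar P" "Dom P b = Dom P j" "Cod P b = one" by (rule to_one[of "Dom P j"]) simp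
  obtain \<chi> where \<chi> [simp]: "\<chi> \<in> Ar P" "Dom P \<chi> = Cod P i" "Cod P \<chi> = Cod P u" "\<chi> \<cdot> i = u \<cdot> a" "\<chi> \<cdot> j = v \<cdot> b"
    by (rule copair[OF c(1), of "u \<cdot> a" "v \<cdot> b"]) simp_all
  have "triv (\<chi> \<cdot> f)" by (rule triv_through[OF U]) simp_all
  then obtain \<chi>' where \<chi>' [simp]: "\<chi>' \<in> Ar P" "Dom P \<chi>' = Cod P q" "Cod P \<chi>' = Cod P u" "\<chi>' \<cdot> q = \<chi>"
    using zcokernel_lift[OF q, of \<chi>] by auto
  obtain e0 e1 x y where e: "is_coproduct P e0 e1" "is_pullback P \<chi>' u e0 x" "is_pullback P \<chi>' v e1 y" "Cod P e0 = Dom P \<chi>'"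
    by (rule decompose[OF uv, of \<chi>']) simp_all
  obtain q0 where "q0 \<in> Ar P" "Dom P q0 = Dom P (q \<cdot> i)" "Cod P q0 = Dom P e0" "e0 \<cdot> q0 = q \<cdot> i"
    by (rule pullback_lift[OF e(2), of "q \<cdot> i" a]) (simp_all add: reassoc[OF \<chi>'(4)])
  moreover obtain q1 where "q1 \<in> Ar P" "Dom P q1 = Dom P (q \<cdot> j)" "Cod P q1 = Dom P e1" "e1 \<cdot> q1 = q \<cdot> j"
    by (rule pullback_lift[OF e(3), of "q \<cdot> j" b]) (simp_all add: reassoc[OF \<chi>'(4)])
  ultimately show thesis using that[OF e(1), of q0 q1] e(4) by simp
qed

text \<open>The decomposition of the source of \<open>q\<close> that witnesses the congruence is
  compatible with one of its target, by \<open>zcokernel_decompose\<close>. The universal property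
  of \<open>q\<close> speaks only of arrows on the whole target, so arrows given on one summand are
  first extended over the other one.\<close>

lemma zcokernel_sim_cancel:
  assumes q: "is_zcokernel P Z q f" and s: "sim (g \<cdot> q) (h \<cdot> q)"
    and gh [simp]: "g \<in> Ar P" "h \<in> Ar P" "Dom P g = Cod P q" "Dom P h = Cod P q"
  shows "sim g h"
proof -
  note [simp] = zcokernelD(1-3)[OF q]
  have [simp]: "Cod P h = Cod P g" using simD(4)[OF s] by simp
  obtain i j where c: "is_coproduct P i j" "Cod P i = Dom P (g \<cdot> q)" "(g \<cdot> q) \<cdot> i = (h \<cdot> q) \<cdot> i"
    "triv ((g \<cdot> q) \<cdot> j)" "triv ((h \<cdot> q) \<cdot> j)" using s by (rule simE)
  have ci: "Cod P i = Dom P q" using c(2) by simp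
  note [simp] = coproductD[OF c(1)] ci
  obtain e0 e1 q0 q1 where e: "is_coproduct P e0 e1" and [simp]: "Cod P e0 = Cod P q" "q0 \<in> Ar P" "q1 \<in> Ar P"
    "Dom P q0 = Dom P i" "Dom P q1 = Dom P j" "Cod P q0 = Dom P e0" "Cod P q1 = Dom P e1"
    and eq: "e0 \<cdot> q0 = q \<cdot> i" "e1 \<cdot> q1 = q \<cdot> j"
    by (rule zcokernel_decompose[OF q c(1) ci])
  note [simp] = coproductD[OF e]
  have tr: "triv (w \<cdot> e1)" if [simp]: "w \<in> Ar P" "Dom P w = Cod P q" and w: "triv ((w \<cdot> q) \<cdot> j)" for w
  proof -
    obtain a where [simp]: "a \<in> Ar P" "Dom P a = Dom P e0" "Cod P a = one" by (rule to_one[of "Dom P e0"]) simp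
    \<comment> \<open>\<open>b\<close> is \<open>w\<close> on \<open>e1\<close> and the point on
      \<open>e0\<close>. It is trivial after \<open>q\<close> and hence trivial, while
      \<open>w\<close> is known to be trivial after \<open>q\<close> only on
      \<open>j\<close>.\<close>
    obtain b where b [simp]: "b \<in> Ar P" "Dom P b = Cod P e0" "Cod P b = maybe (Cod P w)"
      "b \<cdot> e0 = pt (Cod P w) \<cdot> a" "b \<cdot> e1 = incl (Cod P w) \<cdot> w \<cdot> e1"
      by (rule copair[OF e, of "pt (Cod P w) \<cdot> a" "incl (Cod P w) \<cdot> w \<cdot> e1"]) simp_all
    have "triv (b \<cdot> q)"
    proof (rule triv_coproduct[OF c(1)])
      have "triv (pt (Cod P w) \<cdot> a \<cdot> q0)" by (rule triv_pt) simp_all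
      then show "triv ((b \<cdot> q) \<cdot> i)" using reassoc[OF b(4), of q0] by (simp add: eq)
      have "triv (incl (Cod P w) \<cdot> w \<cdot> q \<cdot> j)" using triv_comp_left[OF w, of "incl (Cod P w)"] by simp
      then show "triv ((b \<cdot> q) \<cdot> j)" using reassoc[OF b(5), of q1] by (simp add: eq)
    qed simp_all
    then have "triv b" by (rule zcokernel_triv_cancel[OF q]) simp_all
    then have "triv (b \<cdot> e1)" by (rule triv_comp_right) simp_all
    then show ?thesis using trivial_mono_cancel[OF incl_mono[of "Cod P w"], of "w \<cdot> e1"] by simp
  qed
  \<comment> \<open>\<open>a\<close> is \<open>h\<close> on \<open>e0\<close> and \<open>g\<close>
    on \<open>e1\<close>. It coincides with \<open>g\<close> after \<open>q\<close>, hence equals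
    \<open>g\<close>; read on \<open>e0\<close> this is the wanted agreement.\<close>
  obtain a where a [simp]: "a \<in> Ar P" "Dom P a = Cod P e0" "Cod P a = Cod P g" "a \<cdot> e0 = h \<cdot> e0" "a \<cdot> e1 = g \<cdot> e1"
    by (rule copair[OF e, of "h \<cdot> e0" "g \<cdot> e1"]) simp_all
  have "a \<cdot> q = g \<cdot> q"
    by (rule coproduct_eq[OF c(1)])
      (use reassoc[OF a(4), of q0] reassoc[OF a(5), of q1] c(3) in \<open>simp_all add: eq\<close>)
  then have "a = g" by (rule zcokernel_eq[OF q]) simp_all
  then have "g \<cdot> e0 = h \<cdot> e0" using a(4) by simp
  then show ?thesis using tr[OF _ _ c(4)] tr[OF _ _ c(5)] by (intro simI[OF e]) simp_all
qed

text \<open>If \<phi> kills the image of \<open>f\<close>, then the classifying arrow of \<phi>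
  kills \<open>f\<close> up to triviality and factors through \<open>q\<close> already in
  \<open>P\<close>. Uniqueness is \<open>zcokernel_sim_cancel\<close>.\<close>

lemma Sg_zcokernel:
  assumes q: "is_zcokernel P Z q f" shows "is_cokernel St (Sg q) (Sg f)"
proof (rule K.zcokernelI)
  note [simp] = zcokernelD(1-3)[OF q]
  show "Sg q \<in> Ar St" "Sg f \<in> Ar St" "Dom St (Sg q) = Cod St (Sg f)" by simp_all
  show "zero (Sg q \<cdot>\<^bsub>St\<^esub> Sg f)" using triv_Sg[OF zcokernelD(4)[OF q]] by (simp add: Sg_comp)
  show "\<phi> = \<psi>" if [simp]: "\<phi> \<in> Ar St" "\<psi> \<in> Ar St" "Dom St \<phi> = Cod St (Sg q)" "Dom St \<psi> = Cod St (Sg q)" "Cod St \<psi> = Cod St \<phi>"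
    and eq: "\<phi> \<cdot>\<^bsub>St\<^esub> Sg q = \<psi> \<cdot>\<^bsub>St\<^esub> Sg q" for \<phi> \<psi>
  proof -
    obtain t where t [simp]: "t \<in> Ar P" "Dom P t = Dom St \<phi>" "Cod P t = maybe (Cod St \<phi>)" and B: "Cod St \<phi> \<in> Ob P"
      and e: "Sg (incl (Cod St \<phi>)) \<cdot>\<^bsub>St\<^esub> \<phi> = Sg t" by (rule St_factor[of \<phi>]) simp_all
    obtain s where s [simp]: "s \<in> Ar P" "Dom P s = Dom St \<phi>" "Cod P s = maybe (Cod St \<phi>)"
      and e': "Sg (incl (Cod St \<phi>)) \<cdot>\<^bsub>St\<^esub> \<psi> = Sg s" by (rule St_factor[of \<psi>]) simp_all
    note [simp] = B
    have "Sg (t \<cdot> q) = Sg (s \<cdot> q)"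
      using K.reassoc[OF e, of "Sg q"] K.reassoc[OF e', of "Sg q"] eq by (simp add: Sg_comp)
    then have "sim (t \<cdot> q) (s \<cdot> q)" by (simp add: Sg_eq_iff)
    then have "sim t s" by (rule zcokernel_sim_cancel[OF q]) simp_all
    then have "Sg t = Sg s" by (simp add: Sg_eq_iff)
    then show ?thesis using e e' by - (rule Sg_incl_cancel[OF B], simp_all)
  qed
  fix \<phi> assume [simp]: "\<phi> \<in> Ar St" "Dom St \<phi> = Cod St (Sg f)" and z: "zero (\<phi> \<cdot>\<^bsub>St\<^esub> Sg f)"
  obtain t where t [simp]: "t \<in> Ar P" "Dom P t = Dom St \<phi>" "Cod P t = maybe (Cod St \<phi>)" "Cod St \<phi> \<in> Ob P"
    and e: "Sg (incl (Cod St \<phi>)) \<cdot>\<^bsub>St\<^esub> \<phi> = Sg t" by (rule St_factor[of \<phi>]) simp_all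
  have "triv (t \<cdot> f)"
    using z zero_factor_iff[of "\<phi> \<cdot>\<^bsub>St\<^esub> Sg f" "t \<cdot> f"] K.reassoc[OF e, of "Sg f"] by (simp add: Sg_comp)
  then obtain h where h [simp]: "h \<in> Ar P" "Dom P h = Cod P q" "Cod P h = Cod P t" "h \<cdot> q = t"
    by (rule zcokernel_lift[OF q, rotated 2]) simp_all
  obtain \<theta> where \<theta> [simp]: "\<theta> \<in> Ar St" "Dom St \<theta> = Dom P h" "Cod St \<theta> = Cod St \<phi>"
    and e\<theta>: "Sg (incl (Cod St \<phi>)) \<cdot>\<^bsub>St\<^esub> \<theta> = Sg h" by (rule St_arrow[of h "Cod St \<phi>"]) simp_all
  have "\<theta> \<cdot>\<^bsub>St\<^esub> Sg q = \<phi>"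
    using K.reassoc[OF e\<theta>, of "Sg q"]
    by - (rule Sg_incl_cancel[of "Cod St \<phi>"], simp_all add: e Sg_comp[symmetric])
  then show "\<exists>h. h \<in> Ar St \<and> Dom St h = Cod St (Sg q) \<and> Cod St h = Cod St \<phi> \<and> h \<cdot>\<^bsub>St\<^esub> Sg q = \<phi>"
    by (intro exI[of _ \<theta>]) simp
qed

text \<open>The source of \<phi> has three parts: those mapped to the first and to the second
  summand, and the one where \<phi> is undefined. The third part is added to the second, and \<beta>
  is undefined on it.\<close>

lemma Sg_preuniversal:
  assumes c: "is_coproduct P i j" and [simp]: "\<phi> \<in> Ar St" "Cod St \<phi> = Cod P i"
  obtains a m \<alpha> \<beta> where "is_coproduct P a m" "Cod P a = Dom St \<phi>" "\<alpha> \<in> Ar St" "\<beta> \<in> Ar St" "Dom St \<alpha> = Dom P a"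
    "Dom St \<beta> = Dom P m" "Cod St \<alpha> = Dom P i" "Cod St \<beta> = Dom P j"
    "\<phi> \<cdot>\<^bsub>St\<^esub> Sg a = Sg i \<cdot>\<^bsub>St\<^esub> \<alpha>" "\<phi> \<cdot>\<^bsub>St\<^esub> Sg m = Sg j \<cdot>\<^bsub>St\<^esub> \<beta>"
proof -
  note [simp] = coproductD[OF c]
  let ?S = "Cod P i" and ?B = "Dom P j"
  obtain t where t [simp]: "t \<in> Ar P" "Dom P t = Dom St \<phi>" "Cod P t = maybe ?S"
    and e: "Sg (incl ?S) \<cdot>\<^bsub>St\<^esub> \<phi> = Sg t" by (rule St_factor[of \<phi>]) simp_all
  obtain d1 d2 g x where d: "is_coproduct P d1 d2"
    and [simp]: "d1 \<in> Ar P" "d2 \<in> Ar P" "g \<in> Ar P" "x \<in> Ar P" "Cod P d1 = Dom P t" "Cod P d2 = Dom P t"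
    "Dom P g = Dom P d1" "Dom P x = Dom P d2" "Cod P g = ?S" "Cod P x = one"
    and td: "t \<cdot> d1 = incl ?S \<cdot> g" "t \<cdot> d2 = pt ?S \<cdot> x"
    by (rule decompose[OF incl_coproduct(1)[of ?S], of t]) simp_all
  obtain a b ga gb where ab: "is_coproduct P a b"
    and [simp]: "a \<in> Ar P" "b \<in> Ar P" "ga \<in> Ar P" "gb \<in> Ar P" "Cod P a = Dom P g" "Cod P b = Dom P g"
    "Dom P ga = Dom P a" "Dom P gb = Dom P b" "Cod P ga = Dom P i" "Cod P gb = Dom P j"
    and gab: "g \<cdot> a = i \<cdot> ga" "g \<cdot> b = j \<cdot> gb"
    by (rule decompose[OF c, of g]) simp_all
  obtain p q where pq: "is_coproduct P p q" and [simp]: "Dom P p = Dom P b" "Dom P q = Dom P d2"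
    "p \<in> Ar P" "q \<in> Ar P" "Cod P q = Cod P p" by (rule coproduct_exists[of "Dom P b" "Dom P d2"]) simp_all
  obtain m where m [simp]: "m \<in> Ar P" "Dom P m = Cod P p" "Cod P m = Cod P d1" "m \<cdot> p = d1 \<cdot> b" "m \<cdot> q = d2"
    by (rule copair[OF pq, of "d1 \<cdot> b" d2]) simp_all
  have am: "is_coproduct P (d1 \<cdot> a) m" by (rule coproduct_assoc[OF d ab _ pq]) simp_all
  obtain r where r [simp]: "r \<in> Ar P" "Dom P r = Cod P p" "Cod P r = maybe ?B" "r \<cdot> p = incl ?B \<cdot> gb" "r \<cdot> q = pt ?B \<cdot> x"
    by (rule copair[OF pq, of "incl ?B \<cdot> gb" "pt ?B \<cdot> x"]) simp_all
  have tm: "t \<cdot> m = maybe_map j \<cdot> r"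
    by (rule coproduct_eq[OF pq])
      (simp_all add: reassoc[OF td(1)] td(2) gab
        reassoc[OF maybe_map_incl(1)[of j ?B ?S]] reassoc[OF maybe_map_incl(2)[of j ?B ?S]])
  obtain \<beta> where \<beta> [simp]: "\<beta> \<in> Ar St" "Dom St \<beta> = Dom P r" "Cod St \<beta> = ?B"
    and e\<beta>: "Sg (incl ?B) \<cdot>\<^bsub>St\<^esub> \<beta> = Sg r" by (rule St_arrow[of r ?B]) simp_all
  have "\<phi> \<cdot>\<^bsub>St\<^esub> Sg (d1 \<cdot> a) = Sg i \<cdot>\<^bsub>St\<^esub> Sg ga"
  proof (rule Sg_incl_cancel[of ?S])
    have "t \<cdot> d1 \<cdot> a = incl ?S \<cdot> i \<cdot> ga" by (simp add: reassoc[OF td(1)] gab)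
    then have "Sg (t \<cdot> d1 \<cdot> a) = Sg (incl ?S \<cdot> i \<cdot> ga)" by simp
    then show "Sg (incl ?S) \<cdot>\<^bsub>St\<^esub> \<phi> \<cdot>\<^bsub>St\<^esub> Sg (d1 \<cdot> a) = Sg (incl ?S) \<cdot>\<^bsub>St\<^esub> Sg i \<cdot>\<^bsub>St\<^esub> Sg ga"
      using K.reassoc[OF e, of "Sg (d1 \<cdot> a)"] by (simp add: Sg_comp)
  qed simp_all
  moreover have "\<phi> \<cdot>\<^bsub>St\<^esub> Sg m = Sg j \<cdot>\<^bsub>St\<^esub> \<beta>"
  proof (rule Sg_incl_cancel[of ?S])
    have "Sg (t \<cdot> m) = Sg (maybe_map j \<cdot> r)" by (simp add: tm)
    then show "Sg (incl ?S) \<cdot>\<^bsub>St\<^esub> \<phi> \<cdot>\<^bsub>St\<^esub> Sg m = Sg (incl ?S) \<cdot>\<^bsub>St\<^esub> Sg j \<cdot>\<^bsub>St\<^esub> \<beta>"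
      using K.reassoc[OF e, of "Sg m"] Sg_maybe_map[of j \<beta> r] e\<beta> by (simp add: Sg_comp)
  qed simp_all
  ultimately show thesis by (intro that[OF am, of "Sg ga" \<beta>]) simp_all
qed

text \<open>A coproduct in the quotient is isomorphic to the image of one in \<open>P\<close>; the
  decomposition is found there and carried back along the comparison \<kappa>.\<close>

lemma preuniversal_St: "preuniversal_coproducts St"
  unfolding preuniversal_coproducts_def
proof (intro allI impI)
  fix sA sB \<phi> assume *: "is_coproduct St sA sB \<and> \<phi> \<in> Ar St \<and> Cod St \<phi> = Cod St sA"
  then have s: "is_coproduct St sA sB" and [simp]: "\<phi> \<in> Ar St" "Cod St \<phi> = Cod St sA" by auto
  note [simp] = K.coproductD[OF s]
  obtain i j where c: "is_coproduct P i j" and [simp]: "Dom P i = Dom St sA" "Dom P j = Dom St sB" "i \<in> Ar P" "j \<in> Ar P"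
    by (rule coproduct_exists[of "Dom St sA" "Dom St sB"]) (use K.Dom_Ob[of sA] K.Dom_Ob[of sB] in simp_all)
  note [simp] = coproductD(3)[OF c]
  obtain \<kappa> where \<kappa>: "is_iso St \<kappa>" and [simp]: "\<kappa> \<in> Ar St" "Dom St \<kappa> = Cod P i" "Cod St \<kappa> = Cod St sA"
    and \<kappa>s: "\<kappa> \<cdot>\<^bsub>St\<^esub> Sg i = sA" "\<kappa> \<cdot>\<^bsub>St\<^esub> Sg j = sB"
    by (rule K.coproduct_unique[OF Sg_coproduct[OF c] s]) simp_all
  obtain l where [simp]: "l \<in> Ar St" "Dom St l = Cod St sA" "Cod St l = Cod P i" and l: "\<kappa> \<cdot>\<^bsub>St\<^esub> l = Ide St (Cod St sA)"
    using \<kappa> by (rule K.is_isoE) simp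
  obtain a m \<alpha> \<beta> where am: "is_coproduct P a m" and [simp]: "Cod P a = Dom St \<phi>" "\<alpha> \<in> Ar St" "\<beta> \<in> Ar St" "Dom St \<alpha> = Dom P a"
    "Dom St \<beta> = Dom P m" "Cod St \<alpha> = Dom P i" "Cod St \<beta> = Dom P j"
    and e: "(l \<cdot>\<^bsub>St\<^esub> \<phi>) \<cdot>\<^bsub>St\<^esub> Sg a = Sg i \<cdot>\<^bsub>St\<^esub> \<alpha>" "(l \<cdot>\<^bsub>St\<^esub> \<phi>) \<cdot>\<^bsub>St\<^esub> Sg m = Sg j \<cdot>\<^bsub>St\<^esub> \<beta>"
    by (rule Sg_preuniversal[OF c, of "l \<cdot>\<^bsub>St\<^esub> \<phi>"]) simp_all
  note [simp] = coproductD[OF am]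
  have "\<kappa> \<cdot>\<^bsub>St\<^esub> (l \<cdot>\<^bsub>St\<^esub> \<phi>) \<cdot>\<^bsub>St\<^esub> Sg a = sA \<cdot>\<^bsub>St\<^esub> \<alpha>" "\<kappa> \<cdot>\<^bsub>St\<^esub> (l \<cdot>\<^bsub>St\<^esub> \<phi>) \<cdot>\<^bsub>St\<^esub> Sg m = sB \<cdot>\<^bsub>St\<^esub> \<beta>"
    unfolding e by (simp_all add: K.reassoc[OF \<kappa>s(1)] K.reassoc[OF \<kappa>s(2)])
  then have "\<phi> \<cdot>\<^bsub>St\<^esub> Sg a = sA \<cdot>\<^bsub>St\<^esub> \<alpha>" "\<phi> \<cdot>\<^bsub>St\<^esub> Sg m = sB \<cdot>\<^bsub>St\<^esub> \<beta>" by (simp_all add: K.reassoc[OF l])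
  then show "\<exists>sA' sB'. is_coproduct St sA' sB' \<and> Cod St sA' = Dom St \<phi> \<and>
           (\<exists>fA\<in>hom St (Dom St sA') (Dom St sA). \<phi> \<cdot>\<^bsub>St\<^esub> sA' = sA \<cdot>\<^bsub>St\<^esub> fA) \<and>
           (\<exists>fB\<in>hom St (Dom St sB') (Dom St sB). \<phi> \<cdot>\<^bsub>St\<^esub> sB' = sB \<cdot>\<^bsub>St\<^esub> fB)"
    by (intro exI[of _ "Sg a"] exI[of _ "Sg m"] conjI bexI[of _ \<alpha>] bexI[of _ \<beta>] Sg_coproduct[OF am]) simp_all
qed

end

section \<open>The torsion theory of the stable category\<close>

text \<open>Closure of \<open>F\<close> under sums puts \<open>A + 1\<close> into \<open>F\<close>
  for torsion-free \<open>A\<close>, so the classifying arrow of an arrow from \<open>T\<close> to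
  \<open>F\<close> is again of this kind. Kernels and cokernels are asked for all arrows because
  those of a stable arrow are taken from its classifying arrow.\<close>

locale stable_torsion = stable P Z for P :: "('o, 'm) cat" (structure) and Z +
  fixes T F :: "'o set"
  assumes pretorsion: "pretorsion_theory P T F" and TF: "T \<inter> F = Z"
    and F_coproduct: "is_coproduct P i j \<Longrightarrow> Dom P i \<in> F \<Longrightarrow> Dom P j \<in> F \<Longrightarrow> Cod P i \<in> F"
    and zkernels: "f \<in> Ar P \<Longrightarrow> \<exists>k. is_zkernel P Z k f"
    and zcokernels: "f \<in> Ar P \<Longrightarrow> \<exists>q. is_zcokernel P Z q f"
begin

lemma T_Ob: "A \<in> T \<Longrightarrow> A \<in> Ob P" and F_Ob: "A \<in> F \<Longrightarrow> A \<in> Ob P"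
  using pretorsion by (auto simp: pretorsion_theory_def replete_def)

lemma maybe_F: "A \<in> F \<Longrightarrow> maybe A \<in> F"
  using F_coproduct[OF incl_coproduct(1)[of A]] incl[of A] one(1) TF F_Ob by auto

lemma St_torsion_free_zero:
  assumes [simp]: "\<phi> \<in> Ar St" and TF': "Dom St \<phi> \<in> T" "Cod St \<phi> \<in> F"
  shows "zero \<phi>"
proof -
  obtain t where [simp]: "t \<in> Ar P" "Dom P t = Dom St \<phi>" "Cod P t = maybe (Cod St \<phi>)"
    and e: "Sg (incl (Cod St \<phi>)) \<cdot>\<^bsub>St\<^esub> \<phi> = Sg t" by (rule St_factor[of \<phi>]) simp_all
  have "triv t" using pretorsion TF' maybe_F unfolding pretorsion_theory_def TF by simp
  then show ?thesis using zero_factor_iff[of \<phi> t] e by simp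
qed

lemma canonical_exists:
  assumes "X \<in> Ob P"
  obtains t f where "canonical_sequence P T F X t f" "t \<in> Ar P" "f \<in> Ar P" "Cod P t = X" "Dom P f = X"
    "Dom P t \<in> T" "Cod P f \<in> F"
proof -
  obtain t f where c: "canonical_sequence P T F X t f"
    using pretorsion assms unfolding pretorsion_theory_def by blast
  then have "is_zkernel P (T \<inter> F) t f" "Cod P t = X" "Dom P t \<in> T" "Cod P f \<in> F"
    by (simp_all add: canonical_sequence_def short_zexact_def)
  then show thesis using that[OF c] zkernelD[of "T \<inter> F" t f] by simp
qed

lemma Sg_canonical:
  assumes "canonical_sequence P T F X t f"
  shows "canonical_sequence St T F X (Sg t) (Sg f)"
proof -
  have k: "is_zkernel P Z t f" "is_zcokernel P Z f t" and *: "Cod P t = X" "Dom P t \<in> T" "Cod P f \<in> F"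
    using assms by (simp_all add: canonical_sequence_def short_zexact_def TF)
  show ?thesis
    using Sg_zkernel[OF k(1)] Sg_zcokernel[OF k(2)] * zkernelD[OF k(1)]
    by (simp add: canonical_sequence_def short_zexact_def TF zero_objects_St)
qed

text \<open>An isomorphism of the quotient need not come from one of \<open>P\<close>, so
  repleteness in \<open>P\<close> does not apply to it. Instead the torsion-free quotient
  \<open>f\<close> of the target is shown to be trivial: it vanishes after \<phi>, and \<phi> is
  invertible.\<close>

lemma replete_St_T: "replete St T"
  unfolding replete_def
proof (intro conjI allI impI)
  show "T \<subseteq> Ob St" using T_Ob by auto
  fix \<phi> assume *: "is_iso St \<phi> \<and> Dom St \<phi> \<in> T"
  then obtain \<psi> where [simp]: "\<phi> \<in> Ar St" "\<psi> \<in> Ar St" "Dom St \<psi> = Cod St \<phi>" "Cod St \<psi> = Dom St \<phi>"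
    and e: "\<phi> \<cdot>\<^bsub>St\<^esub> \<psi> = Ide St (Cod St \<phi>)" by (auto elim!: K.is_isoE)
  obtain t f where c: "canonical_sequence P T F (Cod St \<phi>) t f" and [simp]: "t \<in> Ar P" "f \<in> Ar P"
    "Cod P t = Cod St \<phi>" "Dom P f = Cod St \<phi>" and f: "Cod P f \<in> F"
    by (rule canonical_exists[of "Cod St \<phi>"]) (use K.Cod_Ob[of \<phi>] in simp_all)
  have "zero (Sg f \<cdot>\<^bsub>St\<^esub> \<phi>)" by (rule St_torsion_free_zero) (use * f in simp_all)
  then have "zero ((Sg f \<cdot>\<^bsub>St\<^esub> \<phi>) \<cdot>\<^bsub>St\<^esub> \<psi>)" by (rule K.triv_comp_right) simp_all
  then have "triv f" by (simp add: e zero_Sg_iff)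
  then show "Cod St \<phi> \<in> T" using pretorsion_torsionI[OF pretorsion c] by (simp add: TF)
qed

lemma replete_St_F: "replete St F"
  unfolding replete_def
proof (intro conjI allI impI)
  show "F \<subseteq> Ob St" using F_Ob by auto
  fix \<phi> assume *: "is_iso St \<phi> \<and> Dom St \<phi> \<in> F"
  then obtain \<psi> where [simp]: "\<phi> \<in> Ar St" "\<psi> \<in> Ar St" "Dom St \<psi> = Cod St \<phi>" "Cod St \<psi> = Dom St \<phi>"
    and e: "\<phi> \<cdot>\<^bsub>St\<^esub> \<psi> = Ide St (Cod St \<phi>)" by (auto elim!: K.is_isoE)
  obtain t f where c: "canonical_sequence P T F (Cod St \<phi>) t f" and [simp]: "t \<in> Ar P" "f \<in> Ar P"
    "Cod P t = Cod St \<phi>" "Dom P f = Cod St \<phi>" and t: "Dom P t \<in> T"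
    by (rule canonical_exists[of "Cod St \<phi>"]) (use K.Cod_Ob[of \<phi>] in simp_all)
  have "zero (\<psi> \<cdot>\<^bsub>St\<^esub> Sg t)" by (rule St_torsion_free_zero) (use * t in simp_all)
  then have "zero (\<phi> \<cdot>\<^bsub>St\<^esub> \<psi> \<cdot>\<^bsub>St\<^esub> Sg t)" by (rule K.triv_comp_left) simp_all
  then have "triv t" by (simp add: K.reassoc[OF e] zero_Sg_iff)
  then show "Cod St \<phi> \<in> F" using pretorsion_freeI[OF pretorsion c] by (simp add: TF)
qed

lemma pretorsion_St: "pretorsion_theory St T F"
  unfolding pretorsion_theory_def
proof (intro conjI ballI impI)
  fix \<phi> assume "\<phi> \<in> Ar St" "Dom St \<phi> \<in> T \<and> Cod St \<phi> \<in> F"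
  then show "trivial_arrow St (T \<inter> F) \<phi>" using St_torsion_free_zero[of \<phi>] by (simp add: TF zero_objects_St)
next
  fix X assume "X \<in> Ob St"
  then have "X \<in> Ob P" by simp
  then obtain t f where "canonical_sequence P T F X t f" by (rule canonical_exists)
  then show "\<exists>t f. canonical_sequence St T F X t f" using Sg_canonical by blast
qed (rule replete_St_T replete_St_F)+

lemma admissible_St: "admissible_target St T F"
  using pretorsion_St pointed_St category_St has_binary_coproducts_St preuniversal_St
    K.pointed_disjoint_coproducts
  by (simp add: admissible_target_def torsion_theory_def TF zero_objects_St)

definition Sgf :: "('o, 'm, 'o, ('m \<times> 'm) set set) ftor" where
  "Sgf = \<lparr>on_ob = \<lambda>A. A, on_ar = Sg\<rparr>"

lemma Sgf_coproduct_torsion_functor: "coproduct_torsion_functor P T F St T F Sgf"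
proof -
  have "is_functor P St Sgf"
    by (simp add: is_functor_def Sgf_def Sg_Ide Sg_comp)
  moreover have "preserves_finite_coproducts P St Sgf"
    by (simp add: preserves_finite_coproducts_def Sgf_def Sg_initial Sg_coproduct)
  moreover have "short_exact St (Sg t) (Sg f)" if "canonical_sequence P T F X t f" for X t f
    using Sg_canonical[OF that] by (simp add: canonical_sequence_def TF zero_objects_St)
  ultimately show ?thesis
    by (auto simp: coproduct_torsion_functor_def torsion_theory_functor_def Sgf_def)
qed

end


section \<open>The universal property\<close>

locale stable_universal = stable_torsion P Z T F + X: cat X
  for P :: "('o, 'm) cat" (structure) and Z T F and X :: "('p, 'q) cat" +
  fixes TX FX :: "'p set" and G :: "('o, 'm, 'p, 'q) ftor"
  assumes torsion_X: "torsion_theory X TX FX"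
    and G: "coproduct_torsion_functor P T F X TX FX G"
begin

lemma G_functor: "is_functor P X G"
  using G by (simp add: coproduct_torsion_functor_def torsion_theory_functor_def)

lemma G_Ob [simp]: "A \<in> Ob P \<Longrightarrow> on_ob G A \<in> Ob X"
  and G_Ar [simp]: "f \<in> Ar P \<Longrightarrow> on_ar G f \<in> Ar X"
  and Dom_G [simp]: "f \<in> Ar P \<Longrightarrow> Dom X (on_ar G f) = on_ob G (Dom P f)"
  and Cod_G [simp]: "f \<in> Ar P \<Longrightarrow> Cod X (on_ar G f) = on_ob G (Cod P f)"
  and G_Ide: "A \<in> Ob P \<Longrightarrow> on_ar G (Ide P A) = Ide X (on_ob G A)"
  and G_comp: "f \<in> Ar P \<Longrightarrow> g \<in> Ar P \<Longrightarrow> Cod P f = Dom P g \<Longrightarrow> on_ar G (g \<cdot> f) = on_ar G g \<cdot>\<^bsub>X\<^esub> on_ar G f"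
  using G_functor by (auto simp: is_functor_def)

lemma G_coproduct: "is_coproduct P i j \<Longrightarrow> is_coproduct X (on_ar G i) (on_ar G j)"
  and G_initial: "is_initial P I \<Longrightarrow> is_initial X (on_ob G I)"
  using G by (auto simp: coproduct_torsion_functor_def preserves_finite_coproducts_def)

lemma G_T: "A \<in> T \<Longrightarrow> on_ob G A \<in> TX" and G_F: "A \<in> F \<Longrightarrow> on_ob G A \<in> FX"
  using G by (auto simp: coproduct_torsion_functor_def torsion_theory_functor_def)

lemma G_Z: "A \<in> Z \<Longrightarrow> on_ob G A \<in> zero_objects X"
  using G_T[of A] G_F[of A] torsion_X TF by (auto simp: torsion_theory_def)

lemma G_triv:
  assumes "triv f" shows "trivial_arrow X (zero_objects X) (on_ar G f)"
proof -
  obtain g h where "f = h \<cdot> g" "g \<in> Ar P" "h \<in> Ar P" "Cod P g = Dom P h" "Cod P g \<in> Z"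
    using assms by (rule trivE)
  then show ?thesis using G_Z[of "Cod P g"] by (simp add: G_comp X.trivI)
qed

text \<open>The images agree on one summand. On the other both are zero, hence equal, and
  \<open>G\<close> preserves the coproduct.\<close>

lemma G_sim:
  assumes "sim f g" shows "on_ar G f = on_ar G g"
proof -
  obtain i j where c: "is_coproduct P i j" "Cod P i = Dom P f" "f \<cdot> i = g \<cdot> i" "triv (f \<cdot> j)" "triv (g \<cdot> j)"
    using assms by (rule simE)
  note [simp] = simD[OF assms] coproductD[OF c(1)] c(2)
  show ?thesis
  proof (rule X.coproduct_eq[OF G_coproduct[OF c(1)]])
    show "on_ar G f \<cdot>\<^bsub>X\<^esub> on_ar G i = on_ar G g \<cdot>\<^bsub>X\<^esub> on_ar G i"
      using c(3) by (simp add: G_comp[symmetric])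
    have "on_ar G (f \<cdot> j) = on_ar G (g \<cdot> j)"
      using G_triv[OF c(4)] G_triv[OF c(5)] by (rule X.zero_arrow_eq) simp_all
    then show "on_ar G f \<cdot>\<^bsub>X\<^esub> on_ar G j = on_ar G g \<cdot>\<^bsub>X\<^esub> on_ar G j" by (simp add: G_comp)
  qed simp_all
qed

text \<open>A trivial object is torsion and torsion-free, so \<open>G\<close> sends
  \<open>one\<close> to a zero object, and a coproduct with an initial object is just the other
  summand.\<close>

lemma G_incl_iso:
  assumes "B \<in> Ob P" shows "is_iso X (on_ar G (incl B))"
proof (rule X.coproduct_initial_iso[OF G_coproduct[OF incl_coproduct(1)[OF assms]]])
  show "is_initial X (Dom X (on_ar G (pt B)))"
    using G_Z[OF one(1)] assms by (simp add: zero_objects_def)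
qed

lemma G_incl_cancel:
  assumes "B \<in> Ob P" "on_ar G (incl B) \<cdot>\<^bsub>X\<^esub> u = on_ar G (incl B) \<cdot>\<^bsub>X\<^esub> v" "u \<in> Ar X" "v \<in> Ar X"
    "Cod X u = on_ob G B" "Cod X v = on_ob G B"
  shows "u = v"
  by (rule X.mono_cancel[OF X.iso_mono[OF G_incl_iso[OF assms(1)]] assms(2)]) (simp_all add: assms)

text \<open>The value on \<open>\<phi>\<close> is forced, because \<open>Sg (incl B) \<circ> \<phi> = Sg t\<close> and \<open>G (incl B)\<close> is invertible.\<close>

definition bar :: "('m \<times> 'm) set set \<Rightarrow> 'q" where
  "bar \<phi> = (SOME u. u \<in> Ar X \<and> Dom X u = on_ob G (Dom St \<phi>) \<and> Cod X u = on_ob G (Cod St \<phi>) \<and>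
     (\<forall>t\<in>Ar P. Dom P t = Dom St \<phi> \<and> Cod P t = maybe (Cod St \<phi>) \<and> Sg (incl (Cod St \<phi>)) \<cdot>\<^bsub>St\<^esub> \<phi> = Sg t \<longrightarrow>
       on_ar G (incl (Cod St \<phi>)) \<cdot>\<^bsub>X\<^esub> u = on_ar G t))"

lemma bar:
  assumes "\<phi> \<in> Ar St"
  shows "bar \<phi> \<in> Ar X" "Dom X (bar \<phi>) = on_ob G (Dom St \<phi>)" "Cod X (bar \<phi>) = on_ob G (Cod St \<phi>)"
    "t \<in> Ar P \<Longrightarrow> Dom P t = Dom St \<phi> \<Longrightarrow> Cod P t = maybe (Cod St \<phi>) \<Longrightarrow> Sg (incl (Cod St \<phi>)) \<cdot>\<^bsub>St\<^esub> \<phi> = Sg t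
      \<Longrightarrow> on_ar G (incl (Cod St \<phi>)) \<cdot>\<^bsub>X\<^esub> bar \<phi> = on_ar G t"
proof -
  let ?B = "Cod St \<phi>"
  obtain s where s [simp]: "s \<in> Ar P" "Dom P s = Dom St \<phi>" "Cod P s = maybe ?B" "?B \<in> Ob P"
    and e: "Sg (incl ?B) \<cdot>\<^bsub>St\<^esub> \<phi> = Sg s" by (rule St_factor[of \<phi>]) (simp_all add: assms)
  obtain l where l [simp]: "l \<in> Ar X" "Dom X l = on_ob G (maybe ?B)" "Cod X l = on_ob G ?B"
    and le: "on_ar G (incl ?B) \<cdot>\<^bsub>X\<^esub> l = Ide X (on_ob G (maybe ?B))"
    using G_incl_iso[of ?B] by (auto elim!: X.is_isoE)
  have "on_ar G (incl ?B) \<cdot>\<^bsub>X\<^esub> l \<cdot>\<^bsub>X\<^esub> on_ar G s = on_ar G t"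
    if "t \<in> Ar P" "Cod P t = maybe ?B" "Sg (incl ?B) \<cdot>\<^bsub>St\<^esub> \<phi> = Sg t" for t
  proof -
    \<comment> \<open>Any two classifying arrows of \<phi> are congruent and identified by
      \<open>G\<close>, so the value found with \<open>s\<close> fits every
      \<open>t\<close>.\<close>
    have "sim s t" using that e by (subst Sg_eq_iff[symmetric]) simp_all
    then have "on_ar G s = on_ar G t" by (rule G_sim)
    then show ?thesis using that by (simp add: X.reassoc[OF le])
  qed
  then have "\<exists>u. u \<in> Ar X \<and> Dom X u = on_ob G (Dom St \<phi>) \<and> Cod X u = on_ob G ?B \<and>
     (\<forall>t\<in>Ar P. Dom P t = Dom St \<phi> \<and> Cod P t = maybe ?B \<and> Sg (incl ?B) \<cdot>\<^bsub>St\<^esub> \<phi> = Sg t \<longrightarrow>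
       on_ar G (incl ?B) \<cdot>\<^bsub>X\<^esub> u = on_ar G t)"
    by (intro exI[of _ "l \<cdot>\<^bsub>X\<^esub> on_ar G s"]) simp
  note * = someI_ex[OF this, folded bar_def]
  show "bar \<phi> \<in> Ar X" "Dom X (bar \<phi>) = on_ob G (Dom St \<phi>)" "Cod X (bar \<phi>) = on_ob G (Cod St \<phi>)"
    "t \<in> Ar P \<Longrightarrow> Dom P t = Dom St \<phi> \<Longrightarrow> Cod P t = maybe (Cod St \<phi>) \<Longrightarrow> Sg (incl (Cod St \<phi>)) \<cdot>\<^bsub>St\<^esub> \<phi> = Sg t
      \<Longrightarrow> on_ar G (incl (Cod St \<phi>)) \<cdot>\<^bsub>X\<^esub> bar \<phi> = on_ar G t"
    using * by blast+
qed

declare bar(1-3) [simp]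

lemma bar_Sg:
  assumes [simp]: "f \<in> Ar P" shows "bar (Sg f) = on_ar G f"
proof (rule G_incl_cancel[of "Cod P f"])
  have "on_ar G (incl (Cod P f)) \<cdot>\<^bsub>X\<^esub> bar (Sg f) = on_ar G (incl (Cod P f) \<cdot> f)"
    using bar(4)[of "Sg f" "incl (Cod P f) \<cdot> f"] by (simp add: Sg_comp)
  then show "on_ar G (incl (Cod P f)) \<cdot>\<^bsub>X\<^esub> bar (Sg f) = on_ar G (incl (Cod P f)) \<cdot>\<^bsub>X\<^esub> on_ar G f"
    by (simp add: G_comp)
qed simp_all

text \<open>After the image of \<open>incl\<close> both sides become the value of \<open>G\<close>
  at the Kleisli composite \<open>ext ?B s \<cdot> t\<close>, and that isomorphism is
  cancelled.\<close>

lemma bar_comp: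
  assumes [simp]: "\<phi> \<in> Ar St" "\<psi> \<in> Ar St" "Cod St \<phi> = Dom St \<psi>"
  shows "bar (\<psi> \<cdot>\<^bsub>St\<^esub> \<phi>) = bar \<psi> \<cdot>\<^bsub>X\<^esub> bar \<phi>"
proof -
  let ?A = "Dom St \<psi>" and ?B = "Cod St \<psi>"
  obtain t where t [simp]: "t \<in> Ar P" "Dom P t = Dom St \<phi>" "Cod P t = maybe ?A"
    and e: "Sg (incl ?A) \<cdot>\<^bsub>St\<^esub> \<phi> = Sg t" by (rule St_factor[of \<phi>]) simp_all
  obtain s where s [simp]: "s \<in> Ar P" "Dom P s = ?A" "Cod P s = maybe ?B" "?B \<in> Ob P"
    and e': "Sg (incl ?B) \<cdot>\<^bsub>St\<^esub> \<psi> = Sg s" by (rule St_factor[of \<psi>]) simp_all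
  have A [simp]: "?A \<in> Ob P" using Dom_Ob[OF s(1)] by simp
  have x: "ext ?B s \<cdot> incl ?A = s" by (simp add: ext_incl)
  have "Sg (incl ?B) \<cdot>\<^bsub>St\<^esub> \<psi> \<cdot>\<^bsub>St\<^esub> \<phi> = Sg (ext ?B s \<cdot> incl ?A) \<cdot>\<^bsub>St\<^esub> \<phi>"
    by (simp add: K.reassoc[OF e'] x)
  also have "\<dots> = Sg (ext ?B s \<cdot> t)" by (simp add: Sg_comp e)
  finally have 1: "on_ar G (incl ?B) \<cdot>\<^bsub>X\<^esub> bar (\<psi> \<cdot>\<^bsub>St\<^esub> \<phi>) = on_ar G (ext ?B s \<cdot> t)"
    using bar(4)[of "\<psi> \<cdot>\<^bsub>St\<^esub> \<phi>" "ext ?B s \<cdot> t"] by simp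
  have gt: "on_ar G (incl ?A) \<cdot>\<^bsub>X\<^esub> bar \<phi> = on_ar G t" using bar(4)[of \<phi> t] e by simp
  have gs: "on_ar G (incl ?B) \<cdot>\<^bsub>X\<^esub> bar \<psi> = on_ar G s" using bar(4)[of \<psi> s] e' by simp
  have "on_ar G (incl ?B) \<cdot>\<^bsub>X\<^esub> bar \<psi> \<cdot>\<^bsub>X\<^esub> bar \<phi> = on_ar G (ext ?B s \<cdot> incl ?A) \<cdot>\<^bsub>X\<^esub> bar \<phi>"
    by (simp add: X.reassoc[OF gs] x)
  also have "\<dots> = on_ar G (ext ?B s \<cdot> t)" by (simp add: G_comp gt)
  finally show ?thesis using 1 by - (rule G_incl_cancel[of ?B], simp_all)
qed

definition Gbar :: "('o, ('m \<times> 'm) set set, 'p, 'q) ftor" where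
  "Gbar = \<lparr>on_ob = on_ob G, on_ar = bar\<rparr>"

lemma Gbar_functor: "is_functor St X Gbar"
  using bar_Sg[of "Ide P _"] by (simp add: is_functor_def Gbar_def bar_comp Sg_Ide[symmetric] G_Ide)

lemma Gbar_Sgf: "functor_eq P (functor_comp Gbar Sgf) G"
  by (simp add: functor_eq_def functor_comp_def Gbar_def Sgf_def bar_Sg)

lemma Gbar_unique:
  assumes H: "is_functor St X H" "functor_eq P (functor_comp H Sgf) G"
  shows "functor_eq St H Gbar"
proof -
  have ob: "on_ob H A = on_ob G A" if "A \<in> Ob P" for A
    using H(2) that by (simp add: functor_eq_def functor_comp_def Sgf_def)
  have ar: "on_ar H (Sg f) = on_ar G f" if "f \<in> Ar P" for f
    using H(2) that by (simp add: functor_eq_def functor_comp_def Sgf_def)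
  have "on_ar H \<phi> = bar \<phi>" if [simp]: "\<phi> \<in> Ar St" for \<phi>
  proof -
    let ?B = "Cod St \<phi>"
    obtain t where t [simp]: "t \<in> Ar P" "Dom P t = Dom St \<phi>" "Cod P t = maybe ?B" "?B \<in> Ob P"
      and e: "Sg (incl ?B) \<cdot>\<^bsub>St\<^esub> \<phi> = Sg t" by (rule St_factor[of \<phi>]) simp_all
    have "on_ar H (Sg (incl ?B) \<cdot>\<^bsub>St\<^esub> \<phi>) = on_ar H (Sg (incl ?B)) \<cdot>\<^bsub>X\<^esub> on_ar H \<phi>"
      using H(1) unfolding is_functor_def by simp
    then have "on_ar G (incl ?B) \<cdot>\<^bsub>X\<^esub> on_ar H \<phi> = on_ar G t" by (simp add: e ar)
    also have "\<dots> = on_ar G (incl ?B) \<cdot>\<^bsub>X\<^esub> bar \<phi>" using bar(4)[of \<phi> t] e by simp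
    finally have "on_ar G (incl ?B) \<cdot>\<^bsub>X\<^esub> on_ar H \<phi> = on_ar G (incl ?B) \<cdot>\<^bsub>X\<^esub> bar \<phi>" .
    moreover have "on_ar H \<phi> \<in> Ar X" "Cod X (on_ar H \<phi>) = on_ob G ?B"
      using H(1) that ob[of ?B] by (simp_all add: is_functor_def)
    ultimately show ?thesis by - (rule G_incl_cancel[of ?B], simp_all)
  qed
  then show ?thesis using ob by (simp add: functor_eq_def Gbar_def)
qed

lemma bar_iso:
  assumes "is_iso St \<phi>" shows "is_iso X (bar \<phi>)"
proof -
  obtain \<psi> where [simp]: "\<phi> \<in> Ar St" "\<psi> \<in> Ar St" "Dom St \<psi> = Cod St \<phi>" "Cod St \<psi> = Dom St \<phi>"
    and e: "\<psi> \<cdot>\<^bsub>St\<^esub> \<phi> = Ide St (Dom St \<phi>)" "\<phi> \<cdot>\<^bsub>St\<^esub> \<psi> = Ide St (Cod St \<phi>)" using assms by (rule K.is_isoE)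
  have Ob: "Dom St \<phi> \<in> Ob P" "Cod St \<phi> \<in> Ob P" using K.Dom_Ob[of \<phi>] K.Cod_Ob[of \<phi>] by simp_all
  have I: "bar (Ide St A) = Ide X (on_ob G A)" if "A \<in> Ob P" for A
    using that by (simp add: Sg_Ide[symmetric] bar_Sg G_Ide)
  show ?thesis
    by (rule X.is_isoI[of _ "bar \<psi>"]) (simp_all add: bar_comp[symmetric] e I Ob)
qed

text \<open>Coproducts of the quotient are isomorphic to images of coproducts of \<open>P\<close>,
  which \<open>G\<close> preserves.\<close>

lemma bar_coproduct:
  assumes c: "is_coproduct St i j" shows "is_coproduct X (bar i) (bar j)"
proof -
  note [simp] = K.coproductD[OF c]
  obtain a b where ab: "is_coproduct P a b" and [simp]: "Dom P a = Dom St i" "Dom P b = Dom St j" "a \<in> Ar P" "b \<in> Ar P"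
    by (rule coproduct_exists[of "Dom St i" "Dom St j"]) (use K.Dom_Ob[of i] K.Dom_Ob[of j] in simp_all)
  note [simp] = coproductD(3)[OF ab]
  obtain \<kappa> where \<kappa>: "is_iso St \<kappa>" and [simp]: "\<kappa> \<in> Ar St" "Dom St \<kappa> = Cod P a" "Cod St \<kappa> = Cod St i"
    and \<kappa>s: "\<kappa> \<cdot>\<^bsub>St\<^esub> Sg a = i" "\<kappa> \<cdot>\<^bsub>St\<^esub> Sg b = j"
    by (rule K.coproduct_unique[OF Sg_coproduct[OF ab] c]) simp_all
  have "is_coproduct X (bar \<kappa> \<cdot>\<^bsub>X\<^esub> on_ar G a) (bar \<kappa> \<cdot>\<^bsub>X\<^esub> on_ar G b)"
    by (rule X.coproduct_iso_cod[OF G_coproduct[OF ab] bar_iso[OF \<kappa>]]) simp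
  moreover have "bar \<kappa> \<cdot>\<^bsub>X\<^esub> on_ar G a = bar i" "bar \<kappa> \<cdot>\<^bsub>X\<^esub> on_ar G b = bar j"
    using bar_comp[of "Sg a" \<kappa>] bar_comp[of "Sg b" \<kappa>] by (simp_all add: bar_Sg \<kappa>s)
  ultimately show ?thesis by simp
qed

lemma bar_initial:
  assumes "is_initial St I" shows "is_initial X (on_ob G I)"
proof -
  obtain J where J: "is_initial P J" by (rule initial_exists)
  obtain \<kappa> where \<kappa>: "is_iso St \<kappa>" "Dom St \<kappa> = J" "Cod St \<kappa> = I"
    by (rule K.initial_unique_iso[OF Sg_initial[OF J] assms])
  have "\<kappa> \<in> Ar St" using \<kappa>(1) by (simp add: is_iso_def)
  then show ?thesis using X.iso_initial[OF bar_iso[OF \<kappa>(1)]] G_initial[OF J] \<kappa> by simp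
qed

text \<open>A canonical sequence of the quotient differs only by isomorphisms from the image of a
  canonical sequence of \<open>P\<close>, on which \<open>G\<close> is known to give a short exact
  sequence.\<close>

lemma Gbar_coproduct_torsion_functor: "coproduct_torsion_functor St T F X TX FX Gbar"
proof -
  have "preserves_finite_coproducts St X Gbar"
    by (simp add: preserves_finite_coproducts_def Gbar_def bar_initial bar_coproduct)
  moreover have "short_exact X (bar t) (bar f)"
    if c: "canonical_sequence St T F A t f" and A: "A \<in> Ob P" for A t f
  proof -
    obtain t' f' where c': "canonical_sequence P T F A t' f'" and [simp]: "t' \<in> Ar P" "f' \<in> Ar P"
      "Cod P t' = A" "Dom P f' = A" by (rule canonical_exists[OF A])
    obtain m n where m: "is_iso St m" "Cod St m = Dom St (Sg t')" "t = Sg t' \<cdot>\<^bsub>St\<^esub> m"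
      and n: "is_iso St n" "Dom St n = Cod St (Sg f')" "f = n \<cdot>\<^bsub>St\<^esub> Sg f'"
      by (rule K.pretorsion_canonical_unique[OF pretorsion_St Sg_canonical[OF c'] c])
    have [simp]: "m \<in> Ar St" "n \<in> Ar St" using m n by (simp_all add: is_iso_def)
    have "short_exact X (on_ar G t') (on_ar G f')"
      using G c' A by (simp add: coproduct_torsion_functor_def torsion_theory_functor_def)
    then have "short_exact X (on_ar G t' \<cdot>\<^bsub>X\<^esub> bar m) (bar n \<cdot>\<^bsub>X\<^esub> on_ar G f')"
      by (rule X.short_zexact_iso) (use m n in \<open>simp_all add: bar_iso\<close>)
    moreover have "bar t = on_ar G t' \<cdot>\<^bsub>X\<^esub> bar m" "bar f = bar n \<cdot>\<^bsub>X\<^esub> on_ar G f'"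
      using m(2,3) n(2,3) by (simp_all add: bar_comp bar_Sg)
    ultimately show ?thesis by simp
  qed
  ultimately show ?thesis using Gbar_functor G_T G_F
    by (auto simp: coproduct_torsion_functor_def torsion_theory_functor_def Gbar_def)
qed

text \<open>Since \<open>Sg (incl ?B)\<close> is invertible, \<phi> and the image of its classifying
  arrow \<open>t\<close> have the same kernels, one of which is the image of a \<Z>-kernel of
  \<open>t\<close>. The assumption on \<open>G\<close> applies to the latter.\<close>

lemma Gbar_kernels:
  assumes GK: "zkernels_to_kernels P Z X G" and \<kappa>: "is_kernel St \<kappa> \<phi>"
  shows "is_kernel X (bar \<kappa>) (bar \<phi>)"
proof -
  note [simp] = K.zkernelD(1-3)[OF \<kappa>]
  let ?B = "Cod St \<phi>"
  obtain t where t [simp]: "t \<in> Ar P" "Dom P t = Dom St \<phi>" "Cod P t = maybe ?B" "?B \<in> Ob P"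
    and e: "Sg (incl ?B) \<cdot>\<^bsub>St\<^esub> \<phi> = Sg t" by (rule St_factor[of \<phi>]) simp_all
  obtain k where k: "is_zkernel P Z k t" using zkernels[of t] by auto
  note [simp] = zkernelD(1-3)[OF k]
  have "is_kernel St \<kappa> (Sg (incl ?B) \<cdot>\<^bsub>St\<^esub> \<phi>)"
    using \<kappa> by (subst K.zkernel_iso_left) (simp_all add: Sg_incl_iso)
  then have "is_kernel St \<kappa> (Sg t)" by (simp add: e)
  then obtain m where m: "is_iso St m" and [simp]: "m \<in> Ar St" "Dom St m = Dom St \<kappa>" "Cod St m = Dom St (Sg k)"
    and mk: "Sg k \<cdot>\<^bsub>St\<^esub> m = \<kappa>"
    by (rule K.zkernel_unique[OF Sg_zkernel[OF k]])
  have "is_kernel X (on_ar G k) (on_ar G t)" using GK k by (simp add: zkernels_to_kernels_def)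
  then have "is_kernel X (on_ar G k \<cdot>\<^bsub>X\<^esub> bar m) (on_ar G t)"
    by (rule X.zkernel_iso) (simp_all add: bar_iso[OF m])
  moreover have "on_ar G k \<cdot>\<^bsub>X\<^esub> bar m = bar \<kappa>" using bar_comp[of m "Sg k"] by (simp add: mk bar_Sg)
  moreover have "on_ar G t = on_ar G (incl ?B) \<cdot>\<^bsub>X\<^esub> bar \<phi>" using bar(4)[of \<phi> t] e by simp
  ultimately have "is_kernel X (bar \<kappa>) (on_ar G (incl ?B) \<cdot>\<^bsub>X\<^esub> bar \<phi>)" by simp
  then show ?thesis by (subst (asm) X.zkernel_iso_left) (simp_all add: G_incl_iso)
qed

text \<open>As for kernels, except that \<phi> and \<open>t\<close> have different targets: the
  cokernel of \<phi> is that of \<open>t\<close> composed with the image of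
  \<open>incl\<close>.\<close>

lemma Gbar_cokernels:
  assumes GK: "zcokernels_to_cokernels P Z X G" and \<kappa>: "is_cokernel St \<kappa> \<phi>"
  shows "is_cokernel X (bar \<kappa>) (bar \<phi>)"
proof -
  note [simp] = K.zcokernelD(1-3)[OF \<kappa>]
  let ?B = "Cod St \<phi>"
  obtain t where t [simp]: "t \<in> Ar P" "Dom P t = Dom St \<phi>" "Cod P t = maybe ?B" "?B \<in> Ob P"
    and e: "Sg (incl ?B) \<cdot>\<^bsub>St\<^esub> \<phi> = Sg t" by (rule St_factor[of \<phi>]) simp_all
  obtain q where q: "is_zcokernel P Z q t" using zcokernels[of t] by auto
  note [simp] = zcokernelD(1-3)[OF q]
  have "is_cokernel St (Sg q) (Sg (incl ?B) \<cdot>\<^bsub>St\<^esub> \<phi>)"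
    using Sg_zcokernel[OF q] by (simp add: e)
  then have c: "is_cokernel St (Sg q \<cdot>\<^bsub>St\<^esub> Sg (incl ?B)) \<phi>"
    by (rule K.zcokernel_iso_left[rotated 3]) (simp_all add: Sg_incl_iso)
  obtain m where m: "is_iso St m" and [simp]: "m \<in> Ar St" "Dom St m = Cod P q" "Cod St m = Cod St \<kappa>"
    and mk: "m \<cdot>\<^bsub>St\<^esub> Sg q \<cdot>\<^bsub>St\<^esub> Sg (incl ?B) = \<kappa>"
    by (rule K.zcokernel_unique[OF c \<kappa>]) simp_all
  have "is_cokernel X (on_ar G q) (on_ar G t)" using GK q by (simp add: zcokernels_to_cokernels_def)
  moreover have "on_ar G t = on_ar G (incl ?B) \<cdot>\<^bsub>X\<^esub> bar \<phi>" using bar(4)[of \<phi> t] e by simp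
  ultimately have "is_cokernel X (on_ar G q) (on_ar G (incl ?B) \<cdot>\<^bsub>X\<^esub> bar \<phi>)" by simp
  then have "is_cokernel X (on_ar G q \<cdot>\<^bsub>X\<^esub> on_ar G (incl ?B)) (bar \<phi>)"
    by (rule X.zcokernel_iso_left[rotated 3]) (simp_all add: G_incl_iso)
  then have "is_cokernel X (bar m \<cdot>\<^bsub>X\<^esub> on_ar G q \<cdot>\<^bsub>X\<^esub> on_ar G (incl ?B)) (bar \<phi>)"
    by (rule X.zcokernel_iso) (simp_all add: bar_iso[OF m])
  moreover have "bar m \<cdot>\<^bsub>X\<^esub> on_ar G q \<cdot>\<^bsub>X\<^esub> on_ar G (incl ?B) = bar \<kappa>"
    using arg_cong[OF mk, of bar] by (simp add: bar_comp bar_Sg)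
  ultimately show ?thesis by simp
qed

end

context stable_torsion
begin

theorem universal_property:
  assumes X: "admissible_target X TX FX" and G: "coproduct_torsion_functor P T F X TX FX G"
  shows "\<exists>Gbar. is_functor St X Gbar \<and> functor_eq P (functor_comp Gbar Sgf) G \<and>
    (\<forall>H. is_functor St X H \<and> functor_eq P (functor_comp H Sgf) G \<longrightarrow> functor_eq St H Gbar) \<and>
    coproduct_torsion_functor St T F X TX FX Gbar \<and>
    (zkernels_to_kernels P Z X G \<and> zcokernels_to_cokernels P Z X G \<longrightarrow>
       zexact_to_exact P Z X G \<and>
       zkernels_to_kernels St (zero_objects St) X Gbar \<and>
       zcokernels_to_cokernels St (zero_objects St) X Gbar \<and>
       zexact_to_exact St (zero_objects St) X Gbar)"
proof -
  interpret U: stable_universal P Z T F X TX FX G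
    using X G by unfold_locales (simp_all add: admissible_target_def)
  have "zkernels_to_kernels St (zero_objects St) X U.Gbar" if "zkernels_to_kernels P Z X G"
    using U.Gbar_kernels[OF that] by (simp add: zkernels_to_kernels_def U.Gbar_def)
  moreover have "zcokernels_to_cokernels St (zero_objects St) X U.Gbar" if "zcokernels_to_cokernels P Z X G"
    using U.Gbar_cokernels[OF that] by (simp add: zcokernels_to_cokernels_def U.Gbar_def)
  ultimately show ?thesis
    using U.Gbar_functor U.Gbar_Sgf U.Gbar_unique U.Gbar_coproduct_torsion_functor
    by (intro exI[of _ U.Gbar])
      (simp add: zexact_to_exact_def short_zexact_def zkernels_to_kernels_def zcokernels_to_cokernels_def)
qed

end

section \<open>Internal relations through generalized elements\<close>

text \<open>Membership of a pair of generalized elements in a subobject of the square of the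
  carrier. The witness \<open>h\<close> already forces \<open>x\<close> and \<open>y\<close> to be
  parallel arrows into the carrier, so no typing premises are needed.\<close>

definition rel_mem :: "('o, 'm) cat \<Rightarrow> 'm \<times> 'm \<Rightarrow> 'm \<Rightarrow> 'm \<Rightarrow> bool" where
  "rel_mem C R x y \<longleftrightarrow> (\<exists>h\<in>Ar C. Cod C h = Dom C (fst R) \<and> fst R \<cdot>\<^bsub>C\<^esub> h = x \<and> snd R \<cdot>\<^bsub>C\<^esub> h = y)"

context cat
begin

lemma relationD:
  assumes "is_relation C A R"
  shows "fst R \<in> Ar C" "snd R \<in> Ar C" "Dom C (snd R) = Dom C (fst R)" "Cod C (fst R) = A" "Cod C (snd R) = A"
    "A \<in> Ob C"
  using assms by (cases R, auto)+

lemma relation_eq: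
  assumes "is_relation C A R" "fst R \<cdot> u = fst R \<cdot> v" "snd R \<cdot> u = snd R \<cdot> v" "u \<in> Ar C" "v \<in> Ar C"
    "Cod C u = Dom C (fst R)" "Cod C v = Dom C (fst R)"
  shows "u = v"
proof -
  have d: "Dom C v = Dom C u"
    using arg_cong[OF assms(2), of "Dom C"] assms(4-) relationD[OF assms(1)] by simp
  show ?thesis using assms d by (cases R) auto
qed

lemma relationI:
  assumes "r \<in> Ar C" "s \<in> Ar C" "Dom C s = Dom C r" "Cod C r = A" "Cod C s = A"
    "\<And>u v. u \<in> Ar C \<Longrightarrow> v \<in> Ar C \<Longrightarrow> Dom C v = Dom C u \<Longrightarrow> Cod C u = Dom C r \<Longrightarrow> Cod C v = Dom C r
      \<Longrightarrow> r \<cdot> u = r \<cdot> v \<Longrightarrow> s \<cdot> u = s \<cdot> v \<Longrightarrow> u = v"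
  shows "is_relation C A (r, s)"
  unfolding is_relation.simps
proof (intro conjI ballI impI)
  fix u v assume "u \<in> Ar C" "v \<in> Ar C" "Dom C u = Dom C v \<and> Cod C u = Dom C r \<and> Cod C v = Dom C r \<and>
      r \<cdot> u = r \<cdot> v \<and> s \<cdot> u = s \<cdot> v"
  then show "u = v" by (elim conjE) (rule assms(6), simp_all)
qed (use assms(1-5) in simp_all)

lemma rel_memE:
  assumes "rel_mem C R x y"
  obtains h where "h \<in> Ar C" "Cod C h = Dom C (fst R)" "fst R \<cdot> h = x" "snd R \<cdot> h = y"
  using assms by (auto simp: rel_mem_def)

lemma rel_memI: "h \<in> Ar C \<Longrightarrow> Cod C h = Dom C (fst R) \<Longrightarrow> rel_mem C R (fst R \<cdot> h) (snd R \<cdot> h)"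
  by (auto simp: rel_mem_def)

lemma rel_memD:
  assumes "rel_mem C R x y" "is_relation C A R"
  shows "x \<in> Ar C" "y \<in> Ar C" "Dom C y = Dom C x" "Cod C x = A" "Cod C y = A"
  using assms(1) relationD[OF assms(2)] by (auto elim!: rel_memE)

lemma rel_mem_self:
  assumes "is_relation C A R" shows "rel_mem C R (fst R) (snd R)"
  using rel_memI[of "Ide C (Dom C (fst R))" R] relationD[OF assms] by simp

lemma rel_mem_comp:
  assumes "rel_mem C R x y" "is_relation C A R" "u \<in> Ar C" "Cod C u = Dom C x"
  shows "rel_mem C R (x \<cdot> u) (y \<cdot> u)"
proof -
  note [simp] = relationD[OF assms(2)]
  obtain h where [simp]: "h \<in> Ar C" "Cod C h = Dom C (fst R)" and h: "fst R \<cdot> h = x" "snd R \<cdot> h = y"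
    using assms(1) by (rule rel_memE)
  have [simp]: "Dom C x = Dom C h" using h(1) by auto
  show ?thesis using rel_memI[of "h \<cdot> u" R] assms(3,4) by (simp add: reassoc[OF h(1)] reassoc[OF h(2)])
qed

text \<open>The projections of \<open>R\<close> are its generic related pair, and an inclusion is
  tested on that pair.\<close>

lemma rel_le_iff:
  assumes "is_relation C A R" "is_relation C A S"
  shows "rel_le C R S \<longleftrightarrow> rel_mem C S (fst R) (snd R)"
proof -
  note [simp] = relationD[OF assms(1)] relationD[OF assms(2)]
  have "Dom C h = Dom C (fst R)" if "h \<in> Ar C" "Cod C h = Dom C (fst S)" "fst S \<cdot> h = fst R" for h
    using Dom_comp[of h "fst S"] that by simp
  then show ?thesis unfolding rel_mem_def by (cases R, cases S) auto
qed

lemma rel_mem_mono: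
  assumes "rel_mem C S (fst R) (snd R)" "rel_mem C R x y" "is_relation C A R" "is_relation C A S"
  shows "rel_mem C S x y"
proof -
  obtain h where h: "h \<in> Ar C" "Cod C h = Dom C (fst R)" "fst R \<cdot> h = x" "snd R \<cdot> h = y"
    using assms(2) by (rule rel_memE)
  then show ?thesis using rel_mem_comp[OF assms(1,4), of h] by simp
qed

lemma reflexive_iff:
  assumes "is_relation C A R" shows "reflexive_rel C A R \<longleftrightarrow> rel_mem C R (Ide C A) (Ide C A)"
proof -
  note [simp] = relationD[OF assms]
  have "is_relation C A (diagonal C A)" unfolding diagonal_def by (rule relationI) simp_all
  from rel_le_iff[OF this assms] show ?thesis by (simp add: reflexive_rel_def diagonal_def)
qed

lemma reflexiveD:
  assumes "reflexive_rel C A R" "is_relation C A R" "x \<in> Ar C" "Cod C x = A"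
  shows "rel_mem C R x x"
  using rel_mem_comp[of R "Ide C A" "Ide C A" A x] reflexive_iff[OF assms(2)] assms relationD[OF assms(2)] by simp

lemma diagonal_relation: "A \<in> Ob C \<Longrightarrow> is_relation C A (diagonal C A)"
  unfolding diagonal_def by (rule relationI) simp_all

lemma in_diagonal_iff: "A \<in> Ob C \<Longrightarrow> rel_mem C (diagonal C A) x y \<longleftrightarrow> x \<in> Ar C \<and> Cod C x = A \<and> y = x"
  by (auto simp: rel_mem_def diagonal_def)

lemma rel_op_relation: "is_relation C A R \<Longrightarrow> is_relation C A (rel_op R)"
  by (cases R) auto

lemma rel_mem_op: "is_relation C A R \<Longrightarrow> rel_mem C (rel_op R) x y \<longleftrightarrow> rel_mem C R y x"
  using relationD(3)[of A R] by (cases R) (auto simp: rel_mem_def)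

lemma symmetric_iff:
  assumes "is_relation C A R"
  shows "rel_eq C (rel_op R) R \<longleftrightarrow> (\<forall>x y. rel_mem C R x y \<longrightarrow> rel_mem C R y x)"
proof -
  have *: "rel_le C (rel_op R) R \<longleftrightarrow> rel_mem C R (snd R) (fst R)" "rel_le C R (rel_op R) \<longleftrightarrow> rel_mem C R (snd R) (fst R)"
    using rel_le_iff[OF rel_op_relation[OF assms] assms] rel_le_iff[OF assms rel_op_relation[OF assms]]
      rel_mem_op[OF assms] by (cases R; simp)+
  show ?thesis
  proof
    assume "rel_eq C (rel_op R) R"
    then have r: "rel_mem C R (snd R) (fst R)" by (simp add: rel_eq_def *)
    show "\<forall>x y. rel_mem C R x y \<longrightarrow> rel_mem C R y x"
    proof (intro allI impI)
      fix x y assume "rel_mem C R x y"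
      then obtain h where h: "h \<in> Ar C" "Cod C h = Dom C (fst R)" "fst R \<cdot> h = x" "snd R \<cdot> h = y"
        by (rule rel_memE)
      then show "rel_mem C R y x" using rel_mem_comp[OF r assms, of h] relationD[OF assms] by simp
    qed
  next
    assume "\<forall>x y. rel_mem C R x y \<longrightarrow> rel_mem C R y x"
    then show "rel_eq C (rel_op R) R" using rel_mem_self[OF assms] by (simp add: rel_eq_def *)
  qed
qed

lemma transitiveI:
  assumes "is_relation C A R" "\<And>x y z. rel_mem C R x y \<Longrightarrow> rel_mem C R y z \<Longrightarrow> rel_mem C R x z"
  shows "transitive_rel C R"
proof -
  obtain r s where R: "R = (r, s)" by (cases R)
  note [simp] = relationD[OF assms(1), unfolded R, simplified]
  show ?thesis unfolding R
  proof (simp, intro allI impI)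
    fix p q assume pb: "is_pullback C s r p q"
    note [simp] = pullbackD(1-8)[OF pb]
    have "rel_mem C R (r \<cdot> p) (s \<cdot> p)" "rel_mem C R (s \<cdot> p) (s \<cdot> q)"
      using rel_memI[of p R] rel_memI[of q R] pullbackD(9)[OF pb] by (simp_all add: R)
    then have "rel_mem C R (r \<cdot> p) (s \<cdot> q)" by (rule assms(2))
    then obtain h where h: "h \<in> Ar C" "Cod C h = Dom C r" "r \<cdot> h = r \<cdot> p" "s \<cdot> h = s \<cdot> q"
      by (auto simp: rel_mem_def R)
    have "Dom C h = Dom C p" using arg_cong[OF h(3), of "Dom C"] h(1,2) by simp
    then show "\<exists>h. h \<in> Ar C \<and> Dom C h = Dom C (r \<cdot> p) \<and> Cod C h = Dom C r \<and> r \<cdot> h = r \<cdot> p \<and> s \<cdot> h = s \<cdot> q"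
      using h by (intro exI[of _ h]) simp
  qed
qed

text \<open>The witnesses on the two summands copair to one, which has the right projections because
  this can be checked on the summands.\<close>

lemma rel_mem_local:
  assumes R: "is_relation C A R" and d: "is_coproduct C d1 d2" "Cod C d1 = Dom C x" and x: "x \<in> Ar C" "y \<in> Ar C"
    "Dom C y = Dom C x" "Cod C x = A" "Cod C y = A"
    and in1: "rel_mem C R (x \<cdot> d1) (y \<cdot> d1)" and in2: "rel_mem C R (x \<cdot> d2) (y \<cdot> d2)"
  shows "rel_mem C R x y"
proof -
  note [simp] = relationD[OF R] coproductD[OF d(1)] d(2) x
  obtain h where [simp]: "h \<in> Ar C" "Cod C h = Dom C (fst R)" and h: "fst R \<cdot> h = x \<cdot> d1" "snd R \<cdot> h = y \<cdot> d1"
    using in1 by (rule rel_memE)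
  obtain k where [simp]: "k \<in> Ar C" "Cod C k = Dom C (fst R)" and k: "fst R \<cdot> k = x \<cdot> d2" "snd R \<cdot> k = y \<cdot> d2"
    using in2 by (rule rel_memE)
  have [simp]: "Dom C h = Dom C d1" "Dom C k = Dom C d2"
    using arg_cong[OF h(1), of "Dom C"] arg_cong[OF k(1), of "Dom C"] by simp_all
  obtain l where l [simp]: "l \<in> Ar C" "Dom C l = Dom C x" "Cod C l = Dom C (fst R)" "l \<cdot> d1 = h" "l \<cdot> d2 = k"
    by (rule copair[OF d(1), of h k]) simp_all
  have "fst R \<cdot> l = x" by (rule coproduct_eq[OF d(1)]) (simp_all add: h k)
  moreover have "snd R \<cdot> l = y" by (rule coproduct_eq[OF d(1)]) (simp_all add: h k)
  ultimately show ?thesis using rel_memI[of l R] by simp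
qed


end

context lextensive
begin

lemma transitiveD:
  assumes "transitive_rel C R" "is_relation C A R" "rel_mem C R x y" "rel_mem C R y z"
  shows "rel_mem C R x z"
proof -
  obtain r s where R: "R = (r, s)" by (cases R)
  note [simp] = relationD[OF assms(2), unfolded R, simplified]
  obtain h where [simp]: "h \<in> Ar C" "Cod C h = Dom C r" and h: "r \<cdot> h = x" "s \<cdot> h = y"
    using assms(3) by (auto simp: rel_mem_def R)
  obtain k where [simp]: "k \<in> Ar C" "Cod C k = Dom C r" and k: "r \<cdot> k = y" "s \<cdot> k = z"
    using assms(4) by (auto simp: rel_mem_def R)
  have [simp]: "Dom C k = Dom C h" using arg_cong[OF trans[OF k(1) h(2)[symmetric]], of "Dom C"] by simp
  obtain p q where pb: "is_pullback C s r p q" by (rule pullback_exists[of s r]) simp_all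
  note [simp] = pullbackD(1-8)[OF pb]
  obtain l where l [simp]: "l \<in> Ar C" "Dom C l = Dom C h" "Cod C l = Dom C p" "p \<cdot> l = h" "q \<cdot> l = k"
    by (rule pullback_lift[OF pb, of h k]) (simp_all add: h k)
  obtain m where m: "m \<in> Ar C" "Dom C m = Dom C (r \<cdot> p)" "Cod C m = Dom C r" "r \<cdot> m = r \<cdot> p" "s \<cdot> m = s \<cdot> q"
    using assms(1)[unfolded R transitive_rel.simps, rule_format, OF pb] by auto
  show ?thesis
    using rel_memI[of "m \<cdot> l" R] m(1-3) h(1) k(2) by (simp add: R reassoc[OF m(4)] reassoc[OF m(5)])
qed

section \<open>Products and the relations built from them\<close>

lemma product_exists:
  assumes "A \<in> Ob C" "B \<in> Ob C"
  obtains p q where "p \<in> Ar C" "q \<in> Ar C" "Dom C q = Dom C p" "Cod C p = A" "Cod C q = B"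
    "\<And>u v. u \<in> Ar C \<Longrightarrow> v \<in> Ar C \<Longrightarrow> Dom C v = Dom C u \<Longrightarrow> Cod C u = A \<Longrightarrow> Cod C v = B
      \<Longrightarrow> \<exists>h. h \<in> Ar C \<and> Dom C h = Dom C u \<and> Cod C h = Dom C p \<and> p \<cdot> h = u \<and> q \<cdot> h = v"
    "\<And>h k. h \<in> Ar C \<Longrightarrow> k \<in> Ar C \<Longrightarrow> Cod C h = Dom C p \<Longrightarrow> Cod C k = Dom C p
      \<Longrightarrow> p \<cdot> h = p \<cdot> k \<Longrightarrow> q \<cdot> h = q \<cdot> k \<Longrightarrow> h = k"
proof -
  obtain I where T: "is_terminal C I" by (rule terminal_exists)
  obtain a where [simp]: "a \<in> Ar C" "Dom C a = A" "Cod C a = I" by (rule terminal_arrow[OF T assms(1)])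
  obtain b where [simp]: "b \<in> Ar C" "Dom C b = B" "Cod C b = I" by (rule terminal_arrow[OF T assms(2)])
  obtain p q where pb: "is_pullback C a b p q" by (rule pullback_exists[of a b]) simp_all
  note D = pullbackD[OF pb]
  show thesis
  proof (rule that[of p q])
    show "\<exists>h. h \<in> Ar C \<and> Dom C h = Dom C u \<and> Cod C h = Dom C p \<and> p \<cdot> h = u \<and> q \<cdot> h = v"
      if uv: "u \<in> Ar C" "v \<in> Ar C" "Dom C v = Dom C u" "Cod C u = A" "Cod C v = B" for u v
    proof -
      have e: "a \<cdot> u = b \<cdot> v" by (rule terminal_eq) (simp_all add: uv T)
      obtain h where "h \<in> Ar C" "Dom C h = Dom C u" "Cod C h = Dom C p" "p \<cdot> h = u" "q \<cdot> h = v"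
        by (rule pullback_lift[OF pb e]) (simp_all add: uv)
      then show ?thesis by blast
    qed
    show "h = k" if "h \<in> Ar C" "k \<in> Ar C" "Cod C h = Dom C p" "Cod C k = Dom C p" "p \<cdot> h = p \<cdot> k" "q \<cdot> h = q \<cdot> k" for h k
      using that by - (rule pullback_eq[OF pb])
  qed (use D in simp_all)
qed

text \<open>The relations become arrows \<open>r\<close> and \<open>s\<close> to the square of
  \<open>A\<close>, and the pullback of these arrows is the intersection.\<close>

lemma rel_inter:
  assumes R: "is_relation C A R" and S: "is_relation C A S"
  obtains T where "is_relation C A T" "\<And>x y. rel_mem C T x y \<longleftrightarrow> rel_mem C R x y \<and> rel_mem C S x y"
proof -
  note [simp] = relationD[OF R] relationD[OF S]
  obtain p q where pq [simp]: "p \<in> Ar C" "q \<in> Ar C" "Dom C q = Dom C p" "Cod C p = A" "Cod C q = A"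
    and pair: "\<And>u v. u \<in> Ar C \<Longrightarrow> v \<in> Ar C \<Longrightarrow> Dom C v = Dom C u \<Longrightarrow> Cod C u = A \<Longrightarrow> Cod C v = A
      \<Longrightarrow> \<exists>h. h \<in> Ar C \<and> Dom C h = Dom C u \<and> Cod C h = Dom C p \<and> p \<cdot> h = u \<and> q \<cdot> h = v"
    and peq: "\<And>h k. h \<in> Ar C \<Longrightarrow> k \<in> Ar C \<Longrightarrow> Cod C h = Dom C p \<Longrightarrow> Cod C k = Dom C p
      \<Longrightarrow> p \<cdot> h = p \<cdot> k \<Longrightarrow> q \<cdot> h = q \<cdot> k \<Longrightarrow> h = k"
    by (rule product_exists[of A A]) simp_all
  obtain r where r [simp]: "r \<in> Ar C" "Dom C r = Dom C (fst R)" "Cod C r = Dom C p" "p \<cdot> r = fst R" "q \<cdot> r = snd R"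
    using pair[of "fst R" "snd R"] by auto
  obtain s where s [simp]: "s \<in> Ar C" "Dom C s = Dom C (fst S)" "Cod C s = Dom C p" "p \<cdot> s = fst S" "q \<cdot> s = snd S"
    using pair[of "fst S" "snd S"] by auto
  obtain a b where pb: "is_pullback C r s a b" by (rule pullback_exists[of r s]) simp_all
  note [simp] = pullbackD(1-8)[OF pb]
  have e: "fst R \<cdot> a = fst S \<cdot> b" "snd R \<cdot> a = snd S \<cdot> b"
    using arg_cong[OF pullbackD(9)[OF pb], of "\<lambda>x. p \<cdot> x"] arg_cong[OF pullbackD(9)[OF pb], of "\<lambda>x. q \<cdot> x"]
    by (simp_all add: reassoc[OF r(4)] reassoc[OF r(5)] reassoc[OF s(4)] reassoc[OF s(5)])
  have T: "is_relation C A (fst R \<cdot> a, snd R \<cdot> a)"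
  proof (rule relationI)
    fix u v assume [simp]: "u \<in> Ar C" "v \<in> Ar C" "Dom C v = Dom C u" "Cod C u = Dom C (fst R \<cdot> a)" "Cod C v = Dom C (fst R \<cdot> a)"
      and uv: "(fst R \<cdot> a) \<cdot> u = (fst R \<cdot> a) \<cdot> v" "(snd R \<cdot> a) \<cdot> u = (snd R \<cdot> a) \<cdot> v"
    have a: "a \<cdot> u = a \<cdot> v" by (rule relation_eq[OF R]) (use uv in simp_all)
    have "(fst S \<cdot> b) \<cdot> u = (fst S \<cdot> b) \<cdot> v" "(snd S \<cdot> b) \<cdot> u = (snd S \<cdot> b) \<cdot> v"
      using uv by (simp_all only: e)
    then have "b \<cdot> u = b \<cdot> v" by - (rule relation_eq[OF S], simp_all)
    with a show "u = v" by (rule pullback_eq[OF pb]) simp_all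
  qed simp_all
  have "rel_mem C (fst R \<cdot> a, snd R \<cdot> a) x y \<longleftrightarrow> rel_mem C R x y \<and> rel_mem C S x y" for x y
  proof
    assume "rel_mem C (fst R \<cdot> a, snd R \<cdot> a) x y"
    then obtain h where [simp]: "h \<in> Ar C" "Cod C h = Dom C a" and h: "(fst R \<cdot> a) \<cdot> h = x" "(snd R \<cdot> a) \<cdot> h = y"
      by (auto simp: rel_mem_def)
    have "fst R \<cdot> a \<cdot> h = x" "snd R \<cdot> a \<cdot> h = y" "fst S \<cdot> b \<cdot> h = x" "snd S \<cdot> b \<cdot> h = y"
      using h reassoc[OF e(1), of h] reassoc[OF e(2), of h] by simp_all
    then show "rel_mem C R x y \<and> rel_mem C S x y"
      using rel_memI[of "a \<cdot> h" R] rel_memI[of "b \<cdot> h" S] by simp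
  next
    assume *: "rel_mem C R x y \<and> rel_mem C S x y"
    then obtain h where [simp]: "h \<in> Ar C" "Cod C h = Dom C (fst R)" and h: "fst R \<cdot> h = x" "snd R \<cdot> h = y"
      by (auto simp: rel_mem_def)
    obtain k where [simp]: "k \<in> Ar C" "Cod C k = Dom C (fst S)" and k: "fst S \<cdot> k = x" "snd S \<cdot> k = y"
      using * by (auto simp: rel_mem_def)
    have [simp]: "Dom C k = Dom C h" using arg_cong[OF trans[OF k(1) h(1)[symmetric]], of "Dom C"] by simp
    have "r \<cdot> h = s \<cdot> k"
      by (rule peq) (simp_all add: reassoc[OF r(4)] reassoc[OF r(5)] reassoc[OF s(4)] reassoc[OF s(5)] h k)
    then obtain l where l [simp]: "l \<in> Ar C" "Dom C l = Dom C h" "Cod C l = Dom C a" "a \<cdot> l = h" "b \<cdot> l = k"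
      by (rule pullback_lift[OF pb]) simp_all
    show "rel_mem C (fst R \<cdot> a, snd R \<cdot> a) x y"
      using rel_memI[of l "(fst R \<cdot> a, snd R \<cdot> a)"] by (simp add: h)
  qed
  then show thesis using that[OF T] by blast
qed

lemma rel_inverse_image:
  assumes S: "is_relation C B S" and f: "f \<in> Ar C" "Dom C f = A" "Cod C f = B"
  obtains T where "is_relation C A T"
    "\<And>x y. x \<in> Ar C \<Longrightarrow> y \<in> Ar C \<Longrightarrow> Cod C x = A \<Longrightarrow> Cod C y = A
      \<Longrightarrow> rel_mem C T x y \<longleftrightarrow> rel_mem C S (f \<cdot> x) (f \<cdot> y)"
proof -
  note [simp] = relationD[OF S] f
  have [simp]: "A \<in> Ob C" using Dom_Ob[OF f(1)] by simp
  obtain p q where pq [simp]: "p \<in> Ar C" "q \<in> Ar C" "Dom C q = Dom C p" "Cod C p = A" "Cod C q = A"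
    and pair: "\<And>u v. u \<in> Ar C \<Longrightarrow> v \<in> Ar C \<Longrightarrow> Dom C v = Dom C u \<Longrightarrow> Cod C u = A \<Longrightarrow> Cod C v = A
      \<Longrightarrow> \<exists>h. h \<in> Ar C \<and> Dom C h = Dom C u \<and> Cod C h = Dom C p \<and> p \<cdot> h = u \<and> q \<cdot> h = v"
    and peq: "\<And>h k. h \<in> Ar C \<Longrightarrow> k \<in> Ar C \<Longrightarrow> Cod C h = Dom C p \<Longrightarrow> Cod C k = Dom C p
      \<Longrightarrow> p \<cdot> h = p \<cdot> k \<Longrightarrow> q \<cdot> h = q \<cdot> k \<Longrightarrow> h = k"
    by (rule product_exists[of A A]) simp_all
  obtain p' q' where pq' [simp]: "p' \<in> Ar C" "q' \<in> Ar C" "Dom C q' = Dom C p'" "Cod C p' = B" "Cod C q' = B"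
    and pair': "\<And>u v. u \<in> Ar C \<Longrightarrow> v \<in> Ar C \<Longrightarrow> Dom C v = Dom C u \<Longrightarrow> Cod C u = B \<Longrightarrow> Cod C v = B
      \<Longrightarrow> \<exists>h. h \<in> Ar C \<and> Dom C h = Dom C u \<and> Cod C h = Dom C p' \<and> p' \<cdot> h = u \<and> q' \<cdot> h = v"
    and peq': "\<And>h k. h \<in> Ar C \<Longrightarrow> k \<in> Ar C \<Longrightarrow> Cod C h = Dom C p' \<Longrightarrow> Cod C k = Dom C p'
      \<Longrightarrow> p' \<cdot> h = p' \<cdot> k \<Longrightarrow> q' \<cdot> h = q' \<cdot> k \<Longrightarrow> h = k"
    by (rule product_exists[of B B]) simp_all
  obtain r where r [simp]: "r \<in> Ar C" "Dom C r = Dom C p" "Cod C r = Dom C p'" "p' \<cdot> r = f \<cdot> p" "q' \<cdot> r = f \<cdot> q"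
    using pair'[of "f \<cdot> p" "f \<cdot> q"] by auto
  obtain s where s [simp]: "s \<in> Ar C" "Dom C s = Dom C (fst S)" "Cod C s = Dom C p'" "p' \<cdot> s = fst S" "q' \<cdot> s = snd S"
    using pair'[of "fst S" "snd S"] by auto
  obtain a b where pb: "is_pullback C r s a b" by (rule pullback_exists[of r s]) simp_all
  note [simp] = pullbackD(1-8)[OF pb]
  have e: "fst S \<cdot> b = f \<cdot> p \<cdot> a" "snd S \<cdot> b = f \<cdot> q \<cdot> a"
    using arg_cong[OF pullbackD(9)[OF pb], of "\<lambda>x. p' \<cdot> x"] arg_cong[OF pullbackD(9)[OF pb], of "\<lambda>x. q' \<cdot> x"]
    by (simp_all add: reassoc[OF r(4)] reassoc[OF r(5)] reassoc[OF s(4)] reassoc[OF s(5)])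
  have T: "is_relation C A (p \<cdot> a, q \<cdot> a)"
  proof (rule relationI)
    fix u v assume [simp]: "u \<in> Ar C" "v \<in> Ar C" "Dom C v = Dom C u" "Cod C u = Dom C (p \<cdot> a)" "Cod C v = Dom C (p \<cdot> a)"
      and uv: "(p \<cdot> a) \<cdot> u = (p \<cdot> a) \<cdot> v" "(q \<cdot> a) \<cdot> u = (q \<cdot> a) \<cdot> v"
    have a: "a \<cdot> u = a \<cdot> v" by (rule peq) (use uv in simp_all)
    have pu: "p \<cdot> a \<cdot> u = p \<cdot> a \<cdot> v" "q \<cdot> a \<cdot> u = q \<cdot> a \<cdot> v" by (simp_all add: a)
    have "b \<cdot> u = b \<cdot> v" by (rule relation_eq[OF S]) (simp_all add: reassoc[OF e(1)] reassoc[OF e(2)] pu)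
    with a show "u = v" by (rule pullback_eq[OF pb]) simp_all
  qed simp_all
  have "rel_mem C (p \<cdot> a, q \<cdot> a) x y \<longleftrightarrow> rel_mem C S (f \<cdot> x) (f \<cdot> y)"
    if [simp]: "x \<in> Ar C" "y \<in> Ar C" "Cod C x = A" "Cod C y = A" for x y
  proof
    assume "rel_mem C (p \<cdot> a, q \<cdot> a) x y"
    then obtain h where [simp]: "h \<in> Ar C" "Cod C h = Dom C a" and h: "(p \<cdot> a) \<cdot> h = x" "(q \<cdot> a) \<cdot> h = y"
      by (auto simp: rel_mem_def)
    have "fst S \<cdot> b \<cdot> h = f \<cdot> x" "snd S \<cdot> b \<cdot> h = f \<cdot> y"
      using h by (auto simp: reassoc[OF e(1)] reassoc[OF e(2)])
    then show "rel_mem C S (f \<cdot> x) (f \<cdot> y)" using rel_memI[of "b \<cdot> h" S] by simp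
  next
    assume *: "rel_mem C S (f \<cdot> x) (f \<cdot> y)"
    have [simp]: "Dom C y = Dom C x" using rel_memD(3)[OF * S] by simp
    obtain k where [simp]: "k \<in> Ar C" "Cod C k = Dom C (fst S)" and k: "fst S \<cdot> k = f \<cdot> x" "snd S \<cdot> k = f \<cdot> y"
      using * by (rule rel_memE)
    have [simp]: "Dom C k = Dom C x" using arg_cong[OF k(1), of "Dom C"] by simp
    obtain h where h [simp]: "h \<in> Ar C" "Dom C h = Dom C x" "Cod C h = Dom C p" "p \<cdot> h = x" "q \<cdot> h = y"
      using pair[of x y] by auto
    have "r \<cdot> h = s \<cdot> k"
      by (rule peq') (simp_all add: reassoc[OF r(4)] reassoc[OF r(5)] reassoc[OF s(4)] reassoc[OF s(5)] k)
    then obtain l where l [simp]: "l \<in> Ar C" "Dom C l = Dom C h" "Cod C l = Dom C a" "a \<cdot> l = h" "b \<cdot> l = k"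
      by (rule pullback_lift[OF pb]) simp_all
    show "rel_mem C (p \<cdot> a, q \<cdot> a) x y"
      using rel_memI[of l "(p \<cdot> a, q \<cdot> a)"] by simp
  qed
  then show thesis using that[OF T] by blast
qed

text \<open>This is the kernel pair of \<open>f\<close>, obtained as the inverse image of the
  diagonal.\<close>

lemma kernel_relation:
  assumes f: "f \<in> Ar C" "Dom C f = A"
  obtains T where "is_relation C A T" "\<And>x y. x \<in> Ar C \<Longrightarrow> y \<in> Ar C \<Longrightarrow> Cod C x = A \<Longrightarrow> Cod C y = A
      \<Longrightarrow> rel_mem C T x y \<longleftrightarrow> f \<cdot> x = f \<cdot> y"
proof -
  have d: "is_relation C (Cod C f) (diagonal C (Cod C f))" by (rule diagonal_relation) (simp add: f)
  obtain T where T: "is_relation C A T"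
    "\<And>x y. x \<in> Ar C \<Longrightarrow> y \<in> Ar C \<Longrightarrow> Cod C x = A \<Longrightarrow> Cod C y = A
      \<Longrightarrow> rel_mem C T x y \<longleftrightarrow> rel_mem C (diagonal C (Cod C f)) (f \<cdot> x) (f \<cdot> y)"
    by (rule rel_inverse_image[OF d f refl]) blast
  have "rel_mem C T x y \<longleftrightarrow> f \<cdot> x = f \<cdot> y" if "x \<in> Ar C" "y \<in> Ar C" "Cod C x = A" "Cod C y = A" for x y
    using T(2)[OF that] that f by (auto simp: in_diagonal_iff)
  then show thesis using that[OF T(1)] by blast
qed

text \<open>The copaired projections are jointly monic since the first components of a pair from
  \<open>R\<close> and of a pair from \<open>S\<close> lie in different summands. The last property
  is how related pairs of a sum are used later: piece by piece, as related pairs of the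
  summands.\<close>

lemma rel_sum:
  assumes R: "is_relation C A R" and S: "is_relation C B S"
    and c: "is_coproduct C i j" "Dom C i = A" "Dom C j = B"
  obtains T where "is_relation C (Cod C i) T"
    "\<And>x y. rel_mem C R x y \<Longrightarrow> rel_mem C T (i \<cdot> x) (i \<cdot> y)"
    "\<And>x y. rel_mem C S x y \<Longrightarrow> rel_mem C T (j \<cdot> x) (j \<cdot> y)"
    "\<And>x y. rel_mem C T x y \<Longrightarrow> \<exists>d1 d2 x1 y1 x2 y2. is_coproduct C d1 d2 \<and> Cod C d1 = Dom C x \<and>
      rel_mem C R x1 y1 \<and> rel_mem C S x2 y2 \<and> x \<cdot> d1 = i \<cdot> x1 \<and> y \<cdot> d1 = i \<cdot> y1 \<and> x \<cdot> d2 = j \<cdot> x2 \<and> y \<cdot> d2 = j \<cdot> y2"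
proof -
  note [simp] = relationD[OF R] relationD[OF S] coproductD[OF c(1)] c(2,3)
  obtain k l where kl: "is_coproduct C k l" and [simp]: "Dom C k = Dom C (fst R)" "Dom C l = Dom C (fst S)"
    "k \<in> Ar C" "l \<in> Ar C" "Cod C l = Cod C k"
    by (rule coproduct_exists[of "Dom C (fst R)" "Dom C (fst S)"]) simp_all
  obtain s where s [simp]: "s \<in> Ar C" "Dom C s = Cod C k" "Cod C s = Cod C i" "s \<cdot> k = i \<cdot> fst R" "s \<cdot> l = j \<cdot> fst S"
    by (rule copair[OF kl, of "i \<cdot> fst R" "j \<cdot> fst S"]) simp_all
  obtain t where t [simp]: "t \<in> Ar C" "Dom C t = Cod C k" "Cod C t = Cod C i" "t \<cdot> k = i \<cdot> snd R" "t \<cdot> l = j \<cdot> snd S"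
    by (rule copair[OF kl, of "i \<cdot> snd R" "j \<cdot> snd S"]) simp_all
  note mi = coproj_mono[OF c(1)]
  have T: "is_relation C (Cod C i) (s, t)"
  proof (rule relationI)
    fix u v assume uv: "u \<in> Ar C" "v \<in> Ar C" "Dom C v = Dom C u" "Cod C u = Dom C s" "Cod C v = Dom C s"
      "s \<cdot> u = s \<cdot> v" "t \<cdot> u = t \<cdot> v"
    show "u = v"
    proof (rule copair_jointly_monic[OF kl, of "i \<cdot> fst R" "i \<cdot> snd R" "Cod C i" "Cod C i" "j \<cdot> fst S" "j \<cdot> snd S" s t])
      fix x y assume xy [simp]: "x \<in> Ar C" "y \<in> Ar C" "Cod C x = Dom C k" "Cod C y = Dom C k" "Dom C y = Dom C x"
        and e: "(i \<cdot> fst R) \<cdot> x = (i \<cdot> fst R) \<cdot> y" "(i \<cdot> snd R) \<cdot> x = (i \<cdot> snd R) \<cdot> y"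
      have "fst R \<cdot> x = fst R \<cdot> y" by (rule mono_cancel[OF mi(1)]) (use e in simp_all)
      moreover have "snd R \<cdot> x = snd R \<cdot> y" by (rule mono_cancel[OF mi(1)]) (use e in simp_all)
      ultimately show "x = y" by (rule relation_eq[OF R]) simp_all
    next
      fix x y assume xy [simp]: "x \<in> Ar C" "y \<in> Ar C" "Cod C x = Dom C l" "Cod C y = Dom C l" "Dom C y = Dom C x"
        and e: "(j \<cdot> fst S) \<cdot> x = (j \<cdot> fst S) \<cdot> y" "(j \<cdot> snd S) \<cdot> x = (j \<cdot> snd S) \<cdot> y"
      have "fst S \<cdot> x = fst S \<cdot> y" by (rule mono_cancel[OF mi(2)]) (use e in simp_all)
      moreover have "snd S \<cdot> x = snd S \<cdot> y" by (rule mono_cancel[OF mi(2)]) (use e in simp_all)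
      ultimately show "x = y" by (rule relation_eq[OF S]) simp_all
    next
      fix x y assume xy [simp]: "x \<in> Ar C" "y \<in> Ar C" "Cod C x = Dom C k" "Cod C y = Dom C l" "Dom C y = Dom C x"
        and e: "(i \<cdot> fst R) \<cdot> x = (j \<cdot> fst S) \<cdot> y"
      have e': "i \<cdot> fst R \<cdot> x = j \<cdot> fst S \<cdot> y" using e by simp
      have "is_initial C (Dom C (fst R \<cdot> x))" by (rule disjoint[OF c(1) e']) simp_all
      then show "is_initial C (Dom C x)" by simp
    qed (use uv in simp_all)
  qed simp_all
  have 1: "rel_mem C (s, t) (i \<cdot> x) (i \<cdot> y)" if xy: "rel_mem C R x y" for x y
  proof -
    obtain h where [simp]: "h \<in> Ar C" "Cod C h = Dom C (fst R)" and h: "fst R \<cdot> h = x" "snd R \<cdot> h = y"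
      using xy by (rule rel_memE)
    show ?thesis using rel_memI[of "k \<cdot> h" "(s, t)"] by (simp add: reassoc[OF s(4)] reassoc[OF t(4)] h)
  qed
  have 2: "rel_mem C (s, t) (j \<cdot> x) (j \<cdot> y)" if xy: "rel_mem C S x y" for x y
  proof -
    obtain h where [simp]: "h \<in> Ar C" "Cod C h = Dom C (fst S)" and h: "fst S \<cdot> h = x" "snd S \<cdot> h = y"
      using xy by (rule rel_memE)
    show ?thesis using rel_memI[of "l \<cdot> h" "(s, t)"] by (simp add: reassoc[OF s(5)] reassoc[OF t(5)] h)
  qed
  have 3: "\<exists>d1 d2 x1 y1 x2 y2. is_coproduct C d1 d2 \<and> Cod C d1 = Dom C x \<and>
      rel_mem C R x1 y1 \<and> rel_mem C S x2 y2 \<and> x \<cdot> d1 = i \<cdot> x1 \<and> y \<cdot> d1 = i \<cdot> y1 \<and> x \<cdot> d2 = j \<cdot> x2 \<and> y \<cdot> d2 = j \<cdot> y2"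
    if xy: "rel_mem C (s, t) x y" for x y
  proof -
    obtain h where [simp]: "h \<in> Ar C" "Cod C h = Cod C k" and h: "s \<cdot> h = x" "t \<cdot> h = y"
      using xy by (auto simp: rel_mem_def)
    obtain d1 d2 h1 h2 where d: "is_coproduct C d1 d2"
      and [simp]: "d1 \<in> Ar C" "d2 \<in> Ar C" "h1 \<in> Ar C" "h2 \<in> Ar C" "Cod C d1 = Dom C h" "Cod C d2 = Dom C h"
      "Dom C h1 = Dom C d1" "Dom C h2 = Dom C d2" "Cod C h1 = Dom C k" "Cod C h2 = Dom C l"
      and hd: "h \<cdot> d1 = k \<cdot> h1" "h \<cdot> d2 = l \<cdot> h2"
      by (rule decompose[OF kl, of h]) simp_all
    show ?thesis
    proof (intro exI conjI)
      show "is_coproduct C d1 d2" by (rule d)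
      show "rel_mem C R (fst R \<cdot> h1) (snd R \<cdot> h1)" by (rule rel_memI) simp_all
      show "rel_mem C S (fst S \<cdot> h2) (snd S \<cdot> h2)" by (rule rel_memI) simp_all
    qed (auto simp: h[symmetric] hd reassoc[OF s(4)] reassoc[OF s(5)] reassoc[OF t(4)] reassoc[OF t(5)])
  qed
  show thesis by (rule that[OF T 1 2 3])
qed

end


section \<open>Images and quotients in a \<open>\<tau>\<close>-pretopos\<close>

locale tau_cat =
  fixes C :: "('o, 'm) cat" (structure)
  assumes tau: "tau_pretopos C"

sublocale tau_cat \<subseteq> lextensive C
  using tau by unfold_locales
    (auto simp: tau_pretopos_def pretopos_def exact_category_def regular_category_def)

context tau_cat
begin

lemma kernel_pair_coequalizer: "is_pullback C f f p q \<Longrightarrow> \<exists>e. is_coequalizer C p q e"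
  and regular_epi_pullback: "is_pullback C f g p q \<Longrightarrow> is_regular_epi C g \<Longrightarrow> is_regular_epi C p"
  and equivalence_effective: "A \<in> Ob C \<Longrightarrow> is_equivalence_rel C A (r1, r2) \<Longrightarrow> \<exists>f. is_pullback C f f r1 r2"
  and transitive_closure_exists: "is_relation C A R \<Longrightarrow> \<exists>T. is_transitive_closure C A R T"
  using tau relationD(6)[of A R]
  unfolding tau_pretopos_def pretopos_def exact_category_def regular_category_def by blast+

section \<open>Coequalizers, covers and images\<close>

lemma coequalizerD:
  assumes "is_coequalizer C f g q"
  shows "f \<in> Ar C" "g \<in> Ar C" "q \<in> Ar C" "Dom C g = Dom C f" "Cod C g = Cod C f" "Dom C q = Cod C f" "q \<cdot> f = q \<cdot> g"
  using assms by (auto simp: is_coequalizer_def)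

lemma coequalizer_ex1:
  assumes "is_coequalizer C f g q" "u \<in> Ar C" "Dom C u = Cod C f" "u \<cdot> f = u \<cdot> g"
  shows "\<exists>!h. h \<in> hom C (Cod C q) (Cod C u) \<and> h \<cdot> q = u"
  using assms unfolding is_coequalizer_def by blast

lemma coequalizer_lift:
  assumes "is_coequalizer C f g q" "u \<in> Ar C" "Dom C u = Cod C f" "u \<cdot> f = u \<cdot> g"
  obtains h where "h \<in> Ar C" "Dom C h = Cod C q" "Cod C h = Cod C u" "h \<cdot> q = u"
  using coequalizer_ex1[OF assms] that by auto

lemma coequalizer_epi:
  assumes "is_coequalizer C f g q" "u \<cdot> q = v \<cdot> q" "u \<in> Ar C" "v \<in> Ar C" "Dom C u = Cod C q" "Dom C v = Cod C q"
    "Cod C v = Cod C u"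
  shows "u = v"
proof -
  note [simp] = coequalizerD(1-6)[OF assms(1)] assms(3-)
  have "\<exists>!h. h \<in> hom C (Cod C q) (Cod C (u \<cdot> q)) \<and> h \<cdot> q = u \<cdot> q"
    by (rule coequalizer_ex1[OF assms(1)]) (simp_all add: coequalizerD(7)[OF assms(1)])
  then show ?thesis by (rule ex1_eq) (simp_all add: assms(2))
qed

text \<open>The descent property that arguments with local lifts need: membership in any relation
  may be checked after composing with \<open>c\<close>. In this form closure under composition is
  immediate, and the case of the diagonal says that \<open>c\<close> is epic.\<close>

definition cover :: "'m \<Rightarrow> bool" where
  "cover c \<longleftrightarrow> c \<in> Ar C \<and> (\<forall>A S x y. is_relation C A S \<and> x \<in> Ar C \<and> y \<in> Ar C \<and> Dom C x = Cod C c \<and>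
     Dom C y = Cod C c \<and> Cod C x = A \<and> Cod C y = A \<and> rel_mem C S (x \<cdot> c) (y \<cdot> c) \<longrightarrow> rel_mem C S x y)"

lemma cover_Ar: "cover c \<Longrightarrow> c \<in> Ar C"
  by (simp add: cover_def)

lemma cover_descent: "cover c \<Longrightarrow> is_relation C A S \<Longrightarrow> rel_mem C S (x \<cdot> c) (y \<cdot> c) \<Longrightarrow> x \<in> Ar C \<Longrightarrow> y \<in> Ar C
    \<Longrightarrow> Dom C x = Cod C c \<Longrightarrow> Dom C y = Cod C c \<Longrightarrow> Cod C x = A \<Longrightarrow> Cod C y = A \<Longrightarrow> rel_mem C S x y"
  unfolding cover_def by blast

lemma cover_epi:
  assumes "cover c" "x \<cdot> c = y \<cdot> c" "x \<in> Ar C" "y \<in> Ar C" "Dom C x = Cod C c" "Dom C y = Cod C c" "Cod C y = Cod C x"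
  shows "x = y"
proof -
  have A: "Cod C x \<in> Ob C" using assms by simp
  have "rel_mem C (diagonal C (Cod C x)) x y"
    by (rule cover_descent[OF assms(1) diagonal_relation[OF A]])
      (use assms cover_Ar[OF assms(1)] A in \<open>simp_all add: in_diagonal_iff\<close>)
  then show ?thesis using A by (simp add: in_diagonal_iff)
qed

lemma cover_comp:
  assumes "cover c" "cover d" "Cod C d = Dom C c"
  shows "cover (c \<cdot> d)"
  unfolding cover_def
proof (intro conjI allI impI; (elim conjE)?)
  note [simp] = cover_Ar[OF assms(1)] cover_Ar[OF assms(2)] assms(3)
  show "c \<cdot> d \<in> Ar C" by simp
  fix A S x y assume S: "is_relation C A S" and [simp]: "x \<in> Ar C" "y \<in> Ar C" "Dom C x = Cod C (c \<cdot> d)"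
    "Dom C y = Cod C (c \<cdot> d)" "Cod C x = A" "Cod C y = A" and e: "rel_mem C S (x \<cdot> c \<cdot> d) (y \<cdot> c \<cdot> d)"
  have "rel_mem C S (x \<cdot> c) (y \<cdot> c)" by (rule cover_descent[OF assms(2) S]) (use e in simp_all)
  then show "rel_mem C S x y" by (rule cover_descent[OF assms(1) S]) simp_all
qed

text \<open>A membership witness over the source of \<open>c\<close> coequalizes \<open>f\<close>
  and \<open>g\<close>, because relations are jointly monic, and so descends along
  \<open>c\<close>.\<close>

lemma coequalizer_cover:
  assumes q: "is_coequalizer C f g c" shows "cover c"
  unfolding cover_def
proof (intro conjI allI impI; (elim conjE)?)
  note [simp] = coequalizerD(1-6)[OF q]
  show "c \<in> Ar C" by simp
  fix A S x y assume S: "is_relation C A S" and [simp]: "x \<in> Ar C" "y \<in> Ar C" "Dom C x = Cod C c"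
    "Dom C y = Cod C c" "Cod C x = A" "Cod C y = A" and e: "rel_mem C S (x \<cdot> c) (y \<cdot> c)"
  note [simp] = relationD[OF S]
  obtain h where [simp]: "h \<in> Ar C" "Cod C h = Dom C (fst S)" and h: "fst S \<cdot> h = x \<cdot> c" "snd S \<cdot> h = y \<cdot> c"
    using e by (rule rel_memE)
  have [simp]: "Dom C h = Cod C f" using arg_cong[OF h(1), of "Dom C"] by simp
  have hf: "h \<cdot> f = h \<cdot> g"
    by (rule relation_eq[OF S])
      (simp_all add: reassoc[OF h(1)] reassoc[OF h(2)] coequalizerD(7)[OF q])
  obtain k where k [simp]: "k \<in> Ar C" "Dom C k = Cod C c" "Cod C k = Dom C (fst S)" "k \<cdot> c = h"
    by (rule coequalizer_lift[OF q _ _ hf]) simp_all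
  have "fst S \<cdot> k = x" by (rule coequalizer_epi[OF q]) (simp_all add: h)
  moreover have "snd S \<cdot> k = y" by (rule coequalizer_epi[OF q]) (simp_all add: h)
  ultimately show "rel_mem C S x y" using rel_memI[of k S] by simp
qed

lemma regular_epi_cover: "is_regular_epi C c \<Longrightarrow> cover c"
  by (auto simp: is_regular_epi_def coequalizer_cover)

text \<open>Elements lift along a regular epimorphism only locally, on the pullback; stability of
  regular epimorphisms makes the pulled back arrow a cover.\<close>

lemma cover_lift:
  assumes "is_regular_epi C e" "z \<in> Ar C" "Cod C z = Cod C e"
  obtains c x where "cover c" "c \<in> Ar C" "x \<in> Ar C" "Cod C c = Dom C z" "Dom C x = Dom C c" "Cod C x = Dom C e" "e \<cdot> x = z \<cdot> c"
proof -
  have [simp]: "e \<in> Ar C" using cover_Ar[OF regular_epi_cover[OF assms(1)]] .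
  obtain c x where pb: "is_pullback C z e c x" by (rule pullback_exists[of z e]) (simp_all add: assms)
  then have "cover c" using regular_epi_cover[OF regular_epi_pullback[OF pb assms(1)]] by simp
  then show thesis using that pullbackD[OF pb] by simp
qed

text \<open>The pair is an arrow \<open>m\<close> to the square of \<open>A\<close>, which factors
  as \<open>n \<cdot> e\<close> through the coequalizer \<open>e\<close> of its kernel pair. That
  \<open>n\<close> is monic is seen on local lifts along \<open>e\<close>: lifts with the same image
  under \<open>m\<close> factor through the kernel pair and are identified by
  \<open>e\<close>.\<close>

lemma image_relation:
  assumes uv [simp]: "u \<in> Ar C" "v \<in> Ar C" "Dom C v = Dom C u" "Cod C u = A" "Cod C v = A"
  obtains R e where "is_relation C A R" "is_regular_epi C e" "e \<in> Ar C" "Dom C e = Dom C u" "Cod C e = Dom C (fst R)"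
    "fst R \<cdot> e = u" "snd R \<cdot> e = v"
proof -
  have [simp]: "A \<in> Ob C" using Cod_Ob[OF uv(1)] by simp
  obtain p q where pq [simp]: "p \<in> Ar C" "q \<in> Ar C" "Dom C q = Dom C p" "Cod C p = A" "Cod C q = A"
    and pair: "\<And>u v. u \<in> Ar C \<Longrightarrow> v \<in> Ar C \<Longrightarrow> Dom C v = Dom C u \<Longrightarrow> Cod C u = A \<Longrightarrow> Cod C v = A
      \<Longrightarrow> \<exists>h. h \<in> Ar C \<and> Dom C h = Dom C u \<and> Cod C h = Dom C p \<and> p \<cdot> h = u \<and> q \<cdot> h = v"
    and peq: "\<And>h k. h \<in> Ar C \<Longrightarrow> k \<in> Ar C \<Longrightarrow> Cod C h = Dom C p \<Longrightarrow> Cod C k = Dom C p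
      \<Longrightarrow> p \<cdot> h = p \<cdot> k \<Longrightarrow> q \<cdot> h = q \<cdot> k \<Longrightarrow> h = k"
    by (rule product_exists[of A A]) simp_all
  obtain m where m [simp]: "m \<in> Ar C" "Dom C m = Dom C u" "Cod C m = Dom C p" "p \<cdot> m = u" "q \<cdot> m = v"
    using pair[of u v] by auto
  obtain k1 k2 where pb: "is_pullback C m m k1 k2" by (rule pullback_exists[of m m]) simp_all
  obtain e where ce: "is_coequalizer C k1 k2 e" using kernel_pair_coequalizer[OF pb] by blast
  note [simp] = pullbackD(1-8)[OF pb] coequalizerD(1-6)[OF ce]
  have re: "is_regular_epi C e" using ce by (auto simp: is_regular_epi_def)
  obtain n where n [simp]: "n \<in> Ar C" "Dom C n = Cod C e" "Cod C n = Dom C p" "n \<cdot> e = m"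
    by (rule coequalizer_lift[OF ce _ _ pullbackD(9)[OF pb]]) simp_all
  have R: "is_relation C A (p \<cdot> n, q \<cdot> n)"
  proof (rule relationI)
    fix a b assume [simp]: "a \<in> Ar C" "b \<in> Ar C" "Dom C b = Dom C a" "Cod C a = Dom C (p \<cdot> n)" "Cod C b = Dom C (p \<cdot> n)"
      and ab: "(p \<cdot> n) \<cdot> a = (p \<cdot> n) \<cdot> b" "(q \<cdot> n) \<cdot> a = (q \<cdot> n) \<cdot> b"
    have nab: "n \<cdot> a = n \<cdot> b" by (rule peq) (use ab in simp_all)
    obtain c x where c: "cover c" and [simp]: "c \<in> Ar C" "x \<in> Ar C" "Cod C c = Dom C a" "Dom C x = Dom C c" "Cod C x = Dom C e"
      and x: "e \<cdot> x = a \<cdot> c" by (rule cover_lift[OF re, of a]) simp_all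
    obtain d y where d: "cover d" and [simp]: "d \<in> Ar C" "y \<in> Ar C" "Cod C d = Dom C c" "Dom C y = Dom C d" "Cod C y = Dom C e"
      and y: "e \<cdot> y = (b \<cdot> c) \<cdot> d" by (rule cover_lift[OF re, of "b \<cdot> c"]) simp_all
    have y': "e \<cdot> y = b \<cdot> c \<cdot> d" using y by simp
    have "m \<cdot> x \<cdot> d = n \<cdot> e \<cdot> x \<cdot> d" by (simp add: reassoc[OF n(4)])
    also have "\<dots> = n \<cdot> a \<cdot> c \<cdot> d" by (simp add: reassoc[OF x])
    also have "\<dots> = n \<cdot> b \<cdot> c \<cdot> d" by (simp add: reassoc[OF nab])
    also have "\<dots> = m \<cdot> y" by (simp add: y'[symmetric] reassoc[OF n(4)])
    finally have xy: "m \<cdot> x \<cdot> d = m \<cdot> y" .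
    obtain h where [simp]: "h \<in> Ar C" "Dom C h = Dom C (x \<cdot> d)" "Cod C h = Dom C k1" and h: "k1 \<cdot> h = x \<cdot> d" "k2 \<cdot> h = y"
      by (rule pullback_lift[OF pb xy]) simp_all
    have "e \<cdot> x \<cdot> d = e \<cdot> y"
      unfolding h[symmetric] by (simp add: reassoc[OF coequalizerD(7)[OF ce]])
    then have "(a \<cdot> c) \<cdot> d = (b \<cdot> c) \<cdot> d" using reassoc[OF x, of d] by (simp add: y')
    then have "a \<cdot> c = b \<cdot> c" by (rule cover_epi[OF d]) simp_all
    then show "a = b" by (rule cover_epi[OF c]) simp_all
  qed simp_all
  show thesis by (rule that[OF R re]) simp_all
qed

lemma image_cover:
  assumes R: "is_relation C A R" and e: "is_regular_epi C e" "e \<in> Ar C" "Cod C e = Dom C (fst R)"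
    and xy: "rel_mem C R x y"
  obtains c d where "cover c" "c \<in> Ar C" "d \<in> Ar C" "Cod C c = Dom C x" "Dom C d = Dom C c" "Cod C d = Dom C e"
    "(fst R \<cdot> e) \<cdot> d = x \<cdot> c" "(snd R \<cdot> e) \<cdot> d = y \<cdot> c"
proof -
  note [simp] = relationD[OF R] e(2,3)
  obtain h where [simp]: "h \<in> Ar C" "Cod C h = Dom C (fst R)" and h: "fst R \<cdot> h = x" "snd R \<cdot> h = y"
    using xy by (rule rel_memE)
  obtain c d where c: "cover c" and [simp]: "c \<in> Ar C" "d \<in> Ar C" "Cod C c = Dom C h" "Dom C d = Dom C c" "Cod C d = Dom C e"
    and ed: "e \<cdot> d = h \<cdot> c" by (rule cover_lift[OF e(1), of h]) simp_all
  show thesis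
    by (rule that[OF c, of d]) (simp_all add: h[symmetric] ed)
qed

text \<open>Coequalizers are given for kernel pairs, so the equivalence relation generated by
  \<open>u\<close> and \<open>v\<close> has to be built. The pair is enlarged by its reversal and by
  the diagonal, and the transitive closure of the image is effective, hence a kernel pair whose
  coequalizer is the required one.\<close>

lemma coequalizer_exists:
  assumes [simp]: "u \<in> Ar C" "v \<in> Ar C" "Dom C v = Dom C u" "Cod C v = Cod C u"
  obtains q where "is_coequalizer C u v q"
proof -
  let ?B = "Cod C u"
  have B [simp]: "?B \<in> Ob C" by simp
  obtain k l where kl: "is_coproduct C k l" and [simp]: "Dom C k = Dom C u" "Dom C l = Dom C u" "k \<in> Ar C" "l \<in> Ar C" "Cod C l = Cod C k"
    by (rule coproduct_exists[of "Dom C u" "Dom C u"]) simp_all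
  \<comment> \<open>\<open>u2\<close> and \<open>v2\<close> combine the given pair with its
    reversal; \<open>u3\<close> and \<open>v3\<close> add the diagonal.\<close>
  obtain u2 where u2 [simp]: "u2 \<in> Ar C" "Dom C u2 = Cod C k" "Cod C u2 = ?B" "u2 \<cdot> k = u" "u2 \<cdot> l = v"
    by (rule copair[OF kl, of u v]) simp_all
  obtain v2 where v2 [simp]: "v2 \<in> Ar C" "Dom C v2 = Cod C k" "Cod C v2 = ?B" "v2 \<cdot> k = v" "v2 \<cdot> l = u"
    by (rule copair[OF kl, of v u]) simp_all
  obtain i j where ij: "is_coproduct C i j" and [simp]: "Dom C i = Cod C k" "Dom C j = ?B" "i \<in> Ar C" "j \<in> Ar C" "Cod C j = Cod C i"
    by (rule coproduct_exists[of "Cod C k" ?B]) simp_all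
  obtain u3 where u3 [simp]: "u3 \<in> Ar C" "Dom C u3 = Cod C i" "Cod C u3 = ?B" "u3 \<cdot> i = u2" "u3 \<cdot> j = Ide C ?B"
    by (rule copair[OF ij, of u2 "Ide C ?B"]) simp_all
  obtain v3 where v3 [simp]: "v3 \<in> Ar C" "Dom C v3 = Cod C i" "Cod C v3 = ?B" "v3 \<cdot> i = v2" "v3 \<cdot> j = Ide C ?B"
    by (rule copair[OF ij, of v2 "Ide C ?B"]) simp_all
  obtain R e where R: "is_relation C ?B R" and re: "is_regular_epi C e" and [simp]: "e \<in> Ar C" "Dom C e = Cod C i" "Cod C e = Dom C (fst R)"
    and Re: "fst R \<cdot> e = u3" "snd R \<cdot> e = v3" by (rule image_relation[of u3 v3 ?B]) simp_all
  note [simp] = relationD[OF R]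
  obtain T where "is_transitive_closure C ?B R T" using transitive_closure_exists[OF R] by blast
  then have T: "is_relation C ?B T" "transitive_rel C T" "rel_mem C T (fst R) (snd R)"
    and Tmin: "\<And>S. is_relation C ?B S \<Longrightarrow> transitive_rel C S \<Longrightarrow> rel_mem C S (fst R) (snd R) \<Longrightarrow> rel_mem C S (fst T) (snd T)"
    using rel_le_iff[OF R] rel_le_iff[where R = T] unfolding is_transitive_closure_def by blast+
  note [simp] = relationD[OF T(1)]
  have le: "rel_mem C S (fst R) (snd R)" if S: "is_relation C ?B S" and "rel_mem C S u3 v3" for S
    by (rule cover_descent[OF regular_epi_cover[OF re] S]) (use that(2) in \<open>simp_all add: Re\<close>)
  have uv3: "rel_mem C T u3 v3" using rel_mem_comp[OF T(3,1), of e] by (simp add: Re)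
  have uv2: "rel_mem C T u2 v2" "rel_mem C T (Ide C ?B) (Ide C ?B)"
    using rel_mem_comp[OF uv3 T(1), of i] rel_mem_comp[OF uv3 T(1), of j] by simp_all
  have uv: "rel_mem C T u v" "rel_mem C T v u"
    using rel_mem_comp[OF uv2(1) T(1), of k] rel_mem_comp[OF uv2(1) T(1), of l] by simp_all
  have "rel_mem C T v2 u2" by (rule rel_mem_local[OF T(1) kl]) (simp_all add: uv)
  then have vu3: "rel_mem C T v3 u3" by - (rule rel_mem_local[OF T(1) ij], simp_all add: uv2)
  have op: "is_relation C ?B (rel_op T)" by (rule rel_op_relation[OF T(1)])
  \<comment> \<open>Symmetry follows from minimality: the opposite of \<open>T\<close> is
    transitive, and it contains \<open>R\<close> because the generating pair was made
    symmetric.\<close>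
  have "rel_mem C (rel_op T) (fst T) (snd T)"
  proof (rule Tmin[OF op])
    show "transitive_rel C (rel_op T)"
      by (rule transitiveI[OF op]) (use transitiveD[OF T(2,1)] in \<open>auto simp: rel_mem_op[OF T(1)]\<close>)
    show "rel_mem C (rel_op T) (fst R) (snd R)" by (rule le[OF op]) (simp add: rel_mem_op[OF T(1)] vu3)
  qed
  then have sym: "rel_mem C T y x" if "rel_mem C T x y" for x y
    using rel_mem_mono[OF _ that T(1) op] by (simp add: rel_mem_op[OF T(1)])
  have "is_equivalence_rel C ?B T"
    unfolding is_equivalence_rel_def symmetric_rel_def
    using T(1,2) uv2(2) sym by (simp add: reflexive_iff[OF T(1)] symmetric_iff[OF T(1)])
  then obtain f where pf: "is_pullback C f f (fst T) (snd T)" using equivalence_effective[of ?B "fst T" "snd T"] by auto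
  obtain q where q: "is_coequalizer C (fst T) (snd T) q" using kernel_pair_coequalizer[OF pf] by blast
  note [simp] = coequalizerD(3,6)[OF q]
  have qT: "q \<cdot> x = q \<cdot> y" if xy: "rel_mem C T x y" for x y
  proof -
    obtain h where "h \<in> Ar C" "Cod C h = Dom C (fst T)" "fst T \<cdot> h = x" "snd T \<cdot> h = y" using xy by (rule rel_memE)
    then show ?thesis using reassoc[OF coequalizerD(7)[OF q], of h] by simp
  qed
  have "is_coequalizer C u v q"
    unfolding is_coequalizer_def
  proof (intro conjI ballI impI)
    show "q \<cdot> u = q \<cdot> v" by (rule qT[OF uv(1)])
    fix w assume "w \<in> Ar C" "Dom C w = Cod C u \<and> w \<cdot> u = w \<cdot> v"
    then have [simp]: "w \<in> Ar C" "Dom C w = ?B" and w: "w \<cdot> u = w \<cdot> v" by auto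
    \<comment> \<open>The kernel relation of \<open>w\<close> is transitive and contains the
      generators, so it contains the closure \<open>T\<close>.\<close>
    obtain S where S: "is_relation C ?B S" and Sin: "\<And>x y. x \<in> Ar C \<Longrightarrow> y \<in> Ar C \<Longrightarrow> Cod C x = ?B \<Longrightarrow> Cod C y = ?B
      \<Longrightarrow> rel_mem C S x y \<longleftrightarrow> w \<cdot> x = w \<cdot> y" by (rule kernel_relation[of w ?B]) simp_all
    have w2: "w \<cdot> u2 = w \<cdot> v2" by (rule coproduct_eq[OF kl]) (simp_all add: w)
    have "w \<cdot> u3 = w \<cdot> v3" by (rule coproduct_eq[OF ij]) (simp_all add: w2)
    then have "rel_mem C S (fst R) (snd R)" by (intro le[OF S]) (simp add: Sin)
    moreover have "transitive_rel C S"
    proof (rule transitiveI[OF S])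
      fix x y z assume "rel_mem C S x y" "rel_mem C S y z"
      then show "rel_mem C S x z" using rel_memD[OF _ S, of x y] rel_memD[OF _ S, of y z] by (simp add: Sin)
    qed
    ultimately have "rel_mem C S (fst T) (snd T)" by (intro Tmin[OF S])
    then have wT: "w \<cdot> fst T = w \<cdot> snd T" by (simp add: Sin)
    show "\<exists>!h. h \<in> hom C (Cod C q) (Cod C w) \<and> h \<cdot> q = w"
      by (rule coequalizer_ex1[OF q _ _ wT]) simp_all
  qed simp_all
  then show thesis by (rule that)
qed

end

section \<open>The category of internal preorders\<close>

declare is_relation.simps [simp del] transitive_rel.simps [simp del] rel_le.simps [simp del]

context cat
begin

text \<open>Extensivity quantifies over all coproducts and pullbacks. As these are unique up to
  isomorphism, one coproduct for each pair of objects and one choice of pullbacks are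
  enough.\<close>

lemma extensiveI:
  assumes initial: "\<exists>I. is_initial C I"
    and strict: "\<And>f. f \<in> Ar C \<Longrightarrow> is_initial C (Cod C f) \<Longrightarrow> is_initial C (Dom C f)"
    and sums: "\<And>A B. A \<in> Ob C \<Longrightarrow> B \<in> Ob C \<Longrightarrow> \<exists>i j. is_coproduct C i j \<and> Dom C i = A \<and> Dom C j = B \<and>
      is_mono C i \<and> is_mono C j \<and> (\<exists>p q. is_pullback C i j p q \<and> is_initial C (Dom C p)) \<and>
      (\<forall>f\<in>Ar C. Cod C f = Cod C i \<longrightarrow>
        (\<exists>p p' q q'. is_pullback C f i p p' \<and> is_pullback C f j q q' \<and> is_coproduct C p q))"
  shows "extensive C"
proof -
  have compare: "\<exists>i' j' k. is_iso C k \<and> Dom C k = Cod C i \<and> k \<cdot> i = i' \<and> k \<cdot> j = j' \<and> is_coproduct C i' j' \<and>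
      is_mono C i' \<and> is_mono C j' \<and> (\<exists>p q. is_pullback C i' j' p q \<and> is_initial C (Dom C p)) \<and>
      (\<forall>f\<in>Ar C. Cod C f = Cod C i' \<longrightarrow>
        (\<exists>p p' q q'. is_pullback C f i' p p' \<and> is_pullback C f j' q q' \<and> is_coproduct C p q))"
    if c: "is_coproduct C i j" for i j
  proof -
    note [simp] = coproductD[OF c]
    obtain i' j' where *: "is_coproduct C i' j'" "Dom C i' = Dom C i" "Dom C j' = Dom C j"
      and rest: "is_mono C i'" "is_mono C j'" "\<exists>p q. is_pullback C i' j' p q \<and> is_initial C (Dom C p)"
      "\<forall>f\<in>Ar C. Cod C f = Cod C i' \<longrightarrow>
        (\<exists>p p' q q'. is_pullback C f i' p p' \<and> is_pullback C f j' q q' \<and> is_coproduct C p q)"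
      using sums[of "Dom C i" "Dom C j"] by auto
    obtain k where "is_iso C k" "Dom C k = Cod C i" "k \<cdot> i = i'" "k \<cdot> j = j'"
      by (rule coproduct_unique[OF c *])
    then show ?thesis using *(1) rest by blast
  qed
  show ?thesis
    unfolding extensive_def
  proof (intro conjI allI impI ballI; (elim conjE)?)
    show "has_finite_coproducts C"
      unfolding has_finite_coproducts_def has_binary_coproducts_def using initial sums by blast
  next
    fix i j assume c: "is_coproduct C i j"
    note [simp] = coproductD[OF c]
    obtain i' j' k where k: "is_iso C k" "Dom C k = Cod C i" "k \<cdot> i = i'" "k \<cdot> j = j'" and m: "is_mono C i'" "is_mono C j'"
      and d: "\<exists>p q. is_pullback C i' j' p q \<and> is_initial C (Dom C p)" using compare[OF c] by blast
    have [simp]: "k \<in> Ar C" using k(1) by (simp add: is_iso_def)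
    show "is_mono C i" by (rule mono_left_factor[of k]) (simp_all add: k m)
    show "is_mono C j" by (rule mono_left_factor[of k]) (simp_all add: k m)
    fix p q assume pb: "is_pullback C i j p q"
    obtain p' q' where pb': "is_pullback C i' j' p' q'" "is_initial C (Dom C p')" using d by blast
    have pb'': "is_pullback C i' j' p q"
      using pullback_mono_cod[OF pb iso_mono[OF k(1)]] by (simp add: k)
    obtain l where l: "is_iso C l" "Dom C l = Dom C p'" "Cod C l = Dom C p"
      by (rule pullback_unique[OF pb'' pb'(1)])
    show "is_initial C (Dom C p)" using iso_initial[OF l(1)] pb'(2) l by simp
  next
    fix i j f p p' q q' assume c: "is_coproduct C i j" and 1: "is_pullback C f i p p'" and 2: "is_pullback C f j q q'"
    note [simp] = coproductD[OF c]
    note [simp] = pullbackD(1)[OF 1] pullbackD(5)[OF 1, symmetric]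
    obtain i' j' k where k: "is_iso C k" "Dom C k = Cod C i" "k \<cdot> i = i'" "k \<cdot> j = j'"
      and u: "\<forall>f\<in>Ar C. Cod C f = Cod C i' \<longrightarrow>
        (\<exists>p p' q q'. is_pullback C f i' p p' \<and> is_pullback C f j' q q' \<and> is_coproduct C p q)" using compare[OF c] by blast
    have [simp]: "k \<in> Ar C" using k(1) by (simp add: is_iso_def)
    have "Cod C (k \<cdot> f) = Cod C i'" by (simp add: k(2) k(3)[symmetric])
    moreover have "k \<cdot> f \<in> Ar C" by (simp add: k(2))
    ultimately obtain r r' s s' where rs: "is_pullback C (k \<cdot> f) i' r r'" "is_pullback C (k \<cdot> f) j' s s'" "is_coproduct C r s"
      using u by blast
    have pp: "is_pullback C (k \<cdot> f) i' p p'" "is_pullback C (k \<cdot> f) j' q q'"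
      using pullback_mono_cod[OF 1 iso_mono[OF k(1)]] pullback_mono_cod[OF 2 iso_mono[OF k(1)]] by (simp_all add: k)
    obtain l where l: "is_iso C l" "Cod C l = Dom C r" "r \<cdot> l = p" by (rule pullback_unique[OF rs(1) pp(1)])
    obtain m where m: "is_iso C m" "Cod C m = Dom C s" "s \<cdot> m = q" by (rule pullback_unique[OF rs(2) pp(2)])
    show "is_coproduct C p q" using coproduct_iso_dom[OF rs(3) l(1) m(1) l(2) m(2)] by (simp add: l m)
  next
    fix f assume "f \<in> Ar C" "is_initial C (Cod C f)" then show "is_initial C (Dom C f)" by (rule strict)
  qed
qed

end

context tau_cat
begin

abbreviation Pre :: "(('o, 'm) preord, ('o, 'm) preord_arrow) cat" where
  "Pre \<equiv> PreOrd C"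

lemma preordD:
  assumes "is_preord C X"
  shows "fst X \<in> Ob C" "is_relation C (fst X) (snd X)"
    "x \<in> Ar C \<Longrightarrow> Cod C x = fst X \<Longrightarrow> rel_mem C (snd X) x x"
    "rel_mem C (snd X) x y \<Longrightarrow> rel_mem C (snd X) y z \<Longrightarrow> rel_mem C (snd X) x z"
proof -
  show R: "fst X \<in> Ob C" "is_relation C (fst X) (snd X)" using assms by (cases X, simp)+
  have "reflexive_rel C (fst X) (snd X)" and T: "transitive_rel C (snd X)" using assms by (cases X, simp)+
  then show "x \<in> Ar C \<Longrightarrow> Cod C x = fst X \<Longrightarrow> rel_mem C (snd X) x x"
    by - (rule reflexiveD[OF _ R(2)])
  show "rel_mem C (snd X) x y \<Longrightarrow> rel_mem C (snd X) y z \<Longrightarrow> rel_mem C (snd X) x z"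
    by (rule transitiveD[OF T R(2)])
qed

lemma preordI:
  assumes R: "is_relation C A R" and "rel_mem C R (Ide C A) (Ide C A)"
    "\<And>x y z. rel_mem C R x y \<Longrightarrow> rel_mem C R y z \<Longrightarrow> rel_mem C R x z"
  shows "is_preord C (A, R)"
  using assms(2) relationD(6)[OF R] transitiveI[OF R assms(3)] by (simp add: R reflexive_iff)

lemma PreOrd_simps [simp]:
  "Ob Pre = {X. is_preord C X}" "Dom Pre (X, f, Y) = X" "Cod Pre (X, f, Y) = Y"
  "Ide Pre X = (X, Ide C (fst X), X)" "(Y', g, W) \<cdot>\<^bsub>Pre\<^esub> (X, f, Y) = (X, g \<cdot> f, W)"
  by (simp_all add: PreOrd_def)

text \<open>The lift between the carriers of the orders is preservation of the generic related pair,
  and every related pair is a composite of that one. Arrows of preorders can thus be treated as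
  monotone maps on elements.\<close>

lemma PreOrd_Ar_iff:
  "(X, f, Y) \<in> Ar Pre \<longleftrightarrow> is_preord C X \<and> is_preord C Y \<and> f \<in> Ar C \<and> Dom C f = fst X \<and> Cod C f = fst Y \<and>
     (\<forall>x y. rel_mem C (snd X) x y \<longrightarrow> rel_mem C (snd Y) (f \<cdot> x) (f \<cdot> y))"
proof (cases "is_preord C X \<and> is_preord C Y \<and> f \<in> Ar C \<and> Dom C f = fst X \<and> Cod C f = fst Y")
  case True
  then have XY: "is_preord C X" "is_preord C Y" and f [simp]: "f \<in> Ar C" "Dom C f = fst X" "Cod C f = fst Y" by auto
  note [simp] = relationD[OF preordD(2)[OF XY(1)]] relationD[OF preordD(2)[OF XY(2)]]
  have 1: "(X, f, Y) \<in> Ar Pre \<longleftrightarrow> rel_mem C (snd Y) (f \<cdot> fst (snd X)) (f \<cdot> snd (snd X))"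
  proof -
    obtain A r s B r' s' where XY': "X = (A, r, s)" "Y = (B, r', s')" by (cases X, cases Y)
    have "(X, f, Y) \<in> Ar Pre \<longleftrightarrow> (\<exists>h \<in> hom C (Dom C r) (Dom C r'). f \<cdot> r = r' \<cdot> h \<and> f \<cdot> s = s' \<cdot> h)"
      using True by (simp add: PreOrd_def XY' del: is_preord.simps)
    also have "\<dots> \<longleftrightarrow> rel_mem C (r', s') (f \<cdot> r) (f \<cdot> s)"
    proof
      assume "rel_mem C (r', s') (f \<cdot> r) (f \<cdot> s)"
      then obtain h where h: "h \<in> Ar C" "Cod C h = Dom C r'" "r' \<cdot> h = f \<cdot> r" "s' \<cdot> h = f \<cdot> s"
        by (auto simp: rel_mem_def)
      have "Dom C h = Dom C r"
        using arg_cong[OF h(3), of "Dom C"] h(1,2) relationD[OF preordD(2)[OF XY(1)]] relationD[OF preordD(2)[OF XY(2)]] f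
        by (simp add: XY')
      then show "\<exists>h \<in> hom C (Dom C r) (Dom C r'). f \<cdot> r = r' \<cdot> h \<and> f \<cdot> s = s' \<cdot> h"
        using h by (intro bexI[of _ h]) simp_all
    qed (auto simp: rel_mem_def)
    finally show ?thesis by (simp add: XY')
  qed
  moreover have "rel_mem C (snd Y) (f \<cdot> x) (f \<cdot> y)"
    if m: "rel_mem C (snd Y) (f \<cdot> fst (snd X)) (f \<cdot> snd (snd X))" and xy: "rel_mem C (snd X) x y" for x y
  proof -
    obtain h where "h \<in> Ar C" "Cod C h = Dom C (fst (snd X))" "fst (snd X) \<cdot> h = x" "snd (snd X) \<cdot> h = y"
      using xy by (rule rel_memE)
    then show ?thesis using rel_mem_comp[OF m preordD(2)[OF XY(2)], of h] by auto
  qed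
  moreover have "rel_mem C (snd X) (fst (snd X)) (snd (snd X))" by (rule rel_mem_self[OF preordD(2)[OF XY(1)]])
  ultimately show ?thesis using True by blast
next
  case False
  then show ?thesis by (cases X, cases Y) (auto simp: PreOrd_def)
qed

lemma PreOrd_ArD:
  assumes "(X, f, Y) \<in> Ar Pre"
  shows "is_preord C X" "is_preord C Y" "f \<in> Ar C" "Dom C f = fst X" "Cod C f = fst Y"
    "rel_mem C (snd X) x y \<Longrightarrow> rel_mem C (snd Y) (f \<cdot> x) (f \<cdot> y)"
  using assms by (simp_all add: PreOrd_Ar_iff)

lemma PreOrd_ArE:
  assumes "F \<in> Ar Pre"
  obtains X f Y where "F = (X, f, Y)" "(X, f, Y) \<in> Ar Pre"
  using assms by (cases F) auto

lemma preord_memD: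
  assumes "is_preord C X" "rel_mem C (snd X) x y"
  shows "x \<in> Ar C" "y \<in> Ar C" "Dom C y = Dom C x" "Cod C x = fst X" "Cod C y = fst X"
  by (rule rel_memD[OF assms(2) preordD(2)[OF assms(1)]])+

lemma category_PreOrd: "category Pre"
  unfolding category_def
proof (intro conjI ballI impI)
  fix F assume "F \<in> Ar Pre"
  then obtain X f Y where F [simp]: "F = (X, f, Y)" and f: "(X, f, Y) \<in> Ar Pre" by (rule PreOrd_ArE)
  note [simp] = PreOrd_ArD(1-5)[OF f]
  show "Dom Pre F \<in> Ob Pre" "Cod Pre F \<in> Ob Pre" by simp_all
  show "F \<cdot>\<^bsub>Pre\<^esub> Ide Pre (Dom Pre F) = F" "Ide Pre (Cod Pre F) \<cdot>\<^bsub>Pre\<^esub> F = F" by simp_all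
  fix G assume "G \<in> Ar Pre"
  then obtain Y' g W where G [simp]: "G = (Y', g, W)" and g: "(Y', g, W) \<in> Ar Pre" by (rule PreOrd_ArE)
  note [simp] = PreOrd_ArD(1-5)[OF g]
  show "G \<cdot>\<^bsub>Pre\<^esub> F \<in> hom Pre (Dom Pre F) (Cod Pre G)" if "Cod Pre F = Dom Pre G"
  proof -
    have [simp]: "Y' = Y" using that by simp
    have "rel_mem C (snd W) ((g \<cdot> f) \<cdot> x) ((g \<cdot> f) \<cdot> y)" if xy: "rel_mem C (snd X) x y" for x y
      using PreOrd_ArD(6)[OF g, of "f \<cdot> x" "f \<cdot> y"] PreOrd_ArD(6)[OF f xy] preord_memD[OF _ xy] by simp
    then show ?thesis by (simp add: PreOrd_Ar_iff)
  qed
  fix H assume "H \<in> Ar Pre"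
  then obtain W' h V where H [simp]: "H = (W', h, V)" and h: "(W', h, V) \<in> Ar Pre" by (rule PreOrd_ArE)
  note [simp] = PreOrd_ArD(1-5)[OF h]
  show "H \<cdot>\<^bsub>Pre\<^esub> G \<cdot>\<^bsub>Pre\<^esub> F = (H \<cdot>\<^bsub>Pre\<^esub> G) \<cdot>\<^bsub>Pre\<^esub> F" if "Cod Pre F = Dom Pre G \<and> Cod Pre G = Dom Pre H"
    using that by simp
next
  fix X assume "X \<in> Ob Pre"
  then have X: "is_preord C X" by simp
  have "rel_mem C (snd X) (Ide C (fst X) \<cdot> x) (Ide C (fst X) \<cdot> y)" if "rel_mem C (snd X) x y" for x y
    using that preord_memD[OF X that] by simp
  then show "Ide Pre X \<in> hom Pre X X" using X preordD(1)[OF X] by (simp add: PreOrd_Ar_iff)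
qed

sublocale PO: cat "PreOrd C"
  by unfold_locales (rule category_PreOrd)

section \<open>Monomorphisms and finite limits of preorders\<close>

lemma PreOrd_mono:
  assumes m: "(X, m, Y) \<in> Ar Pre" "is_mono C m" shows "is_mono Pre (X, m, Y)"
proof (rule PO.is_monoI[OF m(1)])
  fix u v assume u: "u \<in> Ar Pre" and v: "v \<in> Ar Pre" and d: "Dom Pre v = Dom Pre u" "Cod Pre u = Dom Pre (X, m, Y)"
    "Cod Pre v = Dom Pre (X, m, Y)" and e: "(X, m, Y) \<cdot>\<^bsub>Pre\<^esub> u = (X, m, Y) \<cdot>\<^bsub>Pre\<^esub> v"
  obtain W u0 where u0 [simp]: "u = (W, u0, X)" using d(2) u by (cases u) auto
  obtain v0 where v0 [simp]: "v = (W, v0, X)" using d by (cases v) auto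
  note [simp] = PreOrd_ArD(1-5)[OF m(1)] PreOrd_ArD(1-5)[OF u[unfolded u0]] PreOrd_ArD(1-5)[OF v[unfolded v0]]
  have "m \<cdot> u0 = m \<cdot> v0" using e by simp
  then have "u0 = v0" by (rule mono_cancel[OF m(2)]) simp_all
  then show "u = v" by simp
qed

definition disc :: "'o \<Rightarrow> ('o, 'm) preord" where "disc A = (A, diagonal C A)"

lemma disc_simps [simp]: "fst (disc A) = A" "snd (disc A) = diagonal C A"
  by (simp_all add: disc_def)

lemma disc_preord: "A \<in> Ob C \<Longrightarrow> is_preord C (disc A)"
  unfolding disc_def by (rule preordI[OF diagonal_relation]) (auto simp: in_diagonal_iff)

lemma disc_Ar: "is_preord C X \<Longrightarrow> f \<in> Ar C \<Longrightarrow> Cod C f = fst X \<Longrightarrow> (disc (Dom C f), f, X) \<in> Ar Pre"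
  by (auto simp: PreOrd_Ar_iff disc_preord in_diagonal_iff preordD(3))

text \<open>Any arrow into the underlying object is monotone on a discrete preorder, so test arrows
  of the base category lift to preorders.\<close>

lemma PreOrd_monoD:
  assumes "is_mono Pre (X, m, Y)" shows "is_mono C m"
proof (rule is_monoI)
  have m: "(X, m, Y) \<in> Ar Pre" using assms by (rule PO.is_mono_Ar)
  note [simp] = PreOrd_ArD(1-5)[OF m]
  show "m \<in> Ar C" by simp
  fix u v assume [simp]: "u \<in> Ar C" "v \<in> Ar C" "Dom C v = Dom C u" "Cod C u = Dom C m" "Cod C v = Dom C m"
    and e: "m \<cdot> u = m \<cdot> v"
  have "(disc (Dom C u), u, X) \<in> Ar Pre" "(disc (Dom C u), v, X) \<in> Ar Pre"
    using disc_Ar[of X u] disc_Ar[of X v] by simp_all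
  moreover have "(X, m, Y) \<cdot>\<^bsub>Pre\<^esub> (disc (Dom C u), u, X) = (X, m, Y) \<cdot>\<^bsub>Pre\<^esub> (disc (Dom C u), v, X)" by (simp add: e)
  ultimately have "(disc (Dom C u), u, X) = (disc (Dom C u), v, X)"
    by - (rule PO.mono_cancel[OF assms], simp_all)
  then show "u = v" by simp
qed

text \<open>Related elements of an initial object have an initial domain, so every arrow out of it
  is monotone, whatever order it carries.\<close>

lemma PreOrd_initial:
  assumes "is_initial C (fst X)" "is_preord C X" shows "is_initial Pre X"
  unfolding is_initial_def
proof (intro conjI ballI)
  show "X \<in> Ob Pre" using assms(2) by simp
  fix Y assume "Y \<in> Ob Pre"
  then have Y: "is_preord C Y" by simp
  obtain u where u: "u \<in> Ar C" "Dom C u = fst X" "Cod C u = fst Y"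
    by (rule initial_arrow[OF assms(1) preordD(1)[OF Y]])
  have "rel_mem C (snd Y) (u \<cdot> x) (u \<cdot> y)" if xy: "rel_mem C (snd X) x y" for x y
  proof -
    note [simp] = preord_memD[OF assms(2) xy] u
    have "is_initial C (Dom C x)" by (rule strict_initial) (simp_all add: assms(1))
    then have "u \<cdot> x = u \<cdot> y" by - (rule initial_eq, simp_all)
    then show ?thesis using preordD(3)[OF Y, of "u \<cdot> x"] by simp
  qed
  then have a: "(X, u, Y) \<in> Ar Pre" using u assms(2) Y by (simp add: PreOrd_Ar_iff)
  show "\<exists>!f. f \<in> hom Pre X Y"
  proof (rule ex1I[of _ "(X, u, Y)"])
    show "(X, u, Y) \<in> hom Pre X Y" using a by simp
    fix F assume F: "F \<in> hom Pre X Y"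
    then obtain v where v: "F = (X, v, Y)" "(X, v, Y) \<in> Ar Pre" by (cases F) auto
    have "v = u" by (rule initial_eq) (use PreOrd_ArD[OF v(2)] u assms(1) in simp_all)
    then show "F = (X, u, Y)" by (simp add: v)
  qed
qed

lemma PreOrd_initialD:
  assumes "is_initial Pre X" shows "is_initial C (fst X)"
proof -
  obtain I where I: "is_initial C I" by (rule initial_exists)
  then have "I \<in> Ob C" by (simp add: is_initial_def)
  then have "disc I \<in> Ob Pre" by (simp add: disc_preord)
  with assms obtain F where F: "F \<in> Ar Pre" "Dom Pre F = X" "Cod Pre F = disc I" by (rule PO.initial_arrow)
  obtain f where f: "F = (X, f, disc I)" using F by (cases F) auto
  show ?thesis using strict_initial[of f] PreOrd_ArD[OF F(1)[unfolded f]] I by simp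
qed

lemma PreOrd_terminal:
  assumes "is_terminal C A" shows "is_terminal Pre (disc A)"
  unfolding is_terminal_def
proof (intro conjI ballI)
  have A: "A \<in> Ob C" using assms by (simp add: is_terminal_def)
  show "disc A \<in> Ob Pre" using A by (simp add: disc_preord)
  fix Y assume "Y \<in> Ob Pre"
  then have Y: "is_preord C Y" by simp
  obtain u where u: "u \<in> Ar C" "Dom C u = fst Y" "Cod C u = A"
    by (rule terminal_arrow[OF assms preordD(1)[OF Y]])
  have "rel_mem C (diagonal C A) (u \<cdot> x) (u \<cdot> y)" if xy: "rel_mem C (snd Y) x y" for x y
  proof -
    note [simp] = preord_memD[OF Y xy] u
    have "u \<cdot> x = u \<cdot> y" by (rule terminal_eq) (simp_all add: assms)
    then show ?thesis by (simp add: in_diagonal_iff A)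
  qed
  then have a: "(Y, u, disc A) \<in> Ar Pre" using u A Y by (simp add: PreOrd_Ar_iff disc_preord)
  show "\<exists>!f. f \<in> hom Pre Y (disc A)"
  proof (rule ex1I[of _ "(Y, u, disc A)"])
    show "(Y, u, disc A) \<in> hom Pre Y (disc A)" using a by simp
    fix F assume F: "F \<in> hom Pre Y (disc A)"
    then obtain v where v: "F = (Y, v, disc A)" "(Y, v, disc A) \<in> Ar Pre" by (cases F) auto
    have "v = u" by (rule terminal_eq) (use PreOrd_ArD[OF v(2)] u assms in simp_all)
    then show "F = (Y, u, disc A)" by (simp add: v)
  qed
qed

text \<open>The pullback carries the intersection of the orders pulled back along \<open>p\<close>
  and \<open>q\<close>. That this order reflects relatedness is exported, since universality of sums
  of preorders needs it.\<close>

lemma PreOrd_pullback: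
  assumes f: "(X, f, W) \<in> Ar Pre" and g: "(Y, g, W) \<in> Ar Pre" and pb: "is_pullback C f g p q"
  obtains D where "fst D = Dom C p" "(D, p, X) \<in> Ar Pre" "(D, q, Y) \<in> Ar Pre"
    "\<And>x y. x \<in> Ar C \<Longrightarrow> y \<in> Ar C \<Longrightarrow> Cod C x = Dom C p \<Longrightarrow> Cod C y = Dom C p \<Longrightarrow>
      rel_mem C (snd X) (p \<cdot> x) (p \<cdot> y) \<Longrightarrow> rel_mem C (snd Y) (q \<cdot> x) (q \<cdot> y) \<Longrightarrow> rel_mem C (snd D) x y"
    "is_pullback Pre (X, f, W) (Y, g, W) (D, p, X) (D, q, Y)"
proof -
  note [simp] = PreOrd_ArD(1-5)[OF f] PreOrd_ArD(1-5)[OF g] pullbackD(3-8)[OF pb]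
  have X: "is_preord C X" and Y: "is_preord C Y" by simp_all
  obtain R where R: "is_relation C (Dom C p) R" and R_iff: "\<And>x y. x \<in> Ar C \<Longrightarrow> y \<in> Ar C \<Longrightarrow> Cod C x = Dom C p \<Longrightarrow> Cod C y = Dom C p
      \<Longrightarrow> rel_mem C R x y \<longleftrightarrow> rel_mem C (snd X) (p \<cdot> x) (p \<cdot> y)"
    by (rule rel_inverse_image[OF preordD(2)[OF X], of p "Dom C p"]) simp_all
  obtain S where S: "is_relation C (Dom C p) S" and S_iff: "\<And>x y. x \<in> Ar C \<Longrightarrow> y \<in> Ar C \<Longrightarrow> Cod C x = Dom C p \<Longrightarrow> Cod C y = Dom C p
      \<Longrightarrow> rel_mem C S x y \<longleftrightarrow> rel_mem C (snd Y) (q \<cdot> x) (q \<cdot> y)"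
    by (rule rel_inverse_image[OF preordD(2)[OF Y], of q "Dom C p"]) simp_all
  obtain T where T: "is_relation C (Dom C p) T" and "\<And>x y. rel_mem C T x y \<longleftrightarrow> rel_mem C R x y \<and> rel_mem C S x y"
    by (rule rel_inter[OF R S]) blast
  then have T_iff: "rel_mem C T x y \<longleftrightarrow> rel_mem C (snd X) (p \<cdot> x) (p \<cdot> y) \<and> rel_mem C (snd Y) (q \<cdot> x) (q \<cdot> y)"
    if "x \<in> Ar C" "y \<in> Ar C" "Cod C x = Dom C p" "Cod C y = Dom C p" for x y
    using R_iff[OF that] S_iff[OF that] by simp
  let ?D = "(Dom C p, T)"
  have D: "is_preord C ?D"
  proof (rule preordI[OF T])
    show "rel_mem C T (Ide C (Dom C p)) (Ide C (Dom C p))"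
      using preordD(3)[OF X, of p] preordD(3)[OF Y, of q] by (simp add: T_iff)
    fix x y z assume xy: "rel_mem C T x y" "rel_mem C T y z"
    show "rel_mem C T x z"
      using xy rel_memD[OF xy(1) T] rel_memD[OF xy(2) T]
        preordD(4)[OF X, of "p \<cdot> x" "p \<cdot> y" "p \<cdot> z"] preordD(4)[OF Y, of "q \<cdot> x" "q \<cdot> y" "q \<cdot> z"]
      by (simp add: T_iff)
  qed
  have mono: "rel_mem C (snd X) (p \<cdot> x) (p \<cdot> y)" "rel_mem C (snd Y) (q \<cdot> x) (q \<cdot> y)" if xy: "rel_mem C T x y" for x y
    using T_iff[of x y] xy rel_memD[OF xy T] by simp_all
  have p: "(?D, p, X) \<in> Ar Pre" and q: "(?D, q, Y) \<in> Ar Pre"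
    using D mono by (simp_all add: PreOrd_Ar_iff)
  have "is_pullback Pre (X, f, W) (Y, g, W) (?D, p, X) (?D, q, Y)"
  proof (rule PO.pullbackI)
    fix u v assume u: "u \<in> Ar Pre" and v: "v \<in> Ar Pre" and d: "Dom Pre v = Dom Pre u" "Cod Pre u = Dom Pre (X, f, W)"
      "Cod Pre v = Dom Pre (Y, g, W)" and e: "(X, f, W) \<cdot>\<^bsub>Pre\<^esub> u = (Y, g, W) \<cdot>\<^bsub>Pre\<^esub> v"
    obtain E u0 where u0 [simp]: "u = (E, u0, X)" using d by (cases u) auto
    obtain v0 where v0 [simp]: "v = (E, v0, Y)" using d by (cases v) auto
    note [simp] = PreOrd_ArD(1-5)[OF u[unfolded u0]] PreOrd_ArD(1-5)[OF v[unfolded v0]]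
    obtain h where h [simp]: "h \<in> Ar C" "Dom C h = Dom C u0" "Cod C h = Dom C p" "p \<cdot> h = u0" "q \<cdot> h = v0"
      by (rule pullback_lift[OF pb, of u0 v0]) (use e in simp_all)
    have "rel_mem C T (h \<cdot> x) (h \<cdot> y)" if xy: "rel_mem C (snd E) x y" for x y
      using PreOrd_ArD(6)[OF u[unfolded u0] xy] PreOrd_ArD(6)[OF v[unfolded v0] xy] preord_memD[OF _ xy]
      by (simp add: T_iff reassoc[OF h(4)] reassoc[OF h(5)])
    then have "(E, h, ?D) \<in> Ar Pre" using D by (simp add: PreOrd_Ar_iff)
    then show "\<exists>h. h \<in> Ar Pre \<and> Dom Pre h = Dom Pre u \<and> Cod Pre h = Dom Pre (?D, p, X) \<and> (?D, p, X) \<cdot>\<^bsub>Pre\<^esub> h = u \<and> (?D, q, Y) \<cdot>\<^bsub>Pre\<^esub> h = v"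
      by (intro exI[of _ "(E, h, ?D)"]) simp
  next
    fix h k assume h: "h \<in> Ar Pre" and k: "k \<in> Ar Pre" and d: "Dom Pre k = Dom Pre h" "Cod Pre h = Dom Pre (?D, p, X)"
      "Cod Pre k = Dom Pre (?D, p, X)" and e: "(?D, p, X) \<cdot>\<^bsub>Pre\<^esub> h = (?D, p, X) \<cdot>\<^bsub>Pre\<^esub> k" "(?D, q, Y) \<cdot>\<^bsub>Pre\<^esub> h = (?D, q, Y) \<cdot>\<^bsub>Pre\<^esub> k"
    obtain E h0 where h0 [simp]: "h = (E, h0, ?D)" using d by (cases h) auto
    obtain k0 where k0 [simp]: "k = (E, k0, ?D)" using d by (cases k) auto
    have "h0 = k0"
      by (rule pullback_eq[OF pb]) (use e PreOrd_ArD[OF h[unfolded h0]] PreOrd_ArD[OF k[unfolded k0]] in simp_all)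
    then show "h = k" by simp
  qed (use f g p q pullbackD(9)[OF pb] in simp_all)
  then show thesis
    by (intro that[of ?D]) (simp_all add: p q T_iff)
qed

lemma has_finite_limits_PreOrd: "has_finite_limits Pre"
  unfolding has_finite_limits_def
proof (intro conjI ballI impI)
  show "\<exists>T. is_terminal Pre T" using PreOrd_terminal terminal_exists by metis
  fix F G assume F: "F \<in> Ar Pre" and G: "G \<in> Ar Pre" and c: "Cod Pre F = Cod Pre G"
  obtain X f W where f: "F = (X, f, W)" "(X, f, W) \<in> Ar Pre" using F by (rule PreOrd_ArE)
  obtain Y g where g: "G = (Y, g, W)" using c f by (cases G) auto
  have g': "(Y, g, W) \<in> Ar Pre" using G g by simp
  obtain p q where pb: "is_pullback C f g p q"
    by (rule pullback_exists[of f g]) (use PreOrd_ArD[OF f(2)] PreOrd_ArD[OF g'] in simp_all)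
  obtain D where "is_pullback Pre (X, f, W) (Y, g, W) (D, p, X) (D, q, Y)"
    by (rule PreOrd_pullback[OF f(2) g' pb])
  then show "\<exists>p q. is_pullback Pre F G p q" unfolding f g by blast
qed

text \<open>The part of the coproduct order that concerns the base category only. As a separate
  predicate it also applies to a given preorder over a pulled back decomposition, whose order was
  not built by \<open>rel_sum\<close>.\<close>

definition splits :: "'m \<Rightarrow> 'm \<Rightarrow> 'm \<times> 'm \<Rightarrow> 'm \<times> 'm \<Rightarrow> 'm \<times> 'm \<Rightarrow> bool" where
  "splits i j R S T \<longleftrightarrow> (\<forall>x y. rel_mem C T x y \<longrightarrow> (\<exists>d1 d2 x1 y1 x2 y2. is_coproduct C d1 d2 \<and> Cod C d1 = Dom C x \<and>
      rel_mem C R x1 y1 \<and> rel_mem C S x2 y2 \<and> x \<cdot> d1 = i \<cdot> x1 \<and> y \<cdot> d1 = i \<cdot> y1 \<and> x \<cdot> d2 = j \<cdot> x2 \<and> y \<cdot> d2 = j \<cdot> y2))"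

lemma splitsE:
  assumes "splits i j R S T" "rel_mem C T x y"
  obtains d1 d2 x1 y1 x2 y2 where "is_coproduct C d1 d2" "Cod C d1 = Dom C x"
    "rel_mem C R x1 y1" "rel_mem C S x2 y2" "x \<cdot> d1 = i \<cdot> x1" "y \<cdot> d1 = i \<cdot> y1" "x \<cdot> d2 = j \<cdot> x2" "y \<cdot> d2 = j \<cdot> y2"
  using assms unfolding splits_def by blast

lemma splits_sym:
  assumes s: "splits i j R S T" and T: "is_relation C A T" shows "splits j i S R T"
  unfolding splits_def
proof (intro allI impI)
  fix x y assume xy: "rel_mem C T x y"
  obtain d1 d2 x1 y1 x2 y2 where d: "is_coproduct C d1 d2" "Cod C d1 = Dom C x"
    "rel_mem C R x1 y1" "rel_mem C S x2 y2" "x \<cdot> d1 = i \<cdot> x1" "y \<cdot> d1 = i \<cdot> y1" "x \<cdot> d2 = j \<cdot> x2" "y \<cdot> d2 = j \<cdot> y2"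
    by (rule splitsE[OF s xy])
  have "Cod C d2 = Dom C x" using coproductD(3)[OF d(1)] d(2) by simp
  then show "\<exists>d1 d2 x1 y1 x2 y2. is_coproduct C d1 d2 \<and> Cod C d1 = Dom C x \<and>
      rel_mem C S x1 y1 \<and> rel_mem C R x2 y2 \<and> x \<cdot> d1 = j \<cdot> x1 \<and> y \<cdot> d1 = j \<cdot> y1 \<and> x \<cdot> d2 = i \<cdot> x2 \<and> y \<cdot> d2 = i \<cdot> y2"
    using coproduct_sym[OF d(1)] d by blast
qed

text \<open>The second pair is split. On one piece \<open>z\<close> lies in the same summand and
  transitivity of \<open>X\<close> applies; on the other \<open>y\<close> would lie in both
  summands, so this piece is initial and reflexivity of \<open>T\<close> suffices.\<close>

lemma splits_trans:
  assumes X: "is_preord C X" and Y: "is_preord C Y" and c: "is_coproduct C i j" "Dom C i = fst X" "Dom C j = fst Y"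
    and T: "is_relation C (Cod C i) T" "rel_mem C T (Ide C (Cod C i)) (Ide C (Cod C i))"
    and i: "\<And>x y. rel_mem C (snd X) x y \<Longrightarrow> rel_mem C T (i \<cdot> x) (i \<cdot> y)"
    and s: "splits i j (snd X) (snd Y) T"
    and xy: "rel_mem C (snd X) x y" and yz: "rel_mem C T (i \<cdot> y) z"
  shows "rel_mem C T (i \<cdot> x) z"
proof -
  note [simp] = coproductD[OF c(1)] c(2,3) preord_memD[OF X xy]
  note [simp] = rel_memD(2,3,5)[OF yz T(1)]
  obtain d1 d2 y1 z1 y2 z2 where d: "is_coproduct C d1 d2" "Cod C d1 = Dom C (i \<cdot> y)"
    and 1: "rel_mem C (snd X) y1 z1" "(i \<cdot> y) \<cdot> d1 = i \<cdot> y1" "z \<cdot> d1 = i \<cdot> z1"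
    and 2: "rel_mem C (snd Y) y2 z2" "(i \<cdot> y) \<cdot> d2 = j \<cdot> y2" "z \<cdot> d2 = j \<cdot> z2" by (rule splitsE[OF s yz])
  have dx: "Cod C d1 = Dom C x" using d(2) by simp
  note [simp] = coproductD[OF d(1)] dx preord_memD[OF X 1(1)] preord_memD[OF Y 2(1)]
  have "y \<cdot> d1 = y1" by (rule mono_cancel[OF coproj_mono(1)[OF c(1)]]) (use 1(2) in simp_all)
  then have "rel_mem C (snd X) (x \<cdot> d1) y1" using rel_mem_comp[OF xy preordD(2)[OF X], of d1] by simp
  then have "rel_mem C (snd X) (x \<cdot> d1) z1" using 1(1) by (rule preordD(4)[OF X])
  then have on1: "rel_mem C T (i \<cdot> x \<cdot> d1) (z \<cdot> d1)" using i by (simp add: 1(3))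
  have "i \<cdot> y \<cdot> d2 = j \<cdot> y2" using 2(2) by simp
  then have "is_initial C (Dom C (y \<cdot> d2))" by (rule disjoint[OF c(1)]) simp_all
  then have "i \<cdot> x \<cdot> d2 = z \<cdot> d2" by - (rule initial_eq, simp_all)
  then have on2: "rel_mem C T (i \<cdot> x \<cdot> d2) (z \<cdot> d2)" using rel_mem_comp[OF T(2,1), of "z \<cdot> d2"] by simp
  show ?thesis by (rule rel_mem_local[OF T(1) d(1)]) (simp_all add: on1 on2)
qed

lemma splits_copair:
  assumes X: "is_preord C X" and Y: "is_preord C Y" and c: "is_coproduct C i j" "Dom C i = fst X" "Dom C j = fst Y"
    and T: "is_relation C (Cod C i) T" and s: "splits i j (snd X) (snd Y) T" and W: "is_relation C A W"
    and h: "h \<in> Ar C" "Dom C h = Cod C i" "Cod C h = A"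
    and hi: "\<And>x y. rel_mem C (snd X) x y \<Longrightarrow> rel_mem C W (h \<cdot> i \<cdot> x) (h \<cdot> i \<cdot> y)"
    and hj: "\<And>x y. rel_mem C (snd Y) x y \<Longrightarrow> rel_mem C W (h \<cdot> j \<cdot> x) (h \<cdot> j \<cdot> y)"
    and xy: "rel_mem C T x y"
  shows "rel_mem C W (h \<cdot> x) (h \<cdot> y)"
proof -
  note [simp] = coproductD[OF c(1)] c(2,3) rel_memD[OF xy T] h
  obtain d1 d2 x1 y1 x2 y2 where d: "is_coproduct C d1 d2" "Cod C d1 = Dom C x"
    and 1: "rel_mem C (snd X) x1 y1" "x \<cdot> d1 = i \<cdot> x1" "y \<cdot> d1 = i \<cdot> y1"
    and 2: "rel_mem C (snd Y) x2 y2" "x \<cdot> d2 = j \<cdot> x2" "y \<cdot> d2 = j \<cdot> y2" by (rule splitsE[OF s xy])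
  note [simp] = coproductD[OF d(1)] d(2)
  show ?thesis
    by (rule rel_mem_local[OF W d(1)]) (simp_all add: 1(2,3) 2(2,3) hi[OF 1(1)] hj[OF 2(1)])
qed

text \<open>Transitivity of the sum order is proved by splitting the first related pair and using
  \<open>splits_trans\<close> on each piece, the second time with the summands exchanged.\<close>

lemma PreOrd_sum:
  assumes X: "is_preord C X" and Y: "is_preord C Y"
  obtains i j U where "is_coproduct C i j" "Dom C i = fst X" "Dom C j = fst Y" "Cod C i = fst U"
    "(X, i, U) \<in> Ar Pre" "(Y, j, U) \<in> Ar Pre" "splits i j (snd X) (snd Y) (snd U)"
    "is_coproduct Pre (X, i, U) (Y, j, U)"
proof -
  obtain i j where c: "is_coproduct C i j" and ij [simp]: "Dom C i = fst X" "Dom C j = fst Y" "i \<in> Ar C" "j \<in> Ar C" "Cod C j = Cod C i"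
    by (rule coproduct_exists[OF preordD(1)[OF X] preordD(1)[OF Y]])
  obtain T where T: "is_relation C (Cod C i) T"
    and Ti: "\<And>x y. rel_mem C (snd X) x y \<Longrightarrow> rel_mem C T (i \<cdot> x) (i \<cdot> y)"
    and Tj: "\<And>x y. rel_mem C (snd Y) x y \<Longrightarrow> rel_mem C T (j \<cdot> x) (j \<cdot> y)"
    and "\<And>x y. rel_mem C T x y \<Longrightarrow> \<exists>d1 d2 x1 y1 x2 y2. is_coproduct C d1 d2 \<and> Cod C d1 = Dom C x \<and>
      rel_mem C (snd X) x1 y1 \<and> rel_mem C (snd Y) x2 y2 \<and> x \<cdot> d1 = i \<cdot> x1 \<and> y \<cdot> d1 = i \<cdot> y1 \<and> x \<cdot> d2 = j \<cdot> x2 \<and> y \<cdot> d2 = j \<cdot> y2"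
    by (rule rel_sum[OF preordD(2)[OF X] preordD(2)[OF Y] c ij(1,2)]) blast
  then have s: "splits i j (snd X) (snd Y) T" unfolding splits_def by blast
  have s': "splits j i (snd Y) (snd X) T" by (rule splits_sym[OF s T])
  note [simp] = preordD(1)[OF X] preordD(1)[OF Y]
  have ii: "rel_mem C T i i" "rel_mem C T j j"
    using Ti[OF preordD(3)[OF X, of "Ide C (fst X)"]] Tj[OF preordD(3)[OF Y, of "Ide C (fst Y)"]] by simp_all
  have r: "rel_mem C T (Ide C (Cod C i)) (Ide C (Cod C i))"
    by (rule rel_mem_local[OF T c]) (simp_all add: ii)
  let ?U = "(Cod C i, T)"
  have U: "is_preord C ?U"
  proof (rule preordI[OF T r])
    fix x y z assume xy: "rel_mem C T x y" and yz: "rel_mem C T y z"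
    note [simp] = rel_memD[OF xy T] rel_memD(2,3,5)[OF yz T]
    obtain d1 d2 x1 y1 x2 y2 where d: "is_coproduct C d1 d2" "Cod C d1 = Dom C x"
      and 1: "rel_mem C (snd X) x1 y1" "x \<cdot> d1 = i \<cdot> x1" "y \<cdot> d1 = i \<cdot> y1"
      and 2: "rel_mem C (snd Y) x2 y2" "x \<cdot> d2 = j \<cdot> x2" "y \<cdot> d2 = j \<cdot> y2" by (rule splitsE[OF s xy])
    note [simp] = coproductD[OF d(1)] d(2)
    have e1: "rel_mem C T (i \<cdot> y1) (z \<cdot> d1)" using rel_mem_comp[OF yz T, of d1] by (simp add: 1)
    have e2: "rel_mem C T (j \<cdot> y2) (z \<cdot> d2)" using rel_mem_comp[OF yz T, of d2] by (simp add: 2)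
    have "rel_mem C T (i \<cdot> x1) (z \<cdot> d1)"
      by (rule splits_trans[OF X Y c ij(1,2) T r Ti s 1(1) e1])
    moreover have "rel_mem C T (j \<cdot> x2) (z \<cdot> d2)"
      by (rule splits_trans[OF Y X coproduct_sym[OF c] ij(2,1) _ _ Tj s' 2(1) e2]) (simp_all add: T r)
    ultimately show "rel_mem C T x z" by - (rule rel_mem_local[OF T d(1)], simp_all add: 1 2)
  qed
  have i: "(X, i, ?U) \<in> Ar Pre" and j: "(Y, j, ?U) \<in> Ar Pre"
    using X Y U Ti Tj by (simp_all add: PreOrd_Ar_iff)
  have "is_coproduct Pre (X, i, ?U) (Y, j, ?U)"
  proof (rule PO.coproductI)
    fix F G assume F: "F \<in> Ar Pre" and G: "G \<in> Ar Pre" and d: "Dom Pre F = Dom Pre (X, i, ?U)" "Dom Pre G = Dom Pre (Y, j, ?U)"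
      "Cod Pre G = Cod Pre F"
    obtain f W where f [simp]: "F = (X, f, W)" using d by (cases F) auto
    obtain g where g [simp]: "G = (Y, g, W)" using d by (cases G) auto
    note f' = F[unfolded f] and g' = G[unfolded g]
    note [simp] = PreOrd_ArD(1-5)[OF f'] PreOrd_ArD(1-5)[OF g']
    have W: "is_preord C W" by simp
    obtain h where h [simp]: "h \<in> Ar C" "Dom C h = Cod C i" "Cod C h = fst W" "h \<cdot> i = f" "h \<cdot> j = g"
      by (rule copair[OF c, of f g]) simp_all
    have hi: "rel_mem C (snd W) (h \<cdot> i \<cdot> x) (h \<cdot> i \<cdot> y)" if xy: "rel_mem C (snd X) x y" for x y
      using PreOrd_ArD(6)[OF f' xy] preord_memD[OF X xy] by (simp add: reassoc[OF h(4)])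
    have hj: "rel_mem C (snd W) (h \<cdot> j \<cdot> x) (h \<cdot> j \<cdot> y)" if xy: "rel_mem C (snd Y) x y" for x y
      using PreOrd_ArD(6)[OF g' xy] preord_memD[OF Y xy] by (simp add: reassoc[OF h(5)])
    have "rel_mem C (snd W) (h \<cdot> x) (h \<cdot> y)" if xy: "rel_mem C T x y" for x y
      by (rule splits_copair[OF X Y c ij(1,2) T s preordD(2)[OF W] h(1-3) hi hj xy])
    then have "(?U, h, W) \<in> Ar Pre" using U by (simp add: PreOrd_Ar_iff)
    then show "\<exists>h. h \<in> Ar Pre \<and> Dom Pre h = Cod Pre (X, i, ?U) \<and> Cod Pre h = Cod Pre F \<and> h \<cdot>\<^bsub>Pre\<^esub> (X, i, ?U) = F \<and> h \<cdot>\<^bsub>Pre\<^esub> (Y, j, ?U) = G"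
      by (intro exI[of _ "(?U, h, W)"]) simp
  next
    fix h k assume h: "h \<in> Ar Pre" and k: "k \<in> Ar Pre" and d: "Dom Pre h = Cod Pre (X, i, ?U)" "Dom Pre k = Cod Pre (X, i, ?U)"
      "Cod Pre k = Cod Pre h" and e: "h \<cdot>\<^bsub>Pre\<^esub> (X, i, ?U) = k \<cdot>\<^bsub>Pre\<^esub> (X, i, ?U)" "h \<cdot>\<^bsub>Pre\<^esub> (Y, j, ?U) = k \<cdot>\<^bsub>Pre\<^esub> (Y, j, ?U)"
    obtain h0 W where h0 [simp]: "h = (?U, h0, W)" using d by (cases h) auto
    obtain k0 where k0 [simp]: "k = (?U, k0, W)" using d by (cases k) auto
    have "h0 = k0"
      by (rule coproduct_eq[OF c]) (use e PreOrd_ArD[OF h[unfolded h0]] PreOrd_ArD[OF k[unfolded k0]] in simp_all)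
    then show "h = k" by simp
  qed (use i j in simp_all)
  then show thesis
    by (intro that[OF c, of ?U]) (simp_all add: i j s)
qed

text \<open>A related pair of \<open>W\<close> has its image in \<open>U\<close> split. The pieces
  lift to the pullbacks \<open>D\<close> and \<open>E\<close>, and the lifts are related there
  because the pullback orders reflect relatedness. Hence the order of \<open>W\<close> is the
  coproduct order.\<close>

lemma PreOrd_sum_universal:
  assumes X: "is_preord C X" and Y: "is_preord C Y" and c: "is_coproduct C i j" "Dom C i = fst X" "Dom C j = fst Y"
    and i: "(X, i, U) \<in> Ar Pre" and j: "(Y, j, U) \<in> Ar Pre" and s: "splits i j (snd X) (snd Y) (snd U)"
    and f: "(W, f, U) \<in> Ar Pre"
  shows "\<exists>p p' q q'. is_pullback Pre (W, f, U) (X, i, U) p p' \<and> is_pullback Pre (W, f, U) (Y, j, U) q q' \<and> is_coproduct Pre p q"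
proof -
  note [simp] = PreOrd_ArD(1-5)[OF i] PreOrd_ArD(3-5)[OF j] PreOrd_ArD(1-5)[OF f]
  have W: "is_preord C W" by simp
  obtain p q p' q' where pq: "is_coproduct C p q" and pb: "is_pullback C f i p p'" and pb': "is_pullback C f j q q'"
    by (rule decompose[OF c(1), of f]) simp_all
  note [simp] = coproductD[OF pq] pullbackD(4,6-8)[OF pb] pullbackD(4,6-8)[OF pb']
  obtain D where D [simp]: "fst D = Dom C p" and p: "(D, p, W) \<in> Ar Pre" and p': "(D, p', X) \<in> Ar Pre"
    and Dm: "\<And>x y. x \<in> Ar C \<Longrightarrow> y \<in> Ar C \<Longrightarrow> Cod C x = Dom C p \<Longrightarrow> Cod C y = Dom C p \<Longrightarrow>
      rel_mem C (snd W) (p \<cdot> x) (p \<cdot> y) \<Longrightarrow> rel_mem C (snd X) (p' \<cdot> x) (p' \<cdot> y) \<Longrightarrow> rel_mem C (snd D) x y"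
    and PB: "is_pullback Pre (W, f, U) (X, i, U) (D, p, W) (D, p', X)" by (rule PreOrd_pullback[OF f i pb]) blast
  obtain E where E [simp]: "fst E = Dom C q" and q: "(E, q, W) \<in> Ar Pre" and q': "(E, q', Y) \<in> Ar Pre"
    and Em: "\<And>x y. x \<in> Ar C \<Longrightarrow> y \<in> Ar C \<Longrightarrow> Cod C x = Dom C q \<Longrightarrow> Cod C y = Dom C q \<Longrightarrow>
      rel_mem C (snd W) (q \<cdot> x) (q \<cdot> y) \<Longrightarrow> rel_mem C (snd Y) (q' \<cdot> x) (q' \<cdot> y) \<Longrightarrow> rel_mem C (snd E) x y"
    and PB': "is_pullback Pre (W, f, U) (Y, j, U) (E, q, W) (E, q', Y)" by (rule PreOrd_pullback[OF f j pb']) blast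
  note [simp] = PreOrd_ArD(1)[OF p] PreOrd_ArD(1)[OF q]
  have DE: "is_preord C D" "is_preord C E" by simp_all
  have s': "splits p q (snd D) (snd E) (snd W)"
    unfolding splits_def
  proof (intro allI impI)
    fix x y assume xy: "rel_mem C (snd W) x y"
    note [simp] = preord_memD[OF W xy]
    have fxy: "rel_mem C (snd U) (f \<cdot> x) (f \<cdot> y)" by (rule PreOrd_ArD(6)[OF f xy])
    obtain d1 d2 x1 y1 x2 y2 where d: "is_coproduct C d1 d2" "Cod C d1 = Dom C (f \<cdot> x)"
      and 1: "rel_mem C (snd X) x1 y1" "(f \<cdot> x) \<cdot> d1 = i \<cdot> x1" "(f \<cdot> y) \<cdot> d1 = i \<cdot> y1"
      and 2: "rel_mem C (snd Y) x2 y2" "(f \<cdot> x) \<cdot> d2 = j \<cdot> x2" "(f \<cdot> y) \<cdot> d2 = j \<cdot> y2" by (rule splitsE[OF s fxy])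
    have [simp]: "Cod C d1 = Dom C x" using d(2) by simp
    note [simp] = coproductD[OF d(1)] preord_memD[OF X 1(1)] preord_memD[OF Y 2(1)]
    have [simp]: "Dom C x1 = Dom C d1" "Dom C x2 = Dom C d2"
      using arg_cong[OF 1(2), of "Dom C"] arg_cong[OF 2(2), of "Dom C"] by (simp_all add: c)
    obtain a where a [simp]: "a \<in> Ar C" "Dom C a = Dom C d1" "Cod C a = Dom C p" "p \<cdot> a = x \<cdot> d1" "p' \<cdot> a = x1"
      by (rule pullback_lift[OF pb, of "x \<cdot> d1" x1]) (use 1(2) c in simp_all)
    obtain b where b [simp]: "b \<in> Ar C" "Dom C b = Dom C d1" "Cod C b = Dom C p" "p \<cdot> b = y \<cdot> d1" "p' \<cdot> b = y1"
      by (rule pullback_lift[OF pb, of "y \<cdot> d1" y1]) (use 1(3) c in simp_all)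
    obtain a' where a' [simp]: "a' \<in> Ar C" "Dom C a' = Dom C d2" "Cod C a' = Dom C q" "q \<cdot> a' = x \<cdot> d2" "q' \<cdot> a' = x2"
      by (rule pullback_lift[OF pb', of "x \<cdot> d2" x2]) (use 2(2) c in simp_all)
    obtain b' where b' [simp]: "b' \<in> Ar C" "Dom C b' = Dom C d2" "Cod C b' = Dom C q" "q \<cdot> b' = y \<cdot> d2" "q' \<cdot> b' = y2"
      by (rule pullback_lift[OF pb', of "y \<cdot> d2" y2]) (use 2(3) c in simp_all)
    have "rel_mem C (snd D) a b"
      by (rule Dm) (simp_all add: 1(1) rel_mem_comp[OF xy preordD(2)[OF W]])
    moreover have "rel_mem C (snd E) a' b'"
      by (rule Em) (simp_all add: 2(1) rel_mem_comp[OF xy preordD(2)[OF W]])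
    ultimately show "\<exists>d1 d2 x1 y1 x2 y2. is_coproduct C d1 d2 \<and> Cod C d1 = Dom C x \<and>
      rel_mem C (snd D) x1 y1 \<and> rel_mem C (snd E) x2 y2 \<and> x \<cdot> d1 = p \<cdot> x1 \<and> y \<cdot> d1 = p \<cdot> y1 \<and> x \<cdot> d2 = q \<cdot> x2 \<and> y \<cdot> d2 = q \<cdot> y2"
      using d(1) by (intro exI[of _ d1] exI[of _ d2] exI[of _ a] exI[of _ b] exI[of _ a'] exI[of _ b']) simp
  qed
  have "is_coproduct Pre (D, p, W) (E, q, W)"
  proof (rule PO.coproductI)
    fix F G assume F: "F \<in> Ar Pre" and G: "G \<in> Ar Pre" and d: "Dom Pre F = Dom Pre (D, p, W)" "Dom Pre G = Dom Pre (E, q, W)"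
      "Cod Pre G = Cod Pre F"
    obtain u V where u [simp]: "F = (D, u, V)" using d by (cases F) auto
    obtain v where v [simp]: "G = (E, v, V)" using d by (cases G) auto
    note u' = F[unfolded u] and v' = G[unfolded v]
    note [simp] = PreOrd_ArD(2-5)[OF u'] PreOrd_ArD(2-5)[OF v']
    have V: "is_preord C V" by simp
    obtain h where h [simp]: "h \<in> Ar C" "Dom C h = Cod C p" "Cod C h = fst V" "h \<cdot> p = u" "h \<cdot> q = v"
      by (rule copair[OF pq, of u v]) simp_all
    have hp: "rel_mem C (snd V) (h \<cdot> p \<cdot> x) (h \<cdot> p \<cdot> y)" if xy: "rel_mem C (snd D) x y" for x y
      using PreOrd_ArD(6)[OF u' xy] preord_memD[OF DE(1) xy] by (simp add: reassoc[OF h(4)])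
    have hq: "rel_mem C (snd V) (h \<cdot> q \<cdot> x) (h \<cdot> q \<cdot> y)" if xy: "rel_mem C (snd E) x y" for x y
      using PreOrd_ArD(6)[OF v' xy] preord_memD[OF DE(2) xy] by (simp add: reassoc[OF h(5)])
    have Wr: "is_relation C (Cod C p) (snd W)" using preordD(2)[OF W] by simp
    have "rel_mem C (snd V) (h \<cdot> x) (h \<cdot> y)" if xy: "rel_mem C (snd W) x y" for x y
      by (rule splits_copair[OF DE pq _ _ Wr s' preordD(2)[OF V] h(1-3) hp hq xy]) simp_all
    then have "(W, h, V) \<in> Ar Pre" by (simp add: PreOrd_Ar_iff)
    then show "\<exists>h. h \<in> Ar Pre \<and> Dom Pre h = Cod Pre (D, p, W) \<and> Cod Pre h = Cod Pre F \<and> h \<cdot>\<^bsub>Pre\<^esub> (D, p, W) = F \<and> h \<cdot>\<^bsub>Pre\<^esub> (E, q, W) = G"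
      by (intro exI[of _ "(W, h, V)"]) simp
  next
    fix h k assume h: "h \<in> Ar Pre" and k: "k \<in> Ar Pre" and d: "Dom Pre h = Cod Pre (D, p, W)" "Dom Pre k = Cod Pre (D, p, W)"
      "Cod Pre k = Cod Pre h" and e: "h \<cdot>\<^bsub>Pre\<^esub> (D, p, W) = k \<cdot>\<^bsub>Pre\<^esub> (D, p, W)" "h \<cdot>\<^bsub>Pre\<^esub> (E, q, W) = k \<cdot>\<^bsub>Pre\<^esub> (E, q, W)"
    obtain h0 V where h0 [simp]: "h = (W, h0, V)" using d by (cases h) auto
    obtain k0 where k0 [simp]: "k = (W, k0, V)" using d by (cases k) auto
    have "h0 = k0"
      by (rule coproduct_eq[OF pq]) (use e PreOrd_ArD[OF h[unfolded h0]] PreOrd_ArD[OF k[unfolded k0]] in simp_all)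
    then show "h = k" by simp
  qed (use p q in simp_all)
  then show ?thesis using PB PB' by blast
qed

lemma extensive_PreOrd: "extensive Pre"
proof (rule PO.extensiveI)
  obtain I where I: "is_initial C I" by (rule initial_exists)
  then have "is_initial Pre (disc I)" by (intro PreOrd_initial) (simp_all add: disc_preord is_initial_def)
  then show "\<exists>I. is_initial Pre I" by blast
next
  fix F assume F: "F \<in> Ar Pre" and I: "is_initial Pre (Cod Pre F)"
  obtain X f Y where f: "F = (X, f, Y)" "(X, f, Y) \<in> Ar Pre" using F by (rule PreOrd_ArE)
  have "is_initial C (fst Y)" using PreOrd_initialD I f by simp
  then have "is_initial C (fst X)" using strict_initial[of f] PreOrd_ArD[OF f(2)] by simp
  then show "is_initial Pre (Dom Pre F)" using PreOrd_initial PreOrd_ArD(1)[OF f(2)] f by simp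
next
  fix X Y assume "X \<in> Ob Pre" "Y \<in> Ob Pre"
  then have X: "is_preord C X" and Y: "is_preord C Y" by simp_all
  obtain i j U where c: "is_coproduct C i j" "Dom C i = fst X" "Dom C j = fst Y"
    and U: "Cod C i = fst U" and i: "(X, i, U) \<in> Ar Pre" and j: "(Y, j, U) \<in> Ar Pre" and s: "splits i j (snd X) (snd Y) (snd U)"
    and C: "is_coproduct Pre (X, i, U) (Y, j, U)" by (rule PreOrd_sum[OF X Y])
  note [simp] = PreOrd_ArD(3-5)[OF i] PreOrd_ArD(3-5)[OF j]
  show "\<exists>i j. is_coproduct Pre i j \<and> Dom Pre i = X \<and> Dom Pre j = Y \<and> is_mono Pre i \<and> is_mono Pre j \<and>
      (\<exists>p q. is_pullback Pre i j p q \<and> is_initial Pre (Dom Pre p)) \<and>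
      (\<forall>f\<in>Ar Pre. Cod Pre f = Cod Pre i \<longrightarrow>
        (\<exists>p p' q q'. is_pullback Pre f i p p' \<and> is_pullback Pre f j q q' \<and> is_coproduct Pre p q))"
  proof (rule exI[of _ "(X, i, U)"], rule exI[of _ "(Y, j, U)"], intro conjI ballI impI)
    show "is_mono Pre (X, i, U)" "is_mono Pre (Y, j, U)"
      using PreOrd_mono[OF i] PreOrd_mono[OF j] coproj_mono[OF c(1)] by simp_all
    obtain p q where pb: "is_pullback C i j p q" by (rule pullback_exists[of i j]) simp_all
    obtain D where D: "fst D = Dom C p" "(D, p, X) \<in> Ar Pre" "is_pullback Pre (X, i, U) (Y, j, U) (D, p, X) (D, q, Y)"
      by (rule PreOrd_pullback[OF i j pb]) blast
    have "is_initial C (Dom C p)" by (rule disjoint[OF c(1) pullbackD(9)[OF pb]]) (use pullbackD[OF pb] in simp_all)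
    then have "is_initial Pre D" using PreOrd_initial PreOrd_ArD(1)[OF D(2)] D(1) by simp
    then show "\<exists>p q. is_pullback Pre (X, i, U) (Y, j, U) p q \<and> is_initial Pre (Dom Pre p)"
      using D(3) by (intro exI[of _ "(D, p, X)"] exI[of _ "(D, q, Y)"]) simp
    fix F assume F: "F \<in> Ar Pre" "Cod Pre F = Cod Pre (X, i, U)"
    obtain W f where f: "F = (W, f, U)" using F by (cases F) auto
    show "\<exists>p p' q q'. is_pullback Pre F (X, i, U) p p' \<and> is_pullback Pre F (Y, j, U) q q' \<and> is_coproduct Pre p q"
      unfolding f by (rule PreOrd_sum_universal[OF X Y c i j s]) (use F f in simp)
  qed (use C in simp_all)
qed


subsection \<open>Equivalence relations and partial orders\<close>

abbreviation ZOb :: "('o, 'm) preord set" where "ZOb \<equiv> EqOb C \<inter> ParOrdOb C"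

lemma EqOb_iff: "X \<in> EqOb C \<longleftrightarrow> is_preord C X \<and> (\<forall>x y. rel_mem C (snd X) x y \<longrightarrow> rel_mem C (snd X) y x)"
  using symmetric_iff[OF preordD(2), of X] by (cases X) (auto simp: EqOb_def)

text \<open>The intersection of the order with its opposite exists as a relation, so its being below
  the diagonal can be read on elements.\<close>

lemma ParOrdOb_iff:
  "X \<in> ParOrdOb C \<longleftrightarrow> is_preord C X \<and> (\<forall>x y. rel_mem C (snd X) x y \<longrightarrow> rel_mem C (snd X) y x \<longrightarrow> x = y)"
proof (cases "is_preord C X")
  case True
  obtain A R where X: "X = (A, R)" by (cases X)
  have R: "is_relation C A R" and A: "A \<in> Ob C" and refl: "rel_mem C R (Ide C A) (Ide C A)"
    using preordD(1,2)[OF True] preordD(3)[OF True, of "Ide C A"] by (simp_all add: X)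
  note op = rel_op_relation[OF R] and dg = diagonal_relation[OF A]
  have "is_rel_meet C A (diagonal C A) R (rel_op R) \<longleftrightarrow> (\<forall>x y. rel_mem C R x y \<longrightarrow> rel_mem C R y x \<longrightarrow> x = y)"
  proof
    assume m: "is_rel_meet C A (diagonal C A) R (rel_op R)"
    obtain U where U: "is_relation C A U" and Ui: "\<And>x y. rel_mem C U x y \<longleftrightarrow> rel_mem C R x y \<and> rel_mem C (rel_op R) x y"
      by (rule rel_inter[OF R op]) blast
    have "rel_le C U R" "rel_le C U (rel_op R)"
      using rel_mem_self[OF U] by (simp_all add: rel_le_iff[OF U R] rel_le_iff[OF U op] Ui)
    then have "rel_le C U (diagonal C A)" using m U unfolding is_rel_meet_def by blast
    then have "rel_mem C (diagonal C A) (fst U) (snd U)" by (simp add: rel_le_iff[OF U dg])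
    then have "x = y" if "rel_mem C U x y" for x y
      using rel_mem_mono[OF _ that U dg] A by (simp add: in_diagonal_iff)
    then show "\<forall>x y. rel_mem C R x y \<longrightarrow> rel_mem C R y x \<longrightarrow> x = y" by (simp add: Ui rel_mem_op[OF R])
  next
    assume *: "\<forall>x y. rel_mem C R x y \<longrightarrow> rel_mem C R y x \<longrightarrow> x = y"
    show "is_rel_meet C A (diagonal C A) R (rel_op R)"
      unfolding is_rel_meet_def
    proof (intro conjI allI impI)
      show "rel_le C (diagonal C A) R" "rel_le C (diagonal C A) (rel_op R)"
        using refl by (simp_all add: rel_le_iff[OF dg R] rel_le_iff[OF dg op] rel_mem_op[OF R]) (simp_all add: diagonal_def)
      fix U assume "is_relation C A U \<and> rel_le C U R \<and> rel_le C U (rel_op R)"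
      then have U: "is_relation C A U" "rel_mem C R (fst U) (snd U)" "rel_mem C R (snd U) (fst U)"
        using rel_le_iff[OF _ R, of U] rel_le_iff[OF _ op, of U] rel_mem_op[OF R] by auto
      then have "fst U = snd U" using * by blast
      then show "rel_le C U (diagonal C A)"
        using relationD[OF U(1)] A by (simp add: rel_le_iff[OF U(1) dg] in_diagonal_iff)
    qed (rule dg)
  qed
  then show ?thesis using True by (simp add: ParOrdOb_def X)
next
  case False
  then show ?thesis by (cases X) (auto simp: ParOrdOb_def simp del: is_preord.simps)
qed

lemma ZOb_iff: "X \<in> ZOb \<longleftrightarrow> is_preord C X \<and> (\<forall>x y. rel_mem C (snd X) x y \<longrightarrow> x = y)"
  by (auto simp: EqOb_iff ParOrdOb_iff)

lemma disc_ZOb: "A \<in> Ob C \<Longrightarrow> disc A \<in> ZOb"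
  unfolding ZOb_iff by (auto simp: disc_preord in_diagonal_iff)

text \<open>An object of \<open>ZOb\<close> relates only equal elements, so an arrow through it
  identifies related ones. Conversely such an arrow is monotone into the discrete preorder on the
  object underlying its target, and factors through that.\<close>

lemma trivial_iff:
  "trivial_arrow Pre ZOb (X, f, Y) \<longleftrightarrow> (X, f, Y) \<in> Ar Pre \<and> (\<forall>x y. rel_mem C (snd X) x y \<longrightarrow> f \<cdot> x = f \<cdot> y)"
proof
  assume t: "trivial_arrow Pre ZOb (X, f, Y)"
  then obtain G H where GH: "(X, f, Y) = H \<cdot>\<^bsub>Pre\<^esub> G" "G \<in> Ar Pre" "H \<in> Ar Pre" "Cod Pre G = Dom Pre H" "Cod Pre G \<in> ZOb"
    by (rule PO.trivE)
  obtain A g W where g: "G = (A, g, W)" "(A, g, W) \<in> Ar Pre" using GH(2) by (rule PreOrd_ArE)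
  obtain h B where h: "H = (W, h, B)" using GH(4) g by (cases H) auto
  have h': "(W, h, B) \<in> Ar Pre" using GH(3) h by simp
  have e: "A = X" "f = h \<cdot> g" using GH(1) by (simp_all add: g h)
  note [simp] = PreOrd_ArD(1-5)[OF g(2)] PreOrd_ArD(1-5)[OF h']
  have "f \<cdot> x = f \<cdot> y" if xy: "rel_mem C (snd X) x y" for x y
  proof -
    have xy': "rel_mem C (snd A) x y" using xy e by simp
    have "g \<cdot> x = g \<cdot> y" using PreOrd_ArD(6)[OF g(2) xy'] GH(5) unfolding ZOb_iff g by simp
    then show ?thesis using preord_memD[OF PreOrd_ArD(1)[OF g(2)] xy'] by (simp add: e(2))
  qed
  then show "(X, f, Y) \<in> Ar Pre \<and> (\<forall>x y. rel_mem C (snd X) x y \<longrightarrow> f \<cdot> x = f \<cdot> y)" using PO.triv_Ar[OF t] by blast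
next
  assume *: "(X, f, Y) \<in> Ar Pre \<and> (\<forall>x y. rel_mem C (snd X) x y \<longrightarrow> f \<cdot> x = f \<cdot> y)"
  then have f: "(X, f, Y) \<in> Ar Pre" by blast
  note [simp] = PreOrd_ArD(1-5)[OF f]
  have X: "is_preord C X" and Y: "is_preord C Y" by simp_all
  note [simp] = preordD(1)[OF Y]
  have "rel_mem C (diagonal C (fst Y)) (f \<cdot> x) (f \<cdot> y)" if xy: "rel_mem C (snd X) x y" for x y
  proof -
    have "f \<cdot> x = f \<cdot> y" using * xy by blast
    then show ?thesis using preord_memD[OF X xy] by (simp add: in_diagonal_iff)
  qed
  then have 1: "(X, f, disc (fst Y)) \<in> Ar Pre" by (simp add: PreOrd_Ar_iff disc_preord)
  have 2: "(disc (fst Y), Ide C (fst Y), Y) \<in> Ar Pre" using disc_Ar[OF Y, of "Ide C (fst Y)"] by simp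
  have "trivial_arrow Pre ZOb ((disc (fst Y), Ide C (fst Y), Y) \<cdot>\<^bsub>Pre\<^esub> (X, f, disc (fst Y)))"
    by (rule PO.trivI[OF 1 2]) (use disc_ZOb[of "fst Y"] in simp_all)
  then show "trivial_arrow Pre ZOb (X, f, Y)" by simp
qed

lemma trivialD: "trivial_arrow Pre ZOb (X, f, Y) \<Longrightarrow> rel_mem C (snd X) x y \<Longrightarrow> f \<cdot> x = f \<cdot> y"
  by (simp add: trivial_iff)

lemma PreOrd_iso:
  assumes "is_iso Pre F"
  obtains X f Y g where "F = (X, f, Y)" "(X, f, Y) \<in> Ar Pre" "(Y, g, X) \<in> Ar Pre" "g \<cdot> f = Ide C (fst X)" "f \<cdot> g = Ide C (fst Y)"
proof -
  obtain G where *: "F \<in> Ar Pre" "G \<in> Ar Pre" "Dom Pre G = Cod Pre F" "Cod Pre G = Dom Pre F"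
    "G \<cdot>\<^bsub>Pre\<^esub> F = Ide Pre (Dom Pre F)" "F \<cdot>\<^bsub>Pre\<^esub> G = Ide Pre (Cod Pre F)" using assms by (rule PO.is_isoE)
  obtain X f Y where f: "F = (X, f, Y)" by (cases F)
  obtain g where g: "G = (Y, g, X)" using * f by (cases G) auto
  show thesis using * by (intro that[of X f Y g]) (simp_all add: f g)
qed

lemma replete_EqOb: "replete Pre (EqOb C)"
  unfolding replete_def
proof (intro conjI allI impI)
  show "EqOb C \<subseteq> Ob Pre" by (auto simp: EqOb_iff)
  fix F assume *: "is_iso Pre F \<and> Dom Pre F \<in> EqOb C"
  then have "is_iso Pre F" by blast
  then obtain X f Y g where f: "F = (X, f, Y)" "(X, f, Y) \<in> Ar Pre" and g: "(Y, g, X) \<in> Ar Pre" and e: "f \<cdot> g = Ide C (fst Y)"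
    by (rule PreOrd_iso)
  note [simp] = PreOrd_ArD(1-5)[OF f(2)] PreOrd_ArD(1-5)[OF g]
  have "rel_mem C (snd Y) y x" if xy: "rel_mem C (snd Y) x y" for x y
  proof -
    have "rel_mem C (snd X) (g \<cdot> y) (g \<cdot> x)" using PreOrd_ArD(6)[OF g xy] * by (simp add: f EqOb_iff)
    from PreOrd_ArD(6)[OF f(2) this] preord_memD[OF _ xy] show ?thesis by (simp add: reassoc[OF e])
  qed
  then show "Cod Pre F \<in> EqOb C" by (simp add: f EqOb_iff)
qed

lemma replete_ParOrdOb: "replete Pre (ParOrdOb C)"
  unfolding replete_def
proof (intro conjI allI impI)
  show "ParOrdOb C \<subseteq> Ob Pre" by (auto simp: ParOrdOb_iff)
  fix F assume *: "is_iso Pre F \<and> Dom Pre F \<in> ParOrdOb C"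
  then have "is_iso Pre F" by blast
  then obtain X f Y g where f: "F = (X, f, Y)" "(X, f, Y) \<in> Ar Pre" and g: "(Y, g, X) \<in> Ar Pre" and e: "f \<cdot> g = Ide C (fst Y)"
    by (rule PreOrd_iso)
  note [simp] = PreOrd_ArD(1-5)[OF f(2)] PreOrd_ArD(1-5)[OF g]
  have "x = y" if xy: "rel_mem C (snd Y) x y" "rel_mem C (snd Y) y x" for x y
  proof -
    have "g \<cdot> x = g \<cdot> y" using PreOrd_ArD(6)[OF g xy(1)] PreOrd_ArD(6)[OF g xy(2)] * by (simp add: f ParOrdOb_iff)
    then have "f \<cdot> g \<cdot> x = f \<cdot> g \<cdot> y" by simp
    then show ?thesis using preord_memD[OF _ xy(1)] by (simp add: reassoc[OF e])
  qed
  then show "Cod Pre F \<in> ParOrdOb C" by (simp add: f ParOrdOb_iff)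
qed

lemma ParOrdOb_coproduct:
  assumes c: "is_coproduct Pre F G" and FG: "Dom Pre F \<in> ParOrdOb C" "Dom Pre G \<in> ParOrdOb C"
  shows "Cod Pre F \<in> ParOrdOb C"
proof -
  let ?X = "Dom Pre F" and ?Y = "Dom Pre G"
  have X: "is_preord C ?X" and Y: "is_preord C ?Y" using FG by (simp_all add: ParOrdOb_iff)
  obtain i j U where ij: "is_coproduct C i j" "Dom C i = fst ?X" "Dom C j = fst ?Y"
    and i: "(?X, i, U) \<in> Ar Pre" and j: "(?Y, j, U) \<in> Ar Pre" and s: "splits i j (snd ?X) (snd ?Y) (snd U)"
    and C: "is_coproduct Pre (?X, i, U) (?Y, j, U)" by (rule PreOrd_sum[OF X Y])
  note [simp] = PreOrd_ArD(2-5)[OF i] PreOrd_ArD(3-5)[OF j]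
  have U: "is_preord C U" by simp
  have "x = y" if xy: "rel_mem C (snd U) x y" and yx: "rel_mem C (snd U) y x" for x y
  proof -
    note [simp] = preord_memD[OF U xy]
    obtain d1 d2 x1 y1 x2 y2 where d: "is_coproduct C d1 d2" "Cod C d1 = Dom C x"
      and 1: "rel_mem C (snd ?X) x1 y1" "x \<cdot> d1 = i \<cdot> x1" "y \<cdot> d1 = i \<cdot> y1"
      and 2: "rel_mem C (snd ?Y) x2 y2" "x \<cdot> d2 = j \<cdot> x2" "y \<cdot> d2 = j \<cdot> y2" by (rule splitsE[OF s xy])
    note [simp] = coproductD[OF d(1)] d(2)
    \<comment> \<open>Antisymmetry for one summand, stated with variables so that it serves for
      both. The reverse relation in the sum is split: on one piece it lies in \<open>W\<close>,
      which is antisymmetric; the other piece is initial by disjointness.\<close>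
    have half: "a = b"
      if W: "W \<in> ParOrdOb C" and k: "is_coproduct C k l" "Dom C k = fst W" "Dom C l = fst V" "is_preord C V"
        "Cod C k = fst U" and sp: "splits k l (snd W) (snd V) (snd U)"
        and ab: "rel_mem C (snd W) a b" and ba: "rel_mem C (snd U) (k \<cdot> b) (k \<cdot> a)" for W V k l a b
    proof -
      have Wp: "is_preord C W" using W by (simp add: ParOrdOb_iff)
      note [simp] = coproductD[OF k(1)] k(2,3,5) preord_memD[OF Wp ab]
      obtain e1 e2 b1 a1 b2 a2 where e: "is_coproduct C e1 e2" "Cod C e1 = Dom C (k \<cdot> b)"
        and 3: "rel_mem C (snd W) b1 a1" "(k \<cdot> b) \<cdot> e1 = k \<cdot> b1" "(k \<cdot> a) \<cdot> e1 = k \<cdot> a1"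
        and 4: "rel_mem C (snd V) b2 a2" "(k \<cdot> b) \<cdot> e2 = l \<cdot> b2" "(k \<cdot> a) \<cdot> e2 = l \<cdot> a2" by (rule splitsE[OF sp ba])
      have [simp]: "Cod C e1 = Dom C a" using e(2) by simp
      note [simp] = coproductD[OF e(1)] preord_memD[OF Wp 3(1)] preord_memD[OF k(4) 4(1)]
      have 5: "b \<cdot> e1 = b1" "a \<cdot> e1 = a1"
        by (rule mono_cancel[OF coproj_mono(1)[OF k(1)]]; use 3(2,3) in simp)+
      have "rel_mem C (snd W) (a \<cdot> e1) (b \<cdot> e1)" using rel_mem_comp[OF ab preordD(2)[OF Wp], of e1] by simp
      then have on1: "a \<cdot> e1 = b \<cdot> e1" using W 3(1) by (simp add: ParOrdOb_iff 5)
      have "k \<cdot> b \<cdot> e2 = l \<cdot> b2" using 4(2) by simp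
      then have "is_initial C (Dom C (b \<cdot> e2))" by (rule disjoint[OF k(1)]) simp_all
      then have "a \<cdot> e2 = b \<cdot> e2" by - (rule initial_eq, simp_all)
      then show ?thesis using on1 by - (rule coproduct_eq[OF e(1)], simp_all)
    qed
    have "x1 = y1"
      using rel_mem_comp[OF yx preordD(2)[OF U], of d1]
      by - (rule half[OF FG(1) ij Y _ s 1(1)], simp_all add: 1)
    moreover have "x2 = y2"
      using rel_mem_comp[OF yx preordD(2)[OF U], of d2]
      by - (rule half[OF FG(2) coproduct_sym[OF ij(1)] ij(3,2) X _ splits_sym[OF s preordD(2)[OF U]] 2(1)], simp_all add: 2)
    ultimately show ?thesis by - (rule coproduct_eq[OF d(1)], simp_all add: 1 2)
  qed
  then have UP: "U \<in> ParOrdOb C" by (simp add: ParOrdOb_iff)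
  obtain k where "is_iso Pre k" "Dom Pre k = U" "Cod Pre k = Cod Pre F"
    by (rule PO.coproduct_unique[OF C c]) simp_all
  then show ?thesis using replete_ParOrdOb UP unfolding replete_def by metis
qed

text \<open>The coprojections stay monotone into the discrete preorder on the object underlying the
  sum, since related elements of the summands are equal. Their copairing has the identity as
  underlying arrow, so the identity of the sum factors through a discrete preorder.\<close>

lemma ZOb_coproduct:
  assumes c: "is_coproduct Pre F G" and FG: "Dom Pre F \<in> ZOb" "Dom Pre G \<in> ZOb"
  shows "Cod Pre F \<in> ZOb"
proof -
  note D = PO.coproductD[OF c]
  obtain X i U where i: "F = (X, i, U)" "(X, i, U) \<in> Ar Pre" using D(1) by (rule PreOrd_ArE)
  obtain Y j where j: "G = (Y, j, U)" using D(3) i by (cases G) auto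
  have j': "(Y, j, U) \<in> Ar Pre" using D(2) j by simp
  note [simp] = PreOrd_ArD(1-5)[OF i(2)] PreOrd_ArD(1-5)[OF j']
  have X: "is_preord C X" and Y: "is_preord C Y" and U: "is_preord C U" by simp_all
  note [simp] = preordD(1)[OF U]
  let ?V = "disc (fst U)"
  have XZ: "X \<in> ZOb" and YZ: "Y \<in> ZOb" using FG by (simp_all add: i j)
  have 1: "(X, i, ?V) \<in> Ar Pre" "(Y, j, ?V) \<in> Ar Pre"
    unfolding PreOrd_Ar_iff using XZ YZ unfolding ZOb_iff
    by (auto simp: disc_preord in_diagonal_iff preord_memD[OF X] preord_memD[OF Y])
  obtain H where H: "H \<in> Ar Pre" "Dom Pre H = U" "Cod Pre H = ?V" "H \<cdot>\<^bsub>Pre\<^esub> F = (X, i, ?V)" "H \<cdot>\<^bsub>Pre\<^esub> G = (Y, j, ?V)"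
    by (rule PO.copair[OF c 1]) (simp_all add: i j)
  have K: "(?V, Ide C (fst U), U) \<in> Ar Pre" using disc_Ar[OF U, of "Ide C (fst U)"] by simp
  obtain h where h: "H = (U, h, ?V)" using H by (cases H) auto
  note [simp] = PreOrd_ArD(3-5)[OF H(1)[unfolded h]]
  have hij: "h \<cdot> i = i" "h \<cdot> j = j" using H(4,5) by (simp_all add: h i(1) j)
  have KH: "(?V, Ide C (fst U), U) \<cdot>\<^bsub>Pre\<^esub> H = (U, h, U)" by (simp add: h)
  have hA: "(U, h, U) \<in> Ar Pre" using PO.comp_Ar[OF H(1) K] H(2,3) by (simp add: KH)
  have IA: "(U, Ide C (fst U), U) \<in> Ar Pre" using PO.Ide_Ar[of U] U by simp
  have "(U, h, U) = (U, Ide C (fst U), U)"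
    by (rule PO.coproduct_eq[OF c _ _ hA IA]) (simp_all add: i(1) j hij)
  moreover have "trivial_arrow Pre ZOb ((?V, Ide C (fst U), U) \<cdot>\<^bsub>Pre\<^esub> H)"
    by (rule PO.trivI[OF H(1) K]) (use H disc_ZOb[of "fst U"] in simp_all)
  ultimately have t: "trivial_arrow Pre ZOb (U, Ide C (fst U), U)" by (simp add: KH)
  have "x = y" if xy: "rel_mem C (snd U) x y" for x y
    using trivialD[OF t xy] preord_memD[OF U xy] by simp
  then show ?thesis unfolding ZOb_iff by (simp add: i)
qed

text \<open>The underlying object is kept, and the order is restricted to the related pairs that
  \<open>f\<close> identifies.\<close>

lemma PreOrd_zkernel:
  assumes "F \<in> Ar Pre" shows "\<exists>k. is_zkernel Pre ZOb k F"
proof -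
  obtain X f Y where f: "F = (X, f, Y)" "(X, f, Y) \<in> Ar Pre" using assms by (rule PreOrd_ArE)
  note [simp] = PreOrd_ArD(1-5)[OF f(2)]
  have X: "is_preord C X" by simp
  note [simp] = preordD(1)[OF X]
  obtain S where S: "is_relation C (fst X) S" and S_iff: "\<And>x y. x \<in> Ar C \<Longrightarrow> y \<in> Ar C \<Longrightarrow> Cod C x = fst X \<Longrightarrow> Cod C y = fst X
      \<Longrightarrow> rel_mem C S x y \<longleftrightarrow> f \<cdot> x = f \<cdot> y" by (rule kernel_relation[of f "fst X"]) simp_all
  obtain R where R: "is_relation C (fst X) R" and R_iff: "\<And>x y. rel_mem C R x y \<longleftrightarrow> rel_mem C (snd X) x y \<and> rel_mem C S x y"
    by (rule rel_inter[OF preordD(2)[OF X] S]) blast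
  have R_iff': "rel_mem C R x y \<longleftrightarrow> rel_mem C (snd X) x y \<and> f \<cdot> x = f \<cdot> y" for x y
    using R_iff[of x y] S_iff[of x y] preord_memD[OF X, of x y] by blast
  let ?K = "(fst X, R)"
  have K: "is_preord C ?K"
    by (rule preordI[OF R]) (use preordD(3)[OF X, of "Ide C (fst X)"] preordD(4)[OF X] in \<open>auto simp: R_iff'\<close>)
  let ?k = "(?K, Ide C (fst X), X)"
  have k: "?k \<in> Ar Pre" using K preord_memD[OF X] by (auto simp: PreOrd_Ar_iff R_iff')
  have "is_zkernel Pre ZOb ?k F"
  proof (rule PO.zkernelI)
    show "trivial_arrow Pre ZOb (F \<cdot>\<^bsub>Pre\<^esub> ?k)"
      using PO.comp_Ar[OF k f(2)] by (auto simp: f(1) trivial_iff R_iff')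
    show "is_mono Pre ?k" by (rule PreOrd_mono[OF k iso_mono[OF is_iso_Ide]]) simp
    fix G assume G: "G \<in> Ar Pre" "Cod Pre G = Dom Pre F" "trivial_arrow Pre ZOb (F \<cdot>\<^bsub>Pre\<^esub> G)"
    obtain W g where g: "G = (W, g, X)" using G by (cases G) (auto simp: f)
    have g': "(W, g, X) \<in> Ar Pre" using G g by simp
    note [simp] = PreOrd_ArD(1-5)[OF g']
    have W: "is_preord C W" by simp
    have t: "trivial_arrow Pre ZOb (W, f \<cdot> g, Y)" using G(3) by (simp add: f g)
    have "rel_mem C R (g \<cdot> x) (g \<cdot> y)" if xy: "rel_mem C (snd W) x y" for x y
      using PreOrd_ArD(6)[OF g' xy] trivialD[OF t xy] preord_memD[OF W xy] by (simp add: R_iff')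
    then have "(W, g, ?K) \<in> Ar Pre" using K by (simp add: PreOrd_Ar_iff)
    then show "\<exists>h. h \<in> Ar Pre \<and> Dom Pre h = Dom Pre G \<and> Cod Pre h = Dom Pre ?k \<and> ?k \<cdot>\<^bsub>Pre\<^esub> h = G"
      by (intro exI[of _ "(W, g, ?K)"]) (simp add: g)
  qed (use f k in simp_all)
  then show ?thesis by blast
qed

text \<open>An arrow with trivial composite identifies the images of related elements, so it factors
  through \<open>e\<close>; minimality of the order on \<open>Q\<close> makes the factor monotone.
  The minimality premise \<open>Qmin\<close> lets this cover both a transitive closure and an image
  that is already transitive.\<close>

lemma PreOrd_zcokernelI:
  assumes f: "(X, f, Y) \<in> Ar Pre" and e: "is_coequalizer C (f \<cdot> fst (snd X)) (f \<cdot> snd (snd X)) e"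
    and Q: "is_preord C Q" "fst Q = Cod C e" "rel_mem C (snd Q) (e \<cdot> fst (snd Y)) (e \<cdot> snd (snd Y))"
    and Qmin: "\<And>S. is_relation C (Cod C e) S \<Longrightarrow> transitive_rel C S \<Longrightarrow> rel_mem C S (e \<cdot> fst (snd Y)) (e \<cdot> snd (snd Y))
      \<Longrightarrow> rel_mem C S (fst (snd Q)) (snd (snd Q))"
  shows "is_zcokernel Pre ZOb (Y, e, Q) (X, f, Y)"
proof (rule PO.zcokernelI)
  note [simp] = PreOrd_ArD(1-5)[OF f] Q(1,2)
  have X: "is_preord C X" and Y: "is_preord C Y" by simp_all
  note [simp] = relationD[OF preordD(2)[OF X]] relationD[OF preordD(2)[OF Y]] relationD[OF preordD(2)[OF Q(1)]]
  have e' [simp]: "e \<in> Ar C" "Dom C e = fst Y" using coequalizerD[OF e] by simp_all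
  have "rel_mem C (snd Q) (e \<cdot> x) (e \<cdot> y)" if xy: "rel_mem C (snd Y) x y" for x y
  proof -
    obtain h where "h \<in> Ar C" "Cod C h = Dom C (fst (snd Y))" "fst (snd Y) \<cdot> h = x" "snd (snd Y) \<cdot> h = y"
      using xy by (rule rel_memE)
    then show ?thesis using rel_mem_comp[OF Q(3) preordD(2)[OF Q(1)], of h] by auto
  qed
  then show eA: "(Y, e, Q) \<in> Ar Pre" by (simp add: PreOrd_Ar_iff)
  have "(e \<cdot> f) \<cdot> x = (e \<cdot> f) \<cdot> y" if xy: "rel_mem C (snd X) x y" for x y
  proof -
    obtain h where h: "h \<in> Ar C" "Cod C h = Dom C (fst (snd X))" "fst (snd X) \<cdot> h = x" "snd (snd X) \<cdot> h = y"
      using xy by (rule rel_memE)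
    show ?thesis using reassoc[OF coequalizerD(7)[OF e], of h] h(1,2) unfolding h(3,4)[symmetric] by simp
  qed
  then show "trivial_arrow Pre ZOb ((Y, e, Q) \<cdot>\<^bsub>Pre\<^esub> (X, f, Y))"
    using PO.comp_Ar[OF f eA] by (simp add: trivial_iff)
  show "H = K" if H: "H \<in> Ar Pre" and K: "K \<in> Ar Pre" and d: "Dom Pre H = Cod Pre (Y, e, Q)" "Dom Pre K = Cod Pre (Y, e, Q)"
    "Cod Pre K = Cod Pre H" and eq: "H \<cdot>\<^bsub>Pre\<^esub> (Y, e, Q) = K \<cdot>\<^bsub>Pre\<^esub> (Y, e, Q)" for H K
  proof -
    obtain h W where h [simp]: "H = (Q, h, W)" using d by (cases H) auto
    obtain k where k [simp]: "K = (Q, k, W)" using d by (cases K) auto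
    have "h = k"
      by (rule coequalizer_epi[OF e]) (use eq PreOrd_ArD[OF H[unfolded h]] PreOrd_ArD[OF K[unfolded k]] in simp_all)
    then show ?thesis by simp
  qed
  fix G assume G: "G \<in> Ar Pre" "Dom Pre G = Cod Pre (X, f, Y)" "trivial_arrow Pre ZOb (G \<cdot>\<^bsub>Pre\<^esub> (X, f, Y))"
  obtain g W where g: "G = (Y, g, W)" using G by (cases G) auto
  have g': "(Y, g, W) \<in> Ar Pre" using G g by simp
  note [simp] = PreOrd_ArD(1-5)[OF g']
  have W: "is_preord C W" by simp
  have t: "trivial_arrow Pre ZOb (X, g \<cdot> f, W)" using G(3) by (simp add: g)
  have gf: "g \<cdot> f \<cdot> fst (snd X) = g \<cdot> f \<cdot> snd (snd X)"
    using trivialD[OF t rel_mem_self[OF preordD(2)[OF X]]] by simp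
  obtain h where h [simp]: "h \<in> Ar C" "Dom C h = Cod C e" "Cod C h = Cod C g" "h \<cdot> e = g"
    by (rule coequalizer_lift[OF e, of g]) (simp_all add: gf)
  \<comment> \<open>The order of \<open>W\<close> pulled back along \<open>h\<close> is transitive
    and contains the image of the order of \<open>Y\<close>, so it contains that of
    \<open>Q\<close>.\<close>
  obtain S where S: "is_relation C (Cod C e) S" and S_iff: "\<And>x y. x \<in> Ar C \<Longrightarrow> y \<in> Ar C \<Longrightarrow> Cod C x = Cod C e \<Longrightarrow> Cod C y = Cod C e
      \<Longrightarrow> rel_mem C S x y \<longleftrightarrow> rel_mem C (snd W) (h \<cdot> x) (h \<cdot> y)"
    by (rule rel_inverse_image[OF preordD(2)[OF W], of h "Cod C e"]) simp_all
  have "rel_mem C S (fst (snd Q)) (snd (snd Q))"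
  proof (rule Qmin[OF S])
    show "transitive_rel C S"
    proof (rule transitiveI[OF S])
      fix x y z assume xy: "rel_mem C S x y" "rel_mem C S y z"
      show "rel_mem C S x z"
        using xy rel_memD[OF xy(1) S] rel_memD[OF xy(2) S] preordD(4)[OF W, of "h \<cdot> x" "h \<cdot> y" "h \<cdot> z"]
        by (simp add: S_iff)
    qed
    show "rel_mem C S (e \<cdot> fst (snd Y)) (e \<cdot> snd (snd Y))"
      using PreOrd_ArD(6)[OF g' rel_mem_self[OF preordD(2)[OF Y]]] by (simp add: S_iff reassoc[OF h(4)])
  qed
  then have SQ: "rel_mem C S x y" if "rel_mem C (snd Q) x y" for x y
    using rel_mem_mono[OF _ that] S preordD(2)[OF Q(1)] by simp
  have "rel_mem C (snd W) (h \<cdot> x) (h \<cdot> y)" if xy: "rel_mem C (snd Q) x y" for x y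
    using SQ[OF xy] preord_memD[OF Q(1) xy] by (simp add: S_iff)
  then have "(Q, h, W) \<in> Ar Pre" by (simp add: PreOrd_Ar_iff)
  then show "\<exists>h. h \<in> Ar Pre \<and> Dom Pre h = Cod Pre (Y, e, Q) \<and> Cod Pre h = Cod Pre G \<and> h \<cdot>\<^bsub>Pre\<^esub> (Y, e, Q) = G"
    by (intro exI[of _ "(Q, h, W)"]) (simp add: g)
qed (use f in simp_all)

text \<open>The order of \<open>Y\<close> contains the diagonal, so \<open>e\<close> is related to
  itself, and this descends along the cover \<open>e\<close>.\<close>

lemma image_preord_refl:
  assumes Y: "is_preord C Y" and e: "cover e" "Dom C e = fst Y" and S: "is_relation C (Cod C e) S"
    and Se: "rel_mem C S (e \<cdot> fst (snd Y)) (e \<cdot> snd (snd Y))"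
  shows "rel_mem C S (Ide C (Cod C e)) (Ide C (Cod C e))"
proof -
  note [simp] = cover_Ar[OF e(1)] e(2) preordD(1)[OF Y] relationD[OF preordD(2)[OF Y]]
  have "rel_mem C (snd Y) (Ide C (fst Y)) (Ide C (fst Y))" by (rule preordD(3)[OF Y]) simp_all
  then obtain h where h: "h \<in> Ar C" "Cod C h = Dom C (fst (snd Y))" "fst (snd Y) \<cdot> h = Ide C (fst Y)" "snd (snd Y) \<cdot> h = Ide C (fst Y)"
    by (rule rel_memE)
  have "rel_mem C S e e" using rel_mem_comp[OF Se S, of h] h by simp
  then show ?thesis by - (rule cover_descent[OF e(1) S], simp_all)
qed

text \<open>Transitive closures enter twice: in the coequalizer \<open>e\<close>, and because the
  image of a preorder under \<open>e\<close> need not be transitive.\<close>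

lemma PreOrd_zcokernel:
  assumes "F \<in> Ar Pre" shows "\<exists>q. is_zcokernel Pre ZOb q F"
proof -
  obtain X f Y where f: "F = (X, f, Y)" "(X, f, Y) \<in> Ar Pre" using assms by (rule PreOrd_ArE)
  note [simp] = PreOrd_ArD(1-5)[OF f(2)]
  have X: "is_preord C X" and Y: "is_preord C Y" by simp_all
  note [simp] = relationD[OF preordD(2)[OF X]] relationD[OF preordD(2)[OF Y]]
  obtain e where e: "is_coequalizer C (f \<cdot> fst (snd X)) (f \<cdot> snd (snd X)) e"
    by (rule coequalizer_exists[of "f \<cdot> fst (snd X)" "f \<cdot> snd (snd X)"]) simp_all
  have e' [simp]: "e \<in> Ar C" "Dom C e = fst Y" using coequalizerD[OF e] by simp_all
  have ec: "cover e" by (rule coequalizer_cover[OF e])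
  obtain R d where R: "is_relation C (Cod C e) R" and d: "is_regular_epi C d" and [simp]: "d \<in> Ar C"
    "Dom C d = Dom C (fst (snd Y))" "Cod C d = Dom C (fst R)" and Rd: "fst R \<cdot> d = e \<cdot> fst (snd Y)" "snd R \<cdot> d = e \<cdot> snd (snd Y)"
    by (rule image_relation[of "e \<cdot> fst (snd Y)" "e \<cdot> snd (snd Y)" "Cod C e"]) simp_all
  note [simp] = relationD[OF R]
  obtain T where "is_transitive_closure C (Cod C e) R T" using transitive_closure_exists[OF R] by blast
  then have T: "is_relation C (Cod C e) T" "transitive_rel C T" "rel_mem C T (fst R) (snd R)"
    and Tmin: "\<And>S. is_relation C (Cod C e) S \<Longrightarrow> transitive_rel C S \<Longrightarrow> rel_mem C S (fst R) (snd R) \<Longrightarrow> rel_mem C S (fst T) (snd T)"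
    using rel_le_iff[OF R] rel_le_iff[where R = T] unfolding is_transitive_closure_def by blast+
  have Te: "rel_mem C T (e \<cdot> fst (snd Y)) (e \<cdot> snd (snd Y))"
    using rel_mem_comp[OF T(3,1), of d] by (simp add: Rd)
  have Q: "is_preord C (Cod C e, T)"
    by (rule preordI[OF T(1) image_preord_refl[OF Y ec e'(2) T(1) Te]]) (rule transitiveD[OF T(2,1)])
  have "is_zcokernel Pre ZOb (Y, e, (Cod C e, T)) (X, f, Y)"
  proof (rule PreOrd_zcokernelI[OF f(2) e Q])
    fix S assume S: "is_relation C (Cod C e) S" "transitive_rel C S" "rel_mem C S (e \<cdot> fst (snd Y)) (e \<cdot> snd (snd Y))"
    have "rel_mem C S (fst R) (snd R)"
      by (rule cover_descent[OF regular_epi_cover[OF d] S(1)]) (simp_all add: Rd S(3))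
    then show "rel_mem C S (fst (snd (Cod C e, T))) (snd (snd (Cod C e, T)))" using Tmin[OF S(1,2)] by simp
  qed (simp_all add: Te)
  then show ?thesis unfolding f by blast
qed

text \<open>The quotient of \<open>X\<close> by the equivalence \<open>E = R \<inter> R\<degree>\<close> carries the image \<open>T\<close> of the preorder \<open>R\<close>.
  Since \<open>E\<close> is effective, \<open>T\<close> pulls back to \<open>R\<close>, whence \<open>T\<close> is a partial order.\<close>

lemma PreOrd_canonical:
  assumes X: "is_preord C X" shows "\<exists>t f. canonical_sequence Pre (EqOb C) (ParOrdOb C) X t f"
proof -
  let ?R = "snd X"
  have R: "is_relation C (fst X) ?R" by (rule preordD(2)[OF X])
  note [simp] = preordD(1)[OF X] relationD(1-5)[OF R]
  obtain E where E: "is_relation C (fst X) E" and "\<And>x y. rel_mem C E x y \<longleftrightarrow> rel_mem C ?R x y \<and> rel_mem C (rel_op ?R) x y"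
    by (rule rel_inter[OF R rel_op_relation[OF R]]) blast
  then have E_iff: "rel_mem C E x y \<longleftrightarrow> rel_mem C ?R x y \<and> rel_mem C ?R y x" for x y by (simp add: rel_mem_op[OF R])
  note [simp] = relationD(1-5)[OF E]
  have Eid: "rel_mem C E (Ide C (fst X)) (Ide C (fst X))" by (simp add: E_iff preordD(3)[OF X])
  have Etr: "rel_mem C E x z" if "rel_mem C E x y" "rel_mem C E y z" for x y z
    using that preordD(4)[OF X, of x y z] preordD(4)[OF X, of z y x] by (simp add: E_iff)
  let ?K = "(fst X, E)"
  have K: "is_preord C ?K" by (rule preordI[OF E Eid Etr])
  have "is_equivalence_rel C (fst X) E"
    unfolding is_equivalence_rel_def symmetric_rel_def
    using E Eid transitiveI[OF E Etr] by (simp add: reflexive_iff[OF E] symmetric_iff[OF E] E_iff)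
  then obtain g where pg: "is_pullback C g g (fst E) (snd E)" using equivalence_effective[of "fst X" "fst E" "snd E"] by auto
  obtain e where e: "is_coequalizer C (fst E) (snd E) e" using kernel_pair_coequalizer[OF pg] by blast
  have e' [simp]: "e \<in> Ar C" "Dom C e = fst X" using coequalizerD[OF e] by simp_all
  have re: "is_regular_epi C e" using e by (auto simp: is_regular_epi_def)
  have ec: "cover e" by (rule coequalizer_cover[OF e])
  have [simp]: "g \<in> Ar C" "Dom C g = fst X" using pullbackD(1,7)[OF pg] by simp_all
  \<comment> \<open>\<open>E\<close> is the kernel pair of \<open>g\<close>, and \<open>g\<close>
    factors through \<open>e\<close>; hence \<open>e\<close> identifies no more than
    \<open>E\<close> does.\<close>
  obtain g' where [simp]: "g' \<in> Ar C" "Dom C g' = Cod C e" "Cod C g' = Cod C g" and g': "g' \<cdot> e = g"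
    by (rule coequalizer_lift[OF e _ _ pullbackD(9)[OF pg]]) simp_all
  have e_iff: "e \<cdot> x = e \<cdot> y \<longleftrightarrow> rel_mem C E x y" if [simp]: "x \<in> Ar C" "y \<in> Ar C" "Cod C x = fst X" "Cod C y = fst X" for x y
  proof
    assume exy: "e \<cdot> x = e \<cdot> y"
    have [simp]: "Dom C y = Dom C x" using arg_cong[OF exy, of "Dom C"] by simp
    have "g \<cdot> x = g \<cdot> y" using reassoc[OF g', of x] reassoc[OF g', of y] exy by simp
    then obtain h where "h \<in> Ar C" "Cod C h = Dom C (fst E)" "fst E \<cdot> h = x" "snd E \<cdot> h = y"
      by (rule pullback_lift[OF pg]) simp_all
    then show "rel_mem C E x y" using rel_memI[of h E] by auto
  next
    assume "rel_mem C E x y"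
    then obtain h where "h \<in> Ar C" "Cod C h = Dom C (fst E)" "fst E \<cdot> h = x" "snd E \<cdot> h = y" by (rule rel_memE)
    then show "e \<cdot> x = e \<cdot> y" using reassoc[OF coequalizerD(7)[OF e], of h] by auto
  qed
  obtain T d where T: "is_relation C (Cod C e) T" and d: "is_regular_epi C d" and [simp]: "d \<in> Ar C"
    "Dom C d = Dom C (fst ?R)" "Cod C d = Dom C (fst T)" and Td: "fst T \<cdot> d = e \<cdot> fst ?R" "snd T \<cdot> d = e \<cdot> snd ?R"
    by (rule image_relation[of "e \<cdot> fst ?R" "e \<cdot> snd ?R" "Cod C e"]) simp_all
  note [simp] = relationD(1-5)[OF T]
  have Te: "rel_mem C T (e \<cdot> fst ?R) (e \<cdot> snd ?R)"
    using rel_mem_comp[OF rel_mem_self[OF T] T, of d] by (simp add: Td)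
  have TR: "rel_mem C T (e \<cdot> x) (e \<cdot> y)" if xy: "rel_mem C ?R x y" for x y
  proof -
    obtain h where "h \<in> Ar C" "Cod C h = Dom C (fst ?R)" "fst ?R \<cdot> h = x" "snd ?R \<cdot> h = y" using xy by (rule rel_memE)
    then show ?thesis using rel_mem_comp[OF Te T, of h] by auto
  qed
  \<comment> \<open>On a cover the pair in \<open>T\<close> comes from a pair related in
    \<open>?R\<close>, whose members agree with \<open>x\<close> and \<open>y\<close> up to
    \<open>E\<close>. As \<open>E\<close> lies in \<open>?R\<close> and its opposite, transitivity
    gives the claim on the cover, and it descends.\<close>
  have RT: "rel_mem C ?R x y" if xy [simp]: "x \<in> Ar C" "y \<in> Ar C" "Cod C x = fst X" "Cod C y = fst X"
    and m: "rel_mem C T (e \<cdot> x) (e \<cdot> y)" for x y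
  proof -
    have [simp]: "Dom C y = Dom C x" using rel_memD(3)[OF m T] by simp
    obtain c a where c: "cover c" and [simp]: "c \<in> Ar C" "a \<in> Ar C" "Cod C c = Dom C x" "Dom C a = Dom C c" "Cod C a = Dom C d"
      and ca: "(fst T \<cdot> d) \<cdot> a = (e \<cdot> x) \<cdot> c" "(snd T \<cdot> d) \<cdot> a = (e \<cdot> y) \<cdot> c"
      by (rule image_cover[OF T d _ _ m]) simp_all
    have "e \<cdot> fst ?R \<cdot> a = e \<cdot> x \<cdot> c" "e \<cdot> snd ?R \<cdot> a = e \<cdot> y \<cdot> c" using ca unfolding Td by simp_all
    then have E1: "rel_mem C E (fst ?R \<cdot> a) (x \<cdot> c)" "rel_mem C E (snd ?R \<cdot> a) (y \<cdot> c)"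
      by (simp_all add: e_iff)
    have "rel_mem C ?R (fst ?R \<cdot> a) (snd ?R \<cdot> a)" by (rule rel_memI) simp_all
    then have "rel_mem C ?R (x \<cdot> c) (y \<cdot> c)" using E1 preordD(4)[OF X] unfolding E_iff by blast
    then show ?thesis by (rule cover_descent[OF c R]) simp_all
  qed
  \<comment> \<open>The elements \<open>x\<close>, \<open>y\<close> and \<open>z\<close> are lifted
    along \<open>e\<close> one after the other, each on a further cover, so that all three lifts
    live over \<open>c1 \<cdot> c2 \<cdot> c3\<close>, where \<open>RT\<close> and transitivity of
    \<open>?R\<close> apply.\<close>
  have Ttr: "rel_mem C T x z" if xy: "rel_mem C T x y" and yz: "rel_mem C T y z" for x y z
  proof -
    note [simp] = rel_memD[OF xy T] rel_memD(2,3,5)[OF yz T]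
    obtain c1 x1 where c1: "cover c1" and [simp]: "c1 \<in> Ar C" "x1 \<in> Ar C" "Cod C c1 = Dom C x" "Dom C x1 = Dom C c1" "Cod C x1 = Dom C e"
      and x1: "e \<cdot> x1 = x \<cdot> c1" by (rule cover_lift[OF re, of x]) simp_all
    obtain c2 y1 where c2: "cover c2" and [simp]: "c2 \<in> Ar C" "y1 \<in> Ar C" "Cod C c2 = Dom C c1" "Dom C y1 = Dom C c2" "Cod C y1 = Dom C e"
      and y1: "e \<cdot> y1 = (y \<cdot> c1) \<cdot> c2" by (rule cover_lift[OF re, of "y \<cdot> c1"]) simp_all
    obtain c3 z1 where c3: "cover c3" and [simp]: "c3 \<in> Ar C" "z1 \<in> Ar C" "Cod C c3 = Dom C c2" "Dom C z1 = Dom C c3" "Cod C z1 = Dom C e"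
      and z1: "e \<cdot> z1 = ((z \<cdot> c1) \<cdot> c2) \<cdot> c3" by (rule cover_lift[OF re, of "(z \<cdot> c1) \<cdot> c2"]) simp_all
    have y1': "e \<cdot> y1 = y \<cdot> c1 \<cdot> c2" using y1 by simp
    have z1': "e \<cdot> z1 = z \<cdot> c1 \<cdot> c2 \<cdot> c3" using z1 by simp
    have "rel_mem C ?R (x1 \<cdot> c2 \<cdot> c3) (y1 \<cdot> c3)"
      by (rule RT) (use rel_mem_comp[OF xy T, of "c1 \<cdot> c2 \<cdot> c3"] in \<open>simp_all add: reassoc[OF x1] reassoc[OF y1']\<close>)
    moreover have "rel_mem C ?R (y1 \<cdot> c3) z1"
      by (rule RT) (use rel_mem_comp[OF yz T, of "c1 \<cdot> c2 \<cdot> c3"] in \<open>simp_all add: z1' reassoc[OF y1']\<close>)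
    ultimately have "rel_mem C ?R (x1 \<cdot> c2 \<cdot> c3) z1" by (rule preordD(4)[OF X])
    from TR[OF this] have m: "rel_mem C T (x \<cdot> c1 \<cdot> c2 \<cdot> c3) (z \<cdot> c1 \<cdot> c2 \<cdot> c3)" by (simp add: reassoc[OF x1] z1')
    have "cover (c1 \<cdot> c2 \<cdot> c3)" by (intro cover_comp c1 c2 c3) simp_all
    then show ?thesis using m by (rule cover_descent[OF _ T]) simp_all
  qed
  have Tas: "x = y" if xy: "rel_mem C T x y" and yx: "rel_mem C T y x" for x y
  proof -
    note [simp] = rel_memD[OF xy T]
    obtain c1 x1 where c1: "cover c1" and [simp]: "c1 \<in> Ar C" "x1 \<in> Ar C" "Cod C c1 = Dom C x" "Dom C x1 = Dom C c1" "Cod C x1 = Dom C e"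
      and x1: "e \<cdot> x1 = x \<cdot> c1" by (rule cover_lift[OF re, of x]) simp_all
    obtain c2 y1 where c2: "cover c2" and [simp]: "c2 \<in> Ar C" "y1 \<in> Ar C" "Cod C c2 = Dom C c1" "Dom C y1 = Dom C c2" "Cod C y1 = Dom C e"
      and y1: "e \<cdot> y1 = (y \<cdot> c1) \<cdot> c2" by (rule cover_lift[OF re, of "y \<cdot> c1"]) simp_all
    have y1': "e \<cdot> y1 = y \<cdot> c1 \<cdot> c2" using y1 by simp
    have "rel_mem C ?R (x1 \<cdot> c2) y1"
      by (rule RT) (use rel_mem_comp[OF xy T, of "c1 \<cdot> c2"] in \<open>simp_all add: reassoc[OF x1] y1'\<close>)
    moreover have "rel_mem C ?R y1 (x1 \<cdot> c2)"
      by (rule RT) (use rel_mem_comp[OF yx T, of "c1 \<cdot> c2"] in \<open>simp_all add: reassoc[OF x1] y1'\<close>)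
    ultimately have "e \<cdot> x1 \<cdot> c2 = e \<cdot> y1" by (simp add: e_iff E_iff)
    then have xc: "x \<cdot> c1 \<cdot> c2 = y \<cdot> c1 \<cdot> c2" by (simp add: reassoc[OF x1] y1')
    have "cover (c1 \<cdot> c2)" by (intro cover_comp c1 c2) simp_all
    then show ?thesis using xc by (rule cover_epi) simp_all
  qed
  let ?Q = "(Cod C e, T)"
  have Q: "is_preord C ?Q"
    by (rule preordI[OF T image_preord_refl[OF X ec e'(2) T Te] Ttr])
  have QP: "?Q \<in> ParOrdOb C" using Q Tas by (simp add: ParOrdOb_iff)
  have KE: "?K \<in> EqOb C" using K by (simp add: EqOb_iff E_iff)
  let ?t = "(?K, Ide C (fst X), X)"
  have t: "?t \<in> Ar Pre" using K X preord_memD[OF X] by (auto simp: PreOrd_Ar_iff E_iff)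
  have ct: "is_zcokernel Pre ZOb (X, e, ?Q) ?t"
  proof (rule PreOrd_zcokernelI[OF t _ Q])
    fix S assume S: "is_relation C (Cod C e) S" "rel_mem C S (e \<cdot> fst ?R) (e \<cdot> snd ?R)"
    show "rel_mem C S (fst (snd ?Q)) (snd (snd ?Q))"
      by (simp, rule cover_descent[OF regular_epi_cover[OF d] S(1)]) (simp_all add: Td S(2))
  qed (simp_all add: e Te)
  have eA: "(X, e, ?Q) \<in> Ar Pre" using PO.zcokernelD(1)[OF ct] .
  have "is_zkernel Pre ZOb ?t (X, e, ?Q)"
  proof (rule PO.zkernelI)
    show "trivial_arrow Pre ZOb ((X, e, ?Q) \<cdot>\<^bsub>Pre\<^esub> ?t)" by (rule PO.zcokernelD(4)[OF ct])
    show "is_mono Pre ?t" by (rule PreOrd_mono[OF t iso_mono[OF is_iso_Ide]]) simp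
    fix G assume G: "G \<in> Ar Pre" "Cod Pre G = Dom Pre (X, e, ?Q)" "trivial_arrow Pre ZOb ((X, e, ?Q) \<cdot>\<^bsub>Pre\<^esub> G)"
    obtain W h where h: "G = (W, h, X)" using G by (cases G) auto
    have h': "(W, h, X) \<in> Ar Pre" using G h by simp
    note [simp] = PreOrd_ArD(1-5)[OF h']
    have W: "is_preord C W" by simp
    have tr: "trivial_arrow Pre ZOb (W, e \<cdot> h, ?Q)" using G(3) by (simp add: h)
    have "rel_mem C E (h \<cdot> x) (h \<cdot> y)" if xy: "rel_mem C (snd W) x y" for x y
      using trivialD[OF tr xy] preord_memD[OF W xy] by (simp add: e_iff[symmetric])
    then have "(W, h, ?K) \<in> Ar Pre" using K by (simp add: PreOrd_Ar_iff)
    then show "\<exists>k. k \<in> Ar Pre \<and> Dom Pre k = Dom Pre G \<and> Cod Pre k = Dom Pre ?t \<and> ?t \<cdot>\<^bsub>Pre\<^esub> k = G"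
      by (intro exI[of _ "(W, h, ?K)"]) (simp add: h)
  qed (use t eA in simp_all)
  then have "canonical_sequence Pre (EqOb C) (ParOrdOb C) X ?t (X, e, ?Q)"
    using ct KE QP by (simp add: canonical_sequence_def short_zexact_def)
  then show ?thesis by blast
qed

text \<open>An arrow from an equivalence relation to a partial order sends related elements to
  elements related both ways, which are equal.\<close>

lemma pretorsion_PreOrd: "pretorsion_theory Pre (EqOb C) (ParOrdOb C)"
  unfolding pretorsion_theory_def
proof (intro conjI ballI impI)
  fix F assume F: "F \<in> Ar Pre" "Dom Pre F \<in> EqOb C \<and> Cod Pre F \<in> ParOrdOb C"
  obtain X f Y where f: "F = (X, f, Y)" "(X, f, Y) \<in> Ar Pre" using F(1) by (rule PreOrd_ArE)
  have "f \<cdot> x = f \<cdot> y" if "rel_mem C (snd X) x y" for x y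
    using F(2) that PreOrd_ArD(6)[OF f(2), of x y] PreOrd_ArD(6)[OF f(2), of y x] by (simp add: f(1) EqOb_iff ParOrdOb_iff)
  then show "trivial_arrow Pre ZOb F" using f by (simp add: trivial_iff)
qed (use replete_EqOb replete_ParOrdOb PreOrd_canonical in simp_all)

end

text \<open>By \<open>trivial_iff\<close> triviality is an equation on related elements. A mono of
  preorders is monic in \<open>C\<close> and can be cancelled from that equation; for an identity
  the equation says that related elements are equal.\<close>

sublocale tau_cat \<subseteq> PreOrd: stable_torsion "PreOrd C" "EqOb C \<inter> ParOrdOb C" "EqOb C" "ParOrdOb C"
proof unfold_locales
  show "has_finite_limits Pre" "extensive Pre" by (rule has_finite_limits_PreOrd extensive_PreOrd)+
  show "ZOb \<subseteq> Ob Pre" by (auto simp: EqOb_iff)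
  show "Cod Pre i \<in> ZOb" if "is_coproduct Pre i j" "Dom Pre i \<in> ZOb" "Dom Pre j \<in> ZOb" for i j
    using that by (rule ZOb_coproduct)
  obtain I where I: "is_terminal C I" by (rule terminal_exists)
  then have "I \<in> Ob C" by (simp add: is_terminal_def)
  then show "\<exists>T\<in>ZOb. is_terminal Pre T" using PreOrd_terminal[OF I] disc_ZOb by blast
  show "trivial_arrow Pre ZOb F" if m: "is_mono Pre M" and F: "F \<in> Ar Pre" "Cod Pre F = Dom Pre M"
    and t: "trivial_arrow Pre ZOb (M \<cdot>\<^bsub>Pre\<^esub> F)" for M F
  proof -
    obtain X f Y where f: "F = (X, f, Y)" "(X, f, Y) \<in> Ar Pre" using F(1) by (rule PreOrd_ArE)
    obtain k W where k: "M = (Y, k, W)" using F(2) f by (cases M) auto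
    have k': "(Y, k, W) \<in> Ar Pre" using PO.is_mono_Ar[OF m] k by simp
    note [simp] = PreOrd_ArD(1-5)[OF f(2)] PreOrd_ArD(1-5)[OF k']
    have X: "is_preord C X" by simp
    have t': "trivial_arrow Pre ZOb (X, k \<cdot> f, W)" using t by (simp add: f k)
    have km: "is_mono C k" using m PreOrd_monoD k by simp
    have "f \<cdot> x = f \<cdot> y" if xy: "rel_mem C (snd X) x y" for x y
      by (rule mono_cancel[OF km]) (use trivialD[OF t' xy] preord_memD[OF X xy] in simp_all)
    then show ?thesis using f by (simp add: trivial_iff)
  qed
  show "X \<in> ZOb" if X: "X \<in> Ob Pre" and t: "trivial_arrow Pre ZOb (Ide Pre X)" for X
  proof -
    have X': "is_preord C X" using X by simp
    have t': "trivial_arrow Pre ZOb (X, Ide C (fst X), X)" using t by simp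
    have "x = y" if xy: "rel_mem C (snd X) x y" for x y
      using trivialD[OF t' xy] preord_memD[OF X' xy] by simp
    then show ?thesis unfolding ZOb_iff using X' by blast
  qed
  show "pretorsion_theory Pre (EqOb C) (ParOrdOb C)" by (rule pretorsion_PreOrd)
  show "Cod Pre i \<in> ParOrdOb C" if "is_coproduct Pre i j" "Dom Pre i \<in> ParOrdOb C" "Dom Pre j \<in> ParOrdOb C" for i j
    using that by (rule ParOrdOb_coproduct)
  show "\<exists>k. is_zkernel Pre ZOb k f" "\<exists>q. is_zcokernel Pre ZOb q f" if "f \<in> Ar Pre" for f
    using that by (rule PreOrd_zkernel PreOrd_zcokernel)+
qed simp

context tau_cat
begin

lemma Stab_eq: "Stab C = PreOrd.St"
  by (simp add: Stab_def PaPreOrd_def PreOrd.St_def)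

lemma Sigma_functor_eq: "Sigma_functor C = PreOrd.Sgf"
  by (simp add: Sigma_functor_def PreOrd.Sgf_def PreOrd.Sg_def stab_class_def fun_eq_iff)

end

theorem theorem3p12:
  fixes C :: "('o, 'm) cat"
  assumes "tau_pretopos C"
  shows
    "admissible_target (Stab C) (EqOb C) (ParOrdOb C) \<and>
     coproduct_torsion_functor (PreOrd C) (EqOb C) (ParOrdOb C)
       (Stab C) (EqOb C) (ParOrdOb C) (Sigma_functor C) \<and>
     (\<forall>(X :: ('p, 'q) cat) \<T> \<F> G.
        admissible_target X \<T> \<F> \<and>
        coproduct_torsion_functor (PreOrd C) (EqOb C) (ParOrdOb C) X \<T> \<F> G \<longrightarrow>
        (\<exists>Gbar.
           is_functor (Stab C) X Gbar \<and>
           functor_eq (PreOrd C) (functor_comp Gbar (Sigma_functor C)) G \<and>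
           (\<forall>H. is_functor (Stab C) X H \<and>
                functor_eq (PreOrd C) (functor_comp H (Sigma_functor C)) G \<longrightarrow>
                functor_eq (Stab C) H Gbar) \<and>
           coproduct_torsion_functor (Stab C) (EqOb C) (ParOrdOb C) X \<T> \<F> Gbar \<and>
           (zkernels_to_kernels (PreOrd C) (EqOb C \<inter> ParOrdOb C) X G \<and>
            zcokernels_to_cokernels (PreOrd C) (EqOb C \<inter> ParOrdOb C) X G \<longrightarrow>
              zexact_to_exact (PreOrd C) (EqOb C \<inter> ParOrdOb C) X G \<and>
              zkernels_to_kernels (Stab C) (zero_objects (Stab C)) X Gbar \<and>
              zcokernels_to_cokernels (Stab C) (zero_objects (Stab C)) X Gbar \<and>
              zexact_to_exact (Stab C) (zero_objects (Stab C)) X Gbar)))"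
proof -
  interpret tau_cat C using assms by unfold_locales
  show ?thesis
    unfolding Stab_eq Sigma_functor_eq
    by (intro conjI allI impI PreOrd.admissible_St PreOrd.Sgf_coproduct_torsion_functor)
      (elim conjE, rule PreOrd.universal_property)
qed

end
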